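(* $|IR(2,\mathbb Z)|$ is contractible and therefore $B\mathcal R(2,\mathbb Z)\simeq BGL(2,\mathbb Z)$.
   Context: $IR(r,\mathbb Z)$ is the poset, ordered by inclusion, of all subsets $\widetilde E\subseteq\mathbb Z^r$ such that: (1) $0\notin\widetilde E$; (2) $\widetilde E=-\widetilde E$; (3) $\widetilde E$ generates $\mathbb Z^r$ additively; (4) any set of $r$ linearly independent elements of $\widetilde E$ generates $\mathbb Z^r$. Its geometric realization $|IR(r,\mathbb Z)|$ is the realization of its order complex. A two-fold covering of a finite set $E$ is a surjection $p:\widetilde E\to E$ all of whose fibers have two elements; $e\mapsto\overline e$ is the involution of $\widetilde E$ switching the two elements of each fiber. A freely oriented matroid on $E$ is a pair $(\widetilde E,\widetilde M)$ where $\widetilde E$ is a two-fold covering of $E$ and $\widetilde M$ is a collection of nonempty subsets of $\widetilde E$, called (signed) circuits, such that: (1) $C\cap\overline C=\emptyset$ for each circuit $C$; (2) if $C$ is a circuit so is $\overline C$; (3) if $C_1,C_2$ are circuits with $C_1\subseteq C_2\cup\overline{C_2}$ then $C_1=C_2$ or $C_1=\overline{C_2}$; (4) if $C_1\ne C_2$ are circuits and $e\in C_1\cap C_2$ then there is a circuit $C_3\subseteq (C_1\setminus e)\cup\overline{(C_2\setminus e)}$. The images in $E$ of the signed circuits are the circuits of a matroid on $E$, whose rank is the rank of $(\widetilde E,\widetilde M)$; independent sets and bases in $\widetilde E$ are subsets mapping injectively onto independent sets and bases of $E$. A representation over $\mathbb R$ is a function $\rho:\widetilde E\to V$ to a real vector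 space with (i) $\rho(e)+\rho(\overline e)=0$; (ii) for every circuit $C$ there is a relation $\sum_{e_i\in C}a_i\rho(e_i)=0$ with all $a_i>0$; (iii) every independent subset is mapped injectively onto a linearly independent set; (iv) $\rho(\widetilde E)$ spans $V$. It is unipotent if the images of any two bases have the same volume in $V$. $(\widetilde E,\widetilde M)$ is regular if it has a unipotent representation over $\mathbb R$. $\mathcal R(r,\mathbb Z)$ is the category whose objects are regular freely oriented matroids of rank $r$ and whose morphisms are injective maps $\widetilde E_1\to\widetilde E_2$ commuting with the involutions such that a subset of $\widetilde E_1$ is a circuit iff its image is a circuit. $B\mathcal C$ is the classifying space (geometric realization of the nerve) of a category $\mathcal C$, with categories replaced by equivalent small ones. *)

theory Defs
  imports
    "HOL-Analysis.Analysis"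
    "HOL-Homology.Simplices"
    "HOL-Computational_Algebra.Group_Closure"
    "HOL-Library.Infinite_Typeclass"
begin

section \<open>Geometric realization of simplicial complexes\<close>

definition order_complex :: "'p::order set \<Rightarrow> 'p set set" where
  "order_complex P = {\<sigma>. \<sigma> \<noteq> {} \<and> finite \<sigma> \<and> \<sigma> \<subseteq> P \<and> (\<forall>x\<in>\<sigma>. \<forall>y\<in>\<sigma>. x \<le> y \<or> y \<le> x)}"

text \<open>Points of a closed simplex are given by their barycentric coordinates.\<close>

definition closed_simplex :: "'v set \<Rightarrow> ('v \<Rightarrow> real) set" where
  "closed_simplex \<sigma> = {t. (\<forall>v. 0 \<le> t v) \<and> (\<forall>v. v \<notin> \<sigma> \<longrightarrow> t v = 0) \<and> (\<Sum>v\<in>\<sigma>. t v) = 1}"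

text \<open>The realization carries the weak topology: a set is open iff its intersection with every
  closed simplex is open there. The product topology on functions induces the Euclidean topology
  on each (finite-dimensional) closed simplex.\<close>

definition complex_realization :: "'v set set \<Rightarrow> ('v \<Rightarrow> real) topology" where
  "complex_realization K = topology (\<lambda>U. U \<subseteq> (\<Union>\<sigma>\<in>K. closed_simplex \<sigma>) \<and>
     (\<forall>\<sigma>\<in>K. openin (subtopology (powertop_real UNIV) (closed_simplex \<sigma>)) (U \<inter> closed_simplex \<sigma>)))"

lemma openin_complex_realization:
  "openin (complex_realization K) U \<longleftrightarrow> U \<subseteq> (\<Union>\<sigma>\<in>K. closed_simplex \<sigma>) \<and>
     (\<forall>\<sigma>\<in>K. openin (subtopology (powertop_real UNIV) (closed_simplex \<sigma>)) (U \<inter> closed_simplex \<sigma>))"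
proof -
  let ?op = "\<lambda>U. U \<subseteq> (\<Union>\<sigma>\<in>K. closed_simplex \<sigma>) \<and>
     (\<forall>\<sigma>\<in>K. openin (subtopology (powertop_real UNIV) (closed_simplex \<sigma>)) (U \<inter> closed_simplex \<sigma>))"
  have "istopology ?op"
    unfolding istopology_def
  proof (intro conjI allI impI)
    fix S T assume S: "?op S" and T: "?op T"
    show "S \<inter> T \<subseteq> (\<Union>\<sigma>\<in>K. closed_simplex \<sigma>)" using S by blast
    show "\<forall>\<sigma>\<in>K. openin (subtopology (powertop_real UNIV) (closed_simplex \<sigma>)) (S \<inter> T \<inter> closed_simplex \<sigma>)"
    proof
      fix \<sigma> assume "\<sigma> \<in> K"
      then have "openin (subtopology (powertop_real UNIV) (closed_simplex \<sigma>))
          ((S \<inter> closed_simplex \<sigma>) \<inter> (T \<inter> closed_simplex \<sigma>))"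
        using S T by blast
      moreover have "(S \<inter> closed_simplex \<sigma>) \<inter> (T \<inter> closed_simplex \<sigma>) = S \<inter> T \<inter> closed_simplex \<sigma>"
        by blast
      ultimately show "openin (subtopology (powertop_real UNIV) (closed_simplex \<sigma>)) (S \<inter> T \<inter> closed_simplex \<sigma>)"
        by simp
    qed
  next
    fix \<K> assume *: "\<forall>S\<in>\<K>. ?op S"
    show "\<Union>\<K> \<subseteq> (\<Union>\<sigma>\<in>K. closed_simplex \<sigma>)" using * by blast
    show "\<forall>\<sigma>\<in>K. openin (subtopology (powertop_real UNIV) (closed_simplex \<sigma>)) (\<Union>\<K> \<inter> closed_simplex \<sigma>)"
    proof
      fix \<sigma> assume "\<sigma> \<in> K"
      then have "openin (subtopology (powertop_real UNIV) (closed_simplex \<sigma>))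
          (\<Union>((\<lambda>S. S \<inter> closed_simplex \<sigma>) ` \<K>))"
        using * by blast
      moreover have "\<Union>((\<lambda>S. S \<inter> closed_simplex \<sigma>) ` \<K>) = \<Union>\<K> \<inter> closed_simplex \<sigma>"
        by blast
      ultimately show "openin (subtopology (powertop_real UNIV) (closed_simplex \<sigma>)) (\<Union>\<K> \<inter> closed_simplex \<sigma>)"
        by simp
    qed
  qed
  then show ?thesis
    by (simp add: complex_realization_def)
qed


section \<open>Geometric realization of simplicial sets\<close>

definition quotient_topology :: "'x topology \<Rightarrow> ('x \<times> 'x) set \<Rightarrow> 'x set topology" where
  "quotient_topology X R = topology (\<lambda>U. U \<subseteq> topspace X // R \<and> openin X (\<Union>U))"

lemma openin_quotient_topology:
  assumes "equiv (topspace X) R"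
  shows "openin (quotient_topology X R) U \<longleftrightarrow> U \<subseteq> topspace X // R \<and> openin X (\<Union>U)"
proof -
  have "istopology (\<lambda>U. U \<subseteq> topspace X // R \<and> openin X (\<Union>U))"
    unfolding istopology_def
  proof (intro conjI allI impI)
    fix S T
    assume S: "S \<subseteq> topspace X // R \<and> openin X (\<Union>S)" and T: "T \<subseteq> topspace X // R \<and> openin X (\<Union>T)"
    have "\<Union>(S \<inter> T) = \<Union>S \<inter> \<Union>T"
    proof
      show "\<Union>S \<inter> \<Union>T \<subseteq> \<Union>(S \<inter> T)"
      proof
        fix x assume "x \<in> \<Union>S \<inter> \<Union>T"
        then obtain A B where "A \<in> S" "B \<in> T" "x \<in> A" "x \<in> B" by blast
        moreover from this have "A = B"
          using quotient_disj[OF assms, of A B] S T by blast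
        ultimately show "x \<in> \<Union>(S \<inter> T)" by blast
      qed
    qed blast
    then show "openin X (\<Union>(S \<inter> T))" using S T by auto
    show "S \<inter> T \<subseteq> topspace X // R" using S by blast
  next
    fix \<K> assume *: "\<forall>S\<in>\<K>. S \<subseteq> topspace X // R \<and> openin X (\<Union>S)"
    then show "\<Union>\<K> \<subseteq> topspace X // R" by blast
    have "\<Union>(\<Union>\<K>) = \<Union>(\<Union> ` \<K>)" by blast
    then show "openin X (\<Union>(\<Union>\<K>))" using * by auto
  qed
  then show ?thesis
    by (simp add: quotient_topology_def)
qed

definition simplex_op :: "nat \<Rightarrow> nat \<Rightarrow> (nat \<Rightarrow> nat) \<Rightarrow> bool" where
  "simplex_op m n \<theta> \<longleftrightarrow> mono_on {..m} \<theta> \<and> \<theta> ` {..m} \<subseteq> {..n}"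

text \<open>For a weakly monotone map \<open>\<theta>\<close> from \<open>{0..m}\<close> to \<open>{0..n}\<close>,
  \<open>Pull X m \<theta>\<close> is the structure map from \<open>n\<close>-simplices to \<open>m\<close>-simplices.\<close>

record 'x simplicial_set =
  Simplices :: "nat \<Rightarrow> 'x set"
  Pull :: "nat \<Rightarrow> (nat \<Rightarrow> nat) \<Rightarrow> 'x \<Rightarrow> 'x"

definition push_simplex :: "nat \<Rightarrow> (nat \<Rightarrow> nat) \<Rightarrow> (nat \<Rightarrow> real) \<Rightarrow> nat \<Rightarrow> real" where
  "push_simplex m \<theta> t = (\<lambda>j. \<Sum>i\<in>{i. i \<le> m \<and> \<theta> i = j}. t i)"

definition simplices_space :: "('x, 'z) simplicial_set_scheme \<Rightarrow> ((nat \<times> 'x) \<times> (nat \<Rightarrow> real)) topology" where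
  "simplices_space X = sum_topology
     (\<lambda>(n, x). subtopology (powertop_real UNIV) (standard_simplex n)) (Sigma UNIV (Simplices X))"

definition glue ::
  "('x, 'z) simplicial_set_scheme \<Rightarrow> (((nat \<times> 'x) \<times> (nat \<Rightarrow> real)) \<times> ((nat \<times> 'x) \<times> (nat \<Rightarrow> real))) set" where
  "glue X = {(((m, Pull X m \<theta> x), t), ((n, x), push_simplex m \<theta> t)) | m n \<theta> x t.
     simplex_op m n \<theta> \<and> x \<in> Simplices X n \<and> t \<in> standard_simplex m}"

definition gluing_equiv ::
  "('x, 'z) simplicial_set_scheme \<Rightarrow> (((nat \<times> 'x) \<times> (nat \<Rightarrow> real)) \<times> ((nat \<times> 'x) \<times> (nat \<Rightarrow> real))) set" where
  "gluing_equiv X = Restr ((glue X \<union> (glue X)\<inverse>)\<^sup>*) (topspace (simplices_space X))"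

lemma equiv_gluing_equiv: "equiv (topspace (simplices_space X)) (gluing_equiv X)"
proof (rule equivI)
  have "sym ((glue X \<union> (glue X)\<inverse>)\<^sup>*)"
    by (rule sym_rtrancl) (auto simp: sym_def)
  then show "sym (gluing_equiv X)"
    by (auto simp: gluing_equiv_def sym_def)
  show "trans (gluing_equiv X)"
    by (auto simp: gluing_equiv_def trans_def)
qed (auto simp: gluing_equiv_def refl_on_def)

definition realization ::
  "('x, 'z) simplicial_set_scheme \<Rightarrow> ((nat \<times> 'x) \<times> (nat \<Rightarrow> real)) set topology" where
  "realization X = quotient_topology (simplices_space X) (gluing_equiv X)"


section \<open>Small categories and classifying spaces\<close>

text \<open>\<open>Comp C x y z g f\<close> is the composite of \<open>f \<in> Hom C x y\<close> followed by \<open>g \<in> Hom C y z\<close>.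
  Hom-sets need not be disjoint.\<close>

record ('o, 'm) category =
  Obj :: "'o set"
  Hom :: "'o \<Rightarrow> 'o \<Rightarrow> 'm set"
  Id :: "'o \<Rightarrow> 'm"
  Comp :: "'o \<Rightarrow> 'o \<Rightarrow> 'o \<Rightarrow> 'm \<Rightarrow> 'm \<Rightarrow> 'm"

definition is_category :: "('o, 'm, 'z) category_scheme \<Rightarrow> bool" where
  "is_category C \<longleftrightarrow>
     (\<forall>x\<in>Obj C. Id C x \<in> Hom C x x) \<and>
     (\<forall>x\<in>Obj C. \<forall>y\<in>Obj C. \<forall>z\<in>Obj C. \<forall>f\<in>Hom C x y. \<forall>g\<in>Hom C y z. Comp C x y z g f \<in> Hom C x z) \<and>
     (\<forall>x\<in>Obj C. \<forall>y\<in>Obj C. \<forall>f\<in>Hom C x y. Comp C x y y (Id C y) f = f \<and> Comp C x x y f (Id C x) = f) \<and>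
     (\<forall>w\<in>Obj C. \<forall>x\<in>Obj C. \<forall>y\<in>Obj C. \<forall>z\<in>Obj C. \<forall>f\<in>Hom C w x. \<forall>g\<in>Hom C x y. \<forall>h\<in>Hom C y z.
        Comp C w y z h (Comp C w x y g f) = Comp C w x z (Comp C x y z h g) f)"

text \<open>An \<open>n\<close>-simplex of the nerve is a functor from the ordered set \<open>{0..n}\<close>: objects \<open>X i\<close> and
  morphisms \<open>f (i, j)\<close> from \<open>X i\<close> to \<open>X j\<close> for \<open>i \<le> j \<le> n\<close>. Both families are extensional, so
  that a functor has exactly one code.\<close>

definition nerve_simplices ::
  "('o, 'm, 'z) category_scheme \<Rightarrow> nat \<Rightarrow> ((nat \<Rightarrow> 'o) \<times> (nat \<times> nat \<Rightarrow> 'm)) set" where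
  "nerve_simplices C n = {(X, f).
     X \<in> {..n} \<rightarrow>\<^sub>E Obj C \<and> f \<in> extensional {(i, j). i \<le> j \<and> j \<le> n} \<and>
     (\<forall>i j. i \<le> j \<and> j \<le> n \<longrightarrow> f (i, j) \<in> Hom C (X i) (X j)) \<and>
     (\<forall>i\<le>n. f (i, i) = Id C (X i)) \<and>
     (\<forall>i j k. i \<le> j \<and> j \<le> k \<and> k \<le> n \<longrightarrow>
        f (i, k) = Comp C (X i) (X j) (X k) (f (j, k)) (f (i, j)))}"

definition nerve ::
  "('o, 'm, 'z) category_scheme \<Rightarrow> ((nat \<Rightarrow> 'o) \<times> (nat \<times> nat \<Rightarrow> 'm)) simplicial_set" where
  "nerve C = \<lparr> Simplices = nerve_simplices C,
     Pull = (\<lambda>m \<theta> (X, f). (restrict (\<lambda>i. X (\<theta> i)) {..m},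
       restrict (\<lambda>(i, j). f (\<theta> i, \<theta> j)) {(i, j). i \<le> j \<and> j \<le> m})) \<rparr>"

lemma nerve_Pull:
  assumes "simplex_op m n \<theta>" and "x \<in> Simplices (nerve C) n"
  shows "Pull (nerve C) m \<theta> x \<in> Simplices (nerve C) m"
proof -
  have "\<theta> i \<le> n" if "i \<le> m" for i
    using assms(1) that by (auto simp: simplex_op_def)
  moreover have "\<theta> i \<le> \<theta> j" if "i \<le> j" "j \<le> m" for i j
    using assms(1) that by (auto simp: simplex_op_def mono_on_def)
  ultimately show ?thesis
    using assms(2) by (auto simp: nerve_def nerve_simplices_def PiE_iff split: prod.splits)
qed

definition classifying_space ::
  "('o, 'm, 'z) category_scheme \<Rightarrow> ((nat \<times> (nat \<Rightarrow> 'o) \<times> (nat \<times> nat \<Rightarrow> 'm)) \<times> (nat \<Rightarrow> real)) set topology" where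
  "classifying_space C = realization (nerve C)"

definition delooping :: "('g, 'z) monoid_scheme \<Rightarrow> (unit, 'g) category" where
  "delooping G = \<lparr> Obj = {()}, Hom = (\<lambda>_ _. carrier G), Id = (\<lambda>_. one G), Comp = (\<lambda>_ _ _ g f. mult G g f) \<rparr>"

lemma is_category_delooping: "Group.monoid G \<Longrightarrow> is_category (delooping G)"
  by (auto simp: is_category_def delooping_def monoid.m_assoc monoid.m_closed
      monoid.one_closed monoid.l_one monoid.r_one)

definition GL_int :: "(int ^ 'n ^ 'n) monoid" where
  "GL_int = \<lparr> carrier = {A. invertible A}, mult = (**), one = mat 1 \<rparr>"

lemma group_GL_int: "Group.group GL_int"
proof (rule groupI)
  fix A :: "int ^ 'n ^ 'n" assume "A \<in> carrier GL_int"
  then obtain B where B: "A ** B = mat 1" "B ** A = mat 1"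
    by (auto simp: GL_int_def invertible_def)
  then have "B \<in> carrier GL_int" by (auto simp: GL_int_def invertible_def)
  with B show "\<exists>B\<in>carrier GL_int. B \<otimes>\<^bsub>GL_int\<^esub> A = \<one>\<^bsub>GL_int\<^esub>"
    by (auto simp: GL_int_def)
next
  fix A B :: "int ^ 'n ^ 'n" assume "A \<in> carrier GL_int" "B \<in> carrier GL_int"
  then show "A \<otimes>\<^bsub>GL_int\<^esub> B \<in> carrier GL_int"
    by (simp add: GL_int_def invertible_mult)
next
  show "\<one>\<^bsub>GL_int\<^esub> \<in> carrier (GL_int :: (int ^ 'n ^ 'n) monoid)"
    by (auto simp: GL_int_def invertible_def intro: exI[of _ "mat 1"])
qed (auto simp: GL_int_def matrix_mul_assoc)


section \<open>The poset of unimodular subsets of the integer lattice\<close>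

text \<open>Linear independence over the integers is that of the library's locale for modules over
  commutative rings, instantiated here.\<close>

lemma module_int_vec: "Modules.module ((*s) :: int \<Rightarrow> int ^ 'n \<Rightarrow> int ^ 'n)"
  by standard (auto simp: vec_eq_iff algebra_simps)

definition lin_indep_int :: "(int ^ 'n) set \<Rightarrow> bool" where
  "lin_indep_int B \<longleftrightarrow> \<not> Modules.module.dependent (*s) B"

definition IR :: "(int ^ 'n) set set" where
  "IR = {E. 0 \<notin> E \<and> uminus ` E = E \<and> group_closure E = UNIV \<and>
     (\<forall>B. B \<subseteq> E \<and> finite B \<and> card B = CARD('n) \<and> lin_indep_int B \<longrightarrow> group_closure B = UNIV)}"


section \<open>Freely oriented matroids\<close>

record ('a, 'b) signed_system =
  Cover :: "'a set"
  Base :: "'b set"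
  Proj :: "'a \<Rightarrow> 'b"
  Circuits :: "'a set set"

text \<open>The projection is extensional, so that objects do not depend on junk values.\<close>

definition two_fold_covering :: "'a set \<Rightarrow> 'b set \<Rightarrow> ('a \<Rightarrow> 'b) \<Rightarrow> bool" where
  "two_fold_covering T E p \<longleftrightarrow> finite E \<and> p \<in> T \<rightarrow>\<^sub>E E \<and> p ` T = E \<and>
     (\<forall>x\<in>E. card {e \<in> T. p e = x} = 2)"

definition bar :: "('a, 'b, 'z) signed_system_scheme \<Rightarrow> 'a \<Rightarrow> 'a" where
  "bar M e = (THE e'. e' \<in> Cover M \<and> Proj M e' = Proj M e \<and> e' \<noteq> e)"

definition freely_oriented_matroid :: "('a, 'b, 'z) signed_system_scheme \<Rightarrow> bool" where
  "freely_oriented_matroid M \<longleftrightarrow>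
     two_fold_covering (Cover M) (Base M) (Proj M) \<and>
     (\<forall>C\<in>Circuits M. C \<noteq> {} \<and> C \<subseteq> Cover M) \<and>
     (\<forall>C\<in>Circuits M. C \<inter> bar M ` C = {}) \<and>
     (\<forall>C\<in>Circuits M. bar M ` C \<in> Circuits M) \<and>
     (\<forall>C1\<in>Circuits M. \<forall>C2\<in>Circuits M. C1 \<subseteq> C2 \<union> bar M ` C2 \<longrightarrow> C1 = C2 \<or> C1 = bar M ` C2) \<and>
     (\<forall>C1\<in>Circuits M. \<forall>C2\<in>Circuits M. \<forall>e. C1 \<noteq> C2 \<and> e \<in> C1 \<inter> C2 \<longrightarrow>
        (\<exists>C3\<in>Circuits M. C3 \<subseteq> (C1 - {e}) \<union> bar M ` (C2 - {e})))"

definition base_independent :: "('a, 'b, 'z) signed_system_scheme \<Rightarrow> 'b set \<Rightarrow> bool" where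
  "base_independent M I \<longleftrightarrow> I \<subseteq> Base M \<and> \<not> (\<exists>C\<in>Circuits M. Proj M ` C \<subseteq> I)"

definition base_basis :: "('a, 'b, 'z) signed_system_scheme \<Rightarrow> 'b set \<Rightarrow> bool" where
  "base_basis M B \<longleftrightarrow> base_independent M B \<and> (\<forall>I. base_independent M I \<and> B \<subseteq> I \<longrightarrow> I = B)"

definition matroid_rank :: "('a, 'b, 'z) signed_system_scheme \<Rightarrow> nat" where
  "matroid_rank M = Max (card ` {I. base_independent M I})"

definition signed_independent :: "('a, 'b, 'z) signed_system_scheme \<Rightarrow> 'a set \<Rightarrow> bool" where
  "signed_independent M I \<longleftrightarrow> I \<subseteq> Cover M \<and> inj_on (Proj M) I \<and> base_independent M (Proj M ` I)"

definition signed_basis :: "('a, 'b, 'z) signed_system_scheme \<Rightarrow> 'a set \<Rightarrow> bool" where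
  "signed_basis M B \<longleftrightarrow> B \<subseteq> Cover M \<and> inj_on (Proj M) B \<and> base_basis M (Proj M ` B)"

definition representation ::
  "('a, 'b, 'z) signed_system_scheme \<Rightarrow> ('a \<Rightarrow> 'v::real_vector) \<Rightarrow> bool" where
  "representation M \<rho> \<longleftrightarrow>
     (\<forall>e\<in>Cover M. \<rho> e + \<rho> (bar M e) = 0) \<and>
     (\<forall>C\<in>Circuits M. \<exists>a. (\<forall>e\<in>C. a e > 0) \<and> (\<Sum>e\<in>C. a e *\<^sub>R \<rho> e) = 0) \<and>
     (\<forall>I. signed_independent M I \<longrightarrow> inj_on \<rho> I \<and> Real_Vector_Spaces.independent (\<rho> ` I)) \<and>
     Real_Vector_Spaces.span (\<rho> ` Cover M) = UNIV"

text \<open>The volume of a finite set of vectors is that of the parallelepiped which it spans.\<close>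

definition volume :: "'v::euclidean_space set \<Rightarrow> real" where
  "volume B = measure lebesgue {\<Sum>b\<in>B. c b *\<^sub>R b | c. \<forall>b\<in>B. 0 \<le> c b \<and> c b \<le> 1}"

definition unipotent_representation ::
  "('a, 'b, 'z) signed_system_scheme \<Rightarrow> ('a \<Rightarrow> 'v::euclidean_space) \<Rightarrow> bool" where
  "unipotent_representation M \<rho> \<longleftrightarrow> representation M \<rho> \<and>
     (\<forall>B B'. signed_basis M B \<and> signed_basis M B' \<longrightarrow> volume (\<rho> ` B) = volume (\<rho> ` B'))"

text \<open>A space with a representation has the rank of the matroid as its dimension, because a basis
  of the matroid is mapped bijectively onto a basis of it. In rank \<open>CARD('n)\<close> it is therefore
  enough to look for representations in \<open>real ^ 'n\<close>; equality of volumes does not depend on the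
  identification.\<close>

definition regular_of_rank :: "'n::finite itself \<Rightarrow> ('a, 'b, 'z) signed_system_scheme \<Rightarrow> bool" where
  "regular_of_rank _ M \<longleftrightarrow> freely_oriented_matroid M \<and> matroid_rank M = CARD('n) \<and>
     (\<exists>\<rho> :: 'a \<Rightarrow> real ^ 'n. unipotent_representation M \<rho>)"

definition matroid_maps ::
  "('a, 'b, 'z) signed_system_scheme \<Rightarrow> ('a, 'b, 'z) signed_system_scheme \<Rightarrow> ('a \<Rightarrow> 'a) set" where
  "matroid_maps M N = {f \<in> Cover M \<rightarrow>\<^sub>E Cover N. inj_on f (Cover M) \<and>
     (\<forall>e\<in>Cover M. f (bar M e) = bar N (f e)) \<and>
     (\<forall>S\<subseteq>Cover M. S \<in> Circuits M \<longleftrightarrow> f ` S \<in> Circuits N)}"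

text \<open>The total and base sets of the objects are finite, so for infinite types \<open>'a\<close> and \<open>'b\<close> this
  is a small category equivalent to that of all regular freely oriented matroids of rank \<open>CARD('n)\<close>.\<close>

definition regular_category ::
  "'n::finite itself \<Rightarrow> (('a, 'b) signed_system, 'a \<Rightarrow> 'a) category" where
  "regular_category n = \<lparr> Obj = {M. regular_of_rank n M}, Hom = matroid_maps,
     Id = (\<lambda>M. \<lambda>e\<in>Cover M. e), Comp = (\<lambda>M1 M2 M3 g f. compose (Cover M1) g f) \<rparr>"

lemma bar_props:
  assumes "two_fold_covering (Cover M) (Base M) (Proj M)" and "e \<in> Cover M"
  shows "bar M e \<in> Cover M \<and> Proj M (bar M e) = Proj M e \<and> bar M e \<noteq> e"
proof -
  have "card {e' \<in> Cover M. Proj M e' = Proj M e} = 2"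
    using assms by (auto simp: two_fold_covering_def)
  then obtain x y where xy: "{e' \<in> Cover M. Proj M e' = Proj M e} = {x, y}" "x \<noteq> y"
    by (meson card_2_iff)
  moreover have "e \<in> {e' \<in> Cover M. Proj M e' = Proj M e}"
    using assms by simp
  ultimately have "{e' \<in> Cover M. Proj M e' = Proj M e} = {e, y} \<and> e \<noteq> y \<or>
      {e' \<in> Cover M. Proj M e' = Proj M e} = {e, x} \<and> e \<noteq> x"
    by auto
  then obtain z where z: "{e' \<in> Cover M. Proj M e' = Proj M e} = {e, z}" "e \<noteq> z"
    by blast
  have "e' \<in> Cover M \<and> Proj M e' = Proj M e \<longleftrightarrow> e' = e \<or> e' = z" for e'
    using z(1) by (simp add: set_eq_iff)
  then have "\<exists>!e'. e' \<in> Cover M \<and> Proj M e' = Proj M e \<and> e' \<noteq> e"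
    using z(2) by (intro ex1I[of _ z]) auto
  then show ?thesis
    unfolding bar_def by (rule theI')
qed

lemma is_category_regular_category:
  "is_category (regular_category n :: (('a, 'b) signed_system, 'a \<Rightarrow> 'a) category)"
proof -
  let ?C = "regular_category n :: (('a, 'b) signed_system, 'a \<Rightarrow> 'a) category"
  have cov: "two_fold_covering (Cover M) (Base M) (Proj M)" if "M \<in> Obj ?C" for M
    using that by (auto simp: regular_category_def regular_of_rank_def freely_oriented_matroid_def)
  have img: "(\<lambda>e\<in>A. e) ` S = S" "compose A g f ` S = g ` f ` S" if "S \<subseteq> A"
    for A S :: "'a set" and f g :: "'a \<Rightarrow> 'a"
    using that by (auto simp: compose_def image_iff subset_iff Bex_def restrict_def)
  have "(\<lambda>e\<in>Cover M. e) \<in> matroid_maps M M" if "M \<in> Obj ?C" for M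
    using bar_props[OF cov[OF that]] img by (auto simp: matroid_maps_def inj_on_def)
  moreover have "compose (Cover L) g f \<in> matroid_maps L N"
    if "L \<in> Obj ?C" "f \<in> matroid_maps L M" "g \<in> matroid_maps M N" for L M N f g
  proof -
    have f: "f \<in> Cover L \<rightarrow> Cover M" "inj_on f (Cover L)"
      "\<And>e. e \<in> Cover L \<Longrightarrow> f (bar L e) = bar M (f e)"
      "\<And>S. S \<subseteq> Cover L \<Longrightarrow> S \<in> Circuits L \<longleftrightarrow> f ` S \<in> Circuits M"
      using that(2) by (auto simp: matroid_maps_def)
    have g: "g \<in> Cover M \<rightarrow> Cover N" "inj_on g (Cover M)"
      "\<And>e. e \<in> Cover M \<Longrightarrow> g (bar M e) = bar N (g e)"
      "\<And>S. S \<subseteq> Cover M \<Longrightarrow> S \<in> Circuits M \<longleftrightarrow> g ` S \<in> Circuits N"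
      using that(3) by (auto simp: matroid_maps_def)
    have "compose (Cover L) g f \<in> Cover L \<rightarrow>\<^sub>E Cover N"
      using f(1) g(1) by (auto simp: compose_def)
    moreover have "inj_on (compose (Cover L) g f) (Cover L)"
      using f(1,2) g(2) by (auto simp: inj_on_def compose_def Pi_iff)
    moreover have "compose (Cover L) g f (bar L e) = bar N (compose (Cover L) g f e)"
      if "e \<in> Cover L" for e
      using bar_props[OF cov[OF \<open>L \<in> Obj ?C\<close>] that] f g that by (auto simp: compose_def Pi_iff)
    moreover have "S \<in> Circuits L \<longleftrightarrow> compose (Cover L) g f ` S \<in> Circuits N" if "S \<subseteq> Cover L" for S
    proof -
      have "f ` S \<subseteq> Cover M" using f(1) that by auto
      then show ?thesis using f(4)[OF that] g(4)[of "f ` S"] img(2)[OF that] by simp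
    qed
    ultimately show ?thesis by (auto simp: matroid_maps_def)
  qed
  moreover have "compose (Cover L) (\<lambda>e\<in>Cover M. e) f = f \<and> compose (Cover L) f (\<lambda>e\<in>Cover L. e) = f"
    if "f \<in> matroid_maps L M" for L M f
    using that by (auto simp: matroid_maps_def compose_def PiE_iff extensional_def fun_eq_iff restrict_def)
  moreover have "compose (Cover K) h (compose (Cover K) g f) = compose (Cover K) (compose (Cover L) h g) f"
    if "f \<in> matroid_maps K L" for K L f g h
    using that by (auto simp: matroid_maps_def compose_def PiE_iff fun_eq_iff restrict_def)
  ultimately show ?thesis
    unfolding is_category_def regular_category_def category.simps mem_Collect_eq
    by (intro conjI ballI) blast+
qed

end

theory Submission
  imports Defs
begin

text \<open>A reduced positive definite binary quadratic form is a nonnegative combination of the squares of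
  the three vectors of a superbase of the lattice, with weights that the form determines. The quotient
  of the two smallest weights is the coordinate of a point on an edge of the tree \<open>|IR(2, Z)|\<close>. This
  retracts the convex cone of positive definite forms \<open>GL(2, Z)\<close>-equivariantly onto \<open>|IR(2, Z)|\<close>,
  which is therefore contractible.

  Let \<open>E\<close> be the category with objects \<open>IR(2, Z)\<close> and with morphisms \<open>X \<rightarrow> Y\<close> those
  \<open>g \<in> GL(2, Z)\<close> with \<open>g X \<subseteq> Y\<close>. The functor \<open>E \<rightarrow> GL(2, Z)\<close> induces a homotopy equivalence of
  classifying spaces: a simplex of the nerve of \<open>GL(2, Z)\<close> with arbitrary forms at its vertices is
  lifted by retracting convex combinations of these forms, and straight-line homotopies between the
  forms connect all such lifts.

  A unipotent representation of rank two is, in suitable coordinates, a function to the lattice whose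
  nonzero values form an element of \<open>IR(2, Z)\<close>; it is unique up to \<open>GL(2, Z)\<close>, because the signed
  circuits determine the coordinates with respect to a basis. This gives a functor \<open>P\<close> from
  regular matroids to \<open>E\<close>, and the matroid of a vector configuration gives a functor \<open>S\<close> back. Adjoining
  to a matroid a second copy of its nonzero vectors is an endofunctor \<open>F\<close>, which contains both the
  identity and \<open>S \<circ> P\<close> naturally, and \<open>P \<circ> S\<close> is naturally isomorphic to the identity. Since natural
  transformations induce homotopies, \<open>P\<close> is a homotopy equivalence as well.\<close>

section \<open>Maps and homotopies on realizations and classifying spaces\<close>

section \<open>Maps out of realizations\<close>

text \<open>In rank two a member of \<open>IR\<close> is a basis or a superbase, up to signs, so
  that \<open>|IR|\<close> is a graph. The delicate point of the retraction is that a form may be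
  reduced in several ways. Its weights nevertheless depend on the form alone, and the reduction is
  ambiguous only where the ambiguous vertex of the edge has coordinate zero.

  The category \<open>E\<close> is the Grothendieck construction of the action, so its classifying
  space models the homotopy quotient of \<open>|IR|\<close>. Convexity of the cone of forms does the
  work that abstract contractibility would do: since the retraction is continuous and commutes with
  the group, the lift of a simplex is given by one formula, natural in the simplex, rather than
  extended skeleton by skeleton.

  Homotopies and lifts both pass through the product of a simplex with an edge. Its points are
  treated as measures: a point of a simplex and a point of an edge have a monotone coupling, which
  is supported on a chain and is continuous and natural in the simplex. The shuffles that
  triangulate the prism enter only as representatives of this measure, so gluing along common faces
  is automatic.\<close>

abbreviation simplex_top :: "nat \<Rightarrow> (nat \<Rightarrow> real) topology" where
  "simplex_top n \<equiv> subtopology (powertop_real UNIV) (standard_simplex n)"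

definition pull_closed :: "('x, 'z) simplicial_set_scheme \<Rightarrow> bool" where
  "pull_closed X \<longleftrightarrow> (\<forall>m n \<theta> x. simplex_op m n \<theta> \<and> x \<in> Simplices X n \<longrightarrow> Pull X m \<theta> x \<in> Simplices X m)"

definition simplex_class ::
  "('x, 'z) simplicial_set_scheme \<Rightarrow> nat \<Rightarrow> 'x \<Rightarrow> (nat \<Rightarrow> real) \<Rightarrow> ((nat \<times> 'x) \<times> (nat \<Rightarrow> real)) set" where
  "simplex_class X n x t = gluing_equiv X `` {((n, x), t)}"

lemma pull_closed_nerve: "pull_closed (nerve C)"
  by (auto simp: pull_closed_def intro: nerve_Pull)

lemma standard_simplexI:
  assumes "\<And>i. 0 \<le> t i" and "\<And>i. i > n \<Longrightarrow> t i = 0" and "(\<Sum>i\<le>n. t i) = 1"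
  shows "t \<in> standard_simplex n"
proof -
  have "t i \<le> 1" for i
  proof (cases "i \<le> n")
    case True
    then have "t i \<le> (\<Sum>i\<le>n. t i)"
      using assms(1) by (intro member_le_sum) auto
    then show ?thesis using assms(3) by simp
  qed (use assms(2) in force)
  then show ?thesis
    using assms by (auto simp: standard_simplex_def)
qed

lemma standard_simplexD:
  assumes "t \<in> standard_simplex n"
  shows "0 \<le> t i" "t i \<le> 1" "n < i \<Longrightarrow> t i = 0" "(\<Sum>i\<le>n. t i) = 1"
  using assms by (auto simp: standard_simplex_def)

lemma sum_push_simplex:
  assumes "finite A"
  shows "(\<Sum>j\<in>A. push_simplex m \<theta> t j) = (\<Sum>i | i \<le> m \<and> \<theta> i \<in> A. t i)"
proof -
  have "(\<Sum>j\<in>A. push_simplex m \<theta> t j) = (\<Sum>j\<in>A. sum t {i \<in> {i. i \<le> m \<and> \<theta> i \<in> A}. \<theta> i = j})"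
    unfolding push_simplex_def by (intro sum.cong arg_cong2[where f = sum]) auto
  also have "\<dots> = sum t {i. i \<le> m \<and> \<theta> i \<in> A}"
    using assms by (intro sum.group) auto
  finally show ?thesis .
qed

lemma push_simplex_in_standard_simplex:
  assumes "simplex_op m n \<theta>" "t \<in> standard_simplex m"
  shows "push_simplex m \<theta> t \<in> standard_simplex n"
proof (rule standard_simplexI)
  show "0 \<le> push_simplex m \<theta> t i" for i
    unfolding push_simplex_def using standard_simplexD(1)[OF assms(2)] by (intro sum_nonneg) auto
  show "push_simplex m \<theta> t i = 0" if "n < i" for i
  proof -
    have "{k. k \<le> m \<and> \<theta> k = i} = {}"
      using assms(1) that by (auto simp: simplex_op_def)
    then show ?thesis
      unfolding push_simplex_def by (metis sum.empty)
  qed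
  have "{i. i \<le> m \<and> \<theta> i \<in> {..n}} = {..m}"
    using assms(1) by (auto simp: simplex_op_def)
  then show "(\<Sum>i\<le>n. push_simplex m \<theta> t i) = 1"
    using standard_simplexD(4)[OF assms(2)] by (simp add: sum_push_simplex)
qed

lemma topspace_simplices_space:
  "topspace (simplices_space X) = {((n, x), t). x \<in> Simplices X n \<and> t \<in> standard_simplex n}"
  by (auto simp: simplices_space_def)

lemma quotient_map_quotient_topology:
  assumes "equiv (topspace X) R"
  shows "quotient_map X (quotient_topology X R) (\<lambda>x. R `` {x})"
proof -
  have top: "topspace (quotient_topology X R) = topspace X // R"
  proof -
    have "openin (quotient_topology X R) (topspace X // R)"
      using assms by (simp add: openin_quotient_topology Union_quotient)
    then show ?thesis
      using openin_quotient_topology[OF assms] openin_subset by (metis openin_topspace subset_antisym)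
  qed
  \<comment> \<open>The preimage of a set of classes is its union, which is what the definition of
    \<open>quotient_topology\<close> tests for openness.\<close>
  have pre: "{x \<in> topspace X. R `` {x} \<in> U} = \<Union>U" if "U \<subseteq> topspace X // R" for U
  proof
    show "{x \<in> topspace X. R `` {x} \<in> U} \<subseteq> \<Union>U"
    proof
      fix x assume "x \<in> {x \<in> topspace X. R `` {x} \<in> U}"
      then show "x \<in> \<Union>U" using equiv_class_self[OF assms, of x] by blast
    qed
    show "\<Union>U \<subseteq> {x \<in> topspace X. R `` {x} \<in> U}"
    proof
      fix x assume "x \<in> \<Union>U"
      then obtain A where A: "A \<in> U" "x \<in> A" by blast
      then have q: "A \<in> topspace X // R" using that by blast
      then have "x \<in> topspace X" using A(2) in_quotient_imp_subset[OF assms] by blast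
      moreover have "R `` {x} = A"
        using q A(2) quotient_eq_iff[OF assms quotientI[OF \<open>x \<in> topspace X\<close>] q]
          equiv_class_self[OF assms \<open>x \<in> topspace X\<close>] quotient_disj[OF assms quotientI[OF \<open>x \<in> topspace X\<close>] q] by blast
      ultimately show "x \<in> {x \<in> topspace X. R `` {x} \<in> U}" using A by simp
    qed
  qed
  show ?thesis
    unfolding quotient_map_def top
  proof (intro conjI allI impI)
    show "(\<lambda>x. R `` {x}) ` topspace X = topspace X // R"
      by (auto simp: quotient_def)
    show "openin X {x \<in> topspace X. R `` {x} \<in> U} = openin (quotient_topology X R) U"
      if "U \<subseteq> topspace X // R" for U
      using pre[OF that] that by (simp add: openin_quotient_topology[OF assms])
  qed
qed

lemma quotient_map_simplex_class:
  "quotient_map (simplices_space X) (realization X) (\<lambda>((n, x), t). simplex_class X n x t)"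
proof -
  have "(\<lambda>((n, x), t). simplex_class X n x t) = (\<lambda>p. gluing_equiv X `` {p})"
    by (auto simp: simplex_class_def fun_eq_iff)
  then show ?thesis
    unfolding realization_def by (simp add: quotient_map_quotient_topology equiv_gluing_equiv)
qed

lemma topspace_realization:
  "topspace (realization X) = {simplex_class X n x t | n x t. x \<in> Simplices X n \<and> t \<in> standard_simplex n}"
  unfolding quotient_imp_surjective_map[OF quotient_map_simplex_class, symmetric]
    topspace_simplices_space by (force simp: image_iff)

lemma continuous_map_simplex_class:
  assumes "x \<in> Simplices X n"
  shows "continuous_map (simplex_top n) (realization X) (simplex_class X n x)"
proof -
  have "continuous_map (simplex_top n) (simplices_space X) (\<lambda>t. ((n, x), t))"
    unfolding simplices_space_def
    using continuous_map_component_injection[of "(n, x)" "Sigma UNIV (Simplices X)"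
        "\<lambda>(n, x). simplex_top n"] assms by simp
  from continuous_map_compose[OF this quotient_imp_continuous_map[OF quotient_map_simplex_class]]
  show ?thesis by (simp add: o_def)
qed

lemma simplex_class_Pull:
  assumes "pull_closed X" "simplex_op m n \<theta>" "x \<in> Simplices X n" "t \<in> standard_simplex m"
  shows "simplex_class X m (Pull X m \<theta> x) t = simplex_class X n x (push_simplex m \<theta> t)"
proof -
  have "(((m, Pull X m \<theta> x), t), ((n, x), push_simplex m \<theta> t)) \<in> glue X"
    using assms by (auto simp: glue_def)
  moreover have "((m, Pull X m \<theta> x), t) \<in> topspace (simplices_space X)"
    "((n, x), push_simplex m \<theta> t) \<in> topspace (simplices_space X)"
    using assms push_simplex_in_standard_simplex by (auto simp: topspace_simplices_space pull_closed_def)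
  ultimately have "(((m, Pull X m \<theta> x), t), ((n, x), push_simplex m \<theta> t)) \<in> gluing_equiv X"
    by (auto simp: gluing_equiv_def)
  then show ?thesis
    unfolding simplex_class_def using equiv_class_eq[OF equiv_gluing_equiv] by metis
qed

text \<open>The gluing relation is generated by the single identifications in \<open>glue\<close>; a
  function that respects each of them is constant along every zigzag of them.\<close>

lemma gluing_equiv_invariant:
  assumes pc: "pull_closed X"
    and compat: "\<And>m n \<theta> x t. simplex_op m n \<theta> \<Longrightarrow> x \<in> Simplices X n \<Longrightarrow> t \<in> standard_simplex m \<Longrightarrow>
      h m (Pull X m \<theta> x) t = h n x (push_simplex m \<theta> t)"
    and eq: "simplex_class X m x t = simplex_class X n y u"
    and x: "x \<in> Simplices X m" "t \<in> standard_simplex m"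
    and y: "y \<in> Simplices X n" "u \<in> standard_simplex n"
  shows "h m x t = h n y u"
proof -
  let ?h = "\<lambda>((n, x), t). h n x t"
  have step: "?h p = ?h q" if "(p, q) \<in> glue X \<union> (glue X)\<inverse>" for p q
    using that compat by (auto simp: glue_def)
  have "(p, q) \<in> (glue X \<union> (glue X)\<inverse>)\<^sup>* \<Longrightarrow> ?h p = ?h q" for p q
    by (induction rule: rtrancl_induct) (use step in auto)
  moreover have "(((m, x), t), ((n, y), u)) \<in> gluing_equiv X"
    using eq x y unfolding simplex_class_def
    by (intro eq_equiv_class[OF _ equiv_gluing_equiv]) (auto simp: topspace_simplices_space)
  ultimately show ?thesis
    by (force simp: gluing_equiv_def)
qed

text \<open>Crossing with the compact interval preserves the quotient map, so that a homotopy may be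
  defined simplexwise.\<close>

lemma realization_homotopy_out:
  assumes pc: "pull_closed X"
    and cont: "\<And>n x. x \<in> Simplices X n \<Longrightarrow>
      continuous_map (prod_topology (top_of_set {0..1::real}) (simplex_top n)) Y (\<lambda>(s, t). h n x s t)"
    and compat: "\<And>m n \<theta> x s t. simplex_op m n \<theta> \<Longrightarrow> x \<in> Simplices X n \<Longrightarrow> t \<in> standard_simplex m \<Longrightarrow>
      s \<in> {0..1} \<Longrightarrow> h m (Pull X m \<theta> x) s t = h n x s (push_simplex m \<theta> t)"
  obtains H where "continuous_map (prod_topology (top_of_set {0..1}) (realization X)) Y H"
    and "\<And>n x s t. x \<in> Simplices X n \<Longrightarrow> t \<in> standard_simplex n \<Longrightarrow> s \<in> {0..1} \<Longrightarrow>
      H (s, simplex_class X n x t) = h n x s t"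
proof -
  let ?I = "top_of_set {0..1::real}"
  let ?P = "prod_topology ?I (simplices_space X)"
  let ?q = "\<lambda>(s, p). (s, (\<lambda>((n, x), t). simplex_class X n x t) p)"
  let ?h = "\<lambda>(s, ((n, x), t)). h n x s t"
  have "locally_compact_space ?I" "Hausdorff_space ?I"
    by (simp_all add: compact_imp_locally_compact_space compact_space_subtopology Hausdorff_space_subtopology)
  then have q: "quotient_map ?P (prod_topology ?I (realization X)) ?q"
    using quotient_map_prod_right[OF _ _ quotient_map_simplex_class] by blast
  have "continuous_map ?P Y ?h"
    unfolding continuous_map_def
  proof (intro conjI allI impI)
    show "?h \<in> topspace ?P \<rightarrow> topspace Y"
    proof (clarsimp simp: topspace_simplices_space)
      fix n x s t
      assume "x \<in> Simplices X n" "t \<in> standard_simplex n" "0 \<le> s" "s \<le> (1::real)"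
      then have "(s, t) \<in> topspace (prod_topology ?I (simplex_top n))" by simp
      then show "h n x s t \<in> topspace Y"
        using continuous_map_image_subset_topspace[OF cont[OF \<open>x \<in> Simplices X n\<close>]] by blast
    qed
    fix V assume V: "openin Y V"
    let ?U = "{p \<in> topspace ?P. ?h p \<in> V}"
    show "openin ?P ?U"
      unfolding openin_prod_topology_alt
    proof (intro allI impI)
      fix s p assume sp: "(s, p) \<in> ?U"
      obtain n x t where p: "p = ((n, x), t)" by (metis surj_pair)
      have nx: "x \<in> Simplices X n" "t \<in> standard_simplex n" "s \<in> {0..1}" "h n x s t \<in> V"
        using sp by (auto simp: p topspace_simplices_space)
      have "openin (prod_topology ?I (simplex_top n))
          {z \<in> topspace (prod_topology ?I (simplex_top n)). (\<lambda>(s, t). h n x s t) z \<in> V}"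
        using openin_continuous_map_preimage[OF cont[OF nx(1)] V] .
      moreover have "(s, t) \<in> {z \<in> topspace (prod_topology ?I (simplex_top n)). (\<lambda>(s, t). h n x s t) z \<in> V}"
        using nx by auto
      ultimately obtain A B where AB: "openin ?I A" "openin (simplex_top n) B" "s \<in> A" "t \<in> B"
        "A \<times> B \<subseteq> {z \<in> topspace (prod_topology ?I (simplex_top n)). (\<lambda>(s, t). h n x s t) z \<in> V}"
        unfolding openin_prod_topology_alt by meson
      \<comment> \<open>Each summand is open in the sum, so a neighbourhood found within the summand
        of \<open>(n, x)\<close> is one in the whole space.\<close>
      let ?B = "Pair (n, x) ` B"
      have "openin (simplices_space X) ?B"
        using open_map_component_injection[of "(n, x)" "Sigma UNIV (Simplices X)"
            "\<lambda>(n, x). simplex_top n"] nx(1) AB(2)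
        unfolding simplices_space_def open_map_def by auto
      moreover have "A \<times> ?B \<subseteq> ?U"
        using AB(5) nx(1) by (auto simp: topspace_simplices_space)
      ultimately show "\<exists>U V'. openin ?I U \<and> openin (simplices_space X) V' \<and> s \<in> U \<and> p \<in> V' \<and> U \<times> V' \<subseteq> ?U"
        using AB p by blast
    qed
  qed
  moreover have "?h a = ?h b" if ab: "a \<in> topspace ?P" "b \<in> topspace ?P" "?q a = ?q b" for a b
  proof -
    obtain s m x t n y u where "a = (s, ((m, x), t))" "b = (s, ((n, y), u))"
      using ab(3) by (auto split: prod.splits)
    then show ?thesis
      using ab gluing_equiv_invariant[OF pc, of "\<lambda>n x t. h n x s t" m x t n y u] compat
      by (auto simp: topspace_simplices_space)
  qed
  ultimately show thesis
  proof (rule quotient_map_lift_exists[OF q])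
    fix H
    assume H: "continuous_map (prod_topology ?I (realization X)) Y H"
      "\<And>a. a \<in> topspace ?P \<Longrightarrow> H (?q a) = ?h a"
    show thesis
    proof (rule that[OF H(1)])
      show "H (s, simplex_class X n x t) = h n x s t"
        if "x \<in> Simplices X n" "t \<in> standard_simplex n" "s \<in> {0..1}" for n x s t
        using H(2)[of "(s, ((n, x), t))"] that by (simp add: topspace_simplices_space)
    qed
  qed
qed

text \<open>A map is a homotopy that does not depend on time, evaluated at time 0.\<close>

lemma realization_map_out:
  assumes pc: "pull_closed X"
    and cont: "\<And>n x. x \<in> Simplices X n \<Longrightarrow> continuous_map (simplex_top n) Y (h n x)"
    and compat: "\<And>m n \<theta> x t. simplex_op m n \<theta> \<Longrightarrow> x \<in> Simplices X n \<Longrightarrow> t \<in> standard_simplex m \<Longrightarrow>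
      h m (Pull X m \<theta> x) t = h n x (push_simplex m \<theta> t)"
  obtains H where "continuous_map (realization X) Y H"
    and "\<And>n x t. x \<in> Simplices X n \<Longrightarrow> t \<in> standard_simplex n \<Longrightarrow> H (simplex_class X n x t) = h n x t"
proof -
  obtain H where H: "continuous_map (prod_topology (top_of_set {0..1::real}) (realization X)) Y H"
    "\<And>n x s t. x \<in> Simplices X n \<Longrightarrow> t \<in> standard_simplex n \<Longrightarrow> s \<in> {0..1} \<Longrightarrow>
      H (s, simplex_class X n x t) = h n x t"
  proof (rule realization_homotopy_out[OF pc, of Y "\<lambda>n x s t. h n x t"])
    show "continuous_map (prod_topology (top_of_set {0..1::real}) (simplex_top n)) Y (\<lambda>(s, t). h n x t)"
      if "x \<in> Simplices X n" for n x
      using continuous_map_compose[OF continuous_map_snd cont[OF that]]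
      by (simp add: o_def case_prod_unfold)
  qed (use compat in auto)
  have "continuous_map (realization X) (prod_topology (top_of_set {0..1::real}) (realization X)) (\<lambda>p. (0, p))"
    by (simp add: continuous_map_pairedI)
  from continuous_map_compose[OF this H(1)] show thesis
    using H(2)[of _ _ _ 0] by (intro that[of "\<lambda>p. H (0, p)"]) (auto simp: o_def)
qed

lemma realization_homotopic:
  assumes pc: "pull_closed X"
    and cont: "\<And>n x. x \<in> Simplices X n \<Longrightarrow>
      continuous_map (prod_topology (top_of_set {0..1::real}) (simplex_top n)) Y (\<lambda>(s, t). h n x s t)"
    and compat: "\<And>m n \<theta> x s t. simplex_op m n \<theta> \<Longrightarrow> x \<in> Simplices X n \<Longrightarrow> t \<in> standard_simplex m \<Longrightarrow>
      s \<in> {0..1} \<Longrightarrow> h m (Pull X m \<theta> x) s t = h n x s (push_simplex m \<theta> t)"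
    and f: "\<And>n x t. x \<in> Simplices X n \<Longrightarrow> t \<in> standard_simplex n \<Longrightarrow> h n x 0 t = f (simplex_class X n x t)"
    and g: "\<And>n x t. x \<in> Simplices X n \<Longrightarrow> t \<in> standard_simplex n \<Longrightarrow> h n x 1 t = g (simplex_class X n x t)"
  shows "homotopic_with (\<lambda>_. True) (realization X) Y f g"
proof -
  obtain H where H: "continuous_map (prod_topology (top_of_set {0..1}) (realization X)) Y H"
    "\<And>n x s t. x \<in> Simplices X n \<Longrightarrow> t \<in> standard_simplex n \<Longrightarrow> s \<in> {0..1} \<Longrightarrow>
      H (s, simplex_class X n x t) = h n x s t"
    using realization_homotopy_out[OF pc cont compat] by blast
  have "H (0, p) = f p \<and> H (1, p) = g p" if "p \<in> topspace (realization X)" for p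
    using that H(2) f g by (auto simp: topspace_realization)
  then show ?thesis
    using H(1) by (subst homotopic_with) auto
qed

section \<open>Points given by measures on a poset\<close>

definition push_measure :: "nat \<Rightarrow> (nat \<Rightarrow> 'p) \<Rightarrow> (nat \<Rightarrow> real) \<Rightarrow> 'p \<Rightarrow> real" where
  "push_measure m c t p = (\<Sum>i | i \<le> m \<and> c i = p. t i)"

definition chain_map :: "'p::order set \<Rightarrow> nat \<Rightarrow> (nat \<Rightarrow> 'p) \<Rightarrow> bool" where
  "chain_map P m c \<longleftrightarrow> mono_on {..m} c \<and> c ` {..m} \<subseteq> P"

text \<open>A point of the realization of the order complex of \<open>P\<close> is a probability measure \<open>\<mu>\<close> supported on a
  finite chain; the simplices \<open>\<sigma> m c\<close> carry it to the realization of \<open>X\<close>. Off such measures the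
  description is empty.\<close>

definition measure_point ::
  "('x, 'z) simplicial_set_scheme \<Rightarrow> 'p::order set \<Rightarrow> (nat \<Rightarrow> (nat \<Rightarrow> 'p) \<Rightarrow> 'x) \<Rightarrow> ('p \<Rightarrow> real) \<Rightarrow>
    ((nat \<times> 'x) \<times> (nat \<Rightarrow> real)) set" where
  "measure_point X P \<sigma> \<mu> = (THE z. \<exists>m c t. chain_map P m c \<and> t \<in> standard_simplex m \<and>
     \<mu> = push_measure m c t \<and> z = simplex_class X m (\<sigma> m c) t)"

text \<open>In substance a simplicial map from the nerve of \<open>P\<close> to \<open>X\<close>.
  Chains are only weakly increasing, so degenerate simplices are included. A chain is coded by a
  function on all natural numbers; \<open>simplex_cong\<close> says that its values beyond
  \<open>m\<close> do not matter.\<close>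

locale poset_family =
  fixes X :: "('x, 'z) simplicial_set_scheme" and P :: "'p::order set"
    and \<sigma> :: "nat \<Rightarrow> (nat \<Rightarrow> 'p) \<Rightarrow> 'x"
  assumes pull_closed: "pull_closed X"
    and simplex: "chain_map P m c \<Longrightarrow> \<sigma> m c \<in> Simplices X m"
    and Pull_simplex: "simplex_op m n \<theta> \<Longrightarrow> chain_map P n c \<Longrightarrow> Pull X m \<theta> (\<sigma> n c) = \<sigma> m (c \<circ> \<theta>)"
    and simplex_cong: "(\<And>i. i \<le> m \<Longrightarrow> c i = c' i) \<Longrightarrow> \<sigma> m c = \<sigma> m c'"

text \<open>In a finite chain an element is located by the number of elements strictly below
  it.\<close>

lemma finite_chain_enum:
  fixes S :: "'p::order set"
  assumes "finite S" "S \<noteq> {}" and chain: "\<And>x y. x \<in> S \<Longrightarrow> y \<in> S \<Longrightarrow> x \<le> y \<or> y \<le> x"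
  obtains e :: "nat \<Rightarrow> 'p" and p where "bij_betw e {..p} S" and "\<And>i j. i \<le> p \<Longrightarrow> j \<le> p \<Longrightarrow> e i \<le> e j \<longleftrightarrow> i \<le> j"
proof -
  define rank where "rank x = card {y \<in> S. y < x}" for x
  obtain p where p: "card S = Suc p"
    using assms(1,2) by (metis card_gt_0_iff gr0_implies_Suc)
  have less: "rank x < rank y" if "x \<in> S" "y \<in> S" "x < y" for x y
    unfolding rank_def using that assms(1) by (intro psubset_card_mono) auto
  have le: "x \<le> y \<longleftrightarrow> rank x \<le> rank y" if "x \<in> S" "y \<in> S" for x y
    using less[OF that] less[OF that(2,1)] chain[OF that] by force
  have inj: "inj_on rank S"
    using le by (auto intro!: inj_onI antisym)
  have "rank x \<le> p" if "x \<in> S" for x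
  proof -
    have "rank x < card S"
      unfolding rank_def using that assms(1) by (intro psubset_card_mono) auto
    then show ?thesis using p by simp
  qed
  then have "rank ` S = {..p}"
    using inj p by (intro card_subset_eq) (auto simp: card_image)
  then have "bij_betw rank S {..p}"
    using inj by (simp add: bij_betw_def)
  then have b: "bij_betw (inv_into S rank) {..p} S"
    by (rule bij_betw_inv_into)
  show thesis
  proof (rule that[OF b])
    fix i j assume ij: "i \<le> p" "j \<le> p"
    have "inv_into S rank i \<in> S" "inv_into S rank j \<in> S"
      using ij b by (auto simp: bij_betw_def)
    moreover have "rank (inv_into S rank i) = i" "rank (inv_into S rank j) = j"
      using ij \<open>rank ` S = {..p}\<close> by (simp_all add: f_inv_into_f)
    ultimately show "inv_into S rank i \<le> inv_into S rank j \<longleftrightarrow> i \<le> j"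
      using le by simp
  qed
qed

lemma push_measure_nonzero:
  assumes "t \<in> standard_simplex m"
  shows "{q. push_measure m c t q \<noteq> 0} = c ` {i. i \<le> m \<and> t i \<noteq> 0}"
proof -
  have "push_measure m c t q = 0 \<longleftrightarrow> (\<forall>i. i \<le> m \<and> c i = q \<longrightarrow> t i = 0)" for q
    unfolding push_measure_def using standard_simplexD(1)[OF assms]
    by (subst sum_nonneg_eq_0_iff) auto
  then show ?thesis by auto
qed

context poset_family
begin

text \<open>A normal form for points: pass to the face of the vertices with nonzero weight, then
  merge the vertices with the same image by a degeneracy. The result mentions only the pushed
  measure.\<close>

lemma simplex_class_enum:
  assumes c: "chain_map P m c" and t: "t \<in> standard_simplex m"
    and e: "bij_betw e {..p} {q. push_measure m c t q \<noteq> 0}"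
      "\<And>i j. i \<le> p \<Longrightarrow> j \<le> p \<Longrightarrow> e i \<le> e j \<longleftrightarrow> i \<le> j"
  shows "simplex_class X m (\<sigma> m c) t =
    simplex_class X p (\<sigma> p e) (\<lambda>i. if i \<le> p then push_measure m c t (e i) else 0)"
proof -
  \<comment> \<open>First reduction: the face spanned by the vertices of nonzero weight.\<close>
  define I where "I = {i. i \<le> m \<and> t i \<noteq> 0}"
  have "I \<noteq> {}"
    using standard_simplexD(4)[OF t] by (auto simp: I_def intro: ccontr)
  moreover have "finite I" by (simp add: I_def)
  ultimately obtain \<theta> :: "nat \<Rightarrow> nat" and r where \<theta>: "bij_betw \<theta> {..r} I"
    "\<And>i j. i \<le> r \<Longrightarrow> j \<le> r \<Longrightarrow> \<theta> i \<le> \<theta> j \<longleftrightarrow> i \<le> j"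
    using finite_chain_enum[of I] nat_le_linear by metis
  have \<theta>I: "\<theta> i \<in> I" if "i \<le> r" for i
    using \<theta>(1) that by (auto simp: bij_betw_def)
  have op\<theta>: "simplex_op r m \<theta>"
    using \<theta>(2) \<theta>I by (auto simp: simplex_op_def mono_on_def I_def)
  define u where "u i = (if i \<le> r then t (\<theta> i) else 0)" for i
  have sums: "(\<Sum>i | i \<le> r \<and> Q (\<theta> i). u i) = (\<Sum>i | i \<le> m \<and> Q i. t i)" for Q
  proof -
    have bb: "bij_betw \<theta> {i. i \<le> r \<and> Q (\<theta> i)} {i. i \<in> I \<and> Q i}"
      using \<theta>(1) unfolding bij_betw_def by (auto intro: inj_on_subset)
    have "(\<Sum>i | i \<le> r \<and> Q (\<theta> i). u i) = (\<Sum>i | i \<le> r \<and> Q (\<theta> i). t (\<theta> i))"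
      by (rule sum.cong) (auto simp: u_def)
    also have "\<dots> = (\<Sum>i | i \<in> I \<and> Q i. t i)"
      by (rule sum.reindex_bij_betw[OF bb])
    also have "\<dots> = (\<Sum>i | i \<le> m \<and> Q i. t i)"
      by (rule sum.mono_neutral_left) (auto simp: I_def)
    finally show ?thesis .
  qed
  have u: "u \<in> standard_simplex r"
    using sums[of "\<lambda>_. True"] standard_simplexD[OF t]
    by (intro standard_simplexI) (auto simp: u_def atMost_def)
  have "push_simplex r \<theta> u j = t j" for j
  proof -
    have "push_simplex r \<theta> u j = (\<Sum>i | i \<le> m \<and> i = j. t i)"
      unfolding push_simplex_def by (rule sums)
    also have "{i. i \<le> m \<and> i = j} = (if j \<le> m then {j} else {})" by auto
    finally show ?thesis using standard_simplexD(3)[OF t] by auto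
  qed
  then have "simplex_class X m (\<sigma> m c) t = simplex_class X m (\<sigma> m c) (push_simplex r \<theta> u)"
    by presburger
  also have "\<dots> = simplex_class X r (\<sigma> r (c \<circ> \<theta>)) u"
    using simplex_class_Pull[OF pull_closed op\<theta> simplex[OF c] u] Pull_simplex[OF op\<theta> c] by simp
  finally have eq1: "simplex_class X m (\<sigma> m c) t = simplex_class X r (\<sigma> r (c \<circ> \<theta>)) u" .
  \<comment> \<open>Second reduction: the degeneracy that identifies vertices with equal image in
    \<open>P\<close>.\<close>
  define \<kappa> where "\<kappa> i = inv_into {..p} e (c (\<theta> i))" for i
  have im: "e ` {..p} = c ` I"
    using e(1) push_measure_nonzero[OF t, of c] by (auto simp: bij_betw_def I_def)
  have \<kappa>: "\<kappa> i \<le> p" "e (\<kappa> i) = c (\<theta> i)" if "i \<le> r" for i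
  proof -
    have "c (\<theta> i) \<in> e ` {..p}" using im \<theta>I[OF that] by auto
    then show "\<kappa> i \<le> p" "e (\<kappa> i) = c (\<theta> i)"
      unfolding \<kappa>_def by (metis inv_into_into atMost_iff, metis f_inv_into_f)
  qed
  have op\<kappa>: "simplex_op r p \<kappa>"
  proof -
    have "\<kappa> i \<le> \<kappa> j" if "i \<le> j" "j \<le> r" for i j
    proof -
      have "c (\<theta> i) \<le> c (\<theta> j)"
        using c op\<theta> that by (auto simp: chain_map_def simplex_op_def mono_on_def image_subset_iff)
      then show ?thesis using e(2) \<kappa> that by (metis order_trans)
    qed
    then show ?thesis using \<kappa>(1) by (auto simp: simplex_op_def mono_on_def)
  qed
  have cm: "chain_map P p e"
  proof -
    have "e ` {..p} \<subseteq> P" using im c by (auto simp: chain_map_def I_def)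
    then show ?thesis using e(2) by (auto simp: chain_map_def mono_on_def)
  qed
  have "\<sigma> r (c \<circ> \<theta>) = \<sigma> r (e \<circ> \<kappa>)"
    by (rule simplex_cong) (use \<kappa> in auto)
  then have "simplex_class X r (\<sigma> r (c \<circ> \<theta>)) u = simplex_class X p (\<sigma> p e) (push_simplex r \<kappa> u)"
    using simplex_class_Pull[OF pull_closed op\<kappa> simplex[OF cm] u] Pull_simplex[OF op\<kappa> cm] by simp
  moreover have "push_simplex r \<kappa> u = (\<lambda>i. if i \<le> p then push_measure m c t (e i) else 0)"
  proof
    fix j
    show "push_simplex r \<kappa> u j = (if j \<le> p then push_measure m c t (e j) else 0)"
    proof (cases "j \<le> p")
      case True
      have "\<kappa> i = j \<longleftrightarrow> c (\<theta> i) = e j" if "i \<le> r" for i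
        using e(1) \<kappa>[OF that] True by (auto simp: bij_betw_def inj_on_def)
      then have "push_simplex r \<kappa> u j = (\<Sum>i | i \<le> r \<and> c (\<theta> i) = e j. u i)"
        unfolding push_simplex_def by (intro sum.cong) auto
      also have "\<dots> = push_measure m c t (e j)"
        unfolding push_measure_def by (rule sums)
      finally show ?thesis using True by simp
    next
      case False
      then have "{i. i \<le> r \<and> \<kappa> i = j} = {}" using \<kappa>(1) by auto
      then show ?thesis using False unfolding push_simplex_def by (metis sum.empty)
    qed
  qed
  ultimately show ?thesis using eq1 by simp
qed

text \<open>Both representatives have the same normal form, because the support is enumerated from
  the common measure. This is what makes \<open>measure_point\<close> well defined.\<close>

lemma simplex_class_eqI:
  assumes c: "chain_map P m c" "t \<in> standard_simplex m"
    and d: "chain_map P n d" "u \<in> standard_simplex n"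
    and eq: "push_measure m c t = push_measure n d u"
  shows "simplex_class X m (\<sigma> m c) t = simplex_class X n (\<sigma> n d) u"
proof -
  let ?S = "{q. push_measure m c t q \<noteq> 0}"
  have S: "?S = c ` {i. i \<le> m \<and> t i \<noteq> 0}"
    by (rule push_measure_nonzero[OF c(2)])
  have "finite ?S" unfolding S by simp
  moreover have "?S \<noteq> {}"
    unfolding S using standard_simplexD(4)[OF c(2)] by (auto intro: ccontr)
  moreover have "x \<le> y \<or> y \<le> x" if xy: "x \<in> ?S" "y \<in> ?S" for x y
  proof -
    obtain i j where "x = c i" "y = c j" "i \<le> m" "j \<le> m" using xy unfolding S by blast
    then show ?thesis
      using c(1) linear[of i j] by (auto simp: chain_map_def mono_on_def)
  qed
  ultimately obtain e :: "nat \<Rightarrow> 'p" and p where "bij_betw e {..p} ?S" "\<And>i j. i \<le> p \<Longrightarrow> j \<le> p \<Longrightarrow> e i \<le> e j \<longleftrightarrow> i \<le> j"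
    using finite_chain_enum[of ?S] by metis
  from simplex_class_enum[OF c this] simplex_class_enum[OF d this[unfolded eq]] show ?thesis
    unfolding eq by (rule trans[OF _ sym])
qed

lemma measure_point_eq:
  assumes "chain_map P m c" "t \<in> standard_simplex m"
  shows "measure_point X P \<sigma> (push_measure m c t) = simplex_class X m (\<sigma> m c) t"
  unfolding measure_point_def using assms simplex_class_eqI by (intro the_equality) blast+

end

section \<open>The coupling of a point of a simplex with a point of an edge\<close>

definition partial_sum :: "(nat \<Rightarrow> real) \<Rightarrow> nat \<Rightarrow> real" where
  "partial_sum t i = (\<Sum>k<i. t k)"

text \<open>Cut the unit interval into consecutive pieces of lengths \<open>t 0\<close>,
  \<open>t 1\<close>, and so on. This is the length of the part of the piece number \<open>i\<close>
  that lies below \<open>u\<close>.\<close>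

definition low_mass :: "(nat \<Rightarrow> real) \<Rightarrow> real \<Rightarrow> nat \<Rightarrow> real" where
  "low_mass t u i = min (partial_sum t (Suc i)) u - min (partial_sum t i) u"

text \<open>The monotone coupling of the measure \<open>t\<close> with the measure giving mass \<open>u\<close> to \<open>a\<close> and
  \<open>1 - u\<close> to \<open>b\<close>; its support is a chain in the product order.\<close>

definition coupling :: "(nat \<Rightarrow> real) \<Rightarrow> real \<Rightarrow> 'q \<Rightarrow> 'q \<Rightarrow> nat \<times> 'q \<Rightarrow> real" where
  "coupling t u a b = (\<lambda>(i, z). (if z = a then low_mass t u i else 0) + (if z = b then t i - low_mass t u i else 0))"

text \<open>A maximal chain in the product of \<open>{0..n}\<close> with the edge from
  \<open>a\<close> to \<open>b\<close>, that is, a simplex of the prism. The index \<open>k\<close>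
  is visited twice, since there the chain crosses from \<open>a\<close> to \<open>b\<close>.\<close>

definition shuffle :: "nat \<Rightarrow> 'q \<Rightarrow> 'q \<Rightarrow> nat \<Rightarrow> nat \<times> 'q" where
  "shuffle k a b i = (if i \<le> k then (i, a) else (i - 1, b))"

definition shuffle_weights :: "(nat \<Rightarrow> real) \<Rightarrow> real \<Rightarrow> nat \<Rightarrow> nat \<Rightarrow> real" where
  "shuffle_weights t u k i = (if i \<le> k then low_mass t u i else t (i - 1) - low_mass t u (i - 1))"

lemma partial_sum_Suc: "partial_sum t (Suc i) = partial_sum t i + t i"
  by (simp add: partial_sum_def)

lemma partial_sum_0 [simp]: "partial_sum t 0 = 0"
  by (simp add: partial_sum_def)

lemma partial_sum_mono:
  assumes "t \<in> standard_simplex n" "i \<le> j"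
  shows "partial_sum t i \<le> partial_sum t j"
  unfolding partial_sum_def using assms standard_simplexD(1)[OF assms(1)] by (intro sum_mono2) auto

lemma partial_sum_full:
  assumes "t \<in> standard_simplex n" "n < i"
  shows "partial_sum t i = 1"
proof -
  have "partial_sum t i = (\<Sum>k\<le>n. t k)"
    unfolding partial_sum_def
    by (rule sum.mono_neutral_right) (use assms standard_simplexD(3)[OF assms(1)] in auto)
  then show ?thesis using standard_simplexD(4)[OF assms(1)] by simp
qed

lemma partial_sum_nonneg: "t \<in> standard_simplex n \<Longrightarrow> 0 \<le> partial_sum t i"
  using partial_sum_mono[of t n 0 i] by simp

lemma low_mass_bounds:
  assumes "t \<in> standard_simplex n"
  shows "0 \<le> low_mass t u i" "low_mass t u i \<le> t i"
  using standard_simplexD(1)[OF assms, of i] by (auto simp: low_mass_def partial_sum_Suc)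

lemma low_mass_above: "t \<in> standard_simplex n \<Longrightarrow> u \<le> partial_sum t i \<Longrightarrow> low_mass t u i = 0"
  using standard_simplexD(1)[of t n i] by (auto simp: low_mass_def partial_sum_Suc)

lemma low_mass_below: "t \<in> standard_simplex n \<Longrightarrow> partial_sum t (Suc i) \<le> u \<Longrightarrow> low_mass t u i = t i"
  using standard_simplexD(1)[of t n i] by (auto simp: low_mass_def partial_sum_Suc)

lemma sum_low_mass:
  assumes "0 \<le> u"
  shows "(\<Sum>i<l. low_mass t u i) = min (partial_sum t l) u"
  unfolding low_mass_def using assms by (subst sum_lessThan_telescope) simp

text \<open>As \<open>u\<close> falls into the piece number \<open>k\<close>, the first
  \<open>k + 1\<close> weights add up to \<open>u\<close> and the remaining ones to
  \<open>1 - u\<close>.\<close>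

lemma shuffle_weights_in_standard_simplex:
  assumes t: "t \<in> standard_simplex n" and u: "0 \<le> u" "u \<le> 1" and "k \<le> n"
    and k: "partial_sum t k \<le> u" "u \<le> partial_sum t (Suc k)"
  shows "shuffle_weights t u k \<in> standard_simplex (Suc n)"
proof (rule standard_simplexI)
  show "0 \<le> shuffle_weights t u k i" for i
    using low_mass_bounds[OF t] by (simp add: shuffle_weights_def)
  show "shuffle_weights t u k i = 0" if "Suc n < i" for i
    using that \<open>k \<le> n\<close> low_mass_bounds[OF t, of u "i - 1"] standard_simplexD(3)[OF t, of "i - 1"]
    by (simp add: shuffle_weights_def)
  have "{..Suc n} = {..<Suc k} \<union> {Suc k..Suc n}" "{..<Suc n} = {..<k} \<union> {k..<Suc n}"
    using \<open>k \<le> n\<close> by auto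
  then have *: "\<And>f :: nat \<Rightarrow> real. (\<Sum>i<Suc n. f i) = (\<Sum>i<k. f i) + (\<Sum>i=k..<Suc n. f i)"
    and "(\<Sum>i\<le>Suc n. shuffle_weights t u k i) =
      (\<Sum>i<Suc k. shuffle_weights t u k i) + (\<Sum>i=Suc k..Suc n. shuffle_weights t u k i)"
    by (simp_all only: sum.union_disjoint ivl_disj_int_one finite_lessThan finite_atLeastLessThan finite_atLeastAtMost)
  note this(2)
  also have "(\<Sum>i<Suc k. shuffle_weights t u k i) = (\<Sum>i<Suc k. low_mass t u i)"
    by (rule sum.cong) (auto simp: shuffle_weights_def)
  also have "\<dots> = u" unfolding sum_low_mass[OF u(1)] using k by simp
  also have "(\<Sum>i=Suc k..Suc n. shuffle_weights t u k i) = (\<Sum>i=k..n. shuffle_weights t u k (Suc i))"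
    by (rule sum.shift_bounds_cl_Suc_ivl)
  also have "\<dots> = (\<Sum>i=k..<Suc n. t i - low_mass t u i)"
    by (rule sum.cong) (auto simp: shuffle_weights_def)
  also have "\<dots> = (\<Sum>i<Suc n. t i - low_mass t u i) - (\<Sum>i<k. t i - low_mass t u i)"
    using *[of "\<lambda>i. t i - low_mass t u i"] by simp
  also have "\<dots> = (partial_sum t (Suc n) - min (partial_sum t (Suc n)) u) - (partial_sum t k - min (partial_sum t k) u)"
    by (simp only: sum_subtractf sum_low_mass[OF u(1)] partial_sum_def)
  finally show "(\<Sum>i\<le>Suc n. shuffle_weights t u k i) = 1"
    using k u partial_sum_full[OF t, of "Suc n"] by simp
qed

text \<open>Only the piece number \<open>k\<close> is cut by \<open>u\<close>; every earlier piece
  lies entirely below \<open>u\<close> and every later one above. So the coupling has no mass off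
  the chain \<open>shuffle k a b\<close>.\<close>

lemma push_measure_shuffle:
  assumes t: "t \<in> standard_simplex n" and "k \<le> n"
    and k: "partial_sum t k \<le> u" "u \<le> partial_sum t (Suc k)"
  shows "push_measure (Suc n) (shuffle k a b) (shuffle_weights t u k) = coupling t u a b"
proof
  fix p :: "nat \<times> 'a"
  obtain i z where p: "p = (i, z)" by fastforce
  have 1: "low_mass t u i = 0" if "k < i"
    using low_mass_above[OF t, of u i] partial_sum_mono[OF t, of "Suc k" i] that k by simp
  have 2: "low_mass t u i = t i" if "i < k"
    using low_mass_below[OF t, of i u] partial_sum_mono[OF t, of "Suc i" k] that k by simp
  have 3: "low_mass t u i = 0" "t i = 0" if "n < i"
    using standard_simplexD(3)[OF t that] low_mass_bounds[OF t, of u i] by auto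
  have "{j. j \<le> Suc n \<and> shuffle k a b j = p} =
      (if i \<le> k \<and> z = a then {i} else {}) \<union> (if k \<le> i \<and> i \<le> n \<and> z = b then {Suc i} else {})"
    using \<open>k \<le> n\<close> by (auto simp: shuffle_def p split: if_splits)
  then have "push_measure (Suc n) (shuffle k a b) (shuffle_weights t u k) p =
      (if i \<le> k \<and> z = a then shuffle_weights t u k i else 0) +
      (if k \<le> i \<and> i \<le> n \<and> z = b then shuffle_weights t u k (Suc i) else 0)"
    unfolding push_measure_def by auto
  also have "\<dots> = coupling t u a b p"
    using 1 2 3 by (auto simp: p coupling_def shuffle_weights_def)
  finally show "push_measure (Suc n) (shuffle k a b) (shuffle_weights t u k) p = coupling t u a b p" .
qed

lemma shuffle_cut_exists:
  assumes t: "t \<in> standard_simplex n" and u: "0 \<le> u" "u \<le> 1"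
  obtains k where "k \<le> n" "partial_sum t k \<le> u" "u \<le> partial_sum t (Suc k)"
proof -
  define k where "k = (LEAST k. u \<le> partial_sum t (Suc k))"
  have n: "u \<le> partial_sum t (Suc n)"
    using partial_sum_full[OF t, of "Suc n"] u by simp
  have "partial_sum t k \<le> u"
  proof (cases k)
    case (Suc l)
    then have "\<not> u \<le> partial_sum t (Suc l)"
      unfolding k_def using not_less_Least[of l] by (metis lessI)
    then show ?thesis using Suc by simp
  qed (use u in simp)
  moreover have "k \<le> n" "u \<le> partial_sum t (Suc k)"
    unfolding k_def using n by (rule Least_le, rule LeastI)
  ultimately show thesis using that by blast
qed

lemma chain_map_shuffle:
  assumes "k \<le> n" "a \<le> b" "{..n} \<times> {a, b} \<subseteq> P"
  shows "chain_map P (Suc n) (shuffle k a b)"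
  using assms by (auto simp: chain_map_def mono_on_def shuffle_def image_subset_iff subset_iff)

text \<open>If \<open>u\<close> is a partial sum, no piece is cut, and the coupling is the image of
  \<open>t\<close> under a section of the projection to the indices.\<close>

lemma coupling_cut:
  assumes t: "t \<in> standard_simplex n" and k: "partial_sum t k = u"
  shows "coupling t u a b = push_measure n (\<lambda>i. (i, if i < k then a else b)) t"
proof
  fix p :: "nat \<times> 'a"
  obtain i z where p: "p = (i, z)" by fastforce
  have 1: "low_mass t u i = 0" if "k \<le> i"
    using low_mass_above[OF t, of u i] partial_sum_mono[OF t that] k by simp
  have 2: "low_mass t u i = t i" if "i < k"
    using low_mass_below[OF t, of i u] partial_sum_mono[OF t, of "Suc i" k] that k by simp
  have "{j. j \<le> n \<and> (j, if j < k then a else b) = p} =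
      (if i \<le> n \<and> z = (if i < k then a else b) then {i} else {})"
    by (auto simp: p)
  then have "push_measure n (\<lambda>i. (i, if i < k then a else b)) t p =
      (if i \<le> n \<and> z = (if i < k then a else b) then t i else 0)"
    unfolding push_measure_def by auto
  then show "coupling t u a b p = push_measure n (\<lambda>i. (i, if i < k then a else b)) t p"
    using 1 2 standard_simplexD(3)[OF t, of i] by (auto simp: p coupling_def not_le not_less)
qed

lemma coupling_one:
  assumes "t \<in> standard_simplex n"
  shows "coupling t 1 a b = push_measure n (\<lambda>i. (i, a)) t"
  unfolding coupling_cut[OF assms partial_sum_full[OF assms lessI]] push_measure_def
  by (intro ext sum.cong) auto

lemma coupling_zero:
  assumes "t \<in> standard_simplex n"
  shows "coupling t 0 a b = push_measure n (\<lambda>i. (i, b)) t"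
  using coupling_cut[OF assms partial_sum_0, of a b] by simp

text \<open>Naturality of the coupling in the simplex: a monotone \<open>\<theta>\<close> merges
  consecutive pieces of the unit interval and may insert empty ones, so the part of a merged piece
  below \<open>u\<close> is the sum of the parts of its constituents.\<close>

lemma push_measure_map_prod:
  assumes t: "t \<in> standard_simplex m" and \<theta>: "simplex_op m n \<theta>" and u: "0 \<le> u" "u \<le> 1"
    and k: "k \<le> m" "partial_sum t k \<le> u" "u \<le> partial_sum t (Suc k)"
  shows "push_measure (Suc m) (map_prod \<theta> id \<circ> shuffle k a b) (shuffle_weights t u k) =
    coupling (push_simplex m \<theta> t) u a b"
proof
  fix p :: "nat \<times> 'a"
  obtain j z where p: "p = (j, z)" by fastforce
  \<comment> \<open>By monotonicity, preimages of initial segments are initial segments. The value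
    \<open>Suc m\<close> stands for the case that \<open>\<theta>\<close> never reaches
    \<open>j\<close>.\<close>
  have cut: "\<exists>l\<le>Suc m. {i. i \<le> m \<and> \<theta> i < j} = {..<l}" for j
  proof -
    let ?l = "LEAST i. i = Suc m \<or> j \<le> \<theta> i"
    have l: "?l = Suc m \<or> j \<le> \<theta> ?l" "?l \<le> Suc m"
      by (rule LeastI[of _ "Suc m"], simp) (rule Least_le, simp)
    have "i < ?l" if "i \<le> m" "\<theta> i < j" for i
    proof (rule ccontr)
      assume "\<not> i < ?l"
      then have "?l \<le> i" by simp
      then have "?l \<le> m" using that by simp
      then have "\<theta> ?l \<le> \<theta> i"
        using \<theta> that \<open>?l \<le> i\<close> by (auto simp: simplex_op_def mono_on_def)
      then show False using l(1) that \<open>?l \<le> m\<close> by simp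
    qed
    moreover have "\<theta> i < j" if "i < ?l" for i
      using not_less_Least[OF that] by simp
    ultimately have "{i. i \<le> m \<and> \<theta> i < j} = {..<?l}"
      using l(2) by auto
    then show ?thesis using l(2) by blast
  qed
  have ps: "partial_sum (push_simplex m \<theta> t) j = (\<Sum>i | i \<le> m \<and> \<theta> i < j. t i)" for j
    unfolding partial_sum_def by (subst sum_push_simplex) auto
  have lm: "min (partial_sum (push_simplex m \<theta> t) j) u = (\<Sum>i | i \<le> m \<and> \<theta> i < j. low_mass t u i)" for j
  proof -
    obtain l where l: "{i. i \<le> m \<and> \<theta> i < j} = {..<l}" using cut by blast
    show ?thesis unfolding ps l using sum_low_mass[OF u(1)] by (simp add: partial_sum_def)
  qed
  have split: "(\<Sum>i | i \<le> m \<and> \<theta> i < Suc j. f i) =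
      (\<Sum>i | i \<le> m \<and> \<theta> i < j. f i) + (\<Sum>i | i \<le> m \<and> \<theta> i = j. f i)" for f :: "nat \<Rightarrow> real"
  proof -
    have "{i. i \<le> m \<and> \<theta> i < Suc j} = {i. i \<le> m \<and> \<theta> i < j} \<union> {i. i \<le> m \<and> \<theta> i = j}" by auto
    then show ?thesis by (simp only:) (rule sum.union_disjoint, auto)
  qed
  have low: "low_mass (push_simplex m \<theta> t) u j = (\<Sum>i | i \<le> m \<and> \<theta> i = j. low_mass t u i)"
    unfolding low_mass_def[of "push_simplex m \<theta> t"] lm split by simp
  have ps': "push_simplex m \<theta> t j = (\<Sum>i | i \<le> m \<and> \<theta> i = j. t i)"
    by (simp only: push_simplex_def)
  let ?S = "{i. i \<le> Suc m \<and> (map_prod \<theta> id \<circ> shuffle k a b) i = p}"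
  have S: "shuffle k a b i \<in> (\<lambda>i. (i, z)) ` {i. i \<le> m \<and> \<theta> i = j}" if "i \<in> ?S" for i
  proof -
    have "fst (shuffle k a b i) \<le> m" using that k by (auto simp: shuffle_def)
    then show ?thesis using that by (cases "shuffle k a b i") (auto simp: p)
  qed
  have "push_measure (Suc m) (map_prod \<theta> id \<circ> shuffle k a b) (shuffle_weights t u k) p =
      (\<Sum>q \<in> (\<lambda>i. (i, z)) ` {i. i \<le> m \<and> \<theta> i = j}.
        \<Sum>i\<in>{i \<in> ?S. shuffle k a b i = q}. shuffle_weights t u k i)"
    unfolding push_measure_def by (rule sum.group[symmetric]) (use S in auto)
  also have "\<dots> = (\<Sum>i | i \<le> m \<and> \<theta> i = j.
        \<Sum>i'\<in>{i' \<in> ?S. shuffle k a b i' = (i, z)}. shuffle_weights t u k i')"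
    by (subst sum.reindex) (auto simp: inj_on_def)
  also have "\<dots> = (\<Sum>i | i \<le> m \<and> \<theta> i = j. push_measure (Suc m) (shuffle k a b) (shuffle_weights t u k) (i, z))"
    unfolding push_measure_def by (intro sum.cong refl) (auto simp: p)
  also have "\<dots> = (\<Sum>i | i \<le> m \<and> \<theta> i = j. coupling t u a b (i, z))"
    unfolding push_measure_shuffle[OF t k] ..
  also have "\<dots> = coupling (push_simplex m \<theta> t) u a b p"
    using low by (simp add: coupling_def p sum.distrib sum_subtractf ps')
  finally show "push_measure (Suc m) (map_prod \<theta> id \<circ> shuffle k a b) (shuffle_weights t u k) p =
      coupling (push_simplex m \<theta> t) u a b p" .
qed

lemma continuous_map_simplex_coord [continuous_intros]:
  "continuous_map (simplex_top n) euclideanreal (\<lambda>t. t i)"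
  using continuous_map_from_subtopology continuous_map_product_projection[of i UNIV "\<lambda>_. euclideanreal"] by blast

lemma continuous_map_low_mass:
  assumes "\<And>i. continuous_map Z euclideanreal (\<lambda>z. f z i)" "continuous_map Z euclideanreal g"
  shows "continuous_map Z euclideanreal (\<lambda>z. low_mass (f z) (g z) i)"
  unfolding low_mass_def partial_sum_def
  by (intro continuous_map_diff continuous_map_real_min continuous_map_sum assms) auto

context
  fixes X :: "('x, 'z) simplicial_set_scheme" and P :: "(nat \<times> 'q::order) set" and \<sigma> n a b
  assumes fam: "poset_family X P \<sigma>" and ab: "a \<le> b" and nP: "{..n} \<times> {a, b} \<subseteq> P"
begin

lemma measure_point_coupling:
  assumes t: "t \<in> standard_simplex n" and u: "0 \<le> u" "u \<le> 1"
    and k: "k \<le> n" "partial_sum t k \<le> u" "u \<le> partial_sum t (Suc k)"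
  shows "measure_point X P \<sigma> (coupling t u a b) =
    simplex_class X (Suc n) (\<sigma> (Suc n) (shuffle k a b)) (shuffle_weights t u k)"
  using poset_family.measure_point_eq[OF fam chain_map_shuffle[OF k(1) ab nP]
      shuffle_weights_in_standard_simplex[OF t u k]]
  by (simp add: push_measure_shuffle[OF t k])

text \<open>The prism is covered by finitely many closed sets, one for each position
  \<open>k\<close> of the cut. On each the point lies in a fixed simplex with continuous weights,
  and on overlaps the formulas agree because they describe the same measure.\<close>

lemma continuous_map_measure_point_coupling:
  "continuous_map (prod_topology (simplex_top n) (top_of_set {0..1})) (realization X)
    (\<lambda>(t, u). measure_point X P \<sigma> (coupling t u a b))"
proof -
  let ?Z = "prod_topology (simplex_top n) (top_of_set {0..1::real})"
  let ?T = "\<lambda>k. {z \<in> topspace ?Z. partial_sum (fst z) k \<le> snd z \<and> snd z \<le> partial_sum (fst z) (Suc k)}"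
  let ?f = "\<lambda>k z. simplex_class X (Suc n) (\<sigma> (Suc n) (shuffle k a b)) (shuffle_weights (fst z) (snd z) k)"
  have coord: "continuous_map ?Z euclideanreal (\<lambda>z. fst z i)" for i
    using continuous_map_compose[OF continuous_map_fst continuous_map_simplex_coord] by (simp add: o_def)
  have snd: "continuous_map ?Z euclideanreal snd"
    using continuous_map_snd continuous_map_into_fulltopology by blast
  have ps: "continuous_map ?Z euclideanreal (\<lambda>z. partial_sum (fst z) i)" for i
    unfolding partial_sum_def by (intro continuous_map_sum coord) auto
  have val: "measure_point X P \<sigma> (coupling (fst z) (snd z) a b) = ?f k z" if "k \<le> n" "z \<in> ?T k" for k z
    using that by (intro measure_point_coupling) auto
  show ?thesis
  proof (rule pasting_lemma_closed[where I = "{..n}" and T = ?T and f = ?f])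
    fix k assume k: "k \<in> {..n}"
    show "closedin ?Z (?T k)"
      using closedin_Int[OF closedin_continuous_map_preimage[OF continuous_map_diff[OF snd ps[of k]], of "{0..}"]
          closedin_continuous_map_preimage[OF continuous_map_diff[OF ps[of "Suc k"] snd], of "{0..}"]]
      by (rule back_subst[of "closedin ?Z"]) auto
    have "continuous_map ?Z (powertop_real UNIV) (\<lambda>z. shuffle_weights (fst z) (snd z) k)"
      unfolding continuous_map_componentwise_UNIV shuffle_weights_def
      by (auto intro!: continuous_map_diff continuous_map_low_mass coord snd)
    then have "continuous_map (subtopology ?Z (?T k)) (simplex_top (Suc n)) (\<lambda>z. shuffle_weights (fst z) (snd z) k)"
      using k by (auto simp: continuous_map_in_subtopology continuous_map_from_subtopology
          intro!: shuffle_weights_in_standard_simplex)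
    from continuous_map_compose[OF this continuous_map_simplex_class[OF
          poset_family.simplex[OF fam chain_map_shuffle[OF _ ab nP]]]]
    show "continuous_map (subtopology ?Z (?T k)) (realization X) (?f k)"
      using k by (simp add: o_def)
  next
    fix k l z assume "k \<in> {..n}" "l \<in> {..n}" "z \<in> topspace ?Z \<inter> ?T k \<inter> ?T l"
    then show "?f k z = ?f l z" using val[of k z] val[of l z] by simp
  next
    fix z assume z: "z \<in> topspace ?Z"
    then obtain k where "k \<le> n" "partial_sum (fst z) k \<le> snd z" "snd z \<le> partial_sum (fst z) (Suc k)"
      using shuffle_cut_exists[of "fst z" n "snd z" thesis] by (cases z) auto
    then show "\<exists>j. j \<in> {..n} \<and> z \<in> ?T j \<and> (case z of (t, u) \<Rightarrow> measure_point X P \<sigma> (coupling t u a b)) = ?f j z"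
      using z val[of k z] by (intro exI[of _ k]) (auto simp: case_prod_unfold)
  qed simp
qed

end

text \<open>This is the compatibility with structure maps that is needed when a map or homotopy is
  defined simplexwise by couplings.\<close>

lemma measure_point_coupling_Pull:
  assumes fam: "poset_family X P \<sigma>" "poset_family X P' \<sigma>'"
    and P: "{..m} \<times> {a, b} \<subseteq> P'" "{..n} \<times> {a, b} \<subseteq> P"
    and ab: "a \<le> b" and t: "t \<in> standard_simplex m" and \<theta>: "simplex_op m n \<theta>" and u: "0 \<le> u" "u \<le> 1"
    and \<sigma>: "\<And>l c. chain_map P' l c \<Longrightarrow> c ` {..l} \<subseteq> {..m} \<times> {a, b} \<Longrightarrow> \<sigma>' l c = \<sigma> l (map_prod \<theta> id \<circ> c)"
  shows "measure_point X P' \<sigma>' (coupling t u a b) = measure_point X P \<sigma> (coupling (push_simplex m \<theta> t) u a b)"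
proof -
  obtain k where k: "k \<le> m" "partial_sum t k \<le> u" "u \<le> partial_sum t (Suc k)"
    using shuffle_cut_exists[OF t u] .
  have cm: "chain_map P' (Suc m) (shuffle k a b)"
    by (rule chain_map_shuffle[OF k(1) ab P(1)])
  have im: "shuffle k a b ` {..Suc m} \<subseteq> {..m} \<times> {a, b}"
    using k(1) by (auto simp: shuffle_def)
  have cm': "chain_map P (Suc m) (map_prod \<theta> id \<circ> shuffle k a b)"
  proof -
    have "(map_prod \<theta> id \<circ> shuffle k a b) ` {..Suc m} \<subseteq> map_prod \<theta> id ` ({..m} \<times> {a, b})"
      using im by auto
    also have "\<dots> \<subseteq> P" using P(2) \<theta> by (force simp: simplex_op_def)
    finally have "(map_prod \<theta> id \<circ> shuffle k a b) ` {..Suc m} \<subseteq> P" .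
    moreover have "mono_on {..Suc m} (map_prod \<theta> id \<circ> shuffle k a b)"
    proof -
      have "\<theta> i \<le> \<theta> j" if "i \<le> j" "j \<le> m" for i j
        using \<theta> that by (simp add: simplex_op_def mono_on_def)
      then show ?thesis using ab k(1) by (auto simp: mono_on_def shuffle_def)
    qed
    ultimately show ?thesis by (simp add: chain_map_def)
  qed
  have w: "shuffle_weights t u k \<in> standard_simplex (Suc m)"
    by (rule shuffle_weights_in_standard_simplex[OF t u k])
  have "measure_point X P' \<sigma>' (coupling t u a b) =
      simplex_class X (Suc m) (\<sigma>' (Suc m) (shuffle k a b)) (shuffle_weights t u k)"
    by (rule measure_point_coupling[OF fam(2) ab P(1) t u k])
  also have "\<dots> = simplex_class X (Suc m) (\<sigma> (Suc m) (map_prod \<theta> id \<circ> shuffle k a b)) (shuffle_weights t u k)"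
    by (simp only: \<sigma>[OF cm im])
  also have "\<dots> = measure_point X P \<sigma> (coupling (push_simplex m \<theta> t) u a b)"
    using poset_family.measure_point_eq[OF fam(1) cm' w] unfolding push_measure_map_prod[OF t \<theta> u k] ..
  finally show ?thesis .
qed

section \<open>Functors and natural transformations\<close>

definition diagram :: "('o, 'm, 'z) category_scheme \<Rightarrow> 'p::order set \<Rightarrow> ('p \<Rightarrow> 'o) \<Rightarrow> ('p \<Rightarrow> 'p \<Rightarrow> 'm) \<Rightarrow> bool" where
  "diagram C P A M \<longleftrightarrow>
     (\<forall>p\<in>P. A p \<in> Obj C \<and> M p p = Id C (A p)) \<and>
     (\<forall>p\<in>P. \<forall>q\<in>P. p \<le> q \<longrightarrow> M p q \<in> Hom C (A p) (A q)) \<and>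
     (\<forall>p\<in>P. \<forall>q\<in>P. \<forall>r\<in>P. p \<le> q \<and> q \<le> r \<longrightarrow> M p r = Comp C (A p) (A q) (A r) (M q r) (M p q))"

definition diagram_simplex ::
  "('p \<Rightarrow> 'o) \<Rightarrow> ('p \<Rightarrow> 'p \<Rightarrow> 'm) \<Rightarrow> nat \<Rightarrow> (nat \<Rightarrow> 'p) \<Rightarrow> (nat \<Rightarrow> 'o) \<times> (nat \<times> nat \<Rightarrow> 'm)" where
  "diagram_simplex A M m c =
     (restrict (\<lambda>i. A (c i)) {..m}, restrict (\<lambda>(i, j). M (c i) (c j)) {(i, j). i \<le> j \<and> j \<le> m})"

definition is_functor ::
  "('o, 'm, 'y) category_scheme \<Rightarrow> ('p, 'n, 'z) category_scheme \<Rightarrow> ('o \<Rightarrow> 'p) \<Rightarrow> ('o \<Rightarrow> 'o \<Rightarrow> 'm \<Rightarrow> 'n) \<Rightarrow> bool" where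
  "is_functor C D F Fm \<longleftrightarrow>
     (\<forall>x\<in>Obj C. F x \<in> Obj D \<and> Fm x x (Id C x) = Id D (F x)) \<and>
     (\<forall>x\<in>Obj C. \<forall>y\<in>Obj C. \<forall>f\<in>Hom C x y. Fm x y f \<in> Hom D (F x) (F y)) \<and>
     (\<forall>x\<in>Obj C. \<forall>y\<in>Obj C. \<forall>z\<in>Obj C. \<forall>f\<in>Hom C x y. \<forall>g\<in>Hom C y z.
        Fm x z (Comp C x y z g f) = Comp D (F x) (F y) (F z) (Fm y z g) (Fm x y f))"

definition nat_trans ::
  "('o, 'm, 'y) category_scheme \<Rightarrow> ('p, 'n, 'z) category_scheme \<Rightarrow> ('o \<Rightarrow> 'p) \<Rightarrow> ('o \<Rightarrow> 'o \<Rightarrow> 'm \<Rightarrow> 'n) \<Rightarrow>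
     ('o \<Rightarrow> 'p) \<Rightarrow> ('o \<Rightarrow> 'o \<Rightarrow> 'm \<Rightarrow> 'n) \<Rightarrow> ('o \<Rightarrow> 'n) \<Rightarrow> bool" where
  "nat_trans C D F Fm G Gm \<eta> \<longleftrightarrow>
     (\<forall>x\<in>Obj C. \<eta> x \<in> Hom D (F x) (G x)) \<and>
     (\<forall>x\<in>Obj C. \<forall>y\<in>Obj C. \<forall>f\<in>Hom C x y.
        Comp D (F x) (F y) (G y) (\<eta> y) (Fm x y f) = Comp D (F x) (G x) (G y) (Gm x y f) (\<eta> x))"

definition nerve_map ::
  "('o \<Rightarrow> 'p) \<Rightarrow> ('o \<Rightarrow> 'o \<Rightarrow> 'm \<Rightarrow> 'n) \<Rightarrow> nat \<Rightarrow> (nat \<Rightarrow> 'o) \<times> (nat \<times> nat \<Rightarrow> 'm) \<Rightarrow> (nat \<Rightarrow> 'p) \<times> (nat \<times> nat \<Rightarrow> 'n)" where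
  "nerve_map F Fm n x = diagram_simplex (\<lambda>i. F (fst x i)) (\<lambda>i j. Fm (fst x i) (fst x j) (snd x (i, j))) n id"

text \<open>The condition fixes all values at points of the classifying space; the choice only
  settles the values elsewhere.\<close>

definition classifying_map ::
  "('o, 'm, 'y) category_scheme \<Rightarrow> ('p, 'n, 'z) category_scheme \<Rightarrow> ('o \<Rightarrow> 'p) \<Rightarrow> ('o \<Rightarrow> 'o \<Rightarrow> 'm \<Rightarrow> 'n) \<Rightarrow>
     ((nat \<times> (nat \<Rightarrow> 'o) \<times> (nat \<times> nat \<Rightarrow> 'm)) \<times> (nat \<Rightarrow> real)) set \<Rightarrow>
     ((nat \<times> (nat \<Rightarrow> 'p) \<times> (nat \<times> nat \<Rightarrow> 'n)) \<times> (nat \<Rightarrow> real)) set" where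
  "classifying_map C D F Fm = (SOME H. continuous_map (classifying_space C) (classifying_space D) H \<and>
     (\<forall>n x t. x \<in> Simplices (nerve C) n \<and> t \<in> standard_simplex n \<longrightarrow>
       H (simplex_class (nerve C) n x t) = simplex_class (nerve D) n (nerve_map F Fm n x) t))"

lemma Simplices_nerve: "Simplices (nerve C) = nerve_simplices C"
  by (simp add: nerve_def)

lemma nerve_simplex_diagram:
  assumes "x \<in> Simplices (nerve C) n"
  shows "diagram C {..n} (fst x) (\<lambda>i j. snd x (i, j))"
proof -
  obtain X f where x: "x = (X, f)" by fastforce
  have *: "X \<in> {..n} \<rightarrow>\<^sub>E Obj C" "\<forall>i j. i \<le> j \<and> j \<le> n \<longrightarrow> f (i, j) \<in> Hom C (X i) (X j)"
    "\<forall>i\<le>n. f (i, i) = Id C (X i)"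
    "\<forall>i j k. i \<le> j \<and> j \<le> k \<and> k \<le> n \<longrightarrow> f (i, k) = Comp C (X i) (X j) (X k) (f (j, k)) (f (i, j))"
    using assms unfolding x Simplices_nerve nerve_simplices_def mem_Collect_eq case_prod_conv by blast+
  show ?thesis
    unfolding diagram_def x fst_conv snd_conv
  proof (intro conjI ballI impI)
    fix i assume "i \<in> {..n}"
    then show "X i \<in> Obj C" "f (i, i) = Id C (X i)" using *(1,3) by auto
  next
    fix i j assume "i \<in> {..n}" "j \<in> {..n}" "i \<le> j"
    then show "f (i, j) \<in> Hom C (X i) (X j)" using *(2) by auto
  next
    fix i j k assume "i \<in> {..n}" "j \<in> {..n}" "k \<in> {..n}" "i \<le> j \<and> j \<le> k"
    then show "f (i, k) = Comp C (X i) (X j) (X k) (f (j, k)) (f (i, j))" using *(4) by blast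
  qed
qed

lemma nerve_simplex_eq_diagram_simplex:
  assumes "x \<in> Simplices (nerve C) n"
  shows "x = diagram_simplex (fst x) (\<lambda>i j. snd x (i, j)) n id"
proof -
  have "fst x \<in> {..n} \<rightarrow>\<^sub>E Obj C" and *: "snd x \<in> extensional {(i, j). i \<le> j \<and> j \<le> n}"
    using assms unfolding Simplices_nerve nerve_simplices_def mem_Collect_eq case_prod_unfold by blast+
  then have "fst x \<in> extensional {..n}" by (simp add: PiE_iff)
  with * show ?thesis
    by (auto simp: diagram_simplex_def prod_eq_iff fun_eq_iff restrict_def extensional_def)
qed

lemma diagramD:
  assumes "diagram C P A M"
  shows "p \<in> P \<Longrightarrow> A p \<in> Obj C" "p \<in> P \<Longrightarrow> M p p = Id C (A p)"
    and "p \<in> P \<Longrightarrow> q \<in> P \<Longrightarrow> p \<le> q \<Longrightarrow> M p q \<in> Hom C (A p) (A q)"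
    and "p \<in> P \<Longrightarrow> q \<in> P \<Longrightarrow> r \<in> P \<Longrightarrow> p \<le> q \<Longrightarrow> q \<le> r \<Longrightarrow>
      M p r = Comp C (A p) (A q) (A r) (M q r) (M p q)"
  using assms[unfolded diagram_def, THEN conjunct1] assms[unfolded diagram_def, THEN conjunct2, THEN conjunct1]
    assms[unfolded diagram_def, THEN conjunct2, THEN conjunct2, rule_format, of p q r] by auto

lemma is_functorD:
  assumes "is_functor C D F Fm"
  shows "x \<in> Obj C \<Longrightarrow> F x \<in> Obj D" "x \<in> Obj C \<Longrightarrow> Fm x x (Id C x) = Id D (F x)"
    and "x \<in> Obj C \<Longrightarrow> y \<in> Obj C \<Longrightarrow> f \<in> Hom C x y \<Longrightarrow> Fm x y f \<in> Hom D (F x) (F y)"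
    and "x \<in> Obj C \<Longrightarrow> y \<in> Obj C \<Longrightarrow> z \<in> Obj C \<Longrightarrow> f \<in> Hom C x y \<Longrightarrow> g \<in> Hom C y z \<Longrightarrow>
      Fm x z (Comp C x y z g f) = Comp D (F x) (F y) (F z) (Fm y z g) (Fm x y f)"
  using assms[unfolded is_functor_def, THEN conjunct1] assms[unfolded is_functor_def, THEN conjunct2, THEN conjunct1]
    assms[unfolded is_functor_def, THEN conjunct2, THEN conjunct2, rule_format, of x y z f g] by auto

lemma is_categoryD:
  assumes "is_category C"
  shows "x \<in> Obj C \<Longrightarrow> y \<in> Obj C \<Longrightarrow> z \<in> Obj C \<Longrightarrow> f \<in> Hom C x y \<Longrightarrow> g \<in> Hom C y z \<Longrightarrow>
      Comp C x y z g f \<in> Hom C x z"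
    and "w \<in> Obj C \<Longrightarrow> x \<in> Obj C \<Longrightarrow> y \<in> Obj C \<Longrightarrow> z \<in> Obj C \<Longrightarrow> f \<in> Hom C w x \<Longrightarrow> g \<in> Hom C x y \<Longrightarrow>
      h \<in> Hom C y z \<Longrightarrow> Comp C w y z h (Comp C w x y g f) = Comp C w x z (Comp C x y z h g) f"
  using assms[unfolded is_category_def, THEN conjunct2, THEN conjunct1, rule_format, of x y z f g]
    assms[unfolded is_category_def, THEN conjunct2, THEN conjunct2, THEN conjunct2, rule_format, of w x y z f g h]
  by simp_all

lemma nat_transD:
  assumes "nat_trans C D F Fm G Gm \<eta>"
  shows "x \<in> Obj C \<Longrightarrow> \<eta> x \<in> Hom D (F x) (G x)"
    and "x \<in> Obj C \<Longrightarrow> y \<in> Obj C \<Longrightarrow> f \<in> Hom C x y \<Longrightarrow>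
      Comp D (F x) (F y) (G y) (\<eta> y) (Fm x y f) = Comp D (F x) (G x) (G y) (Gm x y f) (\<eta> x)"
  using assms[unfolded nat_trans_def, THEN conjunct1] assms[unfolded nat_trans_def, THEN conjunct2, rule_format, of x y f] by auto

lemma diagram_compose:
  assumes F: "is_functor C D F Fm" and d: "diagram C P A M"
  shows "diagram D P (\<lambda>p. F (A p)) (\<lambda>p q. Fm (A p) (A q) (M p q))"
  unfolding diagram_def
proof (intro conjI ballI impI)
  fix p q r assume pqr: "p \<in> P" "q \<in> P" "r \<in> P" "p \<le> q \<and> q \<le> r"
  then have e: "M p r = Comp C (A p) (A q) (A r) (M q r) (M p q)"
    by (intro diagramD(4)[OF d]) auto
  show "Fm (A p) (A r) (M p r) =
      Comp D (F (A p)) (F (A q)) (F (A r)) (Fm (A q) (A r) (M q r)) (Fm (A p) (A q) (M p q))"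
    unfolding e by (rule is_functorD(4)[OF F]) (use diagramD(1,3)[OF d] pqr in auto)
qed (auto simp: diagramD(1,2,3)[OF d] is_functorD(1,2,3)[OF F])

lemma poset_family_diagram:
  fixes P :: "'p::order set"
  assumes d: "diagram C P A M"
  shows "poset_family (nerve C) P (diagram_simplex A M)"
proof
  show "pull_closed (nerve C)" by (rule pull_closed_nerve)
next
  fix m c assume "chain_map P m c"
  then have c: "c i \<in> P" "c i \<le> c j" if "i \<le> j" "j \<le> m" for i j
    using that by (auto simp: chain_map_def mono_on_def image_subset_iff)
  show "diagram_simplex A M m c \<in> Simplices (nerve C) m"
    unfolding Simplices_nerve nerve_simplices_def diagram_simplex_def
  proof (clarsimp, intro conjI allI impI)
    fix i j k assume "i \<le> j \<and> j \<le> k \<and> k \<le> m"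
    then show "M (c i) (c k) = Comp C (A (c i)) (A (c j)) (A (c k)) (M (c j) (c k)) (M (c i) (c j))"
      by (intro diagramD(4)[OF d]) (use c in auto)
  qed (use diagramD(1,2,3)[OF d] c in auto)
next
  fix m n \<theta> c assume "simplex_op m n \<theta>"
  then have "\<theta> i \<le> n" "\<theta> i \<le> \<theta> j" if "i \<le> j" "j \<le> m" for i j
    using that by (auto simp: simplex_op_def mono_on_def image_subset_iff)
  then show "Pull (nerve C) m \<theta> (diagram_simplex A M n c) = diagram_simplex A M m (c \<circ> \<theta>)"
    by (auto simp: nerve_def diagram_simplex_def restrict_def fun_eq_iff)
next
  fix m and c c' :: "nat \<Rightarrow> 'p" assume "\<And>i. i \<le> m \<Longrightarrow> c i = c' i"
  then show "diagram_simplex A M m c = diagram_simplex A M m c'"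
    by (auto simp: diagram_simplex_def restrict_def fun_eq_iff)
qed

lemma chain_map_id: "chain_map {..n} n id"
  by (simp add: chain_map_def mono_on_def)

lemma diagram_simplex_in_nerve:
  "diagram C P A M \<Longrightarrow> chain_map P m c \<Longrightarrow> diagram_simplex A M m c \<in> Simplices (nerve C) m"
  using poset_family.simplex[OF poset_family_diagram] by blast

lemma nerve_map_in_Simplices:
  assumes "is_functor C D F Fm" "x \<in> Simplices (nerve C) n"
  shows "nerve_map F Fm n x \<in> Simplices (nerve D) n"
  unfolding nerve_map_def
  by (rule diagram_simplex_in_nerve[OF diagram_compose[OF assms(1) nerve_simplex_diagram[OF assms(2)]] chain_map_id])

lemma fst_Pull_nerve: "i \<le> m \<Longrightarrow> fst (Pull (nerve C) m \<theta> x) i = fst x (\<theta> i)"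
  and snd_Pull_nerve: "i \<le> j \<Longrightarrow> j \<le> m \<Longrightarrow> snd (Pull (nerve C) m \<theta> x) (i, j) = snd x (\<theta> i, \<theta> j)"
  by (simp_all add: nerve_def case_prod_unfold)

lemma nerve_map_Pull:
  assumes "simplex_op m n \<theta>"
  shows "nerve_map F Fm m (Pull (nerve C) m \<theta> x) = Pull (nerve D) m \<theta> (nerve_map F Fm n x)"
proof -
  have "\<theta> i \<le> n" "\<theta> i \<le> \<theta> j" if "i \<le> j" "j \<le> m" for i j
    using that assms by (auto simp: simplex_op_def mono_on_def image_subset_iff)
  then show ?thesis
    by (auto simp: nerve_map_def diagram_simplex_def nerve_def restrict_def fun_eq_iff case_prod_unfold)
qed

lemma nerve_map_diagram_simplex:
  "nerve_map F Fm m (diagram_simplex A M m c) =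
     diagram_simplex (\<lambda>p. F (A p)) (\<lambda>p q. Fm (A p) (A q) (M p q)) m c"
  by (auto simp: nerve_map_def diagram_simplex_def restrict_def fun_eq_iff)

lemma classifying_map:
  assumes F: "is_functor C D F Fm"
  shows "continuous_map (classifying_space C) (classifying_space D) (classifying_map C D F Fm)"
    and "x \<in> Simplices (nerve C) n \<Longrightarrow> t \<in> standard_simplex n \<Longrightarrow>
      classifying_map C D F Fm (simplex_class (nerve C) n x t) = simplex_class (nerve D) n (nerve_map F Fm n x) t"
proof -
  let ?Q = "\<lambda>H. continuous_map (classifying_space C) (classifying_space D) H \<and>
     (\<forall>n x t. x \<in> Simplices (nerve C) n \<and> t \<in> standard_simplex n \<longrightarrow>
       H (simplex_class (nerve C) n x t) = simplex_class (nerve D) n (nerve_map F Fm n x) t)"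
  have "\<exists>H. ?Q H"
  proof (rule realization_map_out[OF pull_closed_nerve, of C "classifying_space D" "\<lambda>n x. simplex_class (nerve D) n (nerve_map F Fm n x)"])
    show "continuous_map (simplex_top n) (classifying_space D) (simplex_class (nerve D) n (nerve_map F Fm n x))"
      if "x \<in> Simplices (nerve C) n" for n x
      unfolding classifying_space_def
      by (rule continuous_map_simplex_class[OF nerve_map_in_Simplices[OF F that]])
    show "simplex_class (nerve D) m (nerve_map F Fm m (Pull (nerve C) m \<theta> x)) t =
        simplex_class (nerve D) n (nerve_map F Fm n x) (push_simplex m \<theta> t)"
      if "simplex_op m n \<theta>" "x \<in> Simplices (nerve C) n" "t \<in> standard_simplex m" for m n \<theta> x t
      unfolding nerve_map_Pull[OF that(1), of F Fm C x D]
      by (rule simplex_class_Pull[OF pull_closed_nerve that(1) nerve_map_in_Simplices[OF F that(2)] that(3)])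
  next
    fix H
    assume "continuous_map (realization (nerve C)) (classifying_space D) H"
      "\<And>n x t. x \<in> Simplices (nerve C) n \<Longrightarrow> t \<in> standard_simplex n \<Longrightarrow>
        H (simplex_class (nerve C) n x t) = simplex_class (nerve D) n (nerve_map F Fm n x) t"
    then show "\<exists>H. ?Q H" unfolding classifying_space_def[of C] by blast
  qed
  then have "?Q (classifying_map C D F Fm)"
    unfolding classifying_map_def by (rule someI_ex)
  then show "continuous_map (classifying_space C) (classifying_space D) (classifying_map C D F Fm)"
    and "x \<in> Simplices (nerve C) n \<Longrightarrow> t \<in> standard_simplex n \<Longrightarrow>
      classifying_map C D F Fm (simplex_class (nerve C) n x t) = simplex_class (nerve D) n (nerve_map F Fm n x) t"
    by blast+
qed

lemma is_functor_compose:
  assumes F: "is_functor C D F Fm" and G: "is_functor D E G Gm"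
  shows "is_functor C E (\<lambda>x. G (F x)) (\<lambda>x y f. Gm (F x) (F y) (Fm x y f))"
  unfolding is_functor_def
  by (intro conjI ballI) (simp_all add: is_functorD(1,2,3)[OF F] is_functorD(1,2,3)[OF G]
      is_functorD(4)[OF F] is_functorD(4)[OF G])

lemma classifying_map_compose:
  assumes F: "is_functor C D F Fm" and G: "is_functor D E G Gm" and p: "p \<in> topspace (classifying_space C)"
  shows "classifying_map D E G Gm (classifying_map C D F Fm p) =
    classifying_map C E (\<lambda>x. G (F x)) (\<lambda>x y f. Gm (F x) (F y) (Fm x y f)) p"
proof -
  have GF: "is_functor C E (\<lambda>x. G (F x)) (\<lambda>x y f. Gm (F x) (F y) (Fm x y f))"
    by (rule is_functor_compose[OF F G])
  obtain n x t where p: "p = simplex_class (nerve C) n x t" "x \<in> Simplices (nerve C) n" "t \<in> standard_simplex n"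
    using p by (auto simp: classifying_space_def topspace_realization)
  have "nerve_map G Gm n (nerve_map F Fm n x) = nerve_map (\<lambda>x. G (F x)) (\<lambda>x y f. Gm (F x) (F y) (Fm x y f)) n x"
    unfolding nerve_map_def[of F] nerve_map_diagram_simplex by (simp add: nerve_map_def)
  then show ?thesis
    using p by (simp add: classifying_map(2)[OF F] classifying_map(2)[OF G] classifying_map(2)[OF GF]
        nerve_map_in_Simplices[OF F])
qed

lemma classifying_map_id:
  assumes p: "p \<in> topspace (classifying_space C)"
  shows "classifying_map C C (\<lambda>x. x) (\<lambda>x y f. f) p = p"
proof -
  have I: "is_functor C C (\<lambda>x. x) (\<lambda>x y f. f)" by (simp add: is_functor_def)
  obtain n x t where p: "p = simplex_class (nerve C) n x t" "x \<in> Simplices (nerve C) n" "t \<in> standard_simplex n"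
    using p by (auto simp: classifying_space_def topspace_realization)
  then show ?thesis
    by (simp add: classifying_map(2)[OF I] nerve_map_def nerve_simplex_eq_diagram_simplex[symmetric])
qed

text \<open>A natural transformation is a functor on the product with the arrow from
  \<open>False\<close> to \<open>True\<close>; a morphism that crosses this arrow first applies
  \<open>F\<close> and then \<open>\<eta>\<close>.\<close>

lemma diagram_nat_trans:
  assumes D: "is_category D" and F: "is_functor C D F Fm" and G: "is_functor C D G Gm"
    and \<eta>: "nat_trans C D F Fm G Gm \<eta>" and d: "diagram C P A M"
  shows "diagram D (P \<times> UNIV) (\<lambda>(p, b). if b then G (A p) else F (A p))
    (\<lambda>(p, b) (q, b'). if b then Gm (A p) (A q) (M p q)
       else if b' then Comp D (F (A p)) (F (A q)) (G (A q)) (\<eta> (A q)) (Fm (A p) (A q) (M p q))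
       else Fm (A p) (A q) (M p q))" (is "diagram D _ ?A ?M")
proof -
  have FO: "F (A p) \<in> Obj D" "G (A p) \<in> Obj D" "\<eta> (A p) \<in> Hom D (F (A p)) (G (A p))" "A p \<in> Obj C" if "p \<in> P" for p
    using that is_functorD(1)[OF F] is_functorD(1)[OF G] nat_transD(1)[OF \<eta>] diagramD(1)[OF d] by auto
  have Mh: "M p q \<in> Hom C (A p) (A q)" "Fm (A p) (A q) (M p q) \<in> Hom D (F (A p)) (F (A q))"
    "Gm (A p) (A q) (M p q) \<in> Hom D (G (A p)) (G (A q))"
    if "p \<in> P" "q \<in> P" "p \<le> q" for p q
    using that is_functorD(3)[OF F] is_functorD(3)[OF G] diagramD(1,3)[OF d] by auto
  note cmp = is_categoryD(1)[OF D] and assoc = is_categoryD(2)[OF D]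
  have nat: "Comp D (F (A p)) (F (A q)) (G (A q)) (\<eta> (A q)) (Fm (A p) (A q) (M p q)) =
      Comp D (F (A p)) (G (A p)) (G (A q)) (Gm (A p) (A q) (M p q)) (\<eta> (A p))"
    if "p \<in> P" "q \<in> P" "p \<le> q" for p q
    using nat_transD(2)[OF \<eta>] FO(4) Mh(1) that by auto
  have dF: "Fm (A p) (A r) (M p r) =
        Comp D (F (A p)) (F (A q)) (F (A r)) (Fm (A q) (A r) (M q r)) (Fm (A p) (A q) (M p q))"
    and dG: "Gm (A p) (A r) (M p r) =
        Comp D (G (A p)) (G (A q)) (G (A r)) (Gm (A q) (A r) (M q r)) (Gm (A p) (A q) (M p q))"
    if "p \<in> P" "q \<in> P" "r \<in> P" "p \<le> q" "q \<le> r" for p q r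
    by (rule diagramD(4)[OF diagram_compose[OF F d] that], rule diagramD(4)[OF diagram_compose[OF G d] that])
  show ?thesis
    unfolding diagram_def
  proof (intro conjI ballI impI)
    fix x assume "x \<in> P \<times> (UNIV :: bool set)"
    then show "?A x \<in> Obj D" "?M x x = Id D (?A x)"
      using FO is_functorD(2)[OF F] is_functorD(2)[OF G] diagramD(2)[OF d] by (auto split: prod.splits)
  next
    fix x y assume "x \<in> P \<times> (UNIV :: bool set)" "y \<in> P \<times> (UNIV :: bool set)" "x \<le> y"
    then show "?M x y \<in> Hom D (?A x) (?A y)"
      using FO Mh by (auto intro!: cmp split: prod.splits)
  next
    fix x y z assume xyz: "x \<in> P \<times> (UNIV :: bool set)" "y \<in> P \<times> (UNIV :: bool set)"
      "z \<in> P \<times> (UNIV :: bool set)" "x \<le> y \<and> y \<le> z"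
    obtain p b q b' r b'' where x: "x = (p, b)" "y = (q, b')" "z = (r, b'')"
      by (metis surj_pair)
    have pqr: "p \<in> P" "q \<in> P" "r \<in> P" "p \<le> q" "q \<le> r" "p \<le> r" "b \<le> b'" "b' \<le> b''"
      using xyz by (auto simp: x)
    show "?M x z = Comp D (?A x) (?A y) (?A z) (?M y z) (?M x y)"
    proof (cases b)
      case True
      then show ?thesis using pqr dG[OF pqr(1-5)] by (simp add: x)
    next
      case b: False
      show ?thesis
      proof (cases b')
        case True
        \<comment> \<open>Naturality enters only here: the crossing takes place in the first of the
          two steps, and \<open>\<eta>\<close> has to be moved past the second one.\<close>
        then have "Comp D (F (A p)) (F (A r)) (G (A r)) (\<eta> (A r)) (Fm (A p) (A r) (M p r)) =
            Comp D (F (A p)) (G (A p)) (G (A r)) (Comp D (G (A p)) (G (A q)) (G (A r)) (Gm (A q) (A r) (M q r)) (Gm (A p) (A q) (M p q))) (\<eta> (A p))"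
          using nat[OF pqr(1,3,6)] dG[OF pqr(1-5)] by simp
        also have "\<dots> = Comp D (F (A p)) (G (A q)) (G (A r)) (Gm (A q) (A r) (M q r))
            (Comp D (F (A p)) (G (A p)) (G (A q)) (Gm (A p) (A q) (M p q)) (\<eta> (A p)))"
          by (rule assoc[symmetric]) (use FO Mh pqr in auto)
        finally show ?thesis
          using True b pqr nat[OF pqr(1,2,4)] by (simp add: x)
      next
        case b': False
        have "Comp D (F (A p)) (F (A r)) (G (A r)) (\<eta> (A r))
              (Comp D (F (A p)) (F (A q)) (F (A r)) (Fm (A q) (A r) (M q r)) (Fm (A p) (A q) (M p q))) =
            Comp D (F (A p)) (F (A q)) (G (A r)) (Comp D (F (A q)) (F (A r)) (G (A r)) (\<eta> (A r)) (Fm (A q) (A r) (M q r)))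
              (Fm (A p) (A q) (M p q))"
          by (rule assoc) (use FO Mh pqr in auto)
        then show ?thesis
          using b b' pqr dF[OF pqr(1-5)] by (simp add: x)
      qed
    qed
  qed
qed

text \<open>At time \<open>s\<close> a point of a simplex is coupled with the measure that gives
  \<open>1 - s\<close> to \<open>False\<close> and \<open>s\<close> to \<open>True\<close>. At the
  two ends the coupling lives on one copy of the simplex.\<close>

lemma nat_trans_homotopic:
  fixes C :: "('o, 'm, 'y) category_scheme"
  assumes D: "is_category D" and F: "is_functor C D F Fm" and G: "is_functor C D G Gm"
    and \<eta>: "nat_trans C D F Fm G Gm \<eta>"
  shows "homotopic_with (\<lambda>_. True) (classifying_space C) (classifying_space D)
    (classifying_map C D F Fm) (classifying_map C D G Gm)"
proof -
  define Ob where "Ob x = (\<lambda>(p, b). if b then G (fst x p) else F (fst x p))" for x :: "(nat \<Rightarrow> 'o) \<times> (nat \<times> nat \<Rightarrow> 'm)"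
  define Mo where "Mo x = (\<lambda>(p, b) (q, b'). if b then Gm (fst x p) (fst x q) (snd x (p, q))
       else if b' then Comp D (F (fst x p)) (F (fst x q)) (G (fst x q)) (\<eta> (fst x q)) (Fm (fst x p) (fst x q) (snd x (p, q)))
       else Fm (fst x p) (fst x q) (snd x (p, q)))" for x :: "(nat \<Rightarrow> 'o) \<times> (nat \<times> nat \<Rightarrow> 'm)"
  have dia: "diagram D ({..n} \<times> UNIV) (Ob x) (Mo x)" if "x \<in> Simplices (nerve C) n" for n x
    using diagram_nat_trans[OF D F G \<eta> nerve_simplex_diagram[OF that]] unfolding Ob_def Mo_def .
  note fam = poset_family_diagram[OF dia]
  define h where "h n x s t = measure_point (nerve D) ({..n} \<times> UNIV) (diagram_simplex (Ob x) (Mo x)) (coupling t (1 - s) False True)"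
    for n and x :: "(nat \<Rightarrow> 'o) \<times> (nat \<times> nat \<Rightarrow> 'm)" and s :: real and t
  have ends: "measure_point (nerve D) ({..n} \<times> UNIV) (diagram_simplex (Ob x) (Mo x)) (push_measure n (\<lambda>i. (i, b)) t) =
      simplex_class (nerve D) n (if b then nerve_map G Gm n x else nerve_map F Fm n x) t"
    if "x \<in> Simplices (nerve C) n" "t \<in> standard_simplex n" for n x t b
  proof -
    have "chain_map ({..n} \<times> UNIV) n (\<lambda>i. (i, b))"
      by (auto simp: chain_map_def mono_on_def)
    then show ?thesis
      using poset_family.measure_point_eq[OF fam[OF that(1)] _ that(2)]
      by (simp add: nerve_map_def diagram_simplex_def Ob_def Mo_def)
  qed
  show ?thesis
    unfolding classifying_space_def[of C]
  proof (rule realization_homotopic[OF pull_closed_nerve, of C _ h])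
    fix n x assume x: "x \<in> Simplices (nerve C) n"
    have c1: "continuous_map (prod_topology (simplex_top n) (top_of_set {0..1})) (realization (nerve D))
        (\<lambda>(t, u). measure_point (nerve D) ({..n} \<times> UNIV) (diagram_simplex (Ob x) (Mo x)) (coupling t u False True))"
      by (rule continuous_map_measure_point_coupling[OF fam[OF x]]) auto
    have c2: "continuous_map (prod_topology (top_of_set {0..1::real}) (simplex_top n))
        (prod_topology (simplex_top n) (top_of_set {0..1})) (\<lambda>z. (snd z, 1 - fst z))"
    proof (rule continuous_map_pairedI)
      have "continuous_map (prod_topology (top_of_set {0..1::real}) (simplex_top n)) euclideanreal fst"
        using continuous_map_fst continuous_map_into_fulltopology by blast
      then show "continuous_map (prod_topology (top_of_set {0..1::real}) (simplex_top n)) (top_of_set {0..1}) (\<lambda>z. 1 - fst z)"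
        by (auto simp: continuous_map_in_subtopology intro: continuous_map_diff)
    qed (rule continuous_map_snd)
    show "continuous_map (prod_topology (top_of_set {0..1}) (simplex_top n)) (classifying_space D) (\<lambda>(s, t). h n x s t)"
      unfolding h_def classifying_space_def
      using continuous_map_compose[OF c2 c1] by (simp add: o_def case_prod_unfold)
  next
    fix m n \<theta> x t and s :: real
    assume \<theta>: "simplex_op m n \<theta>" and x: "x \<in> Simplices (nerve C) n" and t: "t \<in> standard_simplex m" and s: "s \<in> {0..1}"
    have x': "Pull (nerve C) m \<theta> x \<in> Simplices (nerve C) m"
      by (rule nerve_Pull[OF \<theta> x])
    show "h m (Pull (nerve C) m \<theta> x) s t = h n x s (push_simplex m \<theta> t)"
      unfolding h_def
    proof (rule measure_point_coupling_Pull[OF fam[OF x] fam[OF x'] _ _ _ t \<theta>])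
      fix l and c :: "nat \<Rightarrow> nat \<times> bool" assume c: "chain_map ({..m} \<times> UNIV) l c"
      have "fst (c i) \<le> m" "fst (c i) \<le> fst (c j)" if "i \<le> j" "j \<le> l" for i j
      proof -
        have "c i \<in> {..m} \<times> UNIV" "c i \<le> c j"
          using c that by (auto simp: chain_map_def mono_on_def image_subset_iff)
        then show "fst (c i) \<le> m" "fst (c i) \<le> fst (c j)"
          by (auto simp: mem_Times_iff less_eq_prod_def)
      qed
      then show "diagram_simplex (Ob (Pull (nerve C) m \<theta> x)) (Mo (Pull (nerve C) m \<theta> x)) l c =
          diagram_simplex (Ob x) (Mo x) l (map_prod \<theta> id \<circ> c)"
        by (auto simp: diagram_simplex_def Ob_def Mo_def restrict_def fun_eq_iff case_prod_unfold
            fst_Pull_nerve snd_Pull_nerve)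
    qed (use s in auto)
  next
    fix n x t assume x: "x \<in> Simplices (nerve C) n" and t: "t \<in> standard_simplex n"
    show "h n x 0 t = classifying_map C D F Fm (simplex_class (nerve C) n x t)"
      using ends[OF x t, of False] by (simp add: h_def coupling_one[OF t] classifying_map(2)[OF F x t])
    show "h n x 1 t = classifying_map C D G Gm (simplex_class (nerve C) n x t)"
      using ends[OF x t, of True] by (simp add: h_def coupling_zero[OF t] classifying_map(2)[OF G x t])
  qed
qed

section \<open>The cone of binary forms and the contractibility of the realization in rank
  two\<close>

section \<open>Integral matrices of size two\<close>

definition vec2 :: "int \<Rightarrow> int \<Rightarrow> int ^ 2" where
  "vec2 x y = vector [x, y]"

definition mat2 :: "int \<Rightarrow> int \<Rightarrow> int \<Rightarrow> int \<Rightarrow> int ^ 2 ^ 2" where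
  "mat2 a b c d = vector [vec2 a b, vec2 c d]"

definition det2 :: "int ^ 2 \<Rightarrow> int ^ 2 \<Rightarrow> int" where
  "det2 u v = u$1 * v$2 - u$2 * v$1"

lemma vec2_nth [simp]: "vec2 x y $ 1 = x" "vec2 x y $ 2 = y"
  by (simp_all add: vec2_def)

lemma mat2_nth [simp]: "mat2 a b c d $ 1 = vec2 a b" "mat2 a b c d $ 2 = vec2 c d"
  by (simp_all add: mat2_def)

lemma vec2_eq_iff: "u = v \<longleftrightarrow> u$1 = v$1 \<and> u$2 = (v$2 :: 'a)" for u v :: "'a ^ 2"
  by (simp add: vec_eq_iff forall_2)

lemma matrix_vector_mult_2: "((A :: 'a::comm_ring_1 ^ 2 ^ 2) *v v) $ i = A$i$1 * v$1 + A$i$2 * v$2"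
  by (simp add: matrix_vector_mult_def sum_2)

lemma matrix_matrix_mult_2: "((A :: 'a::comm_ring_1 ^ 2 ^ 2) ** B) $ i $ j = A$i$1 * B$1$j + A$i$2 * B$2$j"
  by (simp add: matrix_matrix_mult_def sum_2)

lemma matrix_inv_right: "invertible A \<Longrightarrow> A ** matrix_inv A = mat 1"
  and matrix_inv_left: "invertible A \<Longrightarrow> matrix_inv A ** A = mat 1"
  unfolding matrix_inv_def invertible_def by (metis (mono_tags, lifting) someI_ex)+

lemma invertible_matrix_inv: "invertible A \<Longrightarrow> invertible (matrix_inv A)"
  using matrix_inv_right matrix_inv_left unfolding invertible_def by blast

lemma matrix_inv_unique:
  fixes A :: "'a::comm_ring_1 ^ 'n ^ 'n"
  assumes "B ** A = mat 1" "invertible A"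
  shows "B = matrix_inv A"
proof -
  have "B = B ** (A ** matrix_inv A)"
    using assms by (simp add: matrix_inv_right)
  also have "\<dots> = matrix_inv A"
    using assms by (simp add: matrix_mul_assoc)
  finally show ?thesis .
qed

lemma matrix_inv_inv: "invertible A \<Longrightarrow> matrix_inv (matrix_inv A) = A" for A :: "'a::comm_ring_1 ^ 'n ^ 'n"
  by (metis invertible_matrix_inv matrix_inv_right matrix_inv_unique)

lemma matrix_inv_mult:
  fixes A B :: "'a::comm_ring_1 ^ 'n ^ 'n"
  assumes "invertible A" "invertible B"
  shows "matrix_inv (A ** B) = matrix_inv B ** matrix_inv A"
proof -
  have "(matrix_inv B ** matrix_inv A) ** (A ** B) = matrix_inv B ** (matrix_inv A ** A) ** B"
    by (simp add: matrix_mul_assoc)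
  also have "\<dots> = mat 1" using assms by (simp add: matrix_inv_left)
  finally show ?thesis
    using matrix_inv_unique invertible_mult assms by metis
qed

lemma invertible_mat_1: "invertible (mat 1 :: 'a::comm_ring_1 ^ 'n ^ 'n)"
  by (auto simp: invertible_def intro: exI[of _ "mat 1"])

lemma matrix_inv_mat_1: "matrix_inv (mat 1 :: 'a::comm_ring_1 ^ 'n ^ 'n) = mat 1"
  by (metis invertible_mat_1 matrix_inv_unique matrix_mul_lid)

lemma matrix_inv_vector: "invertible A \<Longrightarrow> matrix_inv A *v (A *v v) = v" "invertible A \<Longrightarrow> A *v (matrix_inv A *v v) = v"
  for A :: "'a::comm_ring_1 ^ 'n ^ 'n"
  by (simp_all add: matrix_vector_mul_assoc matrix_inv_left matrix_inv_right)

lemma inj_invertible: "invertible A \<Longrightarrow> inj ((*v) A)" for A :: "'a::comm_ring_1 ^ 'n ^ 'n"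
  by (metis injI matrix_inv_vector(1))

lemma invertible_int_iff: "invertible (A :: int ^ 2 ^ 2) \<longleftrightarrow> \<bar>det A\<bar> = 1"
proof
  assume "invertible A"
  then obtain B where "A ** B = mat 1" by (auto simp: invertible_def)
  then have "det A * det B = 1" by (metis det_I det_mul)
  then show "\<bar>det A\<bar> = 1" using zmult_eq_1_iff by auto
next
  assume d: "\<bar>det A\<bar> = 1"
  \<comment> \<open>The adjugate multiplied by the determinant, which is its own inverse.\<close>
  let ?B = "mat2 (det A * A$2$2) (- det A * A$1$2) (- det A * A$2$1) (det A * A$1$1)"
  have "det A * det A = 1" using d by (metis abs_mult_self_eq mult_1)
  then have "A ** ?B = mat 1" "?B ** A = mat 1"
    by (auto simp: vec_eq_iff forall_2 matrix_matrix_mult_2 mat_def det_2 algebra_simps)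
  then show "invertible A" by (auto simp: invertible_def)
qed

lemma det2_matrix: "det2 (A *v u) (A *v v) = det A * det2 u v"
  by (simp add: det2_def matrix_vector_mult_2 det_2 algebra_simps)

lemma abs_det2_matrix: "invertible A \<Longrightarrow> \<bar>det2 (A *v u) (A *v v)\<bar> = \<bar>det2 u v\<bar>"
  by (simp add: det2_matrix abs_mult invertible_int_iff)

lemma invertible_columns:
  assumes "\<bar>det2 u v\<bar> = 1"
  obtains A where "invertible A" "A *v vec2 1 0 = u" "A *v vec2 0 1 = v"
proof
  show "invertible (mat2 (u$1) (v$1) (u$2) (v$2))"
    using assms by (simp add: invertible_int_iff det_2 det2_def algebra_simps)
qed (simp_all add: vec2_eq_iff matrix_vector_mult_2)

lemma matrix_determined:
  fixes A B :: "int ^ 2 ^ 2"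
  assumes "A *v u = B *v u" "A *v v = B *v v" "\<bar>det2 u v\<bar> = 1"
  shows "A = B"
proof -
  obtain C where C: "invertible C" "C *v vec2 1 0 = u" "C *v vec2 0 1 = v"
    using invertible_columns[OF assms(3)] .
  have "(A ** C) *v vec2 1 0 = (B ** C) *v vec2 1 0" "(A ** C) *v vec2 0 1 = (B ** C) *v vec2 0 1"
    using assms by (simp_all add: matrix_vector_mul_assoc[symmetric] C)
  then have "A ** C = B ** C"
    by (simp add: vec_eq_iff forall_2 matrix_vector_mult_2)
  then have "(A ** C) ** matrix_inv C = (B ** C) ** matrix_inv C" by simp
  then show ?thesis
    by (simp add: matrix_mul_assoc[symmetric] matrix_inv_right[OF C(1)])
qed

lemma finite_bounded_matrices: "finite {A :: int ^ 2 ^ 2. \<forall>i j. \<bar>A$i$j\<bar> \<le> N}"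
proof -
  have "{A :: int ^ 2 ^ 2. \<forall>i j. \<bar>A$i$j\<bar> \<le> N} \<subseteq>
      (\<lambda>(a, b, c, d). mat2 a b c d) ` ({-N..N} \<times> {-N..N} \<times> {-N..N} \<times> {-N..N})"
  proof
    fix A :: "int ^ 2 ^ 2" assume A: "A \<in> {A. \<forall>i j. \<bar>A$i$j\<bar> \<le> N}"
    then have "A$i$j \<in> {-N..N}" for i j using abs_le_iff[of "A$i$j" N] by auto
    moreover have "A = mat2 (A$1$1) (A$1$2) (A$2$1) (A$2$2)"
      by (simp add: vec2_eq_iff)
    ultimately show "A \<in> (\<lambda>(a, b, c, d). mat2 a b c d) ` ({-N..N} \<times> {-N..N} \<times> {-N..N} \<times> {-N..N})"
      by (intro image_eqI[of _ _ "(A$1$1, A$1$2, A$2$1, A$2$2)"]) auto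
  qed
  then show ?thesis by (rule finite_subset) auto
qed


lemma abs_le_square_int: "\<bar>k\<bar> \<le> k\<^sup>2" for k :: int
  using mult_left_mono[of 1 "\<bar>k\<bar>" "\<bar>k\<bar>"] by (cases "k = 0") (auto simp: power2_eq_square)


section \<open>Positive definite binary forms\<close>

text \<open>The triple \<open>(a, b, c)\<close> stands for the symmetric matrix with rows \<open>(a, b)\<close> and \<open>(b, c)\<close>.\<close>

type_synonym form = "real \<times> real \<times> real"

definition form_val :: "form \<Rightarrow> real \<Rightarrow> real \<Rightarrow> real" where
  "form_val = (\<lambda>(a, b, c) x y. a * x\<^sup>2 + 2 * b * x * y + c * y\<^sup>2)"

text \<open>The determinant of the symmetric matrix, with the sign that is positive on definite
  forms.\<close>

definition form_disc :: "form \<Rightarrow> real" where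
  "form_disc = (\<lambda>(a, b, c). a * c - b\<^sup>2)"

definition form_trace :: "form \<Rightarrow> real" where
  "form_trace = (\<lambda>(a, b, c). a + c)"

definition pos_forms :: "form set" where
  "pos_forms = {q. \<forall>x y. (x, y) \<noteq> (0, 0) \<longrightarrow> 0 < form_val q x y}"

text \<open>The rank one matrix \<open>v v^T\<close>, that is, the square of the linear form with
  coefficient vector \<open>v\<close>.\<close>

definition sq_form :: "int ^ 2 \<Rightarrow> form" where
  "sq_form v = ((real_of_int (v$1))\<^sup>2, real_of_int (v$1) * real_of_int (v$2), (real_of_int (v$2))\<^sup>2)"

text \<open>In terms of matrices, \<open>act g q\<close> is \<open>g q g\<^sup>T\<close>.\<close>

definition act :: "int ^ 2 ^ 2 \<Rightarrow> form \<Rightarrow> form" where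
  "act g = (\<lambda>(a, b, c). let p = real_of_int (g$1$1); q = real_of_int (g$1$2); r = real_of_int (g$2$1); s = real_of_int (g$2$2)
     in (p\<^sup>2 * a + 2 * p * q * b + q\<^sup>2 * c, p * r * a + (p * s + q * r) * b + q * s * c,
         r\<^sup>2 * a + 2 * r * s * b + s\<^sup>2 * c))"

lemma act_mult: "act (g ** h) x = act g (act h x)"
  by (cases x) (simp add: act_def Let_def matrix_matrix_mult_2 algebra_simps power2_eq_square)

lemma act_mat_1 [simp]: "act (mat 1) x = x"
  by (cases x) (simp add: act_def mat_def)

lemma act_add: "act g (x + y) = act g x + act g y"
  by (cases x; cases y) (simp add: act_def Let_def algebra_simps)

lemma act_scaleR: "act g (k *\<^sub>R x) = k *\<^sub>R act g x"
  by (cases x) (simp add: act_def Let_def algebra_simps)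

lemma act_zero [simp]: "act g 0 = 0"
  by (simp add: act_def zero_prod_def)

lemma act_sum: "act g (sum f A) = (\<Sum>i\<in>A. act g (f i))"
  by (induction A rule: infinite_finite_induct) (simp_all add: act_add)

lemma act_sq_form: "act g (sq_form v) = sq_form (g *v v)"
  by (simp add: act_def sq_form_def matrix_vector_mult_2 Let_def algebra_simps power2_eq_square)

lemma act_inv [simp]: "invertible g \<Longrightarrow> act g (act (matrix_inv g) x) = x"
  "invertible g \<Longrightarrow> act (matrix_inv g) (act g x) = x"
  by (simp_all add: act_mult[symmetric] matrix_inv_left matrix_inv_right)

lemma form_val_add: "form_val (p + q) x y = form_val p x y + form_val q x y"
  by (cases p; cases q) (simp add: form_val_def algebra_simps)

lemma form_val_scaleR: "form_val (k *\<^sub>R q) x y = k * form_val q x y"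
  by (cases q) (simp add: form_val_def algebra_simps)

lemma form_val_act:
  "form_val (act g q) x y = form_val q (real_of_int (g$1$1) * x + real_of_int (g$2$1) * y) (real_of_int (g$1$2) * x + real_of_int (g$2$2) * y)"
  by (cases q) (simp add: form_val_def act_def Let_def algebra_simps power2_eq_square)

lemma form_val_pos: "q \<in> pos_forms \<Longrightarrow> x \<noteq> 0 \<or> y \<noteq> 0 \<Longrightarrow> 0 < form_val q x y"
  by (auto simp: pos_forms_def)

lemma convex_pos_forms: "convex pos_forms"
  unfolding convex_alt
proof (intro ballI allI impI)
  fix p q :: form and u :: real
  assume p: "p \<in> pos_forms" and q: "q \<in> pos_forms" and u: "0 \<le> u \<and> u \<le> 1"
  have "0 < form_val ((1 - u) *\<^sub>R p + u *\<^sub>R q) x y" if "(x, y) \<noteq> (0, 0)" for x y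
  proof -
    have "0 < form_val p x y" "0 < form_val q x y" using form_val_pos p q that by auto
    then show ?thesis
      using u by (cases "u = 0") (auto simp: form_val_add form_val_scaleR intro!: add_nonneg_pos)
  qed
  then show "(1 - u) *\<^sub>R p + u *\<^sub>R q \<in> pos_forms" by (simp add: pos_forms_def)
qed

lemma pos_formsD:
  assumes "(a, b, c) \<in> pos_forms"
  shows "0 < a" "0 < c" "0 < a * c - b\<^sup>2"
proof -
  have "0 < form_val (a, b, c) 1 0" "0 < form_val (a, b, c) 0 1"
    by (rule form_val_pos[OF assms], simp)+
  then show ac: "0 < a" "0 < c" by (simp_all add: form_val_def)
  \<comment> \<open>At this vector the square \<open>(a * x + b * y)^2\<close> obtained by
    completing the square vanishes, and only the determinant term remains.\<close>
  have "0 < form_val (a, b, c) (- b) a"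
    by (rule form_val_pos[OF assms]) (use ac in simp)
  also have "form_val (a, b, c) (- b) a = a * (a * c - b\<^sup>2)"
    by (simp add: form_val_def algebra_simps power2_eq_square)
  finally show "0 < a * c - b\<^sup>2" using ac by (simp add: zero_less_mult_iff)
qed

lemma form_disc_pos: "q \<in> pos_forms \<Longrightarrow> 0 < form_disc q"
  and form_trace_pos: "q \<in> pos_forms \<Longrightarrow> 0 < form_trace q"
  using pos_formsD[of "fst q" "fst (snd q)" "snd (snd q)"]
  by (simp_all add: form_disc_def form_trace_def case_prod_unfold)

lemma pos_formsI:
  assumes "0 < a" "0 < a * c - b\<^sup>2"
  shows "(a, b, c) \<in> pos_forms"
  unfolding pos_forms_def
proof (intro CollectI allI impI)
  fix x y :: real assume xy: "(x, y) \<noteq> (0, 0)"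
  have "a * form_val (a, b, c) x y = (a * x + b * y)\<^sup>2 + (a * c - b\<^sup>2) * y\<^sup>2"
    by (simp add: form_val_def algebra_simps power2_eq_square)
  moreover have "\<dots> > 0"
  proof (cases "y = 0")
    case True
    then show ?thesis using xy assms by simp
  next
    case False
    then show ?thesis using assms by (intro add_nonneg_pos) auto
  qed
  ultimately show "0 < form_val (a, b, c) x y"
    using assms(1) by (metis zero_less_mult_pos)
qed

lemma act_pos_forms:
  assumes "invertible g" "q \<in> pos_forms"
  shows "act g q \<in> pos_forms"
  unfolding pos_forms_def
proof (intro CollectI allI impI)
  fix x y :: real assume xy: "(x, y) \<noteq> (0, 0)"
  let ?x = "real_of_int (g$1$1) * x + real_of_int (g$2$1) * y" and ?y = "real_of_int (g$1$2) * x + real_of_int (g$2$2) * y"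
  let ?d = "real_of_int (det g)"
  have d: "?d \<noteq> 0" using assms(1) by (auto simp: invertible_int_iff)
  have "?d * x = real_of_int (g$2$2) * ?x - real_of_int (g$2$1) * ?y"
    "?d * y = real_of_int (g$1$1) * ?y - real_of_int (g$1$2) * ?x"
    by (simp_all add: det_2 algebra_simps)
  then have "?x \<noteq> 0 \<or> ?y \<noteq> 0" using d xy by auto
  then show "0 < form_val (act g q) x y"
    using form_val_pos[OF assms(2)] unfolding form_val_act by blast
qed

text \<open>By Cayley-Hamilton the matrix \<open>Q\<close> satisfies
  \<open>trace Q * Q = Q^2 + det Q * 1\<close>, and \<open>Q^2\<close> takes the nonnegative value
  \<open>|Q x|^2\<close>.\<close>

lemma form_val_lower_bound:
  assumes "q \<in> pos_forms"
  shows "form_disc q * (x\<^sup>2 + y\<^sup>2) \<le> form_trace q * form_val q x y"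
proof -
  obtain a b c where q: "q = (a, b, c)" by (cases q)
  have "form_trace q * form_val q x y = (a * x + b * y)\<^sup>2 + (b * x + c * y)\<^sup>2 + form_disc q * (x\<^sup>2 + y\<^sup>2)"
    by (simp add: q form_val_def form_trace_def form_disc_def algebra_simps power2_eq_square)
  then show ?thesis by (smt (verit) zero_le_power2)
qed

text \<open>The trace of \<open>h q h^T\<close> is the sum of the values of \<open>q\<close> at the
  rows of \<open>h\<close>.\<close>

lemma form_trace_act_lower_bound:
  assumes "q \<in> pos_forms"
  shows "form_disc q * (real_of_int (h$i$j))\<^sup>2 \<le> form_trace q * form_trace (act h q)"
proof -
  let ?S = "\<lambda>i. (real_of_int (h$i$1))\<^sup>2 + (real_of_int (h$i$2))\<^sup>2"
  have "form_trace (act h q) = form_val q (real_of_int (h$1$1)) (real_of_int (h$1$2)) +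
      form_val q (real_of_int (h$2$1)) (real_of_int (h$2$2))"
    by (cases q) (simp add: form_trace_def act_def form_val_def Let_def algebra_simps)
  then have "form_disc q * (?S 1 + ?S 2) \<le> form_trace q * form_trace (act h q)"
    using form_val_lower_bound[OF assms, of "real_of_int (h$1$1)" "real_of_int (h$1$2)"]
      form_val_lower_bound[OF assms, of "real_of_int (h$2$1)" "real_of_int (h$2$2)"]
    by (simp add: algebra_simps)
  moreover have "(real_of_int (h$i$j))\<^sup>2 \<le> ?S 1 + ?S 2"
    using exhaust_2[of i] exhaust_2[of j] by auto
  then have "form_disc q * (real_of_int (h$i$j))\<^sup>2 \<le> form_disc q * (?S 1 + ?S 2)"
    using form_disc_pos[OF assms] by (intro mult_left_mono) auto
  ultimately show ?thesis by linarith
qed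

text \<open>Guarantees that the trace attains a minimum on the orbit of a form, from which the
  reduction starts.\<close>

lemma finite_form_trace_act_bounded: 
  assumes "q \<in> pos_forms"
  shows "finite {h. form_trace (act h q) \<le> M}"
proof -
  define N where "N = form_trace q * \<bar>M\<bar> / form_disc q"
  have "\<bar>h$i$j\<bar> \<le> \<lceil>N\<rceil>" if "form_trace (act h q) \<le> M" for h i j
  proof -
    have "form_trace q * form_trace (act h q) \<le> form_trace q * \<bar>M\<bar>"
      using form_trace_pos[OF assms] that by (intro mult_left_mono) auto
    then have "(real_of_int (h$i$j))\<^sup>2 \<le> N"
      using form_trace_act_lower_bound[OF assms, of h i j] form_disc_pos[OF assms]
      by (simp add: N_def field_simps)
    moreover have "real_of_int \<bar>h$i$j\<bar> \<le> real_of_int ((h$i$j)\<^sup>2)"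
      using abs_le_square_int[of "h$i$j"] by (simp only: of_int_le_iff)
    ultimately have "real_of_int \<bar>h$i$j\<bar> \<le> N" by simp
    then show ?thesis by linarith
  qed
  then show ?thesis
    by (intro finite_subset[OF _ finite_bounded_matrices[of "\<lceil>N\<rceil>"]]) auto
qed

section \<open>Bases and superbases of the integer lattice\<close>

abbreviation "E1 \<equiv> vec2 1 0"
abbreviation "E2 \<equiv> vec2 0 1"
abbreviation "E12 \<equiv> vec2 1 1"

definition edge_set :: "int ^ 2 ^ 2 \<Rightarrow> (int ^ 2) set" where
  "edge_set g = (*v) g ` {E1, - E1, E2, - E2}"

text \<open>A superbase up to signs: the columns of \<open>g\<close> and the negative of their sum
  add up to zero, and any two of the three form a basis.\<close>

definition tri_set :: "int ^ 2 ^ 2 \<Rightarrow> (int ^ 2) set" where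
  "tri_set g = (*v) g ` {E1, - E1, E2, - E2, E12, - E12}"

lemma edge_subset_tri: "edge_set g \<subseteq> tri_set g"
  by (auto simp: edge_set_def tri_set_def)

lemma card_edge_set: "invertible g \<Longrightarrow> card (edge_set g) = 4"
  unfolding edge_set_def by (subst card_image[OF inj_on_subset[OF inj_invertible subset_UNIV]])
    (auto simp: vec2_eq_iff card_insert_if)

lemma card_tri_set: "invertible g \<Longrightarrow> card (tri_set g) = 6"
  unfolding tri_set_def by (subst card_image[OF inj_on_subset[OF inj_invertible subset_UNIV]])
    (auto simp: vec2_eq_iff card_insert_if)

lemma edge_neq_tri: "invertible g \<Longrightarrow> invertible h \<Longrightarrow> edge_set g \<noteq> tri_set h"
  using card_edge_set[of g] card_tri_set[of h] by auto

lemma edge_psubset_tri: "invertible g \<Longrightarrow> edge_set g \<subset> tri_set g"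
  using edge_subset_tri edge_neq_tri by blast

lemma finite_edge_set: "finite (edge_set g)" and finite_tri_set: "finite (tri_set g)"
  by (auto simp: edge_set_def tri_set_def)

lemma edge_set_mult: "edge_set (h ** g) = (*v) h ` edge_set g"
  and tri_set_mult: "tri_set (h ** g) = (*v) h ` tri_set g"
  by (simp_all add: edge_set_def tri_set_def matrix_vector_mul_assoc)

lemma matrix_vector_uminus: "g *v (- v) = - (g *v (v :: 'a::comm_ring_1 ^ 'n))"
  by (simp add: vec_eq_iff matrix_vector_mult_def sum_negf)

lemma uminus_tri_set: "v \<in> tri_set g \<Longrightarrow> - v \<in> tri_set g"
  by (auto simp: tri_set_def matrix_vector_uminus)

lemma det2_simps [simp]: "det2 (- u) v = - det2 u v" "det2 u (- v) = - det2 u v" "det2 u u = 0"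
  by (simp_all add: det2_def)

lemma abs_det2_tri_set:
  assumes "invertible g" "u \<in> tri_set g" "v \<in> tri_set g"
  shows "\<bar>det2 u v\<bar> \<le> 1"
proof -
  obtain x y where "u = g *v x" "v = g *v y" "x \<in> {E1, - E1, E2, - E2, E12, - E12}" "y \<in> {E1, - E1, E2, - E2, E12, - E12}"
    using assms by (auto simp: tri_set_def)
  then show ?thesis
    using abs_det2_matrix[OF assms(1), of x y] by (auto simp: det2_def)
qed

lemma tri_set_completes:
  assumes "invertible g" "u \<in> tri_set g"
  obtains v where "\<bar>det2 u v\<bar> = 1"
proof -
  obtain x where x: "u = g *v x" "x \<in> {E1, - E1, E2, - E2, E12, - E12}"
    using assms by (auto simp: tri_set_def)
  have "\<exists>y. \<bar>det2 x y\<bar> = 1"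
  proof (cases "x \<in> {E1, - E1}")
    case True
    then show ?thesis by (intro exI[of _ E2]) (auto simp: det2_def)
  next
    case False
    then show ?thesis using x(2) by (intro exI[of _ E1]) (auto simp: det2_def)
  qed
  then show thesis
    using abs_det2_matrix[OF assms(1)] x(1) that by metis
qed

text \<open>Cramer's rule without division.\<close>

lemma det2_expand: "det2 u v *s x = det2 x v *s u + det2 u x *s v"
  by (simp add: vec2_eq_iff det2_def algebra_simps)

text \<open>By Cramer's rule \<open>v\<close> is an integral multiple of \<open>u\<close>; the
  multiplier divides \<open>det2 v v'\<close>, hence is a unit.\<close>

lemma parallel_primitive:
  assumes "\<bar>det2 u u'\<bar> = 1" "\<bar>det2 v v'\<bar> = 1" "det2 u v = 0"
  shows "u = v \<or> u = - v"
proof -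
  have "det2 u u' *s v = det2 v u' *s u"
    using det2_expand[of u u' v] assms(3) by simp
  moreover have "det2 u u' = 1 \<or> det2 u u' = - 1" using assms(1) by linarith
  ultimately obtain k where k: "v = k *s u"
    by (metis (no_types, lifting) minus_minus scalar_mult_eq_scaleR vector_scalar_mult_def vector_smult_lid vector_sneg_minus1 vector_smult_lneg)
  then have "det2 v v' = k * det2 u v'" by (simp add: det2_def algebra_simps)
  then have "k = 1 \<or> k = - 1"
    using assms(2) abs_zmult_eq_1[of k "det2 u v'"] by auto
  then show ?thesis using k by (auto simp: vec2_eq_iff)
qed

lemma tri_set_nonzero: "invertible g \<Longrightarrow> 0 \<notin> tri_set g"
  using tri_set_completes[of g 0] by (auto simp: det2_def)

lemma not_self_opposite: "(v :: int ^ 2) \<noteq> 0 \<Longrightarrow> v \<noteq> - v"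
  by (auto simp: vec2_eq_iff)


section \<open>Uniqueness of the weights of a form\<close>

text \<open>Twice the polar form of the determinant. On squares of lattice vectors it gives the
  squared determinant of the pair, which ties it to unimodularity.\<close>

definition form_pol :: "form \<Rightarrow> form \<Rightarrow> real" where
  "form_pol = (\<lambda>(a, b, c) (a', b', c'). a * c' + c * a' - 2 * b * b')"

lemma form_pol_add: "form_pol (p + q) r = form_pol p r + form_pol q r" "form_pol p (q + r) = form_pol p q + form_pol p r"
  and form_pol_scaleR: "form_pol (k *\<^sub>R p) q = k * form_pol p q" "form_pol p (k *\<^sub>R q) = k * form_pol p q"
  and form_pol_zero: "form_pol 0 q = 0" "form_pol p 0 = 0"
  by (cases p; cases q; cases r; simp add: form_pol_def algebra_simps zero_prod_def)+

lemma form_pol_sum: "form_pol (sum f A) q = (\<Sum>i\<in>A. form_pol (f i) q)" "form_pol p (sum f A) = (\<Sum>i\<in>A. form_pol p (f i))"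
  by (induction A rule: infinite_finite_induct) (simp_all add: form_pol_add form_pol_zero)

lemma form_pol_sq_form: "form_pol (sq_form u) (sq_form v) = (real_of_int (det2 u v))\<^sup>2"
  by (simp add: form_pol_def sq_form_def det2_def algebra_simps power2_eq_square)

lemma form_pol_self: "form_pol q q = 2 * form_disc q"
  by (cases q) (simp add: form_pol_def form_disc_def power2_eq_square)

lemma form_pol_weights:
  "form_pol (\<Sum>v\<in>T. w v *\<^sub>R sq_form v) (\<Sum>v\<in>T. w' v *\<^sub>R sq_form v) =
    (\<Sum>u\<in>T. \<Sum>v\<in>T. w u * w' v * (real_of_int (det2 u v))\<^sup>2)"
  unfolding form_pol_sum form_pol_scaleR form_pol_sq_form
  by (subst sum.swap) (simp add: sum_distrib_left mult.assoc mult.left_commute)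

text \<open>A reversed Cauchy-Schwarz inequality: the quadratic form \<open>(\<Sum>w)\<^sup>2 - 2 \<Sum>w\<^sup>2\<close> has signature
  \<open>(1, n)\<close>, computes the discriminant on unimodular systems and bounds its polarization from below
  because distinct primitive lines have determinant at least one.\<close>

lemma weights_unique_aux:
  fixes w w' :: "int ^ 2 \<Rightarrow> real"
  assumes T: "finite T" "\<And>v. v \<in> T \<Longrightarrow> - v \<in> T \<and> v \<noteq> - v"
    and nn: "\<And>v. 0 \<le> w v" "\<And>v. 0 \<le> w' v" and even: "\<And>v. w (- v) = w v" "\<And>v. w' (- v) = w' v"
    and prim: "\<And>u v. u \<in> T \<Longrightarrow> v \<in> T \<Longrightarrow> det2 u v = 0 \<Longrightarrow> u = v \<or> u = - v"
    and unim: "\<And>u v. u \<in> T \<Longrightarrow> v \<in> T \<Longrightarrow> 0 < w u \<Longrightarrow> 0 < w v \<Longrightarrow> \<bar>det2 u v\<bar> \<le> 1"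
      "\<And>u v. u \<in> T \<Longrightarrow> v \<in> T \<Longrightarrow> 0 < w' u \<Longrightarrow> 0 < w' v \<Longrightarrow> \<bar>det2 u v\<bar> \<le> 1"
    and q: "q = (\<Sum>v\<in>T. w v *\<^sub>R sq_form v)" "q = (\<Sum>v\<in>T. w' v *\<^sub>R sq_form v)" "0 < form_disc q"
    and le: "sum w' T \<le> sum w T"
  shows "\<forall>v\<in>T. w v = w' v"
proof -
  \<comment> \<open>The squared determinant that two vectors of a unimodular system must have: 0 on
    a common line, 1 otherwise.\<close>
  define \<kappa> where "\<kappa> u v = (1 - (if v = u then 1 else 0) - (if v = - u then 1 else 0) :: real)" for u v :: "int ^ 2"
  have \<kappa>_sum: "(\<Sum>u\<in>T. \<Sum>v\<in>T. f u * h v * \<kappa> u v) = sum f T * sum h T - 2 * (\<Sum>v\<in>T. f v * h v)"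
    if h: "\<And>v. h (- v) = h v" for f h :: "int ^ 2 \<Rightarrow> real"
  proof -
    have "(\<Sum>v\<in>T. f u * h v * \<kappa> u v) = f u * sum h T - 2 * (f u * h u)" if "u \<in> T" for u
    proof -
      have "(\<Sum>v\<in>T. f u * h v * \<kappa> u v) =
          (\<Sum>v\<in>T. f u * h v) - (\<Sum>v\<in>T. if v = u then f u * h v else 0) - (\<Sum>v\<in>T. if v = - u then f u * h v else 0)"
        unfolding sum_subtractf[symmetric] \<kappa>_def by (rule sum.cong) (simp_all add: right_diff_distrib h)
      moreover have "(\<Sum>v\<in>T. if v = u then f u * h v else 0) = f u * h u"
        using that by (subst sum.delta[OF T(1)]) auto
      moreover have "(\<Sum>v\<in>T. if v = - u then f u * h v else 0) = f u * h (- u)"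
        using T(2)[OF that] by (subst sum.delta[OF T(1)]) auto
      ultimately show ?thesis
        by (simp add: h sum_distrib_left)
    qed
    then have "(\<Sum>u\<in>T. \<Sum>v\<in>T. f u * h v * \<kappa> u v) = (\<Sum>u\<in>T. f u * sum h T - 2 * (f u * h u))"
      by (rule sum.cong[OF refl])
    then show ?thesis
      by (simp add: sum_subtractf sum_distrib_right[symmetric] sum_distrib_left[symmetric])
  qed
  have \<kappa>_le: "\<kappa> u v \<le> (real_of_int (det2 u v))\<^sup>2" if "u \<in> T" "v \<in> T" for u v
  proof (cases "det2 u v = 0")
    case True
    then have "v = u \<or> v = - u" using prim[OF that True] by auto
    then show ?thesis by (auto simp: \<kappa>_def)
  next
    case False
    then have "1 \<le> (det2 u v)\<^sup>2" by (simp add: int_one_le_iff_zero_less)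
    then have "1 \<le> (real_of_int (det2 u v))\<^sup>2"
      by (metis of_int_1_le_iff of_int_power)
    then show ?thesis by (simp add: \<kappa>_def)
  qed
  have \<kappa>_eq: "\<kappa> u v = (real_of_int (det2 u v))\<^sup>2" if "u \<in> T" "v \<in> T" "\<bar>det2 u v\<bar> \<le> 1" for u v
  proof (cases "det2 u v = 0")
    case True
    then have "v = u \<or> v = - u" using prim[OF that(1,2) True] by auto
    then show ?thesis using T(2)[OF that(1)] True by (auto simp: \<kappa>_def)
  next
    case False
    then have "\<bar>det2 u v\<bar> = 1" using that(3) by linarith
    then have "(det2 u v)\<^sup>2 = 1" by (simp add: abs_square_eq_1)
    then have "(real_of_int (det2 u v))\<^sup>2 = 1" by (metis of_int_1 of_int_power)
    moreover have "v \<noteq> u" "v \<noteq> - u" using False by auto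
    ultimately show ?thesis by (simp add: \<kappa>_def)
  qed
  have self: "2 * form_disc q = (sum f T)\<^sup>2 - 2 * (\<Sum>v\<in>T. (f v)\<^sup>2)"
    if "q = (\<Sum>v\<in>T. f v *\<^sub>R sq_form v)" "\<And>v. 0 \<le> f v" "\<And>v. f (- v) = f v"
      and un: "\<And>u v. u \<in> T \<Longrightarrow> v \<in> T \<Longrightarrow> 0 < f u \<Longrightarrow> 0 < f v \<Longrightarrow> \<bar>det2 u v\<bar> \<le> 1" for f
  proof -
    have "2 * form_disc q = (\<Sum>u\<in>T. \<Sum>v\<in>T. f u * f v * (real_of_int (det2 u v))\<^sup>2)"
      unfolding form_pol_self[symmetric] that(1) by (rule form_pol_weights)
    also have "\<dots> = (\<Sum>u\<in>T. \<Sum>v\<in>T. f u * f v * \<kappa> u v)"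
    proof (intro sum.cong refl)
      fix u v assume uv: "u \<in> T" "v \<in> T"
      show "f u * f v * (real_of_int (det2 u v))\<^sup>2 = f u * f v * \<kappa> u v"
      proof (cases "f u = 0 \<or> f v = 0")
        case False
        then have "0 < f u" "0 < f v" using that(2) by (simp_all add: less_le)
        then show ?thesis using \<kappa>_eq[OF uv un[OF uv]] by simp
      qed auto
    qed
    also have "\<dots> = (sum f T)\<^sup>2 - 2 * (\<Sum>v\<in>T. (f v)\<^sup>2)"
      unfolding \<kappa>_sum[of f f, OF that(3)] by (simp add: power2_eq_square)
    finally show ?thesis .
  qed
  define N N' where "N = sum w T" and "N' = sum w' T"
  define A B P where "A = (\<Sum>v\<in>T. (w v)\<^sup>2)" and "B = (\<Sum>v\<in>T. (w' v)\<^sup>2)" and "P = (\<Sum>v\<in>T. w v * w' v)"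
  have s1: "2 * form_disc q = N\<^sup>2 - 2 * A"
    using self[OF q(1) nn(1) even(1) unim(1)] by (simp add: N_def A_def)
  have s2: "2 * form_disc q = N'\<^sup>2 - 2 * B"
    using self[OF q(2) nn(2) even(2) unim(2)] by (simp add: N'_def B_def)
  \<comment> \<open>Two vectors of different systems may have a larger determinant, so the mixed sum
    yields an inequality only.\<close>
  have "N * N' - 2 * P = (\<Sum>u\<in>T. \<Sum>v\<in>T. w u * w' v * \<kappa> u v)"
    unfolding \<kappa>_sum[of w' w, OF even(2)] by (simp add: N_def N'_def P_def)
  also have "\<dots> \<le> (\<Sum>u\<in>T. \<Sum>v\<in>T. w u * w' v * (real_of_int (det2 u v))\<^sup>2)"
    using \<kappa>_le nn by (intro sum_mono mult_left_mono) auto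
  also have "\<dots> = 2 * form_disc q"
    unfolding form_pol_weights[symmetric] q(1,2)[symmetric] form_pol_self ..
  finally have s3: "N * N' - 2 * P \<le> 2 * form_disc q" .
  define D where "D = (\<Sum>v\<in>T. (w v - w' v)\<^sup>2)"
  define Q where "Q = (\<Sum>v\<in>T. (w v - w' v) * w' v)"
  have D: "D = A + B - 2 * P" and Q: "Q = P - B"
    unfolding D_def Q_def A_def B_def P_def
    by (simp_all add: power2_diff sum.distrib sum_subtractf algebra_simps sum_distrib_left power2_eq_square)
  have d1: "2 * D \<le> (N - N')\<^sup>2"
    using s1 s2 s3 by (simp add: D power2_diff)
  have d2: "(N - N') * N' \<le> 2 * Q"
    using s2 s3 by (simp add: Q algebra_simps power2_eq_square)
  have CS: "Q\<^sup>2 \<le> D * B"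
    unfolding Q_def D_def B_def by (rule Cauchy_Schwarz_ineq_sum)
  have N': "0 \<le> N'" unfolding N'_def using nn by (intro sum_nonneg) auto
  have B: "0 \<le> B" unfolding B_def by (intro sum_nonneg) auto
  \<comment> \<open>If \<open>N\<close> exceeded \<open>N'\<close>, then \<open>d2\<close>,
    Cauchy-Schwarz and \<open>d1\<close> would give \<open>N'^2 \<le> 2 * B\<close>, against the
    positive value \<open>N'^2 - 2 * B\<close> of twice the determinant. Once the totals agree,
    \<open>d1\<close> leaves no room for \<open>D\<close>.\<close>
  have "N = N'"
  proof (rule ccontr)
    assume "N \<noteq> N'"
    then have pos: "0 < N - N'" using le by (simp add: N_def N'_def)
    have "((N - N') * N')\<^sup>2 \<le> (2 * Q)\<^sup>2"
      using d2 pos N' by (intro power_mono) auto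
    also have "\<dots> \<le> (2 * D) * (2 * B)" using CS by (simp add: power_mult_distrib)
    also have "\<dots> \<le> (N - N')\<^sup>2 * (2 * B)" using d1 B by (intro mult_right_mono) auto
    finally have "N'\<^sup>2 \<le> 2 * B" using pos by (simp add: power_mult_distrib)
    then show False using s2 q(3) by simp
  qed
  then have "D \<le> 0" using d1 by simp
  then have "D = 0" unfolding D_def by (meson antisym sum_nonneg zero_le_power2)
  then show ?thesis
    unfolding D_def using T(1) by (subst (asm) sum_nonneg_eq_0_iff) auto
qed

text \<open>The two systems play symmetric roles, so their totals may be assumed to be
  ordered.\<close>

lemma weights_unique:
  fixes w w' :: "int ^ 2 \<Rightarrow> real"
  assumes T: "finite T" "\<And>v. v \<in> T \<Longrightarrow> - v \<in> T \<and> v \<noteq> - v"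
    and nn: "\<And>v. 0 \<le> w v" "\<And>v. 0 \<le> w' v" and even: "\<And>v. w (- v) = w v" "\<And>v. w' (- v) = w' v"
    and prim: "\<And>u v. u \<in> T \<Longrightarrow> v \<in> T \<Longrightarrow> det2 u v = 0 \<Longrightarrow> u = v \<or> u = - v"
    and unim: "\<And>u v. u \<in> T \<Longrightarrow> v \<in> T \<Longrightarrow> 0 < w u \<Longrightarrow> 0 < w v \<Longrightarrow> \<bar>det2 u v\<bar> \<le> 1"
      "\<And>u v. u \<in> T \<Longrightarrow> v \<in> T \<Longrightarrow> 0 < w' u \<Longrightarrow> 0 < w' v \<Longrightarrow> \<bar>det2 u v\<bar> \<le> 1"
    and q: "q = (\<Sum>v\<in>T. w v *\<^sub>R sq_form v)" "q = (\<Sum>v\<in>T. w' v *\<^sub>R sq_form v)" "0 < form_disc q"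
    and v: "v \<in> T"
  shows "w v = w' v"
proof (cases "sum w' T \<le> sum w T")
  case True
  show ?thesis
    using weights_unique_aux[OF T nn even prim unim q True] v by blast
next
  case False
  then have "sum w T \<le> sum w' T" by simp
  have "\<forall>v\<in>T. w' v = w v"
    by (rule weights_unique_aux[OF T nn(2,1) even(2,1) prim unim(2,1) q(2,1,3)])
      (use False in \<open>(assumption | simp)+\<close>)
  then show ?thesis
    using v by (intro sym[of "w' v"]) (rule bspec)
qed

section \<open>Reduction of forms\<close>

text \<open>Equivalently, among the three weights \<open>a - b\<close>, \<open>c - b\<close> and
  \<open>b\<close> the last is smallest and nonnegative.\<close>

definition reduced :: "form set" where
  "reduced = {(a, b, c). 0 \<le> b \<and> 2 * b \<le> a \<and> 2 * b \<le> c}"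

text \<open>The definite forms whose weights live on the superbase \<open>tri_set g\<close>, with a
  smallest one on the vector \<open>g *v E12\<close>.\<close>

definition tile :: "int ^ 2 ^ 2 \<Rightarrow> form set" where
  "tile g = {q \<in> pos_forms. act (matrix_inv g) q \<in> reduced}"

text \<open>A reduced form \<open>(a, b, c)\<close> is the combination of the squares of \<open>E1\<close>, \<open>E2\<close> and \<open>E12\<close> with
  the weights \<open>a - b\<close>, \<open>c - b\<close> and \<open>b\<close>; its slope is the quotient of the two smallest weights.\<close>

definition slope :: "int ^ 2 ^ 2 \<Rightarrow> form \<Rightarrow> real" where
  "slope g q = (case act (matrix_inv g) q of (a, b, c) \<Rightarrow> b / (min a c - b))"

text \<open>The weights are extended by zero to all lattice vectors, so that those obtained from
  different reductions can be compared.\<close>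

definition tile_weight :: "int ^ 2 ^ 2 \<Rightarrow> form \<Rightarrow> int ^ 2 \<Rightarrow> real" where
  "tile_weight g q v = (case act (matrix_inv g) q of (a, b, c) \<Rightarrow>
     let u = matrix_inv g *v v in
       if u \<in> {E1, - E1} then a - b else if u \<in> {E2, - E2} then c - b else if u \<in> {E12, - E12} then b else 0)"

lemma tile_coords:
  assumes "invertible g" "q \<in> tile g"
  obtains a b c where "act (matrix_inv g) q = (a, b, c)" "q = act g (a, b, c)" "0 \<le> b" "b < a" "b < c" "2 * b \<le> a" "2 * b \<le> c"
    "slope g q = b / (min a c - b)"
proof -
  obtain a b c where abc: "act (matrix_inv g) q = (a, b, c)" by (metis surj_pair)
  have r: "0 \<le> b" "2 * b \<le> a" "2 * b \<le> c" using assms(2) abc by (auto simp: tile_def reduced_def)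
  have "(a, b, c) \<in> pos_forms"
    using act_pos_forms[OF invertible_matrix_inv[OF assms(1)], of q] assms(2) abc by (auto simp: tile_def)
  then have "0 < a" "0 < c" using pos_formsD by blast+
  moreover have "q = act g (a, b, c)"
    unfolding abc[symmetric] using assms(1) by simp
  ultimately show thesis
    using abc r that[of a b c] by (auto simp: slope_def)
qed

lemma slope_bounds:
  assumes "invertible g" "q \<in> tile g"
  shows "0 \<le> slope g q" "slope g q \<le> 1"
proof -
  obtain a b c where "0 \<le> b" "b < a" "b < c" "2 * b \<le> a" "2 * b \<le> c" "slope g q = b / (min a c - b)"
    using tile_coords[OF assms] by metis
  then show "0 \<le> slope g q" "slope g q \<le> 1" by (auto simp: divide_le_eq min_def)
qed

lemma tile_act:
  assumes "invertible g" "invertible h" "q \<in> pos_forms"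
  shows "act h q \<in> tile (h ** g) \<longleftrightarrow> q \<in> tile g" "slope (h ** g) (act h q) = slope g q"
  using assms act_pos_forms[of h q] act_pos_forms[of "matrix_inv h" "act h q"]
  by (auto simp: tile_def slope_def matrix_inv_mult act_mult invertible_matrix_inv)

text \<open>Take a form of least trace in the orbit. Adding a basis vector to the other one, or
  subtracting it, does not lower the trace, which bounds \<open>2 * \<bar>b\<bar>\<close> by
  \<open>a\<close> and by \<open>c\<close>; a reflection then makes \<open>b\<close>
  nonnegative.\<close>

lemma tile_exists:
  assumes q: "q \<in> pos_forms"
  obtains g where "invertible g" "q \<in> tile g"
proof -
  let ?S = "{h. invertible h \<and> form_trace (act h q) \<le> form_trace q}"
  have fin: "finite ?S"
    by (rule finite_subset[OF _ finite_form_trace_act_bounded[OF q, of "form_trace q"]]) auto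
  have "mat 1 \<in> ?S" by (simp add: invertible_mat_1)
  then obtain h where h: "h \<in> ?S" and min: "\<And>k. k \<in> ?S \<Longrightarrow> form_trace (act h q) \<le> form_trace (act k q)"
    using ex_is_arg_min_if_finite[OF fin, of "\<lambda>h. form_trace (act h q)"] unfolding is_arg_min_linorder by blast
  then have inv: "invertible h" by simp
  have min: "form_trace (act h q) \<le> form_trace (act (k ** h) q)" if "invertible k" for k
    using min[of "k ** h"] h invertible_mult[OF that inv] by force
  obtain a b c where abc: "act h q = (a, b, c)" by (metis surj_pair)
  have "form_trace (a, b, c) \<le> form_trace (act (mat2 1 (-1) 0 1) (a, b, c))"
    "form_trace (a, b, c) \<le> form_trace (act (mat2 1 1 0 1) (a, b, c))"
    "form_trace (a, b, c) \<le> form_trace (act (mat2 1 0 (-1) 1) (a, b, c))"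
    "form_trace (a, b, c) \<le> form_trace (act (mat2 1 0 1 1) (a, b, c))"
    using min[unfolded act_mult abc] by (simp_all add: invertible_int_iff det_2)
  then have ineq: "2 * \<bar>b\<bar> \<le> a" "2 * \<bar>b\<bar> \<le> c"
    by (auto simp: act_def form_trace_def)
  define k where "k = (if 0 \<le> b then mat 1 else mat2 1 0 0 (-1))"
  have k: "invertible k" by (simp add: k_def invertible_int_iff det_2 mat_def)
  have "act k (a, b, c) \<in> reduced"
    using ineq by (auto simp: k_def reduced_def act_def mat_def)
  then have "act (k ** h) q \<in> reduced" by (simp add: act_mult abc)
  moreover have inv': "invertible (k ** h)" by (rule invertible_mult[OF k inv])
  ultimately show thesis
    using that[of "matrix_inv (k ** h)"] q by (simp add: tile_def matrix_inv_inv invertible_matrix_inv)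
qed

lemma tile_weight_image:
  assumes "invertible g" "act (matrix_inv g) q = (a, b, c)"
  shows "tile_weight g q (g *v u) =
    (if u \<in> {E1, - E1} then a - b else if u \<in> {E2, - E2} then c - b else if u \<in> {E12, - E12} then b else 0)"
  using assms by (simp add: tile_weight_def matrix_inv_vector)

lemma in_image_matrix_iff:
  fixes g :: "'a::comm_ring_1 ^ 'n ^ 'n"
  assumes "invertible g"
  shows "v \<in> (*v) g ` S \<longleftrightarrow> matrix_inv g *v v \<in> S"
proof
  assume "matrix_inv g *v v \<in> S"
  then have "g *v (matrix_inv g *v v) \<in> (*v) g ` S" by (rule imageI)
  then show "v \<in> (*v) g ` S" by (simp only: matrix_inv_vector(2)[OF assms])
qed (auto simp: matrix_inv_vector(1)[OF assms])

lemma in_tri_set_iff: "invertible g \<Longrightarrow> v \<in> tri_set g \<longleftrightarrow> matrix_inv g *v v \<in> {E1, - E1, E2, - E2, E12, - E12}"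
  and in_edge_set_iff: "invertible g \<Longrightarrow> v \<in> edge_set g \<longleftrightarrow> matrix_inv g *v v \<in> {E1, - E1, E2, - E2}"
  unfolding tri_set_def edge_set_def by (simp_all only: in_image_matrix_iff)

lemma tile_weight_uminus: "tile_weight g q (- v) = tile_weight g q v"
proof -
  have "- u \<in> {e, - e} \<longleftrightarrow> u \<in> {e, - e}" for u e :: "int ^ 2"
    by (metis empty_iff insert_iff minus_minus)
  then show ?thesis
    unfolding tile_weight_def matrix_vector_uminus Let_def by presburger
qed

lemma tile_weight_nonneg:
  assumes "invertible g" "q \<in> tile g"
  shows "0 \<le> tile_weight g q v"
proof -
  obtain a b c where "act (matrix_inv g) q = (a, b, c)" "0 \<le> b" "b < a" "b < c"
    using tile_coords[OF assms] by metis
  then show ?thesis by (simp add: tile_weight_def Let_def)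
qed

lemma tile_weight_outside: "invertible g \<Longrightarrow> v \<notin> tri_set g \<Longrightarrow> tile_weight g q v = 0"
  by (cases "act (matrix_inv g) q") (auto simp: tile_weight_def in_tri_set_iff Let_def)

lemma sum_tri_set:
  fixes f :: "int ^ 2 \<Rightarrow> 'a::comm_monoid_add"
  assumes "invertible g"
  shows "(\<Sum>v\<in>tri_set g. f v) = f (g *v E1) + (f (g *v - E1) + (f (g *v E2) + (f (g *v - E2) + (f (g *v E12) + f (g *v - E12)))))"
  unfolding tri_set_def
  by (subst sum.reindex[OF inj_on_subset[OF inj_invertible[OF assms] subset_UNIV]]) (simp add: vec2_eq_iff)

text \<open>Each line is counted twice, through \<open>v\<close> and \<open>- v\<close>; hence the
  factor 2.\<close>

lemma sum_tile_weight:
  assumes "invertible g" "q \<in> tile g"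
  shows "(\<Sum>v\<in>tri_set g. tile_weight g q v *\<^sub>R sq_form v) = 2 *\<^sub>R q"
proof -
  obtain a b c where abc: "act (matrix_inv g) q = (a, b, c)" "q = act g (a, b, c)"
    using tile_coords[OF assms] by metis
  have "(\<Sum>v\<in>tri_set g. tile_weight g q v *\<^sub>R sq_form v) =
      act g ((a - b) *\<^sub>R sq_form E1 + (a - b) *\<^sub>R sq_form (- E1) + (c - b) *\<^sub>R sq_form E2 + (c - b) *\<^sub>R sq_form (- E2) +
        b *\<^sub>R sq_form E12 + b *\<^sub>R sq_form (- E12))"
    unfolding sum_tri_set[OF assms(1)] tile_weight_image[OF assms(1) abc(1)]
    by (simp add: vec2_eq_iff act_add act_scaleR act_sq_form add.assoc)
  also have "(a - b) *\<^sub>R sq_form E1 + (a - b) *\<^sub>R sq_form (- E1) + (c - b) *\<^sub>R sq_form E2 + (c - b) *\<^sub>R sq_form (- E2) +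
        b *\<^sub>R sq_form E12 + b *\<^sub>R sq_form (- E12) = 2 *\<^sub>R (a, b, c)"
    by (simp add: sq_form_def)
  finally show ?thesis unfolding act_scaleR abc(2)[symmetric] .
qed

text \<open>On the union of the two superbases both weight functions represent
  \<open>2 *\<^sub>R q\<close>. Each is supported in a single superbase, which is all the
  unimodularity that \<open>weights_unique\<close> asks for.\<close>

lemma tile_weight_unique:
  assumes g: "invertible g" "q \<in> tile g" and h: "invertible h" "q \<in> tile h"
  shows "tile_weight g q = tile_weight h q"
proof
  fix v
  let ?T = "tri_set g \<union> tri_set h"
  have sum: "(\<Sum>v\<in>?T. tile_weight k q v *\<^sub>R sq_form v) = 2 *\<^sub>R q"
    if "invertible k" "q \<in> tile k" "tri_set k \<subseteq> ?T" for k
  proof -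
    have "(\<Sum>v\<in>?T. tile_weight k q v *\<^sub>R sq_form v) = (\<Sum>v\<in>tri_set k. tile_weight k q v *\<^sub>R sq_form v)"
      by (rule sum.mono_neutral_right) (use that tile_weight_outside[OF that(1)] finite_tri_set in auto)
    then show ?thesis using sum_tile_weight[OF that(1,2)] by simp
  qed
  have supp: "u \<in> tri_set k" if "invertible k" "0 < tile_weight k q u" for k u
    using tile_weight_outside[OF that(1), of u q] that(2) by (metis less_irrefl)
  show "tile_weight g q v = tile_weight h q v"
  proof (cases "v \<in> ?T")
    case True
    show ?thesis
    proof (rule weights_unique[of ?T])
      show "finite ?T" by (simp add: finite_tri_set)
      show "- v \<in> ?T \<and> v \<noteq> - v" if "v \<in> ?T" for v
      proof -
        have "v \<noteq> 0" using that tri_set_nonzero[OF g(1)] tri_set_nonzero[OF h(1)] by auto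
        then have "v \<noteq> - v" by (rule not_self_opposite)
        moreover have "- v \<in> ?T" using that uminus_tri_set by blast
        ultimately show ?thesis by simp
      qed
      show "u = v \<or> u = - v" if uv: "u \<in> ?T" "v \<in> ?T" "det2 u v = 0" for u v
      proof -
        have "\<exists>x. \<bar>det2 w x\<bar> = 1" if "w \<in> ?T" for w
          using that tri_set_completes[OF g(1)] tri_set_completes[OF h(1)] by (metis Un_iff)
        then show ?thesis using parallel_primitive uv by metis
      qed
      show "\<bar>det2 u v\<bar> \<le> 1" if "0 < tile_weight g q u" "0 < tile_weight g q v" for u v
        using abs_det2_tri_set[OF g(1)] supp[OF g(1)] that by blast
      show "\<bar>det2 u v\<bar> \<le> 1" if "0 < tile_weight h q u" "0 < tile_weight h q v" for u v
        using abs_det2_tri_set[OF h(1)] supp[OF h(1)] that by blast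
      show "2 *\<^sub>R q = (\<Sum>v\<in>?T. tile_weight g q v *\<^sub>R sq_form v)"
        "2 *\<^sub>R q = (\<Sum>v\<in>?T. tile_weight h q v *\<^sub>R sq_form v)"
        using sum[OF g] sum[OF h] by auto
      have "q \<in> pos_forms" using g(2) by (simp add: tile_def)
      then have "0 < form_disc q" by (rule form_disc_pos)
      then show "0 < form_disc (2 *\<^sub>R q)"
        by (cases q) (simp add: form_disc_def power_mult_distrib)
      show "v \<in> ?T" by (rule True)
    qed (simp_all add: tile_weight_nonneg[OF g] tile_weight_nonneg[OF h] tile_weight_uminus)
  next
    case False
    then show ?thesis using tile_weight_outside g(1) h(1) by simp
  qed
qed

text \<open>If \<open>b\<close> is positive, the support of the weights is the whole superbase, so
  the common weight function recovers it together with the values. The claims are one-sided;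
  exchanging \<open>g\<close> and \<open>h\<close> turns them into equalities.\<close>

lemma tile_unique_aux:
  assumes g: "invertible g" "q \<in> tile g" and h: "invertible h" "q \<in> tile h"
    and b: "act (matrix_inv g) q = (a, b, c)" "0 < b" and b': "act (matrix_inv h) q = (a', b', c')"
  shows "tri_set g \<subseteq> tri_set h" "b' \<le> b" "max a c \<le> max a' c' + (b - b')" "a + c - b = a' + c' - b' \<or> tri_set g \<noteq> tri_set h"
proof -
  have w: "tile_weight g q = tile_weight h q" by (rule tile_weight_unique[OF g h])
  have ac: "0 \<le> b" "b < a" "b < c" using tile_coords[OF g] b(1) by (metis prod.inject)+
  have ac': "0 \<le> b'" "b' < a'" "b' < c'" "2 * b' \<le> a'" "2 * b' \<le> c'" using tile_coords[OF h] b' by (metis prod.inject)+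
  have pos: "0 < tile_weight g q v" if "v \<in> tri_set g" for v
    using that ac b tile_weight_image[OF g(1) b(1)] by (auto simp: tri_set_def)
  then show sub: "tri_set g \<subseteq> tri_set h"
    using tile_weight_outside[OF h(1)] w by (metis less_irrefl subsetI)
  have vals: "tile_weight h q v \<in> {a' - b', c' - b', b'}" if "v \<in> tri_set h" for v
    using that tile_weight_image[OF h(1) b'] by (auto simp: tri_set_def)
  have vec: "E12 \<notin> {E1, - E1}" "E12 \<notin> {E2, - E2}" "E2 \<notin> {E1, - E1}" by (auto simp: vec2_eq_iff)
  have "tile_weight g q (g *v E12) = b"
    using tile_weight_image[OF g(1) b(1), of E12] vec by simp
  moreover have "g *v E12 \<in> tri_set h" using sub by (auto simp: tri_set_def)
  ultimately show "b' \<le> b" using vals[of "g *v E12"] w ac' by auto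
  have "tile_weight g q (g *v E1) = a - b" "tile_weight g q (g *v E2) = c - b"
    using tile_weight_image[OF g(1) b(1)] vec by simp_all
  moreover have "g *v E1 \<in> tri_set h" "g *v E2 \<in> tri_set h" using sub by (auto simp: tri_set_def)
  ultimately have "a - b \<in> {a' - b', c' - b', b'}" "c - b \<in> {a' - b', c' - b', b'}"
    using vals w by metis+
  then show "max a c \<le> max a' c' + (b - b')" using ac' by auto
  have tot: "(\<Sum>v\<in>tri_set k. tile_weight k q v) = 2 * (x + z - y)"
    if "invertible k" "act (matrix_inv k) q = (x, y, z)" for k x y z
    unfolding sum_tri_set[OF that(1)] tile_weight_image[OF that] by (simp add: vec2_eq_iff)
  show "a + c - b = a' + c' - b' \<or> tri_set g \<noteq> tri_set h"
    using tot[OF g(1) b(1)] tot[OF h(1) b'] w by auto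
qed

lemma tile_unique_pos:
  assumes g: "invertible g" "q \<in> tile g" and h: "invertible h" "q \<in> tile h" and s: "0 < slope g q"
  shows "tri_set g = tri_set h" "slope g q = slope h q" "slope g q < 1 \<Longrightarrow> edge_set g = edge_set h"
proof -
  obtain a b c where b: "act (matrix_inv g) q = (a, b, c)" "0 \<le> b" "b < a" "b < c" "slope g q = b / (min a c - b)"
    using tile_coords[OF g] by metis
  obtain a' b' c' where b': "act (matrix_inv h) q = (a', b', c')" "0 \<le> b'" "b' < a'" "b' < c'" "slope h q = b' / (min a' c' - b')"
    using tile_coords[OF h] by metis
  have "b > 0" using s b(2,5) by (cases "b = 0") auto
  note 1 = tile_unique_aux[OF g h b(1) this b'(1)]
  show tri: "tri_set g = tri_set h"
    by (rule card_subset_eq[OF finite_tri_set 1(1)]) (simp add: card_tri_set g h)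
  have w: "tile_weight g q = tile_weight h q" by (rule tile_weight_unique[OF g h])
  \<comment> \<open>Otherwise \<open>h *v E12\<close> would have weight zero, although it lies in
    the superbase of \<open>g\<close>, where all weights are positive.\<close>
  have "0 < b'"
  proof (rule ccontr)
    assume "\<not> 0 < b'"
    then have "b' = 0" using b' by simp
    then have "tile_weight h q (h *v E12) = 0"
      using tile_weight_image[OF h(1) b'(1), of E12] by (auto simp: vec2_eq_iff)
    moreover have "h *v E12 \<in> tri_set g" unfolding tri by (simp add: tri_set_def)
    then have "0 < tile_weight g q (h *v E12)"
      using \<open>0 < b\<close> b tile_weight_image[OF g(1) b(1)] by (auto simp: tri_set_def)
    ultimately show False using w by simp
  qed
  note 2 = tile_unique_aux[OF h g b'(1) this b(1)]
  have bb: "b = b'" using 1 2 by simp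
  have "max a c = max a' c'" using 1(3) 2(3) bb by linarith
  moreover have "a + c = a' + c'" using 1(4) tri bb by simp
  ultimately have mm: "min a c = min a' c'" by (auto simp: min_def max_def split: if_splits)
  then show "slope g q = slope h q" using b b' bb by simp
  assume "slope g q < 1"
  then have lt: "b < min a c - b" using b by (auto simp: divide_less_eq min_def split: if_splits)
  \<comment> \<open>If the smallest weight is attained on one line only, the basis consists of the
    vectors of the superbase that carry more than it.\<close>
  have edge: "edge_set k = {v \<in> tri_set k. y < tile_weight k q v}"
    if "invertible k" "act (matrix_inv k) q = (x, y, z)" "y < min x z - y" for k x y z
    using that by (auto simp: in_edge_set_iff in_tri_set_iff tile_weight_def Let_def)
  show "edge_set g = edge_set h"
    using edge[OF g(1) b(1) lt] edge[OF h(1) b'(1)] lt mm bb w tri by simp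
qed

text \<open>At slope zero the weight on \<open>g *v E12\<close> vanishes, and the basis is the
  support of the weights.\<close>

lemma tile_unique_zero:
  assumes g: "invertible g" "q \<in> tile g" and h: "invertible h" "q \<in> tile h" and s: "slope g q = 0" "slope h q = 0"
  shows "edge_set g = edge_set h"
proof -
  have "edge_set k = {v. 0 < tile_weight k q v}" if k: "invertible k" "q \<in> tile k" "slope k q = 0" for k
  proof -
    obtain a b c where b: "act (matrix_inv k) q = (a, b, c)" "0 \<le> b" "b < a" "b < c" "slope k q = b / (min a c - b)"
      using tile_coords[OF k(1,2)] by metis
    then have "b = 0" using k(3) by (auto simp: min_def split: if_splits)
    then show ?thesis using b k(1) by (auto simp: in_edge_set_iff tile_weight_def Let_def)
  qed
  then show ?thesis using assms tile_weight_unique[OF g h] by simp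
qed

text \<open>At slope 1 the basis and at slope 0 the superbase may depend on the reduction. Precisely
  there the corresponding vertex has coordinate zero, so the point on the edge is still well
  defined.\<close>

theorem tile_unique:
  assumes g: "invertible g" "q \<in> tile g" and h: "invertible h" "q \<in> tile h"
  shows "slope g q = slope h q" "slope g q < 1 \<Longrightarrow> edge_set g = edge_set h" "0 < slope g q \<Longrightarrow> tri_set g = tri_set h"
proof -
  note nn = slope_bounds(1)[OF g] slope_bounds(1)[OF h]
  show eq: "slope g q = slope h q"
  proof (cases "0 < slope g q")
    case True
    then show ?thesis by (rule tile_unique_pos(2)[OF g h])
  next
    case g0: False
    show ?thesis
    proof (cases "0 < slope h q")
      case True
      then show ?thesis using tile_unique_pos(2)[OF h g] by simp
    next
      case False
      then show ?thesis using g0 nn by simp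
    qed
  qed
  show "edge_set g = edge_set h" if "slope g q < 1"
  proof (cases "0 < slope g q")
    case True
    then show ?thesis using tile_unique_pos(3)[OF g h] that by simp
  next
    case False
    then show ?thesis using tile_unique_zero[OF g h] nn eq by simp
  qed
  show "tri_set g = tri_set h" if "0 < slope g q"
    by (rule tile_unique_pos(1)[OF g h that])
qed

text \<open>Where the trace is bounded above and the determinant bounded away from zero, a matrix
  that reduces the form has bounded entries, because the reduced form has at most twice the trace of
  the form.\<close>

lemma tiles_locally_finite:
  assumes q: "q \<in> pos_forms"
  obtains V where "open V" "q \<in> V" "finite {g. invertible g \<and> tile g \<inter> V \<noteq> {}}"
proof -
  define V where "V = {p. form_trace p < form_trace q + 1 \<and> form_disc q / 2 < form_disc p}"
  \<comment> \<open>For \<open>p\<close> in \<open>V\<close> and an entry \<open>x\<close> of the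
    reducing matrix, \<open>form_disc q / 2 * x^2\<close> is at most
    \<open>2 * (form_trace p)^2\<close>, which is at most
    \<open>2 * (form_trace q + 1)^2\<close>.\<close>
  define N where "N = 4 * (form_trace q + 1)\<^sup>2 / form_disc q"
  have cont: "continuous_on UNIV form_trace" "continuous_on UNIV form_disc"
    unfolding form_trace_def form_disc_def case_prod_unfold by (intro continuous_intros)+
  have "open V"
    unfolding V_def by (intro open_Collect_conj open_Collect_less continuous_intros cont)
  moreover have "q \<in> V" using form_disc_pos[OF q] by (simp add: V_def)
  moreover have "finite {g. invertible g \<and> tile g \<inter> V \<noteq> {}}"
  proof -
    have bound: "\<bar>matrix_inv g $ i $ j\<bar> \<le> \<lceil>N\<rceil>" if g: "invertible g" and p: "p \<in> tile g" "p \<in> V" for g p i j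
    proof -
      let ?h = "matrix_inv g"
      obtain a b c where b: "act ?h p = (a, b, c)" "p = act g (a, b, c)" "0 \<le> b" "b < a" "b < c" "2 * b \<le> a" "2 * b \<le> c"
        using tile_coords[OF g p(1)] by metis
      let ?S = "\<lambda>v. (real_of_int (v$1))\<^sup>2 + (real_of_int (v$2))\<^sup>2"
      \<comment> \<open>The trace is the weighted sum of the squared lengths of the three vectors.
        Nonzero lattice vectors have length at least one, so \<open>a + c - b\<close> is at most the
        trace of \<open>p\<close>, and \<open>a + c\<close> is at most twice that since
        \<open>2 * b\<close> is at most \<open>a\<close> and \<open>c\<close>.\<close>
      have fp: "form_trace p = (a - b) * ?S (g *v E1) + (c - b) * ?S (g *v E2) + b * ?S (g *v E12)"
        unfolding b(2) form_trace_def act_def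
        by (simp add: Let_def matrix_vector_mult_2 algebra_simps power2_eq_square)
      have S: "1 \<le> ?S (g *v v)" if "v \<in> {E1, E2, E12}" for v
      proof -
        have "g *v v \<noteq> 0"
          using tri_set_nonzero[OF g] that by (force simp: tri_set_def)
        then have "0 < ((g *v v)$1)\<^sup>2 + ((g *v v)$2)\<^sup>2"
          by (auto simp: vec2_eq_iff sum_power2_gt_zero_iff)
        then have "1 \<le> ((g *v v)$1)\<^sup>2 + ((g *v v)$2)\<^sup>2" by simp
        then show ?thesis by (metis of_int_1_le_iff of_int_add of_int_power)
      qed
      have "(a - b) * 1 + (c - b) * 1 + b * 1 \<le> form_trace p"
        unfolding fp by (intro add_mono mult_left_mono S; use b in simp)
      moreover have "form_trace (act ?h p) = a + c" by (simp add: b(1) form_trace_def)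
      ultimately have t2: "form_trace (act ?h p) \<le> 2 * form_trace p"
        using b(3,6,7) by (simp add: algebra_simps)
      moreover have pp: "p \<in> pos_forms" using p(1) by (simp add: tile_def)
      note tp = form_trace_pos[OF this]
      have "form_disc p * (real_of_int (?h$i$j))\<^sup>2 \<le> form_trace p * form_trace (act ?h p)"
        by (rule form_trace_act_lower_bound[OF pp])
      ultimately have "form_disc p * (real_of_int (?h$i$j))\<^sup>2 \<le> form_trace p * (2 * form_trace p)"
        using tp by (meson mult_left_mono less_imp_le order_trans)
      also have "\<dots> \<le> 2 * (form_trace q + 1)\<^sup>2"
        using p(2) tp power_mono[of "form_trace p" "form_trace q + 1" 2] by (simp add: V_def power2_eq_square)
      finally have "form_disc p * (real_of_int (?h$i$j))\<^sup>2 \<le> 2 * (form_trace q + 1)\<^sup>2" .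
      moreover have "form_disc q / 2 * (real_of_int (?h$i$j))\<^sup>2 \<le> form_disc p * (real_of_int (?h$i$j))\<^sup>2"
        using p(2) by (intro mult_right_mono) (auto simp: V_def)
      ultimately have "(real_of_int (?h$i$j))\<^sup>2 \<le> N"
        using form_disc_pos[OF q] by (simp add: N_def field_simps)
      moreover have "real_of_int \<bar>?h$i$j\<bar> \<le> real_of_int ((?h$i$j)\<^sup>2)"
        using abs_le_square_int[of "?h$i$j"] by (simp only: of_int_le_iff)
      ultimately have "real_of_int \<bar>?h$i$j\<bar> \<le> N" by simp
      then show ?thesis by linarith
    qed
    have "{g. invertible g \<and> tile g \<inter> V \<noteq> {}} \<subseteq> matrix_inv ` {A. \<forall>i j. \<bar>A$i$j\<bar> \<le> \<lceil>N\<rceil>}"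
    proof
      fix g assume g: "g \<in> {g. invertible g \<and> tile g \<inter> V \<noteq> {}}"
      then have "\<forall>i j. \<bar>matrix_inv g $ i $ j\<bar> \<le> \<lceil>N\<rceil>" using bound by blast
      moreover have "g = matrix_inv (matrix_inv g)" using g by (simp add: matrix_inv_inv)
      ultimately show "g \<in> matrix_inv ` {A. \<forall>i j. \<bar>A$i$j\<bar> \<le> \<lceil>N\<rceil>}" by blast
    qed
    then show ?thesis
      by (rule finite_subset) (intro finite_imageI finite_bounded_matrices)
  qed
  ultimately show thesis by (rule that)
qed

lemma continuous_on_act: "continuous_on S (act g)"
  unfolding act_def Let_def case_prod_unfold by (intro continuous_intros)

lemma closedin_tile: "closedin (top_of_set pos_forms) (tile g)"
proof -
  have "closed reduced"
    unfolding reduced_def case_prod_unfold by (intro closed_Collect_conj closed_Collect_le continuous_intros)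
  then have "closedin (top_of_set pos_forms) (pos_forms \<inter> act (matrix_inv g) -` reduced)"
    by (intro continuous_closedin_preimage continuous_on_act)
  also have "pos_forms \<inter> act (matrix_inv g) -` reduced = tile g" by (auto simp: tile_def)
  finally show ?thesis .
qed

lemma continuous_on_slope:
  assumes "invertible g"
  shows "continuous_on (tile g) (slope g)"
proof -
  have "min (fst (act (matrix_inv g) q)) (snd (snd (act (matrix_inv g) q))) - fst (snd (act (matrix_inv g) q)) \<noteq> 0"
    if "q \<in> tile g" for q
    using tile_coords[OF assms that] by (metis diff_gt_0_iff_gt fst_conv less_irrefl min_less_iff_conj snd_conv)
  then show ?thesis
    unfolding slope_def case_prod_unfold
    by (intro continuous_intros continuous_on_act) auto
qed

section \<open>The poset in rank two\<close>

lemma group_closure_smult: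
  fixes u :: "int ^ 'n"
  assumes "u \<in> group_closure S"
  shows "k *s u \<in> group_closure S"
proof -
  have nat: "int n *s u \<in> group_closure S" for n
  proof (induction n)
    case (Suc n)
    have "int (Suc n) *s u = int n *s u + u" by (simp add: vec_eq_iff algebra_simps)
    then show ?case using group_closure_add[OF Suc assms] by (simp only:)
  qed simp
  show ?thesis
  proof (cases "0 \<le> k")
    case True
    then show ?thesis using nat[of "nat k"] by simp
  next
    case False
    then have "k *s u = - (int (nat (- k)) *s u)" by (simp add: vec_eq_iff)
    then show ?thesis using nat[of "nat (- k)"] by (simp only: group_closure_minus_iff)
  qed
qed

lemma group_closure_pair:
  assumes "x \<in> group_closure {u, v :: int ^ 'n}"
  shows "\<exists>m n. x = m *s u + n *s v"
  using assms
proof (induction rule: group_closure.induct)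
  case (base s)
  have "0 = 0 *s u + 0 *s v" "u = 1 *s u + 0 *s v" "v = 0 *s u + 1 *s v" by simp_all
  then show ?case using base by (metis insertE singletonD)
next
  case (diff s t)
  then obtain m n m' n' where "s = m *s u + n *s v" "t = m' *s u + n' *s v" by blast
  then have "s - t = (m - m') *s u + (n - n') *s v" by (simp add: vec_eq_iff algebra_simps)
  then show ?case by blast
qed

lemma group_closure_mono: "S \<subseteq> T \<Longrightarrow> group_closure S \<subseteq> group_closure T"
proof
  fix x assume "S \<subseteq> T" "x \<in> group_closure S"
  then show "x \<in> group_closure T"
    by (induction rule: group_closure.induct[OF \<open>x \<in> group_closure S\<close>]) (auto intro: group_closure.intros)
qed

text \<open>Expressing the standard basis in terms of \<open>u\<close> and \<open>v\<close> shows
  that their determinant divides 1. Conversely Cramer's rule puts \<open>det2 u v *s x\<close> into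
  the closure, and multiplying once more by the determinant recovers \<open>x\<close>.\<close>

lemma group_closure_pair_UNIV: "group_closure {u, v :: int ^ 2} = UNIV \<longleftrightarrow> \<bar>det2 u v\<bar> = 1"
proof
  assume "group_closure {u, v} = UNIV"
  then obtain m n m' n' where mn: "E1 = m *s u + n *s v" "E2 = m' *s u + n' *s v"
    using group_closure_pair by (metis UNIV_I)
  have "1 = det2 E1 E2" by (simp add: det2_def)
  also have "\<dots> = (m * n' - n * m') * det2 u v"
    unfolding mn by (simp add: det2_def algebra_simps)
  finally show "\<bar>det2 u v\<bar> = 1"
    by (metis abs_mult abs_one abs_zmult_eq_1 mult.commute)
next
  assume d: "\<bar>det2 u v\<bar> = 1"
  have "x \<in> group_closure {u, v}" for x
  proof -
    have "det2 u v *s x \<in> group_closure {u, v}"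
      unfolding det2_expand[of u v x]
      by (intro group_closure_add group_closure_smult group_closure.base) auto
    then have "det2 u v *s (det2 u v *s x) \<in> group_closure {u, v}" by (rule group_closure_smult)
    moreover have "det2 u v * det2 u v = 1" using d by (metis abs_mult_self_eq mult_1)
    ultimately show ?thesis by (simp add: vector_smult_assoc)
  qed
  then show "group_closure {u, v} = UNIV" by blast
qed

lemma lin_indep_int_pair:
  assumes "u \<noteq> v"
  shows "lin_indep_int {u, v :: int ^ 2} \<longleftrightarrow> det2 u v \<noteq> 0"
proof -
  interpret M: Modules.module "(*s) :: int \<Rightarrow> int ^ 2 \<Rightarrow> int ^ 2" by (rule module_int_vec)
  have "M.dependent {u, v} \<longleftrightarrow> (\<exists>f. (f u \<noteq> 0 \<or> f v \<noteq> 0) \<and> f u *s u + f v *s v = 0)"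
    using assms by (subst M.dependent_finite) auto
  also have "\<dots> \<longleftrightarrow> (\<exists>m n. (m \<noteq> 0 \<or> n \<noteq> 0) \<and> m *s u + n *s v = 0)"
  proof
    assume "\<exists>m n. (m \<noteq> 0 \<or> n \<noteq> 0) \<and> m *s u + n *s v = 0"
    then obtain m n where mn: "m \<noteq> 0 \<or> n \<noteq> 0" "m *s u + n *s v = 0" by blast
    then show "\<exists>f. (f u \<noteq> 0 \<or> f v \<noteq> 0) \<and> f u *s u + f v *s v = 0"
      using assms by (intro exI[of _ "\<lambda>x. if x = u then m else n"]) auto
  qed blast
  also have "\<dots> \<longleftrightarrow> det2 u v = 0"
  proof
    assume "\<exists>m n. (m \<noteq> 0 \<or> n \<noteq> 0) \<and> m *s u + n *s v = 0"
    then obtain m n where mn: "m \<noteq> 0 \<or> n \<noteq> 0" "m *s u + n *s v = 0" by blast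
    then have "m * u$1 + n * v$1 = 0" "m * u$2 + n * v$2 = 0" by (auto simp: vec2_eq_iff)
    then have "m * det2 u v = 0" "n * det2 u v = 0" unfolding det2_def by algebra+
    then show "det2 u v = 0" using mn by auto
  next
    assume d: "det2 u v = 0"
    \<comment> \<open>Either coordinate gives a relation. Both relations could be trivial only if
      \<open>u\<close> and \<open>v\<close> were both zero, which \<open>u \<noteq> v\<close>
      excludes.\<close>
    have r: "v$i *s u + (- (u$i)) *s v = 0" for i
      using d exhaust_2[of i] by (auto simp: vec2_eq_iff det2_def mult.commute)
    have "\<exists>i. v$i \<noteq> 0 \<or> - (u$i) \<noteq> 0" using assms by (metis neg_equal_0_iff_equal vec_eq_iff)
    then show "\<exists>m n. (m \<noteq> 0 \<or> n \<noteq> 0) \<and> m *s u + n *s v = 0" using r by blast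
  qed
  finally show ?thesis by (simp add: lin_indep_int_def)
qed

text \<open>In rank two the conditions concern pairs: a pair is independent if its determinant is
  nonzero and generates if it is a unit. Generation by the whole set only excludes that all
  determinants vanish.\<close>

lemma IR_iff:
  fixes E :: "(int ^ 2) set"
  shows "E \<in> IR \<longleftrightarrow> 0 \<notin> E \<and> uminus ` E = E \<and> (\<exists>u\<in>E. \<exists>v\<in>E. \<bar>det2 u v\<bar> = 1) \<and> (\<forall>u\<in>E. \<forall>v\<in>E. \<bar>det2 u v\<bar> \<le> 1)"
    (is "_ \<longleftrightarrow> ?R")
proof
  assume E: "E \<in> IR"
  have un: "\<bar>det2 u v\<bar> = 1" if uv: "u \<in> E" "v \<in> E" "det2 u v \<noteq> 0" for u v
  proof -
    have "u \<noteq> v" using uv(3) by auto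
    then have "card {u, v} = CARD(2)" "lin_indep_int {u, v}"
      using lin_indep_int_pair uv(3) by auto
    moreover have "\<forall>B. B \<subseteq> E \<and> finite B \<and> card B = CARD(2) \<and> lin_indep_int B \<longrightarrow> group_closure B = UNIV"
      using E unfolding IR_def by blast
    ultimately have "group_closure {u, v} = UNIV" using uv by simp
    then show ?thesis by (simp add: group_closure_pair_UNIV)
  qed
  have gc: "group_closure E = UNIV" and "0 \<notin> E" "uminus ` E = E" using E by (auto simp: IR_def)
  moreover have "\<exists>u\<in>E. \<exists>v\<in>E. \<bar>det2 u v\<bar> = 1"
  proof (rule ccontr)
    assume "\<not> ?thesis"
    then have zero: "det2 u v = 0" if "u \<in> E" "v \<in> E" for u v using un that by blast
    have "E \<noteq> {}"
    proof
      assume "E = {}"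
      then have "(UNIV :: (int ^ 2) set) = {0}" using gc by simp
      then have "E1 = 0" by blast
      then show False by (simp add: vec2_eq_iff)
    qed
    then obtain u where u: "u \<in> E" by blast
    \<comment> \<open>The determinant with \<open>u\<close> is additive, so it would vanish on the
      generated group, the whole lattice.\<close>
    have "det2 u x = 0" if "x \<in> group_closure E" for x
      using that
    proof (induction rule: group_closure.induct)
      case (base s)
      then show ?case using zero[OF u] by (auto simp: det2_def)
    qed (simp add: det2_def algebra_simps)
    then have "det2 u E1 = 0" "det2 u E2 = 0" unfolding gc by auto
    then have "u = 0" by (simp add: det2_def vec2_eq_iff)
    then show False using u \<open>0 \<notin> E\<close> by simp
  qed
  moreover have "\<bar>det2 u v\<bar> \<le> 1" if "u \<in> E" "v \<in> E" for u v
    using un[OF that] by (cases "det2 u v = 0") auto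
  ultimately show ?R by blast
next
  assume R: ?R
  then obtain u v where "u \<in> E" "v \<in> E" "\<bar>det2 u v\<bar> = 1" by blast
  then have "group_closure E = UNIV"
    using group_closure_mono[of "{u, v}" E] group_closure_pair_UNIV[of u v] by auto
  moreover have "group_closure B = UNIV" if B: "B \<subseteq> E" "card B = CARD(2)" "lin_indep_int B" for B
  proof -
    obtain x y where xy: "B = {x, y}" "x \<noteq> y" using B(2) by (auto simp: card_2_iff)
    then have "det2 x y \<noteq> 0" using B(3) lin_indep_int_pair by simp
    moreover have "\<bar>det2 x y\<bar> \<le> 1" using R B(1) xy by blast
    ultimately have "\<bar>det2 x y\<bar> = 1" by linarith
    then show ?thesis unfolding xy by (simp add: group_closure_pair_UNIV)
  qed
  ultimately show "E \<in> IR" using R unfolding IR_def by blast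
qed

lemma abs_le_one_cases: "\<bar>k\<bar> \<le> 1 \<Longrightarrow> k = 0 \<or> k = 1 \<or> k = - (1 :: int)"
  by linarith

lemma IR_image:
  fixes E :: "(int ^ 2) set"
  assumes "invertible g" "E \<in> IR"
  shows "(*v) g ` E \<in> (IR :: (int ^ 2) set set)"
proof -
  have E: "0 \<notin> E" "uminus ` E = E" "\<exists>u\<in>E. \<exists>v\<in>E. \<bar>det2 u v\<bar> = 1" "\<forall>u\<in>E. \<forall>v\<in>E. \<bar>det2 u v\<bar> \<le> 1"
    using assms(2) unfolding IR_iff by blast+
  have "g *v x \<noteq> 0" if "x \<noteq> 0" for x
    using that matrix_inv_vector(1)[OF assms(1), of x] by (metis matrix_vector_mult_0_right)
  then have "0 \<notin> (*v) g ` E" using E(1) by (metis imageE)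
  moreover have "uminus ` (*v) g ` E = (*v) g ` E"
    using E(2) by (metis (no_types, lifting) image_cong image_image matrix_vector_uminus)
  ultimately show ?thesis
    using E(3,4) by (simp add: IR_iff abs_det2_matrix[OF assms(1)])
qed

lemma edge_set_in_IR: "invertible g \<Longrightarrow> edge_set g \<in> IR"
  and tri_set_in_IR: "invertible g \<Longrightarrow> tri_set g \<in> IR"
proof -
  have "edge_set (mat 1) \<in> IR" "tri_set (mat 1) \<in> IR"
    unfolding IR_iff edge_set_def tri_set_def by (simp_all add: det2_def vec2_eq_iff insert_commute)
  then show "invertible g \<Longrightarrow> edge_set g \<in> IR" "invertible g \<Longrightarrow> tri_set g \<in> IR"
    using IR_image[of g] edge_set_mult[of g "mat 1"] tri_set_mult[of g "mat 1"] by simp_all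
qed

text \<open>Move the basis to the standard one. Determinants of absolute value at most one with
  \<open>E1\<close> and \<open>E2\<close> leave eight vectors. Now (1, 1) and (1, -1) have
  determinant -2, so at most one of these lines occurs, and a reflection exchanges them. The given
  basis is kept in the conclusion so that all sets containing it can be compared.\<close>

lemma IR_cases_at:
  assumes E: "E \<in> IR" and uv: "u \<in> E" "v \<in> E" "\<bar>det2 u v\<bar> = 1"
  obtains g where "invertible g" "edge_set g = {u, - u, v, - v}" "E = edge_set g \<or> E = tri_set g"
proof -
  obtain g where g: "invertible g" "g *v E1 = u" "g *v E2 = v"
    using invertible_columns[OF uv(3)] .
  define F where "F = (*v) (matrix_inv g) ` E"
  have EF: "E = (*v) g ` F"
    unfolding F_def image_image by (simp add: matrix_inv_vector(2)[OF g(1)])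
  have F: "0 \<notin> F" "uminus ` F = F" "\<forall>u\<in>F. \<forall>v\<in>F. \<bar>det2 u v\<bar> \<le> 1"
    using IR_image[OF invertible_matrix_inv[OF g(1)] E] unfolding F_def[symmetric] IR_iff by blast+
  have F12: "E1 \<in> F" "E2 \<in> F"
    unfolding F_def using uv(1,2) matrix_inv_vector(1)[OF g(1)] g(2,3) by (metis imageI)+
  have neg: "- x \<in> F \<longleftrightarrow> x \<in> F" for x
    using F(2) by (metis imageI minus_minus)
  let ?E3 = "vec2 1 (- 1)"
  have small: "x \<in> {E1, - E1, E2, - E2, E12, - E12, ?E3, - ?E3}" if "x \<in> F" for x
  proof -
    have "\<bar>x$1\<bar> \<le> 1" "\<bar>x$2\<bar> \<le> 1"
      using F(3) F12 that by (auto simp: det2_def)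
    moreover have "x$1 \<noteq> 0 \<or> x$2 \<noteq> 0"
    proof (rule ccontr)
      assume "\<not> (x$1 \<noteq> 0 \<or> x$2 \<noteq> 0)"
      then have "x = 0" by (simp add: vec2_eq_iff)
      then show False using that F(1) by simp
    qed
    ultimately show ?thesis
      using abs_le_one_cases[of "x$1"] abs_le_one_cases[of "x$2"] by (auto simp: vec2_eq_iff)
  qed
  have eq: "edge_set g = {u, - u, v, - v}"
    by (simp add: edge_set_def matrix_vector_uminus g)
  have base: "{E1, - E1, E2, - E2} \<subseteq> F" using F12 neg by auto
  consider (edge) "E12 \<notin> F" "?E3 \<notin> F" | (tri) "E12 \<in> F" "?E3 \<notin> F" | (tri') "E12 \<notin> F" "?E3 \<in> F"
    using F(3) by (force simp: det2_def)
  then show thesis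
  proof cases
    case edge
    then have "- E12 \<notin> F" "- ?E3 \<notin> F" using neg by simp_all
    then have "F = {E1, - E1, E2, - E2}" using edge small base by blast
    then show thesis using that[OF g(1) eq] EF by (simp add: edge_set_def)
  next
    case tri
    then have "- E12 \<in> F" "- ?E3 \<notin> F" using neg by simp_all
    then have "F = {E1, - E1, E2, - E2, E12, - E12}" using tri small base by blast
    then show thesis using that[OF g(1) eq] EF by (simp add: tri_set_def)
  next
    case tri'
    then have "- E12 \<notin> F" "- ?E3 \<in> F" using neg by simp_all
    then have F: "F = {E1, - E1, E2, - E2, ?E3, - ?E3}" using tri' small base by blast
    let ?k = "mat2 1 0 0 (-1)"
    have k: "invertible ?k" by (simp add: invertible_int_iff det_2)
    have "?k *v E1 = E1" "?k *v E2 = - E2" "?k *v E12 = ?E3"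
      by (simp_all add: vec2_eq_iff matrix_vector_mult_2)
    then have "edge_set ?k = {E1, - E1, E2, - E2}" "tri_set ?k = F"
      by (auto simp: edge_set_def tri_set_def F matrix_vector_uminus)
    then have "edge_set (g ** ?k) = {u, - u, v, - v}" "tri_set (g ** ?k) = E"
      unfolding edge_set_mult tri_set_mult EF using eq by (simp_all add: edge_set_def)
    then show thesis using that[OF invertible_mult[OF g(1) k]] by simp
  qed
qed

text \<open>All members of the interval contain a fixed basis from \<open>Z\<close>; one that is
  larger than the basis is a superbase and equals \<open>Z'\<close> by cardinality. So every finite
  chain lies on a single flag and the order complex is a graph.\<close>

lemma IR_interval:
  assumes Z: "Z \<in> IR" "Z' \<in> IR" "Z \<subseteq> Z'"
  obtains g where "invertible g" "\<And>W. W \<in> IR \<Longrightarrow> Z \<subseteq> W \<Longrightarrow> W \<subseteq> Z' \<Longrightarrow> W = edge_set g \<or> W = tri_set g"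
proof -
  obtain u v where uv: "u \<in> Z" "v \<in> Z" "\<bar>det2 u v\<bar> = 1" using Z(1) unfolding IR_iff by blast
  obtain g where g: "invertible g" "edge_set g = {u, - u, v, - v}" "Z' = edge_set g \<or> Z' = tri_set g"
    using IR_cases_at[OF Z(2)] uv Z(3) by blast
  have "W = edge_set g \<or> W = tri_set g" if W: "W \<in> IR" "Z \<subseteq> W" "W \<subseteq> Z'" for W
  proof -
    obtain h where h: "invertible h" "edge_set h = {u, - u, v, - v}" "W = edge_set h \<or> W = tri_set h"
      using IR_cases_at[OF W(1)] uv W(2) by blast
    show ?thesis
    proof (cases "W = edge_set h")
      case True
      then show ?thesis using g(2) h(2) by simp
    next
      case False
      then have c: "card W = 6" "W = tri_set h" using h card_tri_set by auto
      then have "Z' \<noteq> edge_set g"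
        using W(3) card_edge_set[OF g(1)] card_mono[OF finite_edge_set[of g], of W] by auto
      then have "Z' = tri_set g" using g(3) by simp
      then have "W = tri_set g"
        using c W(3) card_tri_set[OF g(1)] finite_tri_set by (intro card_subset_eq) auto
      then show ?thesis ..
    qed
  qed
  then show thesis using that g(1) by blast
qed

lemma finite_IR: "(Z :: (int ^ 2) set) \<in> IR \<Longrightarrow> finite Z"
  using IR_interval[of Z Z] finite_edge_set finite_tri_set by (metis subset_refl)


section \<open>Barycentres and the retraction of the cone of forms\<close>

text \<open>The factor 1/2 makes each pair \<open>v\<close>, \<open>- v\<close> count once.\<close>

definition barycentre :: "(int ^ 2) set \<Rightarrow> form" where
  "barycentre Z = (1 / 2) *\<^sub>R (\<Sum>v\<in>Z. sq_form v)"

lemma barycentre_image: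
  assumes "invertible g"
  shows "barycentre ((*v) g ` Z) = act g (barycentre Z)"
  unfolding barycentre_def act_scaleR act_sum act_sq_form
  by (subst sum.reindex[OF inj_on_subset[OF inj_invertible[OF assms] subset_UNIV]]) simp

lemma barycentre_edge_set: "invertible g \<Longrightarrow> barycentre (edge_set g) = act g (1, 0, 1)"
  unfolding edge_set_def barycentre_image
  by (simp add: barycentre_def sq_form_def vec2_eq_iff)

lemma barycentre_tri_set: "invertible g \<Longrightarrow> barycentre (tri_set g) = act g (2, 1, 2)"
  unfolding tri_set_def barycentre_image
  by (simp add: barycentre_def sq_form_def vec2_eq_iff)

text \<open>In the basis of \<open>g\<close> the combination is \<open>(1 + s, s, 1 + s)\<close>,
  with weights 1, 1, \<open>s\<close>; so the slope, the quotient of the two smallest weights, is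
  \<open>s\<close>. This normalization makes the retraction the identity on edges.\<close>

lemma flag_form:
  assumes g: "invertible g" and s: "0 \<le> s" "s \<le> 1"
  shows "(1 - s) *\<^sub>R barycentre (edge_set g) + s *\<^sub>R barycentre (tri_set g) \<in> tile g"
    "slope g ((1 - s) *\<^sub>R barycentre (edge_set g) + s *\<^sub>R barycentre (tri_set g)) = s"
proof -
  have eq: "(1 - s) *\<^sub>R barycentre (edge_set g) + s *\<^sub>R barycentre (tri_set g) = act g (1 + s, s, 1 + s)"
    unfolding barycentre_edge_set[OF g] barycentre_tri_set[OF g] act_scaleR[symmetric] act_add[symmetric]
    by (simp add: algebra_simps)
  have "(1 + s, s, 1 + s) \<in> pos_forms"
    using s by (intro pos_formsI) (auto simp: algebra_simps power2_eq_square)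
  then show "(1 - s) *\<^sub>R barycentre (edge_set g) + s *\<^sub>R barycentre (tri_set g) \<in> tile g"
    unfolding eq using act_pos_forms[OF g] g s by (simp add: tile_def reduced_def)
  show "slope g ((1 - s) *\<^sub>R barycentre (edge_set g) + s *\<^sub>R barycentre (tri_set g)) = s"
    unfolding eq using g by (simp add: slope_def)
qed

lemma barycentre_pos:
  assumes "Z \<in> IR"
  shows "barycentre Z \<in> pos_forms"
proof -
  obtain g where "invertible g" "Z = edge_set g \<or> Z = tri_set g"
    using IR_interval[OF assms assms subset_refl] assms by blast
  then show ?thesis
    using flag_form(1)[of g 0] flag_form(1)[of g 1] by (auto simp: tile_def)
qed

definition tile_coord :: "int ^ 2 ^ 2 \<Rightarrow> form \<Rightarrow> (int ^ 2) set \<Rightarrow> real" where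
  "tile_coord g q Z = (if Z = edge_set g then 1 - slope g q else if Z = tri_set g then slope g q else 0)"

definition form_retract :: "form \<Rightarrow> (int ^ 2) set \<Rightarrow> real" where
  "form_retract q = tile_coord (SOME g. invertible g \<and> q \<in> tile g) q"

lemma tile_coord_unique:
  assumes g: "invertible g" "q \<in> tile g" and h: "invertible h" "q \<in> tile h"
  shows "tile_coord g q = tile_coord h q"
proof -
  note u = tile_unique[OF g h] and b = slope_bounds[OF g]
  have ne: "edge_set g \<noteq> tri_set g" "edge_set h \<noteq> tri_set h"
    using edge_neq_tri g(1) h(1) by blast+
  consider "slope g q = 0" | "slope g q = 1" | "0 < slope g q" "slope g q < 1"
    using b by linarith
  then show ?thesis
  proof cases
    case 1
    then show ?thesis using u by (auto simp: tile_coord_def fun_eq_iff)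
  next
    case 2
    then show ?thesis using u ne by (auto simp: tile_coord_def fun_eq_iff)
  next
    case 3
    then show ?thesis using u by (auto simp: tile_coord_def fun_eq_iff)
  qed
qed

lemma form_retract_eq:
  assumes "invertible g" "q \<in> tile g"
  shows "form_retract q = tile_coord g q"
proof -
  let ?h = "SOME g. invertible g \<and> q \<in> tile g"
  have "\<exists>g. invertible g \<and> q \<in> tile g" using assms by blast
  then have "invertible ?h \<and> q \<in> tile ?h" by (rule someI_ex)
  then show ?thesis
    unfolding form_retract_def by (elim conjE) (rule tile_coord_unique[OF _ _ assms])
qed

section \<open>Continuity with respect to the weak topology\<close>

lemma topspace_complex_realization: "topspace (complex_realization K) = (\<Union>\<sigma>\<in>K. closed_simplex \<sigma>)"
proof -
  have "openin (subtopology (powertop_real UNIV) S) S" for S :: "('a \<Rightarrow> real) set"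
    by (simp add: openin_subtopology_refl)
  then have "openin (complex_realization K) (\<Union>\<sigma>\<in>K. closed_simplex \<sigma>)"
    unfolding openin_complex_realization by (auto simp: Int_absorb1 UN_upper)
  then show ?thesis
    by (meson openin_complex_realization openin_subset openin_topspace subset_antisym)
qed

lemma continuous_map_into_complex_realization:
  assumes "\<sigma> \<in> K"
  shows "continuous_map (subtopology (powertop_real UNIV) (closed_simplex \<sigma>)) (complex_realization K) (\<lambda>t. t)"
  unfolding continuous_map_def
proof (intro conjI allI impI)
  show "(\<lambda>t. t) \<in> topspace (subtopology (powertop_real UNIV) (closed_simplex \<sigma>)) \<rightarrow> topspace (complex_realization K)"
    using assms by (auto simp: topspace_complex_realization)
  fix U assume "openin (complex_realization K) U"
  then have "openin (subtopology (powertop_real UNIV) (closed_simplex \<sigma>)) (U \<inter> closed_simplex \<sigma>)"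
    using assms by (simp add: openin_complex_realization)
  moreover have "{t \<in> topspace (subtopology (powertop_real UNIV) (closed_simplex \<sigma>)). t \<in> U} = U \<inter> closed_simplex \<sigma>"
    by auto
  ultimately show "openin (subtopology (powertop_real UNIV) (closed_simplex \<sigma>))
      {t \<in> topspace (subtopology (powertop_real UNIV) (closed_simplex \<sigma>)). t \<in> U}"
    by simp
qed

lemma continuous_map_from_complex_realization:
  assumes "\<And>\<sigma>. \<sigma> \<in> K \<Longrightarrow> continuous_map (subtopology (powertop_real UNIV) (closed_simplex \<sigma>)) Y f"
  shows "continuous_map (complex_realization K) Y f"
  unfolding continuous_map_def
proof (intro conjI allI impI)
  show "f \<in> topspace (complex_realization K) \<rightarrow> topspace Y"
  proof
    fix t assume "t \<in> topspace (complex_realization K)"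
    then obtain \<sigma> where "\<sigma> \<in> K" "t \<in> closed_simplex \<sigma>" by (auto simp: topspace_complex_realization)
    then show "f t \<in> topspace Y"
      using continuous_map_image_subset_topspace[OF assms] by auto
  qed
  fix U assume U: "openin Y U"
  let ?V = "{t \<in> topspace (complex_realization K). f t \<in> U}"
  have "openin (subtopology (powertop_real UNIV) (closed_simplex \<sigma>)) (?V \<inter> closed_simplex \<sigma>)" if "\<sigma> \<in> K" for \<sigma>
  proof -
    have "?V \<inter> closed_simplex \<sigma> = {t \<in> topspace (subtopology (powertop_real UNIV) (closed_simplex \<sigma>)). f t \<in> U}"
      using that by (auto simp: topspace_complex_realization)
    then show ?thesis using openin_continuous_map_preimage[OF assms[OF that] U] by simp
  qed
  then show "openin (complex_realization K) ?V"
    by (auto simp: openin_complex_realization topspace_complex_realization)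
qed

abbreviation IR_realization :: "((int ^ 2) set \<Rightarrow> real) topology" where
  "IR_realization \<equiv> complex_realization (order_complex IR)"

lemma flag_in_order_complex: "invertible g \<Longrightarrow> {edge_set g, tri_set g} \<in> order_complex IR"
  using edge_subset_tri by (auto simp: order_complex_def edge_set_in_IR tri_set_in_IR)

text \<open>The tiles are a locally finite closed cover of the cone. On one tile the values lie in a
  single closed simplex, where continuity is continuity of the slope.\<close>

lemma continuous_map_form_retract: "continuous_map (top_of_set pos_forms) IR_realization form_retract"
proof (rule pasting_lemma_locally_finite[where I = "{g. invertible g}" and T = tile and f = tile_coord])
  fix q assume "q \<in> topspace (top_of_set pos_forms)"
  then have q: "q \<in> pos_forms" by simp
  then obtain V where V: "open V" "q \<in> V" "finite {g. invertible g \<and> tile g \<inter> V \<noteq> {}}"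
    using tiles_locally_finite by blast
  show "\<exists>V. openin (top_of_set pos_forms) V \<and> q \<in> V \<and> finite {g \<in> {g. invertible g}. tile g \<inter> V \<noteq> {}}"
  proof (intro exI conjI)
    show "openin (top_of_set pos_forms) (pos_forms \<inter> V)" using V(1) by (rule openin_open_Int)
    show "finite {g \<in> {g. invertible g}. tile g \<inter> (pos_forms \<inter> V) \<noteq> {}}"
      by (rule finite_subset[OF _ V(3)]) auto
  qed (use q V in auto)
next
  fix g :: "int ^ 2 ^ 2" assume "g \<in> {g. invertible g}"
  then have g: "invertible g" by simp
  let ?\<sigma> = "{edge_set g, tri_set g}"
  have top: "subtopology (top_of_set pos_forms) (tile g) = top_of_set (tile g)"
    by (simp add: subtopology_subtopology tile_def Int_absorb1)
  have ne: "edge_set g \<noteq> tri_set g" using edge_neq_tri g by blast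
  have "continuous_on (tile g) (\<lambda>q. tile_coord g q Z)" for Z
    unfolding tile_coord_def using continuous_on_slope[OF g]
    by (cases "Z = edge_set g"; cases "Z = tri_set g") (simp_all add: continuous_on_diff)
  then have "continuous_map (top_of_set (tile g)) (powertop_real UNIV) (tile_coord g)"
    unfolding continuous_map_componentwise_UNIV by simp
  moreover have "tile_coord g q \<in> closed_simplex ?\<sigma>" if "q \<in> tile g" for q
    using slope_bounds[OF g that] ne by (auto simp: closed_simplex_def tile_coord_def)
  ultimately have "continuous_map (top_of_set (tile g)) (subtopology (powertop_real UNIV) (closed_simplex ?\<sigma>)) (tile_coord g)"
    by (auto simp: continuous_map_in_subtopology)
  from continuous_map_compose[OF this continuous_map_into_complex_realization[OF flag_in_order_complex[OF g]]]
  show "continuous_map (subtopology (top_of_set pos_forms) (tile g)) IR_realization (tile_coord g)"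
    by (simp add: o_def top)
next
  fix g h q assume "g \<in> {g. invertible g}" "h \<in> {g. invertible g}" "q \<in> topspace (top_of_set pos_forms) \<inter> tile g \<inter> tile h"
  then show "tile_coord g q = tile_coord h q" by (intro tile_coord_unique) auto
next
  fix q assume "q \<in> topspace (top_of_set pos_forms)"
  then obtain g where "invertible g" "q \<in> tile g" using tile_exists[of q] by auto
  then show "\<exists>j. j \<in> {g. invertible g} \<and> q \<in> tile j \<and> form_retract q = tile_coord j q"
    by (intro exI[of _ g] conjI form_retract_eq) auto
qed (rule closedin_tile)

text \<open>The map that is affine on simplices and sends vertices to barycentres. Summing over the
  support makes it independent of the simplex that contains the point.\<close>

definition IR_to_form :: "((int ^ 2) set \<Rightarrow> real) \<Rightarrow> form" where
  "IR_to_form t = (\<Sum>Z | t Z \<noteq> 0. t Z *\<^sub>R barycentre Z)"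

lemma IR_to_form_simplex:
  assumes "finite \<sigma>" "t \<in> closed_simplex \<sigma>"
  shows "IR_to_form t = (\<Sum>Z\<in>\<sigma>. t Z *\<^sub>R barycentre Z)"
  unfolding IR_to_form_def by (rule sum.mono_neutral_left) (use assms in \<open>auto simp: closed_simplex_def\<close>)

lemma continuous_map_IR_to_form: "continuous_map IR_realization (top_of_set pos_forms) IR_to_form"
proof (rule continuous_map_from_complex_realization)
  fix \<sigma> :: "(int ^ 2) set set" assume "\<sigma> \<in> order_complex IR"
  then have \<sigma>: "finite \<sigma>" "\<sigma> \<subseteq> IR" by (auto simp: order_complex_def)
  let ?T = "subtopology (powertop_real UNIV) (closed_simplex \<sigma>)"
  have "continuous_map ?T euclidean (\<lambda>t. \<Sum>Z\<in>\<sigma>. t Z *\<^sub>R barycentre Z)"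
  proof (intro continuous_map_sum \<sigma>)
    fix Z
    have c1: "continuous_map ?T euclideanreal (\<lambda>t. t Z)"
      using continuous_map_from_subtopology continuous_map_product_projection[of Z UNIV "\<lambda>_. euclideanreal"] by blast
    have c2: "continuous_map euclideanreal euclidean (\<lambda>x. x *\<^sub>R barycentre Z)"
      by (simp add: continuous_on_scaleR)
    show "continuous_map ?T euclidean (\<lambda>t. t Z *\<^sub>R barycentre Z)"
      using continuous_map_compose[OF c1 c2] by (simp add: o_def)
  qed
  then have "continuous_map ?T euclidean IR_to_form"
    by (rule continuous_map_eq) (use IR_to_form_simplex[OF \<sigma>(1)] in auto)
  moreover have "IR_to_form t \<in> pos_forms" if t: "t \<in> closed_simplex \<sigma>" for t
    unfolding IR_to_form_simplex[OF \<sigma>(1) t]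
    using \<sigma> t barycentre_pos by (intro convex_sum convex_pos_forms) (auto simp: closed_simplex_def)
  ultimately show "continuous_map ?T (top_of_set pos_forms) IR_to_form"
    by (auto simp: continuous_map_in_subtopology)
qed

lemma finite_chain_bounds:
  assumes "finite \<sigma>" "\<sigma> \<noteq> {}" "\<forall>x\<in>\<sigma>. \<forall>y\<in>\<sigma>. x \<subseteq> y \<or> y \<subseteq> x"
  shows "\<exists>a\<in>\<sigma>. \<exists>b\<in>\<sigma>. \<forall>x\<in>\<sigma>. a \<subseteq> x \<and> x \<subseteq> b"
proof -
  obtain a where a: "a \<in> \<sigma>" "\<forall>b\<in>\<sigma>. b \<subseteq> a \<longrightarrow> b = a"
    using finite_has_minimal[OF assms(1,2)] by metis
  obtain b where b: "b \<in> \<sigma>" "\<forall>c\<in>\<sigma>. b \<subseteq> c \<longrightarrow> c = b"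
    using finite_has_maximal[OF assms(1,2)] by metis
  have "a \<subseteq> x" "x \<subseteq> b" if "x \<in> \<sigma>" for x
    using assms(3) that a b by (metis subset_refl)+
  then show ?thesis using a(1) b(1) by blast
qed

text \<open>The carrier of the point is a chain, hence part of one flag, and along the segment of
  its barycentres the slope returns the coordinate.\<close>

lemma form_retract_IR_to_form:
  assumes "t \<in> topspace IR_realization"
  shows "form_retract (IR_to_form t) = t"
proof -
  obtain \<sigma> where \<sigma>: "\<sigma> \<in> order_complex IR" "t \<in> closed_simplex \<sigma>"
    using assms by (auto simp: topspace_complex_realization)
  then have c: "\<sigma> \<noteq> {}" "finite \<sigma>" "\<sigma> \<subseteq> IR" "\<forall>x\<in>\<sigma>. \<forall>y\<in>\<sigma>. x \<subseteq> y \<or> y \<subseteq> x"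
    by (auto simp: order_complex_def)
  then obtain a b where ab: "a \<in> \<sigma>" "b \<in> \<sigma>" "\<forall>x\<in>\<sigma>. a \<subseteq> x \<and> x \<subseteq> b"
    using finite_chain_bounds by metis
  have "a \<in> IR" "b \<in> IR" "a \<subseteq> b" using ab c(3) by auto
  then obtain g where g: "invertible g" "\<And>W. W \<in> IR \<Longrightarrow> a \<subseteq> W \<Longrightarrow> W \<subseteq> b \<Longrightarrow> W = edge_set g \<or> W = tri_set g"
    by (rule IR_interval) (rule that, assumption+)
  let ?\<tau> = "{edge_set g, tri_set g}"
  have sub: "\<sigma> \<subseteq> ?\<tau>"
  proof
    fix W assume "W \<in> \<sigma>"
    then have "W = edge_set g \<or> W = tri_set g" using ab(3) c(3) by (intro g(2)) auto
    then show "W \<in> ?\<tau>" by simp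
  qed
  have ne: "edge_set g \<noteq> tri_set g" using edge_neq_tri g(1) by blast
  have "(\<Sum>v\<in>?\<tau>. t v) = (\<Sum>v\<in>\<sigma>. t v)"
    by (rule sum.mono_neutral_right) (use sub \<sigma>(2) in \<open>auto simp: closed_simplex_def\<close>)
  then have t: "t \<in> closed_simplex ?\<tau>"
    using \<sigma>(2) sub by (auto simp: closed_simplex_def)
  define s where "s = t (tri_set g)"
  have s: "0 \<le> s" "s \<le> 1" "t (edge_set g) = 1 - s"
  proof -
    have "0 \<le> t (edge_set g)" "0 \<le> t (tri_set g)" "t (edge_set g) + t (tri_set g) = 1"
      using t ne by (auto simp: closed_simplex_def)
    then show "0 \<le> s" "s \<le> 1" "t (edge_set g) = 1 - s" by (auto simp: s_def)
  qed
  have "IR_to_form t = (1 - s) *\<^sub>R barycentre (edge_set g) + s *\<^sub>R barycentre (tri_set g)"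
    unfolding IR_to_form_simplex[of ?\<tau>, simplified, OF t] using ne s by (simp add: s_def)
  then have "form_retract (IR_to_form t) = tile_coord g (IR_to_form t)" "slope g (IR_to_form t) = s"
    using form_retract_eq[OF g(1)] flag_form[OF g(1) s(1,2)] by simp_all
  then show ?thesis
    using t s by (auto simp: tile_coord_def closed_simplex_def s_def fun_eq_iff)
qed

lemma contractible_IR_realization: "contractible_space IR_realization"
proof (rule contractible_space_retraction_map_image)
  show "retraction_map (top_of_set pos_forms) IR_realization form_retract"
    unfolding retraction_map_def retraction_maps_def
    using continuous_map_form_retract continuous_map_IR_to_form form_retract_IR_to_form by blast
  show "contractible_space (top_of_set pos_forms)"
    by (simp add: convex_imp_contractible convex_pos_forms)
qed

lemma IR_realization_nonempty: "topspace IR_realization \<noteq> {}"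
proof -
  have "tile_coord (mat 1) (act (mat 1) (1, 0, 1)) \<in> topspace IR_realization"
  proof -
    have "act (mat 1) (1, 0, 1) \<in> pos_forms" by (simp add: pos_formsI)
    then have "form_retract (act (mat 1) (1, 0, 1)) \<in> topspace IR_realization"
      using continuous_map_image_subset_topspace[OF continuous_map_form_retract] by auto
    then show ?thesis
      using form_retract_eq[OF invertible_mat_1, of "act (mat 1) (1, 0, 1)"]
      by (simp add: tile_def reduced_def matrix_inv_mat_1 pos_formsI)
  qed
  then show ?thesis by blast
qed

section \<open>The category of the action and the classifying space of the linear group\<close>

section \<open>The category of the action on the poset\<close>

definition IR_category :: "((int ^ 2) set, int ^ 2 ^ 2) category" where
  "IR_category = \<lparr> Obj = IR, Hom = (\<lambda>X Y. {g. invertible g \<and> (*v) g ` X \<subseteq> Y}), Id = (\<lambda>_. mat 1),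
     Comp = (\<lambda>_ _ _ g f. g ** f) \<rparr>"

abbreviation GL2_category :: "(unit, int ^ 2 ^ 2) category" where
  "GL2_category \<equiv> delooping GL_int"

lemma image_matrix_mult: "(*v) g ` (*v) h ` Z = (*v) (g ** h) ` Z" for g h :: "'a::comm_ring_1 ^ 'n ^ 'n"
  by (simp add: image_image matrix_vector_mul_assoc)

lemma image_mat_1 [simp]: "(*v) (mat 1 :: 'a::comm_ring_1 ^ 'n ^ 'n) ` Z = Z"
  by simp

lemma is_category_IR_category: "is_category IR_category"
  unfolding is_category_def IR_category_def category.simps
proof (intro conjI ballI)
  fix X Y Z :: "(int ^ 2) set" and f g assume "f \<in> {g. invertible g \<and> (*v) g ` X \<subseteq> Y}" "g \<in> {g. invertible g \<and> (*v) g ` Y \<subseteq> Z}"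
  then show "g ** f \<in> {g. invertible g \<and> (*v) g ` X \<subseteq> (Z :: (int ^ 2) set)}"
    by (auto simp: invertible_mult image_matrix_mult[symmetric])
qed (auto simp: invertible_mat_1 matrix_mul_assoc)

lemma is_functor_IR_GL2: "is_functor IR_category GL2_category (\<lambda>_. ()) (\<lambda>_ _ g. g)"
  by (simp add: is_functor_def IR_category_def delooping_def GL_int_def)

text \<open>The matrix \<open>h i\<close> leads from the frame at the vertex \<open>i\<close> to a
  common frame, in which the set \<open>Z\<close> is given; here it is transported back to the
  vertex \<open>i\<close>.\<close>

definition twist_obj :: "(nat \<Rightarrow> int ^ 2 ^ 2) \<Rightarrow> nat \<times> (int ^ 2) set \<Rightarrow> (int ^ 2) set" where
  "twist_obj h = (\<lambda>(i, Z). (*v) (matrix_inv (h i)) ` Z)"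

definition twist_mor :: "(nat \<Rightarrow> int ^ 2 ^ 2) \<Rightarrow> nat \<times> (int ^ 2) set \<Rightarrow> nat \<times> (int ^ 2) set \<Rightarrow> int ^ 2 ^ 2" where
  "twist_mor h = (\<lambda>(i, _) (j, _). matrix_inv (h j) ** h i)"

lemma matrix_inv_cancel: "invertible A \<Longrightarrow> matrix_inv A ** (A ** B) = B" "invertible A \<Longrightarrow> A ** (matrix_inv A ** B) = B"
  "invertible A \<Longrightarrow> (B ** A) ** matrix_inv A = B" "invertible A \<Longrightarrow> (B ** matrix_inv A) ** A = B"
  for A B :: "'a::comm_ring_1 ^ 'n ^ 'n"
  by (simp_all add: matrix_mul_assoc matrix_inv_left matrix_inv_right)
     (simp_all add: matrix_mul_assoc[symmetric] matrix_inv_left matrix_inv_right)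

lemma diagram_twist:
  assumes h: "\<And>i. i \<le> n \<Longrightarrow> invertible (h i)"
  shows "diagram IR_category ({..n} \<times> IR) (twist_obj h) (twist_mor h)"
  unfolding diagram_def
proof (intro conjI ballI impI)
  fix p assume "p \<in> {..n} \<times> (IR :: (int ^ 2) set set)"
  then show "twist_obj h p \<in> Obj IR_category" "twist_mor h p p = Id IR_category (twist_obj h p)"
    by (auto simp: twist_obj_def twist_mor_def IR_category_def h matrix_inv_left IR_image invertible_matrix_inv)
next
  fix p q assume pq: "p \<in> {..n} \<times> (IR :: (int ^ 2) set set)" "q \<in> {..n} \<times> IR" "p \<le> q"
  obtain i Z j Z' where ij: "p = (i, Z)" "q = (j, Z')" by (metis surj_pair)
  have inv: "invertible (h i)" "invertible (h j)" "Z \<subseteq> Z'" using pq h by (auto simp: ij)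
  have "(matrix_inv (h j) ** h i) ** matrix_inv (h i) = matrix_inv (h j)"
    by (rule matrix_inv_cancel(3)[OF inv(1)])
  then show "twist_mor h p q \<in> Hom IR_category (twist_obj h p) (twist_obj h q)"
    using inv by (simp add: ij twist_obj_def twist_mor_def IR_category_def image_matrix_mult
        invertible_mult invertible_matrix_inv image_mono)
next
  fix p q r assume pqr: "p \<in> {..n} \<times> (IR :: (int ^ 2) set set)" "q \<in> {..n} \<times> IR" "r \<in> {..n} \<times> IR" "p \<le> q \<and> q \<le> r"
  obtain i Z j Z' k Z'' where ij: "p = (i, Z)" "q = (j, Z')" "r = (k, Z'')" by (metis surj_pair)
  have "invertible (h j)" using pqr h by (auto simp: ij)
  then have "(matrix_inv (h k) ** h j) ** (matrix_inv (h j) ** h i) = matrix_inv (h k) ** h i"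
    by (metis matrix_inv_cancel(2) matrix_mul_assoc)
  then show "twist_mor h p r = Comp IR_category (twist_obj h p) (twist_obj h q) (twist_obj h r) (twist_mor h q r) (twist_mor h p q)"
    by (simp add: ij twist_mor_def IR_category_def)
qed

text \<open>The parameter is one minus the slope because \<open>coupling\<close> gives it as mass to
  its first vertex, the basis, while the slope is the coordinate of the superbase.\<close>

definition flag_coupling :: "(nat \<Rightarrow> real) \<Rightarrow> form \<Rightarrow> nat \<times> (int ^ 2) set \<Rightarrow> real" where
  "flag_coupling t q = (let g = SOME g. invertible g \<and> q \<in> tile g in coupling t (1 - slope g q) (edge_set g) (tri_set g))"

lemma low_mass_extreme:
  assumes "t \<in> standard_simplex n"
  shows "low_mass t 0 i = 0" "low_mass t 1 i = t i"
  using low_mass_above[OF assms, of 0 i] partial_sum_nonneg[OF assms, of i]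
    low_mass_below[OF assms, of i 1] partial_sum_mono[OF assms, of "Suc i" "Suc (n + i)"] partial_sum_full[OF assms, of "Suc (n + i)"]
  by auto

text \<open>Where the flag depends on the reduction, at slope 0 or 1, the ambiguous vertex receives
  no mass.\<close>

lemma flag_coupling_eq:
  assumes g: "invertible g" "q \<in> tile g" and t: "t \<in> standard_simplex n"
  shows "flag_coupling t q = coupling t (1 - slope g q) (edge_set g) (tri_set g)"
proof -
  let ?h = "SOME g. invertible g \<and> q \<in> tile g"
  have "\<exists>g. invertible g \<and> q \<in> tile g" using g by blast
  then have h: "invertible ?h" "q \<in> tile ?h" by (metis (mono_tags, lifting) someI_ex)+
  note u = tile_unique[OF g h] and b = slope_bounds[OF g]
  consider "slope g q = 0" | "slope g q = 1" | "0 < slope g q" "slope g q < 1" using b by linarith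
  then have "coupling t (1 - slope g q) (edge_set g) (tri_set g) = coupling t (1 - slope ?h q) (edge_set ?h) (tri_set ?h)"
  proof cases
    case 1
    then show ?thesis using u by (simp add: coupling_def low_mass_extreme[OF t] fun_eq_iff)
  next
    case 2
    then show ?thesis using u by (simp add: coupling_def low_mass_extreme[OF t] fun_eq_iff)
  next
    case 3
    then show ?thesis using u by simp
  qed
  then show ?thesis by (simp add: flag_coupling_def Let_def)
qed

text \<open>The retraction sends \<open>q\<close> to a point of the edge \<open>edge_set g \<subset> tri_set g\<close>. Coupled with \<open>t\<close> it is a
  point of the product of a simplex with this edge, and the matrices \<open>h i\<close> spread the edge over
  the vertices \<open>i\<close> of the simplex.\<close>

definition twist_point :: "nat \<Rightarrow> (nat \<Rightarrow> int ^ 2 ^ 2) \<Rightarrow> (nat \<Rightarrow> real) \<Rightarrow> form \<Rightarrow>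
    ((nat \<times> (nat \<Rightarrow> (int ^ 2) set) \<times> (nat \<times> nat \<Rightarrow> int ^ 2 ^ 2)) \<times> (nat \<Rightarrow> real)) set" where
  "twist_point n h t q = measure_point (nerve IR_category) ({..n} \<times> IR)
     (diagram_simplex (twist_obj h) (twist_mor h)) (flag_coupling t q)"

lemma flag_prod_subset: "invertible g \<Longrightarrow> {..n} \<times> {edge_set g, tri_set g} \<subseteq> {..n} \<times> IR"
  by (auto simp: edge_set_in_IR tri_set_in_IR)

lemma twist_point_shuffle:
  assumes h: "\<And>i. i \<le> n \<Longrightarrow> invertible (h i)" and g: "invertible g" "q \<in> tile g" and t: "t \<in> standard_simplex n"
    and k: "k \<le> n" "partial_sum t k \<le> 1 - slope g q" "1 - slope g q \<le> partial_sum t (Suc k)"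
  shows "twist_point n h t q = simplex_class (nerve IR_category) (Suc n)
    (diagram_simplex (twist_obj h) (twist_mor h) (Suc n) (shuffle k (edge_set g) (tri_set g)))
    (shuffle_weights t (1 - slope g q) k)"
  unfolding twist_point_def flag_coupling_eq[OF g t]
  by (rule measure_point_coupling[OF poset_family_diagram[OF diagram_twist[OF h]] edge_subset_tri flag_prod_subset[OF g(1)] t _ _ k])
     (use slope_bounds[OF g] in auto)

text \<open>A change of the common frame by \<open>k\<close> moves the flag and all
  \<open>h i\<close> simultaneously, and the two changes cancel when the sets are transported back
  to the vertices.\<close>

lemma twist_point_equivariant:
  assumes h: "\<And>i. i \<le> n \<Longrightarrow> invertible (h i)" and t: "t \<in> standard_simplex n" and q: "q \<in> pos_forms"
    and k: "invertible k" and h': "\<And>i. i \<le> n \<Longrightarrow> h' i = k ** h i"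
  shows "twist_point n h t q = twist_point n h' t (act k q)"
proof -
  obtain g where g: "invertible g" "q \<in> tile g" using tile_exists[OF q] .
  have kg: "invertible (k ** g)" "act k q \<in> tile (k ** g)" "slope (k ** g) (act k q) = slope g q"
    using invertible_mult[OF k g(1)] tile_act[OF g(1) k q] g(2) by auto
  have inv': "invertible (h' i)" if "i \<le> n" for i
    using h' h k that invertible_mult by metis
  obtain l where l: "l \<le> n" "partial_sum t l \<le> 1 - slope g q" "1 - slope g q \<le> partial_sum t (Suc l)"
    using shuffle_cut_exists[OF t, of "1 - slope g q"] slope_bounds[OF g] by auto
  have e: "edge_set (k ** g) = (*v) k ` edge_set g" "tri_set (k ** g) = (*v) k ` tri_set g"
    by (rule edge_set_mult tri_set_mult)+
  have ob: "twist_obj h' (i, (*v) k ` Z) = twist_obj h (i, Z)" if "i \<le> n" for i Z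
    using that h k by (simp add: twist_obj_def h' matrix_inv_mult image_matrix_mult matrix_inv_cancel(4))
  have mo: "twist_mor h' (i, W) (j, W') = twist_mor h (i, Z) (j, Z')" if "i \<le> n" "j \<le> n" for i j W W' Z Z'
  proof -
    have "(matrix_inv (h j) ** matrix_inv k) ** (k ** h i) = matrix_inv (h j) ** h i"
      by (metis k matrix_inv_cancel(1) matrix_mul_assoc)
    then show ?thesis using that h k by (simp add: twist_mor_def h' matrix_inv_mult)
  qed
  have sh: "\<exists>j\<le>n. \<exists>Z. shuffle l (edge_set g) (tri_set g) i = (j, Z) \<and>
      shuffle l (edge_set (k ** g)) (tri_set (k ** g)) i = (j, (*v) k ` Z)" if "i \<le> Suc n" for i
    using that l(1) by (auto simp: shuffle_def e)
  have "diagram_simplex (twist_obj h) (twist_mor h) (Suc n) (shuffle l (edge_set g) (tri_set g)) =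
      diagram_simplex (twist_obj h') (twist_mor h') (Suc n) (shuffle l (edge_set (k ** g)) (tri_set (k ** g)))"
    unfolding diagram_simplex_def prod.inject
  proof (intro conjI ext)
    fix i
    show "(\<lambda>i\<in>{..Suc n}. twist_obj h (shuffle l (edge_set g) (tri_set g) i)) i =
        (\<lambda>i\<in>{..Suc n}. twist_obj h' (shuffle l (edge_set (k ** g)) (tri_set (k ** g)) i)) i"
      using sh[of i] ob by auto
  next
    fix ij :: "nat \<times> nat"
    obtain i j where ij: "ij = (i, j)" by fastforce
    show "(\<lambda>(i, j)\<in>{(i, j). i \<le> j \<and> j \<le> Suc n}. twist_mor h (shuffle l (edge_set g) (tri_set g) i) (shuffle l (edge_set g) (tri_set g) j)) ij =
        (\<lambda>(i, j)\<in>{(i, j). i \<le> j \<and> j \<le> Suc n}. twist_mor h' (shuffle l (edge_set (k ** g)) (tri_set (k ** g)) i) (shuffle l (edge_set (k ** g)) (tri_set (k ** g)) j)) ij"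
    proof (cases "i \<le> j \<and> j \<le> Suc n")
      case True
      then obtain i' Z j' Z' where "i' \<le> n" "j' \<le> n" "shuffle l (edge_set g) (tri_set g) i = (i', Z)"
        "shuffle l (edge_set (k ** g)) (tri_set (k ** g)) i = (i', (*v) k ` Z)"
        "shuffle l (edge_set g) (tri_set g) j = (j', Z')"
        "shuffle l (edge_set (k ** g)) (tri_set (k ** g)) j = (j', (*v) k ` Z')"
        using sh[of i] sh[of j] by (meson order_trans)
      then show ?thesis using True mo[of i' j' "(*v) k ` Z" "(*v) k ` Z'" Z Z'] by (simp add: ij)
    qed (auto simp: ij)
  qed
  then show ?thesis
    using twist_point_shuffle[OF h g t l] twist_point_shuffle[OF inv' kg(1,2) t l(1)] l(2,3) kg(3) by simp
qed

lemma twist_point_Pull: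
  assumes h: "\<And>i. i \<le> n \<Longrightarrow> invertible (h i)" and t: "t \<in> standard_simplex m" and q: "q \<in> pos_forms"
    and \<theta>: "simplex_op m n \<theta>"
  shows "twist_point m (h \<circ> \<theta>) t q = twist_point n h (push_simplex m \<theta> t) q"
proof -
  obtain g where g: "invertible g" "q \<in> tile g" using tile_exists[OF q] .
  have \<theta>n: "\<theta> i \<le> n" if "i \<le> m" for i using \<theta> that by (auto simp: simplex_op_def image_subset_iff)
  have inv': "invertible ((h \<circ> \<theta>) i)" if "i \<le> m" for i using h \<theta>n[OF that] by simp
  show ?thesis
    unfolding twist_point_def flag_coupling_eq[OF g t] flag_coupling_eq[OF g push_simplex_in_standard_simplex[OF \<theta> t]]
  proof (rule measure_point_coupling_Pull[OF poset_family_diagram[OF diagram_twist[OF h]]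
        poset_family_diagram[OF diagram_twist[OF inv']] flag_prod_subset[OF g(1)] flag_prod_subset[OF g(1)] edge_subset_tri t \<theta>])
    show "diagram_simplex (twist_obj (h \<circ> \<theta>)) (twist_mor (h \<circ> \<theta>)) l c =
        diagram_simplex (twist_obj h) (twist_mor h) l (map_prod \<theta> id \<circ> c)" for l c
      by (simp add: diagram_simplex_def twist_obj_def twist_mor_def case_prod_unfold)
  qed (use slope_bounds[OF g] in auto)
qed

text \<open>Over one tile the flag is constant and only the parameter of the coupling varies; the
  tiles are then pasted by local finiteness.\<close>

lemma continuous_map_twist_point:
  assumes h: "\<And>i. i \<le> n \<Longrightarrow> invertible (h i)"
  shows "continuous_map (prod_topology (simplex_top n) (top_of_set pos_forms)) (classifying_space IR_category)
    (\<lambda>(t, q). twist_point n h t q)"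
proof -
  let ?Z = "prod_topology (simplex_top n) (top_of_set pos_forms)"
  let ?T = "\<lambda>g. {z \<in> topspace ?Z. snd z \<in> tile g}"
  let ?\<sigma> = "diagram_simplex (twist_obj h) (twist_mor h)"
  let ?f = "\<lambda>g z. measure_point (nerve IR_category) ({..n} \<times> IR) ?\<sigma>
      (coupling (fst z) (1 - slope g (snd z)) (edge_set g) (tri_set g))"
  have val: "twist_point n h (fst z) (snd z) = ?f g z" if "invertible g" "z \<in> ?T g" for g z
    using that flag_coupling_eq[OF that(1), of "snd z" "fst z" n] by (auto simp: twist_point_def)
  show ?thesis
  proof (rule pasting_lemma_locally_finite[where I = "{g. invertible g}" and T = ?T and f = ?f])
    fix z assume "z \<in> topspace ?Z"
    then have z: "fst z \<in> standard_simplex n" "snd z \<in> pos_forms" by auto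
    then obtain V where V: "open V" "snd z \<in> V" "finite {g. invertible g \<and> tile g \<inter> V \<noteq> {}}"
      using tiles_locally_finite by blast
    show "\<exists>V. openin ?Z V \<and> z \<in> V \<and> finite {g \<in> {g. invertible g}. ?T g \<inter> V \<noteq> {}}"
    proof (intro exI conjI)
      have "openin (simplex_top n) (standard_simplex n)"
        using openin_topspace[of "simplex_top n"] by simp
      then show "openin ?Z (standard_simplex n \<times> (pos_forms \<inter> V))"
        using V(1) by (simp add: openin_prod_Times_iff openin_open_Int)
      show "z \<in> standard_simplex n \<times> (pos_forms \<inter> V)" using z V(2) by (auto simp: mem_Times_iff)
      show "finite {g \<in> {g. invertible g}. ?T g \<inter> standard_simplex n \<times> (pos_forms \<inter> V) \<noteq> {}}"
        by (rule finite_subset[OF _ V(3)]) auto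
    qed
  next
    fix g :: "int ^ 2 ^ 2" assume "g \<in> {g. invertible g}"
    then have g: "invertible g" by simp
    show "closedin ?Z (?T g)"
      by (rule closedin_continuous_map_preimage[OF continuous_map_snd closedin_tile])
    let ?S = "subtopology ?Z (?T g)"
    have fstc: "continuous_map ?S (simplex_top n) fst"
      by (rule continuous_map_from_subtopology[OF continuous_map_fst])
    have "continuous_map ?S (top_of_set pos_forms) snd"
      by (rule continuous_map_from_subtopology[OF continuous_map_snd])
    then have c1: "continuous_map ?S (top_of_set (tile g)) snd"
      by (auto simp: continuous_map_in_subtopology)
    have c2: "continuous_map (top_of_set (tile g)) (top_of_set {0..1}) (\<lambda>q. 1 - slope g q)"
      using slope_bounds[OF g] continuous_on_slope[OF g]
      by (auto simp: continuous_map_in_subtopology intro!: continuous_intros)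
    have "continuous_map ?S (top_of_set {0..1}) (\<lambda>z. 1 - slope g (snd z))"
      using continuous_map_compose[OF c1 c2] by (simp only: o_def)
    with fstc have "continuous_map ?S (prod_topology (simplex_top n) (top_of_set {0..1})) (\<lambda>z. (fst z, 1 - slope g (snd z)))"
      by (rule continuous_map_pairedI)
    from continuous_map_compose[OF this continuous_map_measure_point_coupling[OF
          poset_family_diagram[OF diagram_twist[OF h]] edge_subset_tri flag_prod_subset[OF g]]]
    show "continuous_map ?S (classifying_space IR_category) (?f g)"
      by (simp add: o_def classifying_space_def)
  next
    fix g g' z assume "g \<in> {g. invertible g}" "g' \<in> {g. invertible g}" "z \<in> topspace ?Z \<inter> ?T g \<inter> ?T g'"
    then show "?f g z = ?f g' z" using val[of g z] val[of g' z] by simp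
  next
    fix z assume z: "z \<in> topspace ?Z"
    then have "snd z \<in> pos_forms" by auto
    then obtain g where g: "invertible g" "snd z \<in> tile g" by (rule tile_exists)
    then show "\<exists>j. j \<in> {g. invertible g} \<and> z \<in> ?T j \<and> (case z of (t, q) \<Rightarrow> twist_point n h t q) = ?f j z"
      using z val[of g z] by (intro exI[of _ g]) (auto simp: case_prod_unfold)
  qed
qed

text \<open>An increasing sequence \<open>Y\<close> jumps at most once, from the basis to the
  superbase of one flag, say at \<open>k\<close>. The averaged form then has basis coordinate
  \<open>partial_sum t k\<close>, so the cut falls between two pieces and the coupling reduces to
  the chain of the pairs \<open>(i, Y i)\<close>. This is the source of the identity at the start of
  the homotopy on the category of the action.\<close>

lemma twist_point_diagonal:
  assumes h: "\<And>i. i \<le> n \<Longrightarrow> invertible (h i)" and t: "t \<in> standard_simplex n"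
    and Y: "\<And>i. i \<le> n \<Longrightarrow> Y i \<in> IR" "\<And>i j. i \<le> j \<Longrightarrow> j \<le> n \<Longrightarrow> Y i \<subseteq> Y j"
  shows "twist_point n h t (\<Sum>i\<le>n. t i *\<^sub>R barycentre (Y i)) =
    simplex_class (nerve IR_category) n (diagram_simplex (twist_obj h) (twist_mor h) n (\<lambda>i. (i, Y i))) t"
proof -
  have "Y 0 \<in> IR" "Y n \<in> IR" "Y 0 \<subseteq> Y n" using Y by auto
  then obtain g where g: "invertible g" "\<And>W. W \<in> IR \<Longrightarrow> Y 0 \<subseteq> W \<Longrightarrow> W \<subseteq> Y n \<Longrightarrow> W = edge_set g \<or> W = tri_set g"
    by (rule IR_interval) (rule that, assumption+)
  have flag: "Y i = edge_set g \<or> Y i = tri_set g" if "i \<le> n" for i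
    using that Y by (intro g(2)) auto
  \<comment> \<open>The alternative \<open>Suc n\<close> covers sequences that never reach the
    superbase.\<close>
  define k where "k = (LEAST i. i = Suc n \<or> Y i = tri_set g)"
  have k: "k = Suc n \<or> Y k = tri_set g" unfolding k_def by (rule LeastI[of _ "Suc n"]) simp
  have kn: "k \<le> Suc n" unfolding k_def by (rule Least_le) simp
  have Yk: "Y i = (if i < k then edge_set g else tri_set g)" if "i \<le> n" for i
  proof (cases "i < k")
    case True
    then have "Y i \<noteq> tri_set g" unfolding k_def using not_less_Least by blast
    then show ?thesis using flag[OF that] True by simp
  next
    case False
    then have "Y k = tri_set g" "Y k \<subseteq> Y i" using k that Y(2)[of k i] by auto
    then have "Y i \<noteq> edge_set g" using edge_psubset_tri[OF g(1)] by auto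
    then show ?thesis using flag[OF that] False by simp
  qed
  define u where "u = partial_sum t k"
  have u: "0 \<le> u" "u \<le> 1"
    unfolding u_def using partial_sum_nonneg[OF t] partial_sum_mono[OF t kn] partial_sum_full[OF t, of "Suc n"] by auto
  have "(\<Sum>i\<le>n. t i *\<^sub>R barycentre (Y i)) =
      (\<Sum>i\<le>n. (if i < k then t i else 0) *\<^sub>R barycentre (edge_set g) + (t i - (if i < k then t i else 0)) *\<^sub>R barycentre (tri_set g))"
    by (rule sum.cong) (auto simp: Yk)
  also have "\<dots> = (\<Sum>i\<le>n. if i < k then t i else 0) *\<^sub>R barycentre (edge_set g) +
      ((\<Sum>i\<le>n. t i) - (\<Sum>i\<le>n. if i < k then t i else 0)) *\<^sub>R barycentre (tri_set g)"
    by (simp only: sum.distrib scaleR_sum_left[symmetric] sum_subtractf)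
  also have "(\<Sum>i\<le>n. if i < k then t i else 0) = u"
  proof -
    have "(\<Sum>i\<le>n. if i < k then t i else 0) = (\<Sum>i\<in>{..n} \<inter> {i. i < k}. t i)"
      by (simp add: sum.inter_restrict)
    also have "{..n} \<inter> {i. i < k} = {..<k}" using kn by auto
    finally show ?thesis by (simp add: u_def partial_sum_def)
  qed
  also have "(\<Sum>i\<le>n. t i) = 1" by (rule standard_simplexD(4)[OF t])
  finally have q: "(\<Sum>i\<le>n. t i *\<^sub>R barycentre (Y i)) =
      (1 - (1 - u)) *\<^sub>R barycentre (edge_set g) + (1 - u) *\<^sub>R barycentre (tri_set g)" by simp
  let ?q = "\<Sum>i\<le>n. t i *\<^sub>R barycentre (Y i)"
  have tile: "?q \<in> tile g" "slope g ?q = 1 - u"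
    unfolding q using flag_form[OF g(1), of "1 - u"] u by auto
  let ?c = "\<lambda>i. (i, if i < k then edge_set g else tri_set g)"
  have "flag_coupling t ?q = push_measure n ?c t"
    using flag_coupling_eq[OF g(1) tile(1) t] coupling_cut[OF t, of k u] tile(2) by (simp add: u_def)
  moreover have cm: "chain_map ({..n} \<times> IR) n ?c"
    using edge_subset_tri[of g] edge_set_in_IR[OF g(1)] tri_set_in_IR[OF g(1)] by (auto simp: chain_map_def mono_on_def)
  ultimately have "twist_point n h t ?q = simplex_class (nerve IR_category) n (diagram_simplex (twist_obj h) (twist_mor h) n ?c) t"
    unfolding twist_point_def
    using poset_family.measure_point_eq[OF poset_family_diagram[OF diagram_twist[OF h]] cm t] by simp
  also have "diagram_simplex (twist_obj h) (twist_mor h) n ?c = diagram_simplex (twist_obj h) (twist_mor h) n (\<lambda>i. (i, Y i))"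
    by (rule poset_family.simplex_cong[OF poset_family_diagram[OF diagram_twist[OF h]]]) (simp_all add: Yk)
  finally show ?thesis .
qed

section \<open>The projection to the linear group is a homotopy equivalence\<close>

text \<open>The matrix part of a simplex of either nerve, so that one construction serves both
  categories.\<close>

definition cocycle :: "nat \<Rightarrow> (nat \<times> nat \<Rightarrow> int ^ 2 ^ 2) \<Rightarrow> bool" where
  "cocycle n f \<longleftrightarrow> (\<forall>i j. i \<le> j \<and> j \<le> n \<longrightarrow> invertible (f (i, j))) \<and> (\<forall>i\<le>n. f (i, i) = mat 1) \<and>
     (\<forall>i j k. i \<le> j \<and> j \<le> k \<and> k \<le> n \<longrightarrow> f (i, k) = f (j, k) ** f (i, j))"

text \<open>The form \<open>p i\<close> lives at the vertex \<open>i\<close>; the transition matrices \<open>f\<close> move all forms to the vertex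
  \<open>0\<close>, where they can be averaged.\<close>

definition cone_point :: "nat \<Rightarrow> (nat \<times> nat \<Rightarrow> int ^ 2 ^ 2) \<Rightarrow> (nat \<Rightarrow> form) \<Rightarrow> (nat \<Rightarrow> real) \<Rightarrow>
    ((nat \<times> (nat \<Rightarrow> (int ^ 2) set) \<times> (nat \<times> nat \<Rightarrow> int ^ 2 ^ 2)) \<times> (nat \<Rightarrow> real)) set" where
  "cone_point n f p t = twist_point n (\<lambda>i. matrix_inv (f (0, i))) t (\<Sum>i\<le>n. t i *\<^sub>R act (matrix_inv (f (0, i))) (p i))"

lemma cocycleD:
  assumes "cocycle n f"
  shows "i \<le> j \<Longrightarrow> j \<le> n \<Longrightarrow> invertible (f (i, j))" "i \<le> n \<Longrightarrow> f (i, i) = mat 1"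
    "i \<le> j \<Longrightarrow> j \<le> k \<Longrightarrow> k \<le> n \<Longrightarrow> f (i, k) = f (j, k) ** f (i, j)"
  using assms[unfolded cocycle_def, THEN conjunct1] assms[unfolded cocycle_def, THEN conjunct2, THEN conjunct1]
    assms[unfolded cocycle_def, THEN conjunct2, THEN conjunct2, rule_format, of i j k] by auto

lemma cocycle_IR_category: "x \<in> Simplices (nerve IR_category) n \<Longrightarrow> cocycle n (snd x)"
proof -
  assume "x \<in> Simplices (nerve IR_category) n"
  note d = nerve_simplex_diagram[OF this]
  show ?thesis
    unfolding cocycle_def
  proof (intro conjI allI impI)
    show "invertible (snd x (i, j))" if "i \<le> j \<and> j \<le> n" for i j
      using diagramD(3)[OF d, of i j] that by (simp add: IR_category_def)
    show "snd x (i, i) = mat 1" if "i \<le> n" for i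
      using diagramD(2)[OF d, of i] that by (simp add: IR_category_def)
    show "snd x (i, k) = snd x (j, k) ** snd x (i, j)" if "i \<le> j \<and> j \<le> k \<and> k \<le> n" for i j k
      using diagramD(4)[OF d, of i j k] that by (simp add: IR_category_def)
  qed
qed

lemma cocycle_GL2_category: "x \<in> Simplices (nerve GL2_category) n \<Longrightarrow> cocycle n (snd x)"
proof -
  assume "x \<in> Simplices (nerve GL2_category) n"
  note d = nerve_simplex_diagram[OF this]
  show ?thesis
    unfolding cocycle_def
  proof (intro conjI allI impI)
    show "invertible (snd x (i, j))" if "i \<le> j \<and> j \<le> n" for i j
      using diagramD(3)[OF d, of i j] that by (simp add: delooping_def GL_int_def)
    show "snd x (i, i) = mat 1" if "i \<le> n" for i
      using diagramD(2)[OF d, of i] that by (simp add: delooping_def GL_int_def)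
    show "snd x (i, k) = snd x (j, k) ** snd x (i, j)" if "i \<le> j \<and> j \<le> k \<and> k \<le> n" for i j k
      using diagramD(4)[OF d, of i j k] that by (simp add: delooping_def GL_int_def)
  qed
qed

lemma sum_push_simplex_scaleR:
  fixes F :: "nat \<Rightarrow> 'v::real_vector"
  assumes "simplex_op m n \<theta>"
  shows "(\<Sum>j\<le>n. push_simplex m \<theta> t j *\<^sub>R F j) = (\<Sum>i\<le>m. t i *\<^sub>R F (\<theta> i))"
proof -
  have "(\<Sum>j\<le>n. push_simplex m \<theta> t j *\<^sub>R F j) = (\<Sum>j\<le>n. \<Sum>i\<in>{i \<in> {..m}. \<theta> i = j}. t i *\<^sub>R F (\<theta> i))"
    unfolding push_simplex_def scaleR_sum_left by (intro sum.cong) auto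
  also have "\<dots> = (\<Sum>i\<le>m. t i *\<^sub>R F (\<theta> i))"
    by (rule sum.group) (use assms in \<open>auto simp: simplex_op_def\<close>)
  finally show ?thesis .
qed

lemma cone_form_pos:
  assumes h: "\<And>i. i \<le> n \<Longrightarrow> invertible (h i)" and p: "\<And>i. i \<le> n \<Longrightarrow> p i \<in> pos_forms" and t: "t \<in> standard_simplex n"
  shows "(\<Sum>i\<le>n. t i *\<^sub>R act (h i) (p i)) \<in> pos_forms"
  using standard_simplexD[OF t] by (intro convex_sum convex_pos_forms) (auto intro: act_pos_forms h p)

text \<open>Pulling back along \<open>\<theta>\<close> replaces the reference vertex 0 by
  \<open>\<theta> 0\<close>; equivariance of \<open>twist_point\<close> under the transition matrix
  between the two absorbs this.\<close>

lemma cone_point_Pull: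
  assumes f: "cocycle n f" and \<theta>: "simplex_op m n \<theta>" and t: "t \<in> standard_simplex m"
    and p: "\<And>i. i \<le> n \<Longrightarrow> p i \<in> pos_forms"
    and f': "\<And>i. i \<le> m \<Longrightarrow> f' (0, i) = f (\<theta> 0, \<theta> i)" and p': "\<And>i. i \<le> m \<Longrightarrow> p' i = p (\<theta> i)"
  shows "cone_point m f' p' t = cone_point n f p (push_simplex m \<theta> t)"
proof -
  have \<theta>n: "\<theta> i \<le> n" "\<theta> 0 \<le> \<theta> i" if "i \<le> m" for i
    using \<theta> that by (auto simp: simplex_op_def image_subset_iff mono_on_def)
  define h where "h i = matrix_inv (f (0, i))" for i
  define h' where "h' i = matrix_inv (f' (0, i))" for i
  have inv: "invertible (h i)" if "i \<le> n" for i
    unfolding h_def using cocycleD(1)[OF f] that by (simp add: invertible_matrix_inv)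
  have inv': "invertible (h' i)" if "i \<le> m" for i
    unfolding h'_def f'[OF that] using cocycleD(1)[OF f] \<theta>n[OF that] by (simp add: invertible_matrix_inv)
  have hh: "(h \<circ> \<theta>) i = h (\<theta> 0) ** h' i" if "i \<le> m" for i
  proof -
    have "f (0, \<theta> i) = f (\<theta> 0, \<theta> i) ** f (0, \<theta> 0)"
      by (rule cocycleD(3)[OF f]) (use \<theta>n[OF that] in auto)
    then show ?thesis
      using cocycleD(1)[OF f] \<theta>n[OF that] \<theta>n[of 0] that by (simp add: h_def h'_def f' matrix_inv_mult)
  qed
  let ?q = "\<Sum>i\<le>m. t i *\<^sub>R act (h' i) (p' i)"
  have k: "invertible (h (\<theta> 0))" using inv \<theta>n[of 0] by simp
  have q: "?q \<in> pos_forms"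
    by (rule cone_form_pos[OF inv' _ t]) (use p p' \<theta>n in auto)
  have act_q: "act (h (\<theta> 0)) ?q = (\<Sum>j\<le>n. push_simplex m \<theta> t j *\<^sub>R act (h j) (p j))"
  proof -
    have "act (h (\<theta> 0)) ?q = (\<Sum>i\<le>m. t i *\<^sub>R act (h (\<theta> i)) (p (\<theta> i)))"
      unfolding act_sum act_scaleR act_mult[symmetric]
    proof (rule sum.cong[OF refl])
      fix i assume "i \<in> {..m}"
      then have i: "i \<le> m" by simp
      show "t i *\<^sub>R act (h (\<theta> 0) ** h' i) (p' i) = t i *\<^sub>R act (h (\<theta> i)) (p (\<theta> i))"
        unfolding hh[OF i, symmetric] p'[OF i] by simp
    qed
    then show ?thesis by (simp only: sum_push_simplex_scaleR[OF \<theta>])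
  qed
  have "twist_point m h' t ?q = twist_point m (h \<circ> \<theta>) t (act (h (\<theta> 0)) ?q)"
    by (rule twist_point_equivariant[OF inv' t q k hh])
  also have "\<dots> = twist_point n h (push_simplex m \<theta> t) (act (h (\<theta> 0)) ?q)"
    by (rule twist_point_Pull[OF inv t act_pos_forms[OF k q] \<theta>])
  finally show ?thesis
    unfolding cone_point_def h_def[symmetric] h'_def[symmetric] act_q .
qed

lemma continuous_map_scaleR_const:
  fixes v :: "'v::real_normed_vector"
  assumes "continuous_map Z euclideanreal f"
  shows "continuous_map Z euclidean (\<lambda>z. f z *\<^sub>R v)"
proof -
  have "continuous_map euclideanreal euclidean (\<lambda>x. x *\<^sub>R v)"
    by (simp add: continuous_on_scaleR)
  from continuous_map_compose[OF assms this] show ?thesis by (simp add: o_def)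
qed

lemma segment_pos_forms:
  "a \<in> pos_forms \<Longrightarrow> b \<in> pos_forms \<Longrightarrow> s \<in> {0..1} \<Longrightarrow> (1 - s) *\<^sub>R a + s *\<^sub>R b \<in> pos_forms"
  using convex_pos_forms by (auto simp: convex_alt)

lemma continuous_map_cone_point:
  assumes f: "cocycle n f" and a: "\<And>i. i \<le> n \<Longrightarrow> a i \<in> pos_forms" and b: "b \<in> pos_forms"
  shows "continuous_map (prod_topology (top_of_set {0..1}) (simplex_top n)) (classifying_space IR_category)
    (\<lambda>(s, t). cone_point n f (\<lambda>i. (1 - s) *\<^sub>R a i + s *\<^sub>R b) t)"
proof -
  let ?Z = "prod_topology (top_of_set {0..1::real}) (simplex_top n)"
  let ?h = "\<lambda>i. matrix_inv (f (0, i))"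
  have inv: "invertible (?h i)" if "i \<le> n" for i
    using cocycleD(1)[OF f] that by (simp add: invertible_matrix_inv)
  let ?q = "\<lambda>z. \<Sum>i\<le>n. snd z i *\<^sub>R act (?h i) ((1 - fst z) *\<^sub>R a i + fst z *\<^sub>R b)"
  have fstc: "continuous_map ?Z euclideanreal fst"
    using continuous_map_fst continuous_map_into_fulltopology by blast
  have coord: "continuous_map ?Z euclideanreal (\<lambda>z. snd z i)" for i
    using continuous_map_compose[OF continuous_map_snd continuous_map_simplex_coord] by (simp add: o_def)
  have "?q = (\<lambda>z. \<Sum>i\<le>n. (snd z i * (1 - fst z)) *\<^sub>R act (?h i) (a i) + (snd z i * fst z) *\<^sub>R act (?h i) b)"
    by (simp add: act_add act_scaleR scaleR_add_right)
  moreover have "continuous_map ?Z euclidean \<dots>"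
    by (intro continuous_map_sum continuous_map_add continuous_map_scaleR_const continuous_map_real_mult
        continuous_map_diff fstc coord) auto
  ultimately have "continuous_map ?Z euclidean ?q" by simp
  moreover have "?q z \<in> pos_forms" if "z \<in> topspace ?Z" for z
    by (rule cone_form_pos[OF inv]) (use that a b in \<open>auto intro!: segment_pos_forms\<close>)
  ultimately have "continuous_map ?Z (top_of_set pos_forms) ?q"
    by (auto simp: continuous_map_in_subtopology)
  then have "continuous_map ?Z (prod_topology (simplex_top n) (top_of_set pos_forms)) (\<lambda>z. (snd z, ?q z))"
    by (rule continuous_map_pairedI[OF continuous_map_snd])
  from continuous_map_compose[OF this continuous_map_twist_point[OF inv]] show ?thesis
    unfolding cone_point_def case_prod_unfold o_def by simp
qed

text \<open>Transported to the vertex 0, the sets of the simplex form an increasing sequence and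
  their barycentres are averaged there. So the diagonal case applies, and transport back to the
  vertices restores \<open>x\<close>.\<close>

lemma cone_point_barycentre:
  assumes x: "x \<in> Simplices (nerve IR_category) n" and t: "t \<in> standard_simplex n"
  shows "cone_point n (snd x) (\<lambda>i. barycentre (fst x i)) t = simplex_class (nerve IR_category) n x t"
proof -
  note f = cocycle_IR_category[OF x] and d = nerve_simplex_diagram[OF x]
  let ?h = "\<lambda>i. matrix_inv (snd x (0, i))"
  let ?Y = "\<lambda>i. (*v) (?h i) ` fst x i"
  have inv0: "invertible (snd x (0, i))" if "i \<le> n" for i using cocycleD(1)[OF f] that by simp
  have inv: "invertible (?h i)" if "i \<le> n" for i using inv0[OF that] by (rule invertible_matrix_inv)
  have X: "fst x i \<in> IR" if "i \<le> n" for i using diagramD(1)[OF d] that by (simp add: IR_category_def)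
  have sub: "(*v) (snd x (i, j)) ` fst x i \<subseteq> fst x j" if "i \<le> j" "j \<le> n" for i j
    using diagramD(3)[OF d] that by (simp add: IR_category_def)
  have cancel: "?h j ** snd x (i, j) = ?h i" if "i \<le> j" "j \<le> n" for i j
  proof -
    have "snd x (0, j) = snd x (i, j) ** snd x (0, i)" by (rule cocycleD(3)[OF f]) (use that in auto)
    then have "?h j = ?h i ** matrix_inv (snd x (i, j))"
      using matrix_inv_mult[of "snd x (i, j)" "snd x (0, i)"] cocycleD(1)[OF f] that by simp
    then show ?thesis using matrix_inv_cancel(4)[of "snd x (i, j)" "?h i"] cocycleD(1)[OF f] that by simp
  qed
  have "(\<Sum>i\<le>n. t i *\<^sub>R act (?h i) (barycentre (fst x i))) = (\<Sum>i\<le>n. t i *\<^sub>R barycentre (?Y i))"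
    by (rule sum.cong) (auto simp: barycentre_image[OF inv])
  then have "cone_point n (snd x) (\<lambda>i. barycentre (fst x i)) t =
      simplex_class (nerve IR_category) n (diagram_simplex (twist_obj ?h) (twist_mor ?h) n (\<lambda>i. (i, ?Y i))) t"
    unfolding cone_point_def
  proof (simp only:, intro twist_point_diagonal[OF inv t])
    show "?Y i \<in> IR" if "i \<le> n" for i by (rule IR_image[OF inv[OF that] X[OF that]])
    show "?Y i \<subseteq> ?Y j" if "i \<le> j" "j \<le> n" for i j
      using image_mono[OF sub[OF that], of "(*v) (?h j)"] by (simp add: image_matrix_mult cancel[OF that])
  qed
  also have "diagram_simplex (twist_obj ?h) (twist_mor ?h) n (\<lambda>i. (i, ?Y i)) =
      diagram_simplex (fst x) (\<lambda>i j. snd x (i, j)) n id"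
  proof -
    have "twist_obj ?h (i, ?Y i) = fst x i" if "i \<le> n" for i
      using inv0[OF that] by (simp add: twist_obj_def image_matrix_mult matrix_inv_inv matrix_inv_right invertible_matrix_inv)
    moreover have "twist_mor ?h (i, ?Y i) (j, ?Y j) = snd x (i, j)" if "i \<le> j" "j \<le> n" for i j
      using cancel[OF that] inv0[of j] inv0[of i] that matrix_inv_cancel(2)[of "snd x (0, j)" "snd x (i, j)"]
      by (simp add: twist_mor_def matrix_inv_inv)
    ultimately show ?thesis by (auto simp: diagram_simplex_def restrict_def fun_eq_iff)
  qed
  also have "\<dots> = x" by (rule nerve_simplex_eq_diagram_simplex[OF x, symmetric])
  finally show ?thesis .
qed

lemma push_simplex_shuffle:
  assumes t: "t \<in> standard_simplex n" and k: "k \<le> n" "partial_sum t k \<le> u" "u \<le> partial_sum t (Suc k)"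
  shows "push_simplex (Suc n) (fst \<circ> shuffle k a b) (shuffle_weights t u k) = t"
proof
  fix i
  \<comment> \<open>The first marginal is the coupling with a one-point second factor, which is
    \<open>t\<close> itself.\<close>
  have "fst (shuffle k a b j) = i \<longleftrightarrow> shuffle k () () j = (i, ())" for j
    by (auto simp: shuffle_def)
  then have "push_simplex (Suc n) (fst \<circ> shuffle k a b) (shuffle_weights t u k) i =
      push_measure (Suc n) (shuffle k () ()) (shuffle_weights t u k) (i, ())"
    by (simp add: push_simplex_def push_measure_def)
  also have "\<dots> = t i" unfolding push_measure_shuffle[OF t k] by (simp add: coupling_def)
  finally show "push_simplex (Suc n) (fst \<circ> shuffle k a b) (shuffle_weights t u k) i = t i" .
qed

abbreviation IR_to_GL2 where
  "IR_to_GL2 \<equiv> classifying_map IR_category GL2_category (\<lambda>_. ()) (\<lambda>_ _ g. g)"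

text \<open>The transition matrices along a shuffle are those of \<open>x\<close>, so the lift
  projects to a degeneracy of \<open>x\<close>, whose weights push forward to \<open>t\<close>. Thus
  the projection undoes every lift exactly, not just up to homotopy.\<close>

lemma IR_to_GL2_cone_point:
  assumes x: "x \<in> Simplices (nerve GL2_category) n" and t: "t \<in> standard_simplex n"
    and p: "\<And>i. i \<le> n \<Longrightarrow> p i \<in> pos_forms"
  shows "IR_to_GL2 (cone_point n (snd x) p t) = simplex_class (nerve GL2_category) n x t"
proof -
  note f = cocycle_GL2_category[OF x]
  let ?h = "\<lambda>i. matrix_inv (snd x (0, i))"
  let ?q = "\<Sum>i\<le>n. t i *\<^sub>R act (?h i) (p i)"
  have inv0: "invertible (snd x (0, i))" if "i \<le> n" for i using cocycleD(1)[OF f] that by simp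
  have inv: "invertible (?h i)" if "i \<le> n" for i using inv0[OF that] by (rule invertible_matrix_inv)
  have "?q \<in> pos_forms" by (rule cone_form_pos[OF inv p t])
  then obtain g where g: "invertible g" "?q \<in> tile g" by (rule tile_exists)
  obtain k where k: "k \<le> n" "partial_sum t k \<le> 1 - slope g ?q" "1 - slope g ?q \<le> partial_sum t (Suc k)"
    using shuffle_cut_exists[OF t, of "1 - slope g ?q"] slope_bounds[OF g] by auto
  let ?s = "shuffle k (edge_set g) (tri_set g)" and ?w = "shuffle_weights t (1 - slope g ?q) k"
  let ?y = "diagram_simplex (twist_obj ?h) (twist_mor ?h) (Suc n) ?s"
  have cp: "cone_point n (snd x) p t = simplex_class (nerve IR_category) (Suc n) ?y ?w"
    unfolding cone_point_def by (rule twist_point_shuffle[OF inv g t k])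
  have w: "?w \<in> standard_simplex (Suc n)"
    by (rule shuffle_weights_in_standard_simplex[OF t _ _ k]) (use slope_bounds[OF g] in auto)
  have y: "?y \<in> Simplices (nerve IR_category) (Suc n)"
    by (rule diagram_simplex_in_nerve[OF diagram_twist[OF inv] chain_map_shuffle[OF k(1) edge_subset_tri flag_prod_subset[OF g(1)]]])
  have \<theta>: "simplex_op (Suc n) n (fst \<circ> ?s)"
    using k(1) by (auto simp: simplex_op_def mono_on_def shuffle_def)
  have "IR_to_GL2 (cone_point n (snd x) p t) = simplex_class (nerve GL2_category) (Suc n) (nerve_map (\<lambda>_. ()) (\<lambda>_ _ g. g) (Suc n) ?y) ?w"
    unfolding cp by (rule classifying_map(2)[OF is_functor_IR_GL2 y w])
  also have "nerve_map (\<lambda>_. ()) (\<lambda>_ _ g. g) (Suc n) ?y = Pull (nerve GL2_category) (Suc n) (fst \<circ> ?s) x"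
  proof -
    have mor: "twist_mor ?h (?s i) (?s j) = snd x (fst (?s i), fst (?s j))" if "i \<le> j" "j \<le> Suc n" for i j
    proof -
      have ij: "fst (?s i) \<le> fst (?s j)" "fst (?s j) \<le> n" "fst (?s i) \<le> n"
        using that k(1) by (auto simp: shuffle_def)
      have "snd x (0, fst (?s j)) = snd x (fst (?s i), fst (?s j)) ** snd x (0, fst (?s i))"
        by (rule cocycleD(3)[OF f]) (use ij in auto)
      then have "snd x (0, fst (?s j)) ** ?h (fst (?s i)) = snd x (fst (?s i), fst (?s j))"
        using matrix_inv_cancel(3)[OF inv0[OF ij(3)]] by simp
      then show ?thesis using inv0[OF ij(2)] by (simp add: twist_mor_def case_prod_unfold matrix_inv_inv)
    qed
    then show ?thesis
      unfolding nerve_map_diagram_simplex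
      by (auto simp: diagram_simplex_def nerve_def case_prod_unfold restrict_def fun_eq_iff)
  qed
  also have "simplex_class (nerve GL2_category) (Suc n) (Pull (nerve GL2_category) (Suc n) (fst \<circ> ?s) x) ?w =
      simplex_class (nerve GL2_category) n x t"
    unfolding simplex_class_Pull[OF pull_closed_nerve \<theta> x w] push_simplex_shuffle[OF t k] ..
  finally show ?thesis .
qed

text \<open>The inverse places one fixed form at every vertex. It is a strict section; the other
  composite is joined to the identity by moving the barycentres linearly to the fixed form.\<close>

theorem IR_category_homotopy_equivalent_GL2:
  "classifying_space IR_category homotopy_equivalent_space classifying_space GL2_category"
proof -
  define b :: form where "b = (1, 0, 1)"
  have b: "b \<in> pos_forms" unfolding b_def by (rule pos_formsI) auto
  obtain G where G: "continuous_map (classifying_space GL2_category) (classifying_space IR_category) G"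
    "\<And>n x t. x \<in> Simplices (nerve GL2_category) n \<Longrightarrow> t \<in> standard_simplex n \<Longrightarrow>
      G (simplex_class (nerve GL2_category) n x t) = cone_point n (snd x) (\<lambda>_. b) t"
    unfolding classifying_space_def[of GL2_category]
  proof (rule realization_map_out[OF pull_closed_nerve, of GL2_category "classifying_space IR_category" "\<lambda>n x. cone_point n (snd x) (\<lambda>_. b)"])
    fix n and x :: "(nat \<Rightarrow> unit) \<times> (nat \<times> nat \<Rightarrow> int ^ 2 ^ 2)"
    assume x: "x \<in> Simplices (nerve GL2_category) n"
    have "continuous_map (simplex_top n) (prod_topology (top_of_set {0..1::real}) (simplex_top n)) (\<lambda>t. (1, t))"
      by (simp add: continuous_map_pairedI)
    from continuous_map_compose[OF this continuous_map_cone_point[OF cocycle_GL2_category[OF x] b b]]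
    show "continuous_map (simplex_top n) (classifying_space IR_category) (cone_point n (snd x) (\<lambda>_. b))"
      by (simp add: o_def)
  next
    fix m n \<theta> x t
    assume *: "simplex_op m n \<theta>" "x \<in> Simplices (nerve GL2_category) n" "t \<in> standard_simplex m"
    show "cone_point m (snd (Pull (nerve GL2_category) m \<theta> x)) (\<lambda>_. b) t = cone_point n (snd x) (\<lambda>_. b) (push_simplex m \<theta> t)"
      by (rule cone_point_Pull[OF cocycle_GL2_category[OF *(2)] *(1,3) b]) (simp_all add: snd_Pull_nerve)
  qed blast
  note F = classifying_map[OF is_functor_IR_GL2]
  have "homotopic_with (\<lambda>_. True) (classifying_space IR_category) (classifying_space IR_category) id (G \<circ> IR_to_GL2)"
    unfolding classifying_space_def[of IR_category]
  proof (rule realization_homotopic[OF pull_closed_nerve, where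
        h = "\<lambda>n x s t. cone_point n (snd x) (\<lambda>i. (1 - s) *\<^sub>R barycentre (fst x i) + s *\<^sub>R b) t"])
    have pos: "barycentre (fst x i) \<in> pos_forms" if "x \<in> Simplices (nerve IR_category) n" "i \<le> n" for x n i
      using diagramD(1)[OF nerve_simplex_diagram[OF that(1)]] that(2) by (intro barycentre_pos) (simp add: IR_category_def)
    fix n and x :: "(nat \<Rightarrow> (int ^ 2) set) \<times> (nat \<times> nat \<Rightarrow> int ^ 2 ^ 2)"
    assume x: "x \<in> Simplices (nerve IR_category) n"
    show "continuous_map (prod_topology (top_of_set {0..1}) (simplex_top n)) (realization (nerve IR_category))
        (\<lambda>(s, t). cone_point n (snd x) (\<lambda>i. (1 - s) *\<^sub>R barycentre (fst x i) + s *\<^sub>R b) t)"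
      using continuous_map_cone_point[OF cocycle_IR_category[OF x] pos[OF x] b] by (simp add: classifying_space_def)
    fix m \<theta> t and s :: real
    assume *: "simplex_op m n \<theta>" "t \<in> standard_simplex m" "s \<in> {0..1}"
    show "cone_point m (snd (Pull (nerve IR_category) m \<theta> x))
          (\<lambda>i. (1 - s) *\<^sub>R barycentre (fst (Pull (nerve IR_category) m \<theta> x) i) + s *\<^sub>R b) t =
        cone_point n (snd x) (\<lambda>i. (1 - s) *\<^sub>R barycentre (fst x i) + s *\<^sub>R b) (push_simplex m \<theta> t)"
      by (rule cone_point_Pull[OF cocycle_IR_category[OF x] *(1,2)])
         (use segment_pos_forms[OF pos[OF x] b *(3)] in \<open>simp_all add: snd_Pull_nerve fst_Pull_nerve\<close>)
  next
    fix n x t assume x: "x \<in> Simplices (nerve IR_category) n" and t: "t \<in> standard_simplex n"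
    show "cone_point n (snd x) (\<lambda>i. (1 - 0) *\<^sub>R barycentre (fst x i) + 0 *\<^sub>R b) t = id (simplex_class (nerve IR_category) n x t)"
      using cone_point_barycentre[OF x t] by simp
    let ?y = "nerve_map (\<lambda>_. ()) (\<lambda>_ _ g. g) n x :: (nat \<Rightarrow> unit) \<times> (nat \<times> nat \<Rightarrow> int ^ 2 ^ 2)"
    \<comment> \<open>The matrix families of \<open>x\<close> and \<open>?y\<close> agree wherever
      \<open>cone_point\<close> evaluates them; naturality for the identity operator expresses
      this.\<close>
    have "cone_point n (snd x) (\<lambda>_. b) t = cone_point n (snd ?y) (\<lambda>_. b) t"
    proof -
      have "simplex_op n n id" by (simp add: simplex_op_def mono_on_def)
      moreover have "push_simplex n id t = t"
      proof
        fix j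
        have "push_simplex n id t j = (\<Sum>i | i \<le> n \<and> i = j. t i)" by (simp add: push_simplex_def)
        also have "{i. i \<le> n \<and> i = j} = (if j \<le> n then {j} else {})" by auto
        finally show "push_simplex n id t j = t j"
          using standard_simplexD(3)[OF t, of j] by (auto split: if_splits simp del: id_apply simp: id_def)
      qed
      ultimately show ?thesis
        using cone_point_Pull[OF cocycle_IR_category[OF x] _ t, of id "\<lambda>_. b" "snd ?y" "\<lambda>_. b"] b
        by (simp add: nerve_map_def diagram_simplex_def)
    qed
    then show "cone_point n (snd x) (\<lambda>i. (1 - 1) *\<^sub>R barycentre (fst x i) + 1 *\<^sub>R b) t =
        (G \<circ> IR_to_GL2) (simplex_class (nerve IR_category) n x t)"
      using G(2)[OF nerve_map_in_Simplices[OF is_functor_IR_GL2 x] t] F(2)[OF x t] by simp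
  qed
  then have 1: "homotopic_with (\<lambda>_. True) (classifying_space IR_category) (classifying_space IR_category) (G \<circ> IR_to_GL2) id"
    by (rule homotopic_with_symD)
  have "(IR_to_GL2 \<circ> G) z = id z" if "z \<in> topspace (classifying_space GL2_category)" for z
    using that G(2) IR_to_GL2_cone_point b by (auto simp: classifying_space_def topspace_realization)
  then have 2: "homotopic_with (\<lambda>_. True) (classifying_space GL2_category) (classifying_space GL2_category) (IR_to_GL2 \<circ> G) id"
    by (intro homotopic_with_equal continuous_map_compose[OF G(1) F(1)]) auto
  show ?thesis
    unfolding homotopy_equivalent_space_def using F(1) G(1) 1 2 by blast
qed

section \<open>Signed circuits and lattice representations of regular matroids of rank two\<close>

section \<open>Circuits of signed vector configurations\<close>

definition pos_dependent :: "('c \<Rightarrow> 'c) \<Rightarrow> ('c \<Rightarrow> 'v::real_vector) \<Rightarrow> 'c set \<Rightarrow> bool" where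
  "pos_dependent \<beta> \<rho> S \<longleftrightarrow> S \<noteq> {} \<and> S \<inter> \<beta> ` S = {} \<and> (\<exists>a. (\<forall>e\<in>S. 0 < a e) \<and> (\<Sum>e\<in>S. a e *\<^sub>R \<rho> e) = 0)"

definition circuit :: "'c set \<Rightarrow> ('c \<Rightarrow> 'c) \<Rightarrow> ('c \<Rightarrow> 'v::real_vector) \<Rightarrow> 'c set \<Rightarrow> bool" where
  "circuit A \<beta> \<rho> S \<longleftrightarrow> S \<subseteq> A \<and> pos_dependent \<beta> \<rho> S \<and> (\<forall>T. T \<subset> S \<longrightarrow> \<not> pos_dependent \<beta> \<rho> T)"

text \<open>Independence of an indexed family: two elements with the same vector are
  dependent.\<close>

definition independent_family :: "('c \<Rightarrow> 'v::real_vector) \<Rightarrow> 'c set \<Rightarrow> bool" where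
  "independent_family \<rho> I \<longleftrightarrow> (\<forall>c. (\<Sum>e\<in>I. c e *\<^sub>R \<rho> e) = 0 \<longrightarrow> (\<forall>e\<in>I. c e = 0))"

lemma independent_familyD:
  "independent_family \<rho> I \<Longrightarrow> (\<Sum>e\<in>I. c e *\<^sub>R \<rho> e) = 0 \<Longrightarrow> e \<in> I \<Longrightarrow> c e = 0"
  by (simp add: independent_family_def)

lemma independent_family_iff:
  assumes "finite I"
  shows "independent_family \<rho> I \<longleftrightarrow> inj_on \<rho> I \<and> independent (\<rho> ` I)"
proof
  assume fam: "independent_family \<rho> I"
  have inj: "inj_on \<rho> I"
  proof (rule inj_onI, rule ccontr)
    fix x y assume xy: "x \<in> I" "y \<in> I" "\<rho> x = \<rho> y" "x \<noteq> y"
    let ?c = "\<lambda>e. (if e = x then 1 else 0) - (if e = y then 1 else 0) :: real"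
    have "(\<Sum>e\<in>I. ?c e *\<^sub>R \<rho> e) = (\<Sum>e\<in>I. if e = x then \<rho> e else 0) - (\<Sum>e\<in>I. if e = y then \<rho> e else 0)"
      unfolding sum_subtractf[symmetric] by (intro sum.cong) auto
    also have "\<dots> = 0" using assms xy by simp
    finally have "(\<Sum>e\<in>I. ?c e *\<^sub>R \<rho> e) = 0" .
    then have "?c x = 0"
      using xy(1) by (rule independent_familyD[OF fam])
    then show False using xy(4) by simp
  qed
  moreover have "independent (\<rho> ` I)"
  proof
    assume "dependent (\<rho> ` I)"
    then obtain u v where uv: "v \<in> \<rho> ` I" "u v \<noteq> 0" "(\<Sum>v\<in>\<rho> ` I. u v *\<^sub>R v) = 0"
      unfolding dependent_finite[OF finite_imageI[OF assms]] by blast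
    then have "(\<Sum>e\<in>I. u (\<rho> e) *\<^sub>R \<rho> e) = 0" using inj by (simp add: sum.reindex)
    then have "\<forall>e\<in>I. u (\<rho> e) = 0" using independent_familyD[OF fam, of "\<lambda>e. u (\<rho> e)"] by blast
    then show False using uv by auto
  qed
  ultimately show "inj_on \<rho> I \<and> independent (\<rho> ` I)" ..
next
  assume ii: "inj_on \<rho> I \<and> independent (\<rho> ` I)"
  show "independent_family \<rho> I"
    unfolding independent_family_def
  proof (intro allI impI ballI)
    fix c e assume sum: "(\<Sum>e\<in>I. c e *\<^sub>R \<rho> e) = 0" and e: "e \<in> I"
    let ?u = "\<lambda>v. c (inv_into I \<rho> v)"
    have "(\<Sum>v\<in>\<rho> ` I. ?u v *\<^sub>R v) = (\<Sum>e\<in>I. c e *\<^sub>R \<rho> e)"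
      using ii by (simp add: sum.reindex)
    then have "?u (\<rho> e) = 0"
      using independentD[of "\<rho> ` I" "\<rho> ` I" ?u "\<rho> e"] ii sum assms e by simp
    then show "c e = 0" using ii e by simp
  qed
qed

locale signed_config =
  fixes A :: "'c set" and \<beta> :: "'c \<Rightarrow> 'c" and \<rho> :: "'c \<Rightarrow> 'v::real_vector"
  assumes finite: "finite A" and inv_in: "\<And>e. e \<in> A \<Longrightarrow> \<beta> e \<in> A"
    and inv_inv: "\<And>e. e \<in> A \<Longrightarrow> \<beta> (\<beta> e) = e" and neg: "\<And>e. e \<in> A \<Longrightarrow> \<rho> (\<beta> e) = - \<rho> e"
begin

lemma sum_inv:
  assumes "B \<subseteq> A"
  shows "(\<Sum>e\<in>\<beta> ` B. f e) = (\<Sum>e\<in>B. f (\<beta> e))"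
  using assms inv_inv by (subst sum.reindex) (auto simp: inj_on_def subset_iff, metis)

lemma image_inv_inv: "B \<subseteq> A \<Longrightarrow> \<beta> ` \<beta> ` B = B"
  using inv_inv by (force simp: image_image subset_iff)

lemma mem_inv_iff: "B \<subseteq> A \<Longrightarrow> e \<in> A \<Longrightarrow> e \<in> \<beta> ` B \<longleftrightarrow> \<beta> e \<in> B"
  using inv_inv by (metis (no_types, lifting) image_iff subset_iff)

text \<open>Folding a relation along the involution leaves the coefficient \<open>c e - c (\<beta> e)\<close> at \<open>e\<close>.\<close>

lemma pos_dependent_from_relation:
  assumes rel: "(\<Sum>e\<in>A. c e *\<^sub>R \<rho> e) = 0" and e0: "e0 \<in> A" "c (\<beta> e0) \<noteq> c e0"
  shows "pos_dependent \<beta> \<rho> {e \<in> A. c (\<beta> e) < c e}"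
proof -
  let ?S = "{e \<in> A. c (\<beta> e) < c e}" and ?Z = "{e \<in> A. c (\<beta> e) = c e}"
  have bS: "\<beta> ` ?S = {e \<in> A. c e < c (\<beta> e)}"
    using inv_in inv_inv by (force simp: image_iff)
  have bZ: "\<beta> ` ?Z = ?Z"
    using inv_in inv_inv by (force simp: image_iff)
  \<comment> \<open>Where the coefficients at \<open>e\<close> and \<open>\<beta> e\<close>
    coincide, the terms cancel in pairs, so this part of the sum is its own negative.\<close>
  have "(\<Sum>e\<in>?Z. c e *\<^sub>R \<rho> e) = (\<Sum>e\<in>\<beta> ` ?Z. c e *\<^sub>R \<rho> e)" by (simp only: bZ)
  also have "\<dots> = (\<Sum>e\<in>?Z. c (\<beta> e) *\<^sub>R \<rho> (\<beta> e))" by (rule sum_inv) auto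
  also have "\<dots> = - (\<Sum>e\<in>?Z. c e *\<^sub>R \<rho> e)"
    unfolding sum_negf[symmetric] by (rule sum.cong) (auto simp: neg)
  finally have Z: "(\<Sum>e\<in>?Z. c e *\<^sub>R \<rho> e) = 0"
    by (simp add: eq_neg_iff_add_eq_0 flip: scaleR_2)
  let ?T = "{e \<in> A. c e < c (\<beta> e)}"
  have fin: "Finite_Set.finite ?Z" "Finite_Set.finite ?S" "Finite_Set.finite ?T" "Finite_Set.finite (?S \<union> ?T)"
    using finite by simp_all
  have dis: "?Z \<inter> (?S \<union> ?T) = {}" "?S \<inter> ?T = {}" by auto
  have "A = ?Z \<union> (?S \<union> ?T)" by auto
  then have "(\<Sum>e\<in>A. c e *\<^sub>R \<rho> e) = (\<Sum>e\<in>?Z \<union> (?S \<union> ?T). c e *\<^sub>R \<rho> e)"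
    by (rule sum.cong) (rule refl)
  also have "\<dots> = (\<Sum>e\<in>?Z. c e *\<^sub>R \<rho> e) + ((\<Sum>e\<in>?S. c e *\<^sub>R \<rho> e) + (\<Sum>e\<in>?T. c e *\<^sub>R \<rho> e))"
    by (simp only: sum.union_disjoint[OF fin(1,4) dis(1)] sum.union_disjoint[OF fin(2,3) dis(2)])
  also have "(\<Sum>e\<in>?T. c e *\<^sub>R \<rho> e) = (\<Sum>e\<in>\<beta> ` ?S. c e *\<^sub>R \<rho> e)" by (simp only: bS)
  also have "(\<Sum>e\<in>\<beta> ` ?S. c e *\<^sub>R \<rho> e) = (\<Sum>e\<in>?S. c (\<beta> e) *\<^sub>R \<rho> (\<beta> e))" by (rule sum_inv) auto
  also have "(\<Sum>e\<in>?S. c (\<beta> e) *\<^sub>R \<rho> (\<beta> e)) = (\<Sum>e\<in>?S. - c (\<beta> e) *\<^sub>R \<rho> e)"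
    by (rule sum.cong) (auto simp: neg)
  finally have "(\<Sum>e\<in>?S. (c e - c (\<beta> e)) *\<^sub>R \<rho> e) = 0"
    using rel Z by (simp add: scaleR_diff_left sum_subtractf sum_negf)
  moreover have "?S \<noteq> {}"
  proof (cases "c (\<beta> e0) < c e0")
    case False
    then have "\<beta> e0 \<in> ?S" using e0 inv_in inv_inv by auto
    then show ?thesis by blast
  qed (use e0 in blast)
  moreover have "?S \<inter> \<beta> ` ?S = {}" unfolding bS by auto
  moreover have "\<forall>e\<in>?S. 0 < c e - c (\<beta> e)" by simp
  ultimately show ?thesis
    unfolding pos_dependent_def by (intro conjI exI[of _ "\<lambda>e. c e - c (\<beta> e)"])
qed

lemma circuit_exists:
  assumes "pos_dependent \<beta> \<rho> S" "S \<subseteq> A"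
  obtains C where "circuit A \<beta> \<rho> C" "C \<subseteq> S"
proof -
  have "finite S" using assms(2) finite finite_subset by blast
  then have "\<exists>C\<subseteq>S. circuit A \<beta> \<rho> C"
    using assms
  proof (induction S rule: finite_psubset_induct)
    case (psubset S)
    show ?case
    proof (cases "\<exists>T. T \<subset> S \<and> pos_dependent \<beta> \<rho> T")
      case True
      then obtain T where T: "T \<subset> S" "pos_dependent \<beta> \<rho> T" by blast
      then have "\<exists>C\<subseteq>T. circuit A \<beta> \<rho> C" using psubset by blast
      then show ?thesis using T(1) by blast
    next
      case False
      then show ?thesis using psubset.prems unfolding circuit_def by blast
    qed
  qed
  then show thesis using that by blast
qed

lemma pos_dependent_inv:
  assumes "pos_dependent \<beta> \<rho> S" "S \<subseteq> A"
  shows "pos_dependent \<beta> \<rho> (\<beta> ` S)"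
proof -
  obtain a where a: "\<forall>e\<in>S. 0 < a e" "(\<Sum>e\<in>S. a e *\<^sub>R \<rho> e) = 0" and S: "S \<noteq> {}" "S \<inter> \<beta> ` S = {}"
    using assms(1) by (auto simp: pos_dependent_def)
  have "(\<Sum>e\<in>\<beta> ` S. a (\<beta> e) *\<^sub>R \<rho> e) = (\<Sum>e\<in>S. a (\<beta> (\<beta> e)) *\<^sub>R \<rho> (\<beta> e))"
    by (rule sum_inv[OF assms(2)])
  also have "\<dots> = - (\<Sum>e\<in>S. a e *\<^sub>R \<rho> e)"
    unfolding sum_negf[symmetric] using assms(2) inv_inv neg by (intro sum.cong) auto
  finally have "(\<Sum>e\<in>\<beta> ` S. a (\<beta> e) *\<^sub>R \<rho> e) = 0" using a(2) by simp
  moreover have "\<forall>e\<in>\<beta> ` S. 0 < a (\<beta> e)" using a(1) assms(2) inv_inv by auto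
  moreover have "\<beta> ` S \<inter> \<beta> ` \<beta> ` S = {}" using S(2) image_inv_inv[OF assms(2)] by auto
  ultimately show ?thesis
    using S(1) unfolding pos_dependent_def by (intro conjI exI[of _ "\<lambda>e. a (\<beta> e)"]) simp_all
qed

lemma circuit_inv:
  assumes "circuit A \<beta> \<rho> C"
  shows "circuit A \<beta> \<rho> (\<beta> ` C)"
proof -
  have C: "C \<subseteq> A" "pos_dependent \<beta> \<rho> C" "\<And>T. T \<subset> C \<Longrightarrow> \<not> pos_dependent \<beta> \<rho> T"
    using assms by (auto simp: circuit_def)
  have "\<not> pos_dependent \<beta> \<rho> T" if "T \<subset> \<beta> ` C" for T
  proof
    assume T: "pos_dependent \<beta> \<rho> T"
    have "T \<subseteq> A" using that C(1) inv_in by blast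
    then have "pos_dependent \<beta> \<rho> (\<beta> ` T)" using pos_dependent_inv T by blast
    moreover have "\<beta> ` T \<subset> C"
    proof -
      have "\<beta> ` T \<subseteq> C" using that image_inv_inv[OF C(1)] by blast
      moreover have "\<beta> ` T \<noteq> C" using that image_inv_inv[OF \<open>T \<subseteq> A\<close>] by blast
      ultimately show ?thesis by blast
    qed
    ultimately show False using C(3) by blast
  qed
  then show ?thesis
    using C(1) inv_in pos_dependent_inv[OF C(2,1)] unfolding circuit_def by blast
qed

text \<open>If the circuits are disjoint, \<open>C1\<close> lies in the opposite of
  \<open>C2\<close>. Otherwise a multiple of the relation of \<open>C1\<close> is subtracted from
  that of \<open>C2\<close> so that an element of \<open>C2\<close> disappears while no sign on
  \<open>C2\<close> is reversed. Minimality of \<open>C2\<close> makes the folded result trivial,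
  and then every element of \<open>C2\<close> occurs in \<open>C1\<close>.\<close>

lemma circuit_incomparable:
  assumes C1: "circuit A \<beta> \<rho> C1" and C2: "circuit A \<beta> \<rho> C2" and sub: "C1 \<subseteq> C2 \<union> \<beta> ` C2"
  shows "C1 = C2 \<or> C1 = \<beta> ` C2"
proof -
  have c: "C1 \<subseteq> A" "C2 \<subseteq> A" using C1 C2 by (auto simp: circuit_def)
  have min1: "T = C1" if "pos_dependent \<beta> \<rho> T" "T \<subseteq> C1" for T
    using C1 that unfolding circuit_def by blast
  have min2: "T = C2" if "pos_dependent \<beta> \<rho> T" "T \<subseteq> C2" for T
    using C2 that unfolding circuit_def by blast
  have p: "pos_dependent \<beta> \<rho> C1" "pos_dependent \<beta> \<rho> C2" using C1 C2 by (auto simp: circuit_def)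
  show ?thesis
  proof (cases "C1 \<inter> C2 = {}")
    case True
    then have "C1 \<subseteq> \<beta> ` C2" using sub by blast
    then have "\<beta> ` C1 \<subseteq> C2" using image_inv_inv[OF c(2)] by blast
    then have "\<beta> ` C1 = C2" using min2[OF pos_dependent_inv[OF p(1) c(1)]] by blast
    then show ?thesis using image_inv_inv[OF c(1)] by auto
  next
    case False
    obtain b where b: "\<forall>e\<in>C1. 0 < b e" "(\<Sum>e\<in>C1. b e *\<^sub>R \<rho> e) = 0" and d1: "C1 \<inter> \<beta> ` C1 = {}"
      using p(1) by (auto simp: pos_dependent_def)
    obtain a where a: "\<forall>e\<in>C2. 0 < a e" "(\<Sum>e\<in>C2. a e *\<^sub>R \<rho> e) = 0" and d2: "C2 \<inter> \<beta> ` C2 = {}"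
      using p(2) by (auto simp: pos_dependent_def)
    have fin: "Finite_Set.finite (C1 \<inter> C2)" using c(1) finite finite_subset by blast
    \<comment> \<open>The largest multiple that keeps the coefficients on the common elements
      nonnegative; at \<open>e0\<close> the coefficient becomes zero.\<close>
    define t where "t = Min ((\<lambda>e. a e / b e) ` (C1 \<inter> C2))"
    have "t \<in> (\<lambda>e. a e / b e) ` (C1 \<inter> C2)" unfolding t_def using False fin by (intro Min_in) auto
    then obtain e0 where e0: "e0 \<in> C1" "e0 \<in> C2" "t = a e0 / b e0" by auto
    have t: "t * b e \<le> a e" if "e \<in> C1" "e \<in> C2" for e
    proof -
      have "t \<le> a e / b e" unfolding t_def using that fin by (intro Min_le) auto
      then show ?thesis using b(1) that by (simp add: field_simps)
    qed
    have t0: "0 < t" using e0 a(1) b(1) by simp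
    define c' where "c' e = (if e \<in> C2 then a e else 0) - t * (if e \<in> C1 then b e else 0)" for e
    have "(\<Sum>e\<in>A. c' e *\<^sub>R \<rho> e) = (\<Sum>e\<in>A. if e \<in> C2 then a e *\<^sub>R \<rho> e else 0) - t *\<^sub>R (\<Sum>e\<in>A. if e \<in> C1 then b e *\<^sub>R \<rho> e else 0)"
      unfolding scaleR_sum_right sum_subtractf[symmetric] c'_def by (rule sum.cong) (auto simp: algebra_simps)
    also have "\<dots> = 0"
      using finite c a(2) b(2) by (simp add: sum.inter_restrict[symmetric] Int_absorb1)
    finally have rel: "(\<Sum>e\<in>A. c' e *\<^sub>R \<rho> e) = 0" .
    have disj: "\<beta> e \<notin> C1" if "e \<in> C1" for e using d1 that by blast
    have disj2: "\<beta> e \<notin> C2" if "e \<in> C2" for e using d2 that by blast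
    have tb: "0 < t * b x" if "x \<in> C1" for x using t0 b(1) that by simp
    have on2: "c' (\<beta> e) \<le> c' e" if "e \<in> C2" for e
    proof -
      have "0 < a e" using a(1) that by blast
      then show ?thesis
        using that t[of e] tb[of "\<beta> e"] disj2[OF that] disj[of e]
        by (cases "e \<in> C1"; cases "\<beta> e \<in> C1") (simp_all add: c'_def)
    qed
    have S2: "{e \<in> A. c' (\<beta> e) < c' e} \<subseteq> C2"
    proof
      fix e assume e: "e \<in> {e \<in> A. c' (\<beta> e) < c' e}"
      show "e \<in> C2"
      proof (rule ccontr)
        assume n: "e \<notin> C2"
        show False
        proof (cases "\<beta> e \<in> C2")
          case True
          then show False using on2[OF True] e inv_inv by auto
        next
          case False
          then have "e \<notin> C1" "\<beta> e \<notin> C1"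
            using n sub e mem_inv_iff[OF c(2)] inv_in inv_inv by (metis (mono_tags, lifting) Un_iff mem_Collect_eq subsetD)+
          then show False using e n False by (simp add: c'_def)
        qed
      qed
    qed
    have e0S: "e0 \<notin> {e \<in> A. c' (\<beta> e) < c' e}"
    proof -
      have "c' e0 = 0" using e0 b(1) by (simp add: c'_def) (metis less_irrefl)
      moreover have "c' (\<beta> e0) = 0" using disj[OF e0(1)] disj2[OF e0(2)] by (simp add: c'_def)
      ultimately show ?thesis by simp
    qed
    \<comment> \<open>A nontrivial folded relation would have its support inside \<open>C2\<close>
      but miss \<open>e0\<close>.\<close>
    have triv: "c' (\<beta> e) = c' e" if "e \<in> A" for e
    proof (rule ccontr)
      assume "c' (\<beta> e) \<noteq> c' e"
      then have "pos_dependent \<beta> \<rho> {e \<in> A. c' (\<beta> e) < c' e}"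
        by (rule pos_dependent_from_relation[OF rel that])
      then have "{e \<in> A. c' (\<beta> e) < c' e} = C2" using min2 S2 by blast
      then show False using e0S e0(2) by blast
    qed
    have "C2 \<subseteq> C1"
    proof
      fix e assume e: "e \<in> C2"
      show "e \<in> C1"
      proof (rule ccontr)
        assume "e \<notin> C1"
        then have "0 < c' e" "c' (\<beta> e) \<le> 0"
          using e a(1) tb[of "\<beta> e"] disj2[OF e] by (auto simp: c'_def)
        then show False using triv[of e] e c(2) by auto
      qed
    qed
    then show ?thesis using min1[OF p(2)] by blast
  qed
qed

text \<open>The combination of the two relations with factors \<open>b e\<close> and
  \<open>- a e\<close> vanishes at \<open>e\<close>. An element of \<open>C1\<close> outside
  \<open>C2\<close> keeps it nontrivial after folding, and a circuit inside its support eliminates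
  \<open>e\<close>.\<close>

lemma circuit_elimination:
  assumes C1: "circuit A \<beta> \<rho> C1" and C2: "circuit A \<beta> \<rho> C2" and ne: "C1 \<noteq> C2" and e: "e \<in> C1" "e \<in> C2"
  obtains C3 where "circuit A \<beta> \<rho> C3" "C3 \<subseteq> (C1 - {e}) \<union> \<beta> ` (C2 - {e})"
proof -
  have c: "C1 \<subseteq> A" "C2 \<subseteq> A" using C1 C2 by (auto simp: circuit_def)
  have p: "pos_dependent \<beta> \<rho> C1" "pos_dependent \<beta> \<rho> C2" using C1 C2 by (auto simp: circuit_def)
  obtain a where a: "\<forall>e\<in>C1. 0 < a e" "(\<Sum>e\<in>C1. a e *\<^sub>R \<rho> e) = 0" and d1: "C1 \<inter> \<beta> ` C1 = {}"
    using p(1) by (auto simp: pos_dependent_def)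
  obtain b where b: "\<forall>e\<in>C2. 0 < b e" "(\<Sum>e\<in>C2. b e *\<^sub>R \<rho> e) = 0" and d2: "C2 \<inter> \<beta> ` C2 = {}"
    using p(2) by (auto simp: pos_dependent_def)
  define c' where "c' x = b e * (if x \<in> C1 then a x else 0) - a e * (if x \<in> C2 then b x else 0)" for x
  have "(\<Sum>x\<in>A. c' x *\<^sub>R \<rho> x) = b e *\<^sub>R (\<Sum>x\<in>A. if x \<in> C1 then a x *\<^sub>R \<rho> x else 0) - a e *\<^sub>R (\<Sum>x\<in>A. if x \<in> C2 then b x *\<^sub>R \<rho> x else 0)"
    unfolding scaleR_sum_right sum_subtractf[symmetric] c'_def by (rule sum.cong) (auto simp: algebra_simps)
  also have "\<dots> = 0"
    using finite c a(2) b(2) by (simp add: sum.inter_restrict[symmetric] Int_absorb1)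
  finally have rel: "(\<Sum>x\<in>A. c' x *\<^sub>R \<rho> x) = 0" .
  have ab: "0 < a e" "0 < b e" using a(1) b(1) e by auto
  \<comment> \<open>Otherwise minimality of \<open>C2\<close> would force equality.\<close>
  have "\<not> C1 \<subseteq> C2" using C2 p(1) ne unfolding circuit_def by blast
  then obtain x where x: "x \<in> C1" "x \<notin> C2" by blast
  have "\<beta> x \<notin> C1" using x(1) d1 by blast
  then have "c' (\<beta> x) \<le> 0" using ab b(1) by (auto simp: c'_def)
  moreover have "0 < c' x" using x ab a(1) by (simp add: c'_def)
  ultimately have "c' (\<beta> x) \<noteq> c' x" by simp
  then have "pos_dependent \<beta> \<rho> {x \<in> A. c' (\<beta> x) < c' x}"
    using pos_dependent_from_relation[OF rel, of x] x(1) c(1) by blast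
  then obtain C3 where C3: "circuit A \<beta> \<rho> C3" "C3 \<subseteq> {x \<in> A. c' (\<beta> x) < c' x}"
    by (rule circuit_exists) auto
  have be: "\<beta> e \<notin> C1" "\<beta> e \<notin> C2" using e d1 d2 by blast+
  have ce: "c' e = 0" "c' (\<beta> e) = 0" using e be by (auto simp: c'_def)
  have "{x \<in> A. c' (\<beta> x) < c' x} \<subseteq> (C1 - {e}) \<union> \<beta> ` (C2 - {e})"
  proof
    fix x assume x: "x \<in> {x \<in> A. c' (\<beta> x) < c' x}"
    have "x \<noteq> e" "\<beta> x \<noteq> e" using x ce inv_inv[of x] by auto
    have "x \<in> C1 \<or> \<beta> x \<in> C2"
    proof (rule ccontr)
      assume "\<not> ?thesis"
      then have "c' x \<le> 0" "0 \<le> c' (\<beta> x)" using ab a(1) b(1) by (auto simp: c'_def)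
      then show False using x by simp
    qed
    then show "x \<in> (C1 - {e}) \<union> \<beta> ` (C2 - {e})"
      using \<open>x \<noteq> e\<close> \<open>\<beta> x \<noteq> e\<close> x inv_inv[of x] by (metis (no_types, lifting) DiffI Un_iff image_eqI mem_Collect_eq singletonD)
  qed
  then show thesis using that C3 by blast
qed

lemma circuit_from_dependent:
  assumes I: "I \<subseteq> A" "I \<inter> \<beta> ` I = {}" and dep: "\<not> independent_family \<rho> I"
  obtains C where "circuit A \<beta> \<rho> C" "C \<subseteq> I \<union> \<beta> ` I"
proof -
  obtain c e0 where c: "(\<Sum>e\<in>I. c e *\<^sub>R \<rho> e) = 0" "e0 \<in> I" "c e0 \<noteq> 0"
    using dep unfolding independent_family_def by blast
  define c' where "c' e = (if e \<in> I then c e else 0)" for e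
  have "(\<Sum>e\<in>A. c' e *\<^sub>R \<rho> e) = (\<Sum>e\<in>A. if e \<in> I then c e *\<^sub>R \<rho> e else 0)"
    by (rule sum.cong) (auto simp: c'_def)
  also have "\<dots> = 0" using finite I(1) c(1) by (simp add: sum.inter_restrict[symmetric] Int_absorb1)
  finally have rel: "(\<Sum>e\<in>A. c' e *\<^sub>R \<rho> e) = 0" .
  have "\<beta> e0 \<notin> I" using c(2) I(2) by blast
  then have "c' (\<beta> e0) \<noteq> c' e0" using c by (simp add: c'_def)
  then have "pos_dependent \<beta> \<rho> {e \<in> A. c' (\<beta> e) < c' e}"
    using pos_dependent_from_relation[OF rel, of e0] c(2) I(1) by blast
  then obtain C where "circuit A \<beta> \<rho> C" "C \<subseteq> {e \<in> A. c' (\<beta> e) < c' e}"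
    by (rule circuit_exists) auto
  moreover have "{e \<in> A. c' (\<beta> e) < c' e} \<subseteq> I \<union> \<beta> ` I"
    using mem_inv_iff[OF I(1)] by (auto simp: c'_def split: if_splits)
  ultimately show thesis using that by blast
qed

lemma circuit_not_independent:
  assumes "pos_dependent \<beta> \<rho> C"
  shows "\<not> independent_family \<rho> C"
  using assms unfolding pos_dependent_def independent_family_def by (metis all_not_in_conv less_irrefl)

end

text \<open>Passing from elements to their opposites only changes signs of vectors, so a relation on
  \<open>C\<close> becomes one on \<open>I\<close> by negating the coefficients at the replaced
  elements.\<close>

lemma (in signed_config) independent_family_signs:
  assumes I: "I \<subseteq> A" "I \<inter> \<beta> ` I = {}" "independent_family \<rho> I"
    and C: "C \<subseteq> I \<union> \<beta> ` I" "C \<inter> \<beta> ` C = {}"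
  shows "independent_family \<rho> C"
  unfolding independent_family_def
proof (intro allI impI ballI)
  fix c e assume rel: "(\<Sum>e\<in>C. c e *\<^sub>R \<rho> e) = 0" and e: "e \<in> C"
  have CA: "C \<subseteq> A" using C(1) I(1) inv_in by blast
  let ?d = "\<lambda>e. if e \<in> C then c e else if \<beta> e \<in> C then - c (\<beta> e) else 0"
  have disj: "\<beta> e \<notin> C" if "e \<in> C" for e using C(2) that by blast
  let ?I1 = "I \<inter> C" and ?I2 = "\<beta> ` I \<inter> C"
  have fin: "Finite_Set.finite I" "Finite_Set.finite C" using I(1) CA finite finite_subset by blast+
  have I2: "\<beta> ` ?I2 = {e \<in> I. \<beta> e \<in> C}"
    using I(1) inv_inv by (force simp: image_iff)
  have "(\<Sum>e\<in>I. ?d e *\<^sub>R \<rho> e) = (\<Sum>e\<in>I. if e \<in> C then c e *\<^sub>R \<rho> e else 0) + (\<Sum>e\<in>I. if e \<in> {e \<in> I. \<beta> e \<in> C} then - c (\<beta> e) *\<^sub>R \<rho> e else 0)"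
    unfolding sum.distrib[symmetric] by (rule sum.cong) (auto dest: disj)
  also have "\<dots> = (\<Sum>e\<in>?I1. c e *\<^sub>R \<rho> e) + (\<Sum>e\<in>I \<inter> {e \<in> I. \<beta> e \<in> C}. - c (\<beta> e) *\<^sub>R \<rho> e)"
    by (simp only: sum.inter_restrict[OF fin(1)])
  also have "I \<inter> {e \<in> I. \<beta> e \<in> C} = \<beta> ` ?I2" unfolding I2 by auto
  also have "(\<Sum>e\<in>\<beta> ` ?I2. - c (\<beta> e) *\<^sub>R \<rho> e) = (\<Sum>e\<in>?I2. - c (\<beta> (\<beta> e)) *\<^sub>R \<rho> (\<beta> e))"
    by (rule sum_inv) (use CA in auto)
  also have "\<dots> = (\<Sum>e\<in>?I2. c e *\<^sub>R \<rho> e)"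
    by (rule sum.cong) (use CA inv_inv neg in auto)
  also have "(\<Sum>e\<in>?I1. c e *\<^sub>R \<rho> e) + (\<Sum>e\<in>?I2. c e *\<^sub>R \<rho> e) = (\<Sum>e\<in>?I1 \<union> ?I2. c e *\<^sub>R \<rho> e)"
    by (rule sum.union_disjoint[symmetric]) (use fin I(2) in auto)
  also have "?I1 \<union> ?I2 = C" using C(1) by auto
  finally have "(\<Sum>e\<in>I. ?d e *\<^sub>R \<rho> e) = 0" using rel by simp
  note d0 = independent_familyD[OF I(3) this]
  show "c e = 0"
  proof (cases "e \<in> I")
    case True
    then show ?thesis using d0[OF True] e by simp
  next
    case False
    then have "\<beta> e \<in> I" using e C(1) mem_inv_iff[OF I(1)] CA by auto
    moreover have "\<beta> (\<beta> e) = e" using e CA inv_inv by auto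
    ultimately show ?thesis using d0[of "\<beta> e"] e disj[OF e] by simp
  qed
qed


section \<open>Representations of freely oriented matroids\<close>

lemma two_fold_fibre:
  assumes "two_fold_covering (Cover M) (Base M) (Proj M)" "e \<in> Cover M"
  shows "{e' \<in> Cover M. Proj M e' = Proj M e} = {e, bar M e}"
proof -
  note b = bar_props[OF assms]
  have card: "card {e' \<in> Cover M. Proj M e' = Proj M e} = 2"
    using assms by (auto simp: two_fold_covering_def)
  have "{e, bar M e} = {e' \<in> Cover M. Proj M e' = Proj M e}"
    by (rule card_subset_eq) (use card b assms(2) in \<open>auto intro: card_ge_0_finite\<close>)
  then show ?thesis ..
qed

lemma bar_bar:
  assumes "two_fold_covering (Cover M) (Base M) (Proj M)" "e \<in> Cover M"
  shows "bar M (bar M e) = e"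
proof -
  note b = bar_props[OF assms] and b' = bar_props[OF assms(1), of "bar M e"]
  have "bar M (bar M e) \<in> {e' \<in> Cover M. Proj M e' = Proj M e}" using b b' by simp
  then show ?thesis using two_fold_fibre[OF assms] b b' by auto
qed

lemma finite_Cover:
  assumes "two_fold_covering (Cover M) (Base M) (Proj M)"
  shows "finite (Cover M)"
proof -
  have "finite {e \<in> Cover M. Proj M e = x}" if "x \<in> Base M" for x
    using assms that by (intro card_ge_0_finite) (auto simp: two_fold_covering_def)
  moreover have "Cover M = (\<Union>x\<in>Base M. {e \<in> Cover M. Proj M e = x})"
    using assms by (auto simp: two_fold_covering_def)
  moreover have "finite (Base M)" using assms by (simp add: two_fold_covering_def)
  ultimately show ?thesis by (metis (no_types, lifting) finite_UN_I)
qed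

lemma Proj_image_subset_iff:
  assumes "two_fold_covering (Cover M) (Base M) (Proj M)" "I \<subseteq> Cover M" "C \<subseteq> Cover M"
  shows "Proj M ` C \<subseteq> Proj M ` I \<longleftrightarrow> C \<subseteq> I \<union> bar M ` I"
proof
  assume L: "Proj M ` C \<subseteq> Proj M ` I"
  show "C \<subseteq> I \<union> bar M ` I"
  proof
    fix e assume e: "e \<in> C"
    then obtain i where i: "i \<in> I" "Proj M e = Proj M i" using L by auto
    then have "e \<in> {e' \<in> Cover M. Proj M e' = Proj M i}" using e assms(3) by auto
    then have "e \<in> {i, bar M i}" using two_fold_fibre[OF assms(1), of i] i(1) assms(2) by (metis subsetD)
    then show "e \<in> I \<union> bar M ` I" using i(1) by auto
  qed
next
  assume R: "C \<subseteq> I \<union> bar M ` I"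
  show "Proj M ` C \<subseteq> Proj M ` I"
    using R bar_props[OF assms(1)] assms(2) by (fastforce simp: image_iff)
qed

lemma inj_on_Proj_iff:
  assumes "two_fold_covering (Cover M) (Base M) (Proj M)" "I \<subseteq> Cover M"
  shows "inj_on (Proj M) I \<longleftrightarrow> I \<inter> bar M ` I = {}"
proof
  assume inj: "inj_on (Proj M) I"
  show "I \<inter> bar M ` I = {}"
  proof (rule ccontr)
    assume "I \<inter> bar M ` I \<noteq> {}"
    then obtain i where "i \<in> I" "bar M i \<in> I" by blast
    then show False using inj bar_props[OF assms(1), of i] assms(2) by (metis inj_onD subsetD)
  qed
next
  assume d: "I \<inter> bar M ` I = {}"
  show "inj_on (Proj M) I"
  proof (rule inj_onI)
    fix x y assume xy: "x \<in> I" "y \<in> I" "Proj M x = Proj M y"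
    then have "x \<in> {e' \<in> Cover M. Proj M e' = Proj M y}" using assms(2) by auto
    then have "x \<in> {y, bar M y}" using two_fold_fibre[OF assms(1), of y] xy(2) assms(2) by (metis subsetD)
    then have "x = y \<or> x = bar M y" by simp
    then show "x = y" using d xy by blast
  qed
qed

text \<open>Expresses independence within the cover: fibres consist of opposite elements, so
  inclusion of projections means inclusion up to opposites.\<close>

lemma signed_independent_iff:
  assumes "two_fold_covering (Cover M) (Base M) (Proj M)" "\<And>C. C \<in> Circuits M \<Longrightarrow> C \<subseteq> Cover M"
  shows "signed_independent M I \<longleftrightarrow> I \<subseteq> Cover M \<and> I \<inter> bar M ` I = {} \<and> \<not> (\<exists>C\<in>Circuits M. C \<subseteq> I \<union> bar M ` I)"
proof (cases "I \<subseteq> Cover M")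
  case True
  then have "Proj M ` I \<subseteq> Base M" using assms(1) by (auto simp: two_fold_covering_def)
  then show ?thesis
    using True Proj_image_subset_iff[OF assms(1) True] assms(2) inj_on_Proj_iff[OF assms(1) True]
    by (auto simp: signed_independent_def base_independent_def)
qed (auto simp: signed_independent_def)

lemma base_independent_lift:
  assumes "two_fold_covering (Cover M) (Base M) (Proj M)" "base_independent M I"
  obtains J where "signed_independent M J" "Proj M ` J = I" "card J = card I"
proof -
  have "I \<subseteq> Proj M ` Cover M"
    using assms by (auto simp: two_fold_covering_def base_independent_def)
  then obtain J where J: "J \<subseteq> Cover M" "inj_on (Proj M) J" "I = Proj M ` J"
    unfolding subset_image_inj by blast
  show thesis
  proof (rule that)
    show "signed_independent M J" using J(1,2) assms(2) unfolding J(3) signed_independent_def by simp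
    show "Proj M ` J = I" by (rule J(3)[symmetric])
    show "card J = card I" unfolding J(3) by (rule card_image[OF J(2), symmetric])
  qed
qed

lemma representation_signed_config:
  assumes fom: "freely_oriented_matroid M" and rep: "representation M \<rho>"
  shows "signed_config (Cover M) (bar M) \<rho>"
proof -
  have cov: "two_fold_covering (Cover M) (Base M) (Proj M)"
    using fom by (simp add: freely_oriented_matroid_def)
  show ?thesis
  proof
    fix e assume e: "e \<in> Cover M"
    show "bar M e \<in> Cover M" using bar_props[OF cov e] by blast
    show "bar M (bar M e) = e" by (rule bar_bar[OF cov e])
    have "\<rho> e + \<rho> (bar M e) = 0" using rep e by (simp add: representation_def)
    then show "\<rho> (bar M e) = - \<rho> e" by (simp add: eq_neg_iff_add_eq_0 add.commute)
  qed (rule finite_Cover[OF cov])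
qed

lemma freely_oriented_matroidD:
  assumes "freely_oriented_matroid M"
  shows "two_fold_covering (Cover M) (Base M) (Proj M)"
    and "C \<in> Circuits M \<Longrightarrow> C \<noteq> {} \<and> C \<subseteq> Cover M" and "C \<in> Circuits M \<Longrightarrow> C \<inter> bar M ` C = {}"
    and "C \<in> Circuits M \<Longrightarrow> bar M ` C \<in> Circuits M"
    and "C1 \<in> Circuits M \<Longrightarrow> C2 \<in> Circuits M \<Longrightarrow> C1 \<subseteq> C2 \<union> bar M ` C2 \<Longrightarrow> C1 = C2 \<or> C1 = bar M ` C2"
proof -
  note f = assms[unfolded freely_oriented_matroid_def]
  show "two_fold_covering (Cover M) (Base M) (Proj M)" by (rule f[THEN conjunct1])
  show "C \<in> Circuits M \<Longrightarrow> C \<noteq> {} \<and> C \<subseteq> Cover M"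
    using f[THEN conjunct2, THEN conjunct1] by (rule bspec)
  show "C \<in> Circuits M \<Longrightarrow> C \<inter> bar M ` C = {}"
    using f[THEN conjunct2, THEN conjunct2, THEN conjunct1] by (rule bspec)
  show "C \<in> Circuits M \<Longrightarrow> bar M ` C \<in> Circuits M"
    using f[THEN conjunct2, THEN conjunct2, THEN conjunct2, THEN conjunct1] by (rule bspec)
  show "C1 \<in> Circuits M \<Longrightarrow> C2 \<in> Circuits M \<Longrightarrow> C1 \<subseteq> C2 \<union> bar M ` C2 \<Longrightarrow> C1 = C2 \<or> C1 = bar M ` C2"
    by (rule f[THEN conjunct2, THEN conjunct2, THEN conjunct2, THEN conjunct2, THEN conjunct1, rule_format])
qed

text \<open>A positively dependent set contains a circuit of \<open>M\<close> up to opposites, since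
  otherwise it would be independent and so would be its image. Both notions of circuit satisfy
  incomparability up to opposites, and therefore they coincide.\<close>

lemma representation_circuits:
  assumes fom: "freely_oriented_matroid M" and rep: "representation M \<rho>"
  shows "Circuits M = {C. circuit (Cover M) (bar M) \<rho> C}"
proof -
  interpret S: signed_config "Cover M" "bar M" \<rho>
    by (rule representation_signed_config[OF assms])
  note cov = freely_oriented_matroidD(1)[OF fom] and C0 = freely_oriented_matroidD(2,3)[OF fom]
    and Cbar = freely_oriented_matroidD(4)[OF fom] and Cinc = freely_oriented_matroidD(5)[OF fom]
  have pd: "pos_dependent (bar M) \<rho> C" if "C \<in> Circuits M" for C
    using rep C0[OF that] that unfolding representation_def pos_dependent_def by blast
  have star: "\<exists>C\<in>Circuits M. C \<subseteq> S \<union> bar M ` S" if S: "pos_dependent (bar M) \<rho> S" "S \<subseteq> Cover M" for S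
  proof (rule ccontr)
    assume n: "\<not> ?thesis"
    have "S \<inter> bar M ` S = {}" using S(1) by (simp add: pos_dependent_def)
    then have "signed_independent M S"
      using signed_independent_iff[OF cov, of S] C0(1) S(2) n by blast
    then have "inj_on \<rho> S \<and> independent (\<rho> ` S)" using rep by (simp add: representation_def)
    then have "independent_family \<rho> S"
      using independent_family_iff[of S \<rho>] finite_subset[OF S(2) S.finite] by blast
    then show False using S.circuit_not_independent[OF S(1)] by blast
  qed
  have 1: "circuit (Cover M) (bar M) \<rho> C" if C: "C \<in> Circuits M" for C
  proof -
    have CA: "C \<subseteq> Cover M" using C0(1)[OF C] by blast
    have "\<not> pos_dependent (bar M) \<rho> T" if T: "T \<subset> C" for T
    proof
      assume "pos_dependent (bar M) \<rho> T"
      then obtain D where D: "D \<in> Circuits M" "D \<subseteq> T \<union> bar M ` T" using star T CA by blast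
      then have "D \<subseteq> C \<union> bar M ` C" using T by blast
      then have "D = C \<or> D = bar M ` C" using Cinc D(1) C by blast
      then have "C \<subseteq> T \<union> bar M ` T"
      proof
        assume "D = bar M ` C"
        then have "bar M ` D = C" using S.image_inv_inv[OF CA] by simp
        moreover have "bar M ` D \<subseteq> bar M ` T \<union> bar M ` bar M ` T" using D(2) by blast
        moreover have "bar M ` bar M ` T = T" by (rule S.image_inv_inv) (use T CA in blast)
        ultimately show ?thesis by blast
      qed (use D(2) in blast)
      moreover have "C \<inter> bar M ` T = {}" using C0(2)[OF C] T by blast
      ultimately show False using T by blast
    qed
    then show ?thesis unfolding circuit_def using CA pd[OF C] by blast
  qed
  have 2: "C \<in> Circuits M" if C: "circuit (Cover M) (bar M) \<rho> C" for C
  proof -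
    have CA: "C \<subseteq> Cover M" "pos_dependent (bar M) \<rho> C" using C by (auto simp: circuit_def)
    then obtain D where D: "D \<in> Circuits M" "D \<subseteq> C \<union> bar M ` C" using star by blast
    then have "D = C \<or> D = bar M ` C" using S.circuit_incomparable[OF 1[OF D(1)] C] by blast
    then show ?thesis using D(1) Cbar[OF D(1)] S.image_inv_inv[OF CA(1)] by auto
  qed
  show ?thesis using 1 2 by blast
qed


section \<open>Lattice representations in rank two\<close>

definition real_vec :: "int ^ 'n \<Rightarrow> real ^ 'n" where
  "real_vec v = (\<chi> i. real_of_int (v$i))"

definition rdet2 :: "real ^ 2 \<Rightarrow> real ^ 2 \<Rightarrow> real" where
  "rdet2 u v = u$1 * v$2 - u$2 * v$1"

definition lattice_config :: "'c set \<Rightarrow> ('c \<Rightarrow> 'c) \<Rightarrow> ('c \<Rightarrow> int ^ 2) \<Rightarrow> bool" where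
  "lattice_config A \<beta> l \<longleftrightarrow> finite A \<and> (\<forall>e\<in>A. \<beta> e \<in> A \<and> \<beta> e \<noteq> e \<and> \<beta> (\<beta> e) = e \<and> l (\<beta> e) = - l e) \<and>
     l ` A - {0} \<in> IR"

definition lattice_rep :: "('a, 'b, 'z) signed_system_scheme \<Rightarrow> ('a \<Rightarrow> int ^ 2) \<Rightarrow> bool" where
  "lattice_rep M l \<longleftrightarrow> lattice_config (Cover M) (bar M) l \<and>
     Circuits M = {C. circuit (Cover M) (bar M) (\<lambda>e. real_vec (l e)) C}"

lemma real_vec_simps: "real_vec (- v) = - real_vec v" "real_vec v = 0 \<longleftrightarrow> v = 0" "real_vec (u + v) = real_vec u + real_vec v"
  "real_vec v $ i = real_of_int (v$i)"
  by (simp_all add: real_vec_def vec_eq_iff)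

lemma real_vec_inject: "real_vec u = real_vec v \<longleftrightarrow> u = v"
  by (simp add: real_vec_def vec_eq_iff)

lemma rdet2_real_vec: "rdet2 (real_vec u) (real_vec v) = real_of_int (det2 u v)"
  by (simp add: rdet2_def det2_def real_vec_def)

lemma lattice_config_signed: "lattice_config A \<beta> l \<Longrightarrow> signed_config A \<beta> (\<lambda>e. real_vec (l e))"
  by unfold_locales (auto simp: lattice_config_def real_vec_simps)

text \<open>The parallelepiped is the image of the unit square under the matrix with columns
  \<open>u\<close> and \<open>v\<close>.\<close>

lemma volume_pair:
  assumes "u \<noteq> v"
  shows "volume {u, v} = \<bar>rdet2 u v\<bar>"
proof -
  let ?f = "\<lambda>x :: real ^ 2. x$1 *\<^sub>R u + x$2 *\<^sub>R v"
  have lin: "linear ?f"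
    by (rule linearI) (simp_all add: algebra_simps)
  have "{\<Sum>b\<in>{u, v}. c b *\<^sub>R b | c. \<forall>b\<in>{u, v}. 0 \<le> c b \<and> c b \<le> 1} = ?f ` cbox 0 1"
  proof (intro Set.set_eqI iffI)
    fix y assume "y \<in> {\<Sum>b\<in>{u, v}. c b *\<^sub>R b | c. \<forall>b\<in>{u, v}. 0 \<le> c b \<and> c b \<le> 1}"
    then obtain c where c: "y = c u *\<^sub>R u + c v *\<^sub>R v" "0 \<le> c u" "c u \<le> 1" "0 \<le> c v" "c v \<le> 1"
      using assms by auto
    let ?x = "vector [c u, c v] :: real ^ 2"
    have "?x \<in> cbox 0 1" using c by (simp add: mem_box_cart forall_2)
    then show "y \<in> ?f ` cbox 0 1" using c(1) by (intro image_eqI[of _ _ ?x]) auto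
  next
    fix y assume "y \<in> ?f ` cbox 0 1"
    then obtain x where x: "y = ?f x" "x \<in> cbox 0 1" by blast
    have "0 \<le> x$i \<and> x$i \<le> 1" for i using x(2) by (simp add: mem_box_cart)
    then show "y \<in> {\<Sum>b\<in>{u, v}. c b *\<^sub>R b | c. \<forall>b\<in>{u, v}. 0 \<le> c b \<and> c b \<le> 1}"
      using assms x(1) by (intro CollectI exI[of _ "\<lambda>b. if b = u then x$1 else x$2"]) auto
  qed
  then have "volume {u, v} = measure lebesgue (?f ` cbox 0 1)"
    by (simp add: volume_def)
  also have "\<dots> = \<bar>det (matrix ?f)\<bar> * measure lebesgue (cbox 0 1 :: (real ^ 2) set)"
    by (rule measure_linear_image[OF lin]) simp
  also have "det (matrix ?f) = rdet2 u v"
    by (simp add: det_2 matrix_def rdet2_def axis_def)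
  also have "measure lebesgue (cbox 0 1 :: (real ^ 2) set) = 1"
    by (simp add: content_cbox_if_cart interval_eq_empty_cart)
  finally show ?thesis by simp
qed

lemma rdet2_expand: "rdet2 u v *\<^sub>R x = rdet2 x v *\<^sub>R u + rdet2 u x *\<^sub>R v"
  by (simp add: vec2_eq_iff rdet2_def algebra_simps)

lemma independent_family_pair:
  assumes "rdet2 (\<rho> e) (\<rho> e') \<noteq> 0"
  shows "independent_family \<rho> {e, e'}"
  unfolding independent_family_def
proof (intro allI impI)
  fix c assume s: "(\<Sum>x\<in>{e, e'}. c x *\<^sub>R \<rho> x) = 0"
  have ne: "e \<noteq> e'" using assms by (auto simp: rdet2_def)
  then have "c e *\<^sub>R \<rho> e + c e' *\<^sub>R \<rho> e' = 0" using s by simp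
  then have *: "c e * \<rho> e $ 1 + c e' * \<rho> e' $ 1 = 0" "c e * \<rho> e $ 2 + c e' * \<rho> e' $ 2 = 0"
    by (auto simp: vec2_eq_iff)
  have "c e * rdet2 (\<rho> e) (\<rho> e') = 0" "c e' * rdet2 (\<rho> e) (\<rho> e') = 0"
    unfolding rdet2_def using * by algebra+
  then show "\<forall>x\<in>{e, e'}. c x = 0" using assms by auto
qed

lemma spanning_pair:
  assumes "span (\<rho> ` A) = (UNIV :: (real ^ 2) set)"
  obtains e e' where "e \<in> A" "e' \<in> A" "rdet2 (\<rho> e) (\<rho> e') \<noteq> 0"
proof -
  have "\<exists>e\<in>A. \<exists>e'\<in>A. rdet2 (\<rho> e) (\<rho> e') \<noteq> 0"
  proof (rule ccontr)
    assume "\<not> ?thesis"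
    then have z: "rdet2 (\<rho> e) (\<rho> e') = 0" if "e \<in> A" "e' \<in> A" for e e' using that by blast
    have sub: "subspace {v. rdet2 u v = 0}" for u
      by (auto simp: subspace_def rdet2_def algebra_simps)
    have "\<rho> e = 0" if "e \<in> A" for e
    proof -
      let ?u = "\<rho> e"
      have "span (\<rho> ` A) \<subseteq> {v. rdet2 ?u v = 0}" by (rule span_minimal[OF _ sub]) (use z that in auto)
      \<comment> \<open>The vector turned by a right angle, whose determinant with \<open>?u\<close>
        is the squared length of \<open>?u\<close>.\<close>
      then have "rdet2 ?u (vector [- (?u$2), ?u$1]) = 0" using assms by auto
      then have "?u$1 * ?u$1 + ?u$2 * ?u$2 = 0" by (simp add: rdet2_def)
      then show ?thesis by (simp add: vec2_eq_iff sum_squares_eq_zero_iff)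
    qed
    then have "span (\<rho> ` A) \<subseteq> {0}" by (intro span_minimal) auto
    then have "(axis 1 1 :: real ^ 2) = 0" using assms by blast
    then show False by simp
  qed
  then show thesis using that by blast
qed

lemma signed_independent_card:
  fixes \<rho> :: "'a \<Rightarrow> real ^ 2"
  assumes "two_fold_covering (Cover M) (Base M) (Proj M)"
    and ind: "\<And>I. signed_independent M I \<Longrightarrow> independent_family \<rho> I"
    and "signed_independent M I"
  shows "card I \<le> 2"
proof -
  have "finite I" using assms(3) finite_Cover[OF assms(1)] by (auto simp: signed_independent_def intro: finite_subset)
  then have "inj_on \<rho> I" "independent (\<rho> ` I)" using ind[OF assms(3)] by (simp_all add: independent_family_iff)
  then show ?thesis using independent_bound[of "\<rho> ` I"] by (simp add: card_image)
qed

lemma base_independent_card: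
  fixes \<rho> :: "'a \<Rightarrow> real ^ 2"
  assumes "two_fold_covering (Cover M) (Base M) (Proj M)"
    and "\<And>I. signed_independent M I \<Longrightarrow> independent_family \<rho> I" and "base_independent M I"
  shows "card I \<le> 2"
  using base_independent_lift[OF assms(1,3)] signed_independent_card[OF assms(1,2)] by metis

text \<open>The pair supports no circuit because its vectors are independent, whatever the signs; it
  is maximal because independent sets have at most two elements in a plane.\<close>

lemma signed_basis_pair:
  fixes \<rho> :: "'a \<Rightarrow> real ^ 2"
  assumes cov: "two_fold_covering (Cover M) (Base M) (Proj M)" and sc: "signed_config (Cover M) (bar M) \<rho>"
    and circ: "\<And>C. C \<in> Circuits M \<Longrightarrow> C \<subseteq> Cover M \<and> pos_dependent (bar M) \<rho> C"
    and ind: "\<And>I. signed_independent M I \<Longrightarrow> independent_family \<rho> I"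
    and e: "e \<in> Cover M" "e' \<in> Cover M" "rdet2 (\<rho> e) (\<rho> e') \<noteq> 0"
  shows "signed_basis M {e, e'}"
proof -
  interpret S: signed_config "Cover M" "bar M" \<rho> by (rule sc)
  have ne: "e \<noteq> e'" "bar M e \<noteq> e'" "bar M e' \<noteq> e"
    using e(3) S.neg[OF e(1)] S.neg[OF e(2)] by (auto simp: rdet2_def)
  have disj: "{e, e'} \<inter> bar M ` {e, e'} = {}"
    using ne bar_props[OF cov e(1)] bar_props[OF cov e(2)] by auto
  have "\<not> C \<subseteq> {e, e'} \<union> bar M ` {e, e'}" if "C \<in> Circuits M" for C
  proof
    assume sub: "C \<subseteq> {e, e'} \<union> bar M ` {e, e'}"
    have C: "C \<subseteq> Cover M" "pos_dependent (bar M) \<rho> C" using circ[OF that] by auto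
    then have "C \<inter> bar M ` C = {}" by (simp add: pos_dependent_def)
    then have "independent_family \<rho> C"
      using S.independent_family_signs[OF _ disj independent_family_pair[of \<rho>, OF e(3)] sub] e by blast
    then show False using S.circuit_not_independent[OF C(2)] by blast
  qed
  then have si: "signed_independent M {e, e'}"
    using signed_independent_iff[OF cov, of "{e, e'}"] circ e disj by blast
  then have bi: "base_independent M (Proj M ` {e, e'})" and inj: "inj_on (Proj M) {e, e'}"
    by (auto simp: signed_independent_def)
  have c2: "card (Proj M ` {e, e'}) = 2" using inj ne by (simp add: card_image)
  have "I = Proj M ` {e, e'}" if I: "base_independent M I" "Proj M ` {e, e'} \<subseteq> I" for I
  proof -
    have "finite I" using I(1) cov by (auto simp: base_independent_def two_fold_covering_def intro: finite_subset)
    moreover have "card I \<le> 2" by (rule base_independent_card[OF cov ind I(1)])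
    ultimately show ?thesis using c2 I(2) card_seteq by metis
  qed
  then show ?thesis
    unfolding signed_basis_def base_basis_def using bi inj e by blast
qed

lemma circuit_linear_image:
  assumes "linear f" "inj f" "\<And>e. e \<in> A \<Longrightarrow> \<rho> e = f (\<tau> e)"
  shows "circuit A \<beta> \<rho> C \<longleftrightarrow> circuit A \<beta> \<tau> C"
proof -
  have pd: "pos_dependent \<beta> \<rho> S \<longleftrightarrow> pos_dependent \<beta> \<tau> S" if "S \<subseteq> A" for S
  proof -
    have "(\<Sum>e\<in>S. a e *\<^sub>R \<rho> e) = f (\<Sum>e\<in>S. a e *\<^sub>R \<tau> e)" for a
      unfolding linear_sum[OF assms(1)] using assms(3) that
      by (intro sum.cong) (auto simp: linear_cmul[OF assms(1)] subset_iff)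
    then have "(\<Sum>e\<in>S. a e *\<^sub>R \<rho> e) = 0 \<longleftrightarrow> (\<Sum>e\<in>S. a e *\<^sub>R \<tau> e) = 0" for a
      using linear_injective_0[OF assms(1)] assms(2) linear_0[OF assms(1)] by metis
    then show ?thesis by (simp add: pos_dependent_def)
  qed
  show ?thesis
  proof (cases "C \<subseteq> A")
    case True
    then have "pos_dependent \<beta> \<rho> T \<longleftrightarrow> pos_dependent \<beta> \<tau> T" if "T \<subset> C" for T
      using that by (intro pd) auto
    then show ?thesis using pd[OF True] by (auto simp: circuit_def)
  qed (simp add: circuit_def)
qed

text \<open>Take coordinates with respect to a fixed basis \<open>p\<close>, \<open>q\<close>. By
  Cramer's rule a coordinate is a quotient of determinants; a nonzero one is a quotient of volumes
  of two bases up to sign. So all coordinates are -1, 0 or 1.\<close>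

theorem lattice_rep_exists:
  assumes M: "regular_of_rank TYPE(2) M"
  shows "\<exists>l. lattice_rep M l"
proof -
  obtain \<rho> :: "'a \<Rightarrow> real ^ 2" where fom: "freely_oriented_matroid M" and uni: "unipotent_representation M \<rho>"
    using M by (auto simp: regular_of_rank_def)
  note rep = uni[unfolded unipotent_representation_def, THEN conjunct1]
    and vol = uni[unfolded unipotent_representation_def, THEN conjunct2, rule_format, OF conjI]
  have cov: "two_fold_covering (Cover M) (Base M) (Proj M)" using fom by (simp add: freely_oriented_matroid_def)
  note sc = representation_signed_config[OF fom rep] and circ = representation_circuits[OF fom rep]
  interpret S: signed_config "Cover M" "bar M" \<rho> by (rule sc)
  have circ': "C \<subseteq> Cover M \<and> pos_dependent (bar M) \<rho> C" if "C \<in> Circuits M" for C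
    using that unfolding circ by (auto simp: circuit_def)
  have ind: "independent_family \<rho> I" if "signed_independent M I" for I
  proof -
    have "finite I" using that S.finite by (auto simp: signed_independent_def intro: finite_subset)
    then show ?thesis using rep that by (simp add: representation_def independent_family_iff)
  qed
  have "span (\<rho> ` Cover M) = UNIV" using rep by (simp add: representation_def)
  then obtain p q where pq: "p \<in> Cover M" "q \<in> Cover M" "rdet2 (\<rho> p) (\<rho> q) \<noteq> 0"
    by (rule spanning_pair)
  let ?D = "rdet2 (\<rho> p) (\<rho> q)"
  have unim: "\<bar>rdet2 (\<rho> e) (\<rho> e')\<bar> = \<bar>?D\<bar>" if e: "e \<in> Cover M" "e' \<in> Cover M" "rdet2 (\<rho> e) (\<rho> e') \<noteq> 0" for e e'
  proof -
    have "volume (\<rho> ` {e, e'}) = volume (\<rho> ` {p, q})"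
      by (rule vol) (rule signed_basis_pair[OF cov sc circ' ind]; use e pq in blast)+
    moreover have "\<rho> e \<noteq> \<rho> e'" "\<rho> p \<noteq> \<rho> q" using e(3) pq(3) by (auto simp: rdet2_def)
    ultimately show ?thesis by (simp add: volume_pair)
  qed
  define x where "x e = rdet2 (\<rho> e) (\<rho> q) / ?D" for e
  define y where "y e = rdet2 (\<rho> p) (\<rho> e) / ?D" for e
  have small: "x e \<in> {-1, 0, 1}" "y e \<in> {-1, 0, 1}" if "e \<in> Cover M" for e
  proof -
    have quot: "r / ?D \<in> {-1, 0, 1}" if "r \<noteq> 0 \<Longrightarrow> \<bar>r\<bar> = \<bar>?D\<bar>" for r
      using that pq(3) by (cases "r = 0") (auto simp: abs_eq_iff)
    show "x e \<in> {-1, 0, 1}" "y e \<in> {-1, 0, 1}"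
      unfolding x_def y_def by (rule quot[OF unim[OF that pq(2)]], assumption)
        (rule quot[OF unim[OF pq(1) that]])
  qed
  have exp: "\<rho> e = x e *\<^sub>R \<rho> p + y e *\<^sub>R \<rho> q" for e
  proof -
    have "(1 / ?D) *\<^sub>R (?D *\<^sub>R \<rho> e) = (1 / ?D) *\<^sub>R (rdet2 (\<rho> e) (\<rho> q) *\<^sub>R \<rho> p + rdet2 (\<rho> p) (\<rho> e) *\<^sub>R \<rho> q)"
      by (rule arg_cong[OF rdet2_expand])
    then show ?thesis using pq(3) by (simp add: x_def y_def scaleR_add_right)
  qed
  define l where "l e = vec2 \<lfloor>x e\<rfloor> \<lfloor>y e\<rfloor>" for e
  have rl: "real_of_int \<lfloor>x e\<rfloor> = x e" "real_of_int \<lfloor>y e\<rfloor> = y e" if "e \<in> Cover M" for e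
  proof -
    have "real_of_int \<lfloor>z\<rfloor> = z" if "z \<in> {-1, 0, 1}" for z :: real
    proof -
      have "z = real_of_int (-1) \<or> z = real_of_int 0 \<or> z = real_of_int 1" using that by auto
      then show ?thesis by (metis floor_of_int)
    qed
    then show "real_of_int \<lfloor>x e\<rfloor> = x e" "real_of_int \<lfloor>y e\<rfloor> = y e"
      using small[OF that] by blast+
  qed
  let ?f = "\<lambda>v :: real ^ 2. v$1 *\<^sub>R \<rho> p + v$2 *\<^sub>R \<rho> q"
  have lin: "linear ?f" by (rule linearI) (simp_all add: algebra_simps)
  have rf: "\<rho> e = ?f (real_vec (l e))" if "e \<in> Cover M" for e
    unfolding l_def real_vec_simps vec2_nth rl[OF that] by (rule exp)
  have injf: "inj ?f"
    unfolding linear_injective_0[OF lin]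
  proof (intro allI impI)
    fix v :: "real ^ 2" assume "?f v = 0"
    then have *: "v$1 * \<rho> p $ 1 + v$2 * \<rho> q $ 1 = 0" "v$1 * \<rho> p $ 2 + v$2 * \<rho> q $ 2 = 0"
      by (auto simp: vec2_eq_iff)
    have "v$1 * ?D = 0" "v$2 * ?D = 0" unfolding rdet2_def using * by algebra+
    then show "v = 0" using pq(3) by (simp add: vec2_eq_iff)
  qed
  have rdet_f: "rdet2 (?f u) (?f v) = rdet2 u v * ?D" for u v
    by (simp add: rdet2_def algebra_simps)
  have det_l: "rdet2 (\<rho> e) (\<rho> e') = real_of_int (det2 (l e) (l e')) * ?D" if "e \<in> Cover M" "e' \<in> Cover M" for e e'
    using rf[OF that(1)] rf[OF that(2)] rdet_f[of "real_vec (l e)" "real_vec (l e')"] by (simp add: rdet2_real_vec)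
  have l_bar: "l (bar M e) = - l e" if "e \<in> Cover M" for e
  proof -
    have "?f (real_vec (l (bar M e))) = ?f (real_vec (- l e))"
      using rf[OF S.inv_in[OF that]] rf[OF that] S.neg[OF that] by (simp add: real_vec_simps)
    then have "real_vec (l (bar M e)) = real_vec (- l e)" by (rule injD[OF injf])
    then show ?thesis by (simp only: real_vec_inject)
  qed
  have "l ` Cover M - {0} \<in> IR"
    unfolding IR_iff
  proof (intro conjI ballI)
    show "uminus ` (l ` Cover M - {0}) = l ` Cover M - {0}"
    proof -
      have "- v \<in> l ` Cover M - {0}" if "v \<in> l ` Cover M - {0}" for v
        using that l_bar S.inv_in by (auto simp: image_iff) (metis minus_minus)
      then show ?thesis by (metis (no_types, lifting) image_subsetI minus_minus subsetI subset_antisym image_eqI)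
    qed
    show "\<exists>u\<in>l ` Cover M - {0}. \<exists>v\<in>l ` Cover M - {0}. \<bar>det2 u v\<bar> = 1"
    proof (intro bexI)
      have "real_of_int (det2 (l p) (l q)) = 1" using det_l[OF pq(1,2)] pq(3) by simp
      then have 1: "det2 (l p) (l q) = 1" by linarith
      then show "\<bar>det2 (l p) (l q)\<bar> = 1" by simp
      show "l p \<in> l ` Cover M - {0}" "l q \<in> l ` Cover M - {0}" using 1 pq by (auto simp: det2_def)
    qed
    show "\<bar>det2 u v\<bar> \<le> 1" if uv: "u \<in> l ` Cover M - {0}" "v \<in> l ` Cover M - {0}" for u v
    proof -
      obtain e e' where e: "u = l e" "v = l e'" "e \<in> Cover M" "e' \<in> Cover M" using uv by blast
      have "\<bar>rdet2 (\<rho> e) (\<rho> e')\<bar> \<le> \<bar>?D\<bar>" using unim[OF e(3,4)] by (cases "rdet2 (\<rho> e) (\<rho> e') = 0") auto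
      then have "\<bar>real_of_int (det2 u v)\<bar> * \<bar>?D\<bar> \<le> 1 * \<bar>?D\<bar>" unfolding det_l[OF e(3,4)] e(1,2) abs_mult by simp
      then have "\<bar>real_of_int (det2 u v)\<bar> \<le> 1" using pq(3) by (simp add: mult_le_cancel_right_pos del: mult_1)
      then show ?thesis by linarith
    qed
  qed simp
  then have "lattice_config (Cover M) (bar M) l"
    using S.finite S.inv_in S.inv_inv l_bar bar_props[OF cov] by (simp add: lattice_config_def)
  moreover have "Circuits M = {C. circuit (Cover M) (bar M) (\<lambda>e. real_vec (l e)) C}"
    unfolding circ by (intro Collect_cong circuit_linear_image[OF lin injf rf])
  ultimately show ?thesis unfolding lattice_rep_def by blast
qed

section \<open>Maps of regular matroids of rank two are induced by linear maps\<close>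

lemma lattice_config_pair:
  assumes "lattice_config A \<beta> l"
  obtains p q where "p \<in> A" "q \<in> A" "\<bar>det2 (l p) (l q)\<bar> = 1"
proof -
  have "l ` A - {0} \<in> IR" using assms by (simp add: lattice_config_def)
  then obtain u v where "u \<in> l ` A - {0}" "v \<in> l ` A - {0}" "\<bar>det2 u v\<bar> = 1" unfolding IR_iff by blast
  then show thesis using that by blast
qed

lemma lattice_config_abs_det2:
  assumes "lattice_config A \<beta> l" "e \<in> A" "e' \<in> A"
  shows "\<bar>det2 (l e) (l e')\<bar> \<le> 1"
proof (cases "l e = 0 \<or> l e' = 0")
  case True
  then show ?thesis by (auto simp: det2_def)
next
  case False
  have "l ` A - {0} \<in> IR" using assms by (simp add: lattice_config_def)
  then have "\<forall>u\<in>l ` A - {0}. \<forall>v\<in>l ` A - {0}. \<bar>det2 u v\<bar> \<le> 1" unfolding IR_iff by blast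
  then show ?thesis using False assms(2,3) by blast
qed

lemma lattice_configD:
  assumes "lattice_config A \<beta> l" "e \<in> A"
  shows "\<beta> e \<in> A" "\<beta> e \<noteq> e" "\<beta> (\<beta> e) = e" "l (\<beta> e) = - l e"
  using assms by (auto simp: lattice_config_def)

lemma independent_family_pair_nonzero:
  fixes \<rho> :: "'c \<Rightarrow> real ^ 2"
  assumes ind: "independent_family \<rho> {e, e'}" and ne: "e \<noteq> e'"
  shows "rdet2 (\<rho> e) (\<rho> e') \<noteq> 0"
proof
  assume z: "rdet2 (\<rho> e) (\<rho> e') = 0"
  have c0: "c = 0 \<and> d = 0" if "c *\<^sub>R \<rho> e + d *\<^sub>R \<rho> e' = 0" for c d
  proof -
    have "(\<Sum>x\<in>{e, e'}. (if x = e then c else d) *\<^sub>R \<rho> x) = 0" using that ne by simp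
    from independent_familyD[OF ind this, of e] independent_familyD[OF ind this, of e'] ne
    show ?thesis by simp
  qed
  have "(\<rho> e' $ i) *\<^sub>R \<rho> e + (- (\<rho> e $ i)) *\<^sub>R \<rho> e' = 0" for i
    using z exhaust_2[of i] by (auto simp: vec2_eq_iff rdet2_def mult.commute)
  then have "\<rho> e' $ i = 0 \<and> - (\<rho> e $ i) = 0" for i by (rule c0)
  then have "\<rho> e = 0" by (simp add: vec_eq_iff)
  then show False using c0[of 1 0] by simp
qed

text \<open>Cramer's rule applied to the relation of \<open>C\<close> determines the sign of each
  coordinate of \<open>l e\<close>. Multiplication by \<open>det2 (l p) (l q)\<close> amounts to
  division by it, as it is a unit.\<close>

lemma circuit_coefficients:
  assumes cfg: "lattice_config A \<beta> l" and pqe: "p \<in> A" "q \<in> A" "e \<in> A" and D: "\<bar>det2 (l p) (l q)\<bar> = 1"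
    and out: "e \<notin> {p, q, \<beta> p, \<beta> q}" and C: "pos_dependent \<beta> (\<lambda>e. real_vec (l e)) C" "e \<in> C" "C \<subseteq> {e, p, q, \<beta> p, \<beta> q}"
  shows "det2 (l e) (l q) * det2 (l p) (l q) = (if p \<in> C then - 1 else if \<beta> p \<in> C then 1 else 0)"
    and "det2 (l p) (l e) * det2 (l p) (l q) = (if q \<in> C then - 1 else if \<beta> q \<in> C then 1 else 0)"
proof -
  note cd = lattice_configD[OF cfg]
  have "p \<noteq> q" "q \<noteq> \<beta> p" "p \<noteq> \<beta> q"
    using D cd(4)[OF pqe(1)] cd(4)[OF pqe(2)] by auto
  then have dist: "distinct [e, p, \<beta> p, q, \<beta> q]"
  proof -
    have "\<beta> p \<noteq> \<beta> q" using \<open>p \<noteq> q\<close> cd(3)[OF pqe(1)] cd(3)[OF pqe(2)] by metis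
    then show ?thesis
      using out cd(2)[OF pqe(1)] cd(2)[OF pqe(2)] \<open>p \<noteq> q\<close> \<open>q \<noteq> \<beta> p\<close> \<open>p \<noteq> \<beta> q\<close> by auto
  qed
  obtain a where a: "\<forall>x\<in>C. 0 < a x" "(\<Sum>x\<in>C. a x *\<^sub>R real_vec (l x)) = 0" and dj: "C \<inter> \<beta> ` C = {}"
    using C(1) by (auto simp: pos_dependent_def)
  let ?a = "\<lambda>x. if x \<in> C then a x else 0"
  define b where "b = ?a p - ?a (\<beta> p)"
  define d where "d = ?a q - ?a (\<beta> q)"
  have nb: "\<not> (p \<in> C \<and> \<beta> p \<in> C)" "\<not> (q \<in> C \<and> \<beta> q \<in> C)" using dj by blast+
  have "(\<Sum>x\<in>C. a x *\<^sub>R real_vec (l x)) = (\<Sum>x\<in>C. ?a x *\<^sub>R real_vec (l x))" by (rule sum.cong) auto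
  also have "\<dots> = (\<Sum>x\<in>set [e, p, \<beta> p, q, \<beta> q]. ?a x *\<^sub>R real_vec (l x))"
    by (rule sum.mono_neutral_left) (use C(3) in auto)
  also have "\<dots> = sum_list (map (\<lambda>x. ?a x *\<^sub>R real_vec (l x)) [e, p, \<beta> p, q, \<beta> q])"
    by (rule sum.distinct_set_conv_list[OF dist])
  also have "\<dots> = a e *\<^sub>R real_vec (l e) + b *\<^sub>R real_vec (l p) + d *\<^sub>R real_vec (l q)"
    using C(2) cd(4)[OF pqe(1)] cd(4)[OF pqe(2)] by (simp add: b_def d_def real_vec_simps algebra_simps)
  finally have rel: "a e *\<^sub>R real_vec (l e) + b *\<^sub>R real_vec (l p) + d *\<^sub>R real_vec (l q) = 0" using a(2) by simp
  have r: "a e * real_of_int (l e $ i) + b * real_of_int (l p $ i) + d * real_of_int (l q $ i) = 0" for i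
    using arg_cong[OF rel, of "\<lambda>v. v $ i"] by (simp add: real_vec_simps)
  let ?D = "det2 (l p) (l q)"
  have "?D = 1 \<or> ?D = - 1" using D by linarith
  then have DD: "?D * ?D = 1" by auto
  have ae: "0 < a e" using a(1) C(2) by blast
  \<comment> \<open>An integer of absolute value at most one equals its sign, and the positive
    factor \<open>a e\<close> does not affect the sign.\<close>
  have key: "k = - sgn_b" if "a e * real_of_int k = - y" "\<bar>k\<bar> \<le> 1" "real_of_int sgn_b = sgn y" for k sgn_b :: int and y :: real
  proof -
    have "k = 0 \<or> k = 1 \<or> k = - 1" using that(2) by linarith
    then have "real_of_int k = - sgn y"
      using that(1) ae by (auto simp: sgn_if)
    then have "real_of_int k = real_of_int (- sgn_b)" using that(3) by simp
    then show ?thesis by (simp only: of_int_eq_iff)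
  qed
  have sb: "real_of_int (if p \<in> C then 1 else if \<beta> p \<in> C then - 1 else 0) = sgn b"
    using a(1) nb(1) by (auto simp: b_def sgn_if)
  have sd: "real_of_int (if q \<in> C then 1 else if \<beta> q \<in> C then - 1 else 0) = sgn d"
    using a(1) nb(2) by (auto simp: d_def sgn_if)
  have small: "\<bar>det2 (l e) (l q) * ?D\<bar> \<le> 1" "\<bar>det2 (l p) (l e) * ?D\<bar> \<le> 1"
    using lattice_config_abs_det2[OF cfg pqe(3,2)] lattice_config_abs_det2[OF cfg pqe(1,3)] D by (simp_all add: abs_mult)
  have "a e * real_of_int (det2 (l e) (l q)) = - b * real_of_int ?D"
    unfolding det2_def using r[of 1] r[of 2] by simp algebra
  then have "a e * real_of_int (det2 (l e) (l q) * ?D) = - b * real_of_int (?D * ?D)" by (simp add: mult.assoc[symmetric])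
  then have "a e * real_of_int (det2 (l e) (l q) * ?D) = - b" unfolding DD by simp
  from key[OF this small(1) sb] show "det2 (l e) (l q) * ?D = (if p \<in> C then - 1 else if \<beta> p \<in> C then 1 else 0)"
    by auto
  have "a e * real_of_int (det2 (l p) (l e)) = - d * real_of_int ?D"
    unfolding det2_def using r[of 1] r[of 2] by simp algebra
  then have "a e * real_of_int (det2 (l p) (l e) * ?D) = - d * real_of_int (?D * ?D)" by (simp add: mult.assoc[symmetric])
  then have "a e * real_of_int (det2 (l p) (l e) * ?D) = - d" unfolding DD by simp
  from key[OF this small(2) sd] show "det2 (l p) (l e) * ?D = (if q \<in> C then - 1 else if \<beta> q \<in> C then 1 else 0)"
    by auto
qed

lemma pos_dependent_image:
  assumes inj: "inj_on f A" and T: "T \<subseteq> A" and \<beta>: "\<And>e. e \<in> A \<Longrightarrow> \<beta> e \<in> A" "\<And>e. e \<in> A \<Longrightarrow> f (\<beta> e) = \<beta>' (f e)"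
  shows "pos_dependent \<beta>' \<rho>' (f ` T) \<longleftrightarrow> pos_dependent \<beta> (\<lambda>e. \<rho>' (f e)) T"
proof -
  have injT: "inj_on f T" using inj T inj_on_subset by blast
  have "\<beta>' ` f ` T = f ` \<beta> ` T" using T \<beta>(2) by (force simp: image_image)
  moreover have "f ` T \<inter> f ` \<beta> ` T = f ` (T \<inter> \<beta> ` T)"
    by (rule inj_on_image_Int[OF inj T, symmetric]) (use T \<beta>(1) in auto)
  ultimately have d: "f ` T \<inter> \<beta>' ` f ` T = {} \<longleftrightarrow> T \<inter> \<beta> ` T = {}" by simp
  have "(\<exists>a. (\<forall>e\<in>f ` T. 0 < a e) \<and> (\<Sum>e\<in>f ` T. a e *\<^sub>R \<rho>' e) = 0) \<longleftrightarrow>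
      (\<exists>a. (\<forall>e\<in>T. 0 < a e) \<and> (\<Sum>e\<in>T. a e *\<^sub>R \<rho>' (f e)) = 0)" (is "(\<exists>a. ?P a) \<longleftrightarrow> (\<exists>a. ?Q a)")
  proof
    assume "\<exists>a. ?P a"
    then obtain a where "?P a" by blast
    then show "\<exists>a. ?Q a" by (intro exI[of _ "\<lambda>e. a (f e)"]) (simp add: sum.reindex[OF injT])
  next
    assume "\<exists>a. ?Q a"
    then obtain a where "?Q a" by blast
    then show "\<exists>a. ?P a"
      by (intro exI[of _ "\<lambda>x. a (inv_into T f x)"]) (simp add: sum.reindex[OF injT] injT)
  qed
  then show ?thesis using d by (simp add: pos_dependent_def)
qed

lemma circuit_image:
  assumes inj: "inj_on f A" and im: "f ` A \<subseteq> A'" and T: "T \<subseteq> A"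
    and \<beta>: "\<And>e. e \<in> A \<Longrightarrow> \<beta> e \<in> A" "\<And>e. e \<in> A \<Longrightarrow> f (\<beta> e) = \<beta>' (f e)"
  shows "circuit A' \<beta>' \<rho>' (f ` T) \<longleftrightarrow> circuit A \<beta> (\<lambda>e. \<rho>' (f e)) T"
proof -
  have pd: "pos_dependent \<beta>' \<rho>' (f ` S) \<longleftrightarrow> pos_dependent \<beta> (\<lambda>e. \<rho>' (f e)) S" if "S \<subseteq> A" for S
    by (rule pos_dependent_image[where f = f and A = A and \<beta> = \<beta> and \<beta>' = \<beta>', OF inj that \<beta>])
  have injT: "inj_on f T" using inj T inj_on_subset by blast
  have "(\<forall>S. S \<subset> f ` T \<longrightarrow> \<not> pos_dependent \<beta>' \<rho>' S) \<longleftrightarrow> (\<forall>S. S \<subset> T \<longrightarrow> \<not> pos_dependent \<beta> (\<lambda>e. \<rho>' (f e)) S)"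
  proof (intro iffI allI impI)
    fix S assume L: "\<forall>S. S \<subset> f ` T \<longrightarrow> \<not> pos_dependent \<beta>' \<rho>' S" and S: "S \<subset> T"
    have "f ` S \<subset> f ` T" using S inj_on_image_eq_iff[OF injT, of S T] by blast
    moreover have "S \<subseteq> A" using S T by blast
    ultimately show "\<not> pos_dependent \<beta> (\<lambda>e. \<rho>' (f e)) S" using L pd by blast
  next
    fix S assume R: "\<forall>S. S \<subset> T \<longrightarrow> \<not> pos_dependent \<beta> (\<lambda>e. \<rho>' (f e)) S" and S: "S \<subset> f ` T"
    then obtain U where U: "U \<subseteq> T" "S = f ` U" by (meson psubset_imp_subset subset_imageE)
    then have "U \<subset> T" "U \<subseteq> A" using S T by blast+
    then show "\<not> pos_dependent \<beta>' \<rho>' S" using R pd U(2) by blast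
  qed
  moreover have "f ` T \<subseteq> A'" using T im by blast
  ultimately show ?thesis
    using pd[OF T] T by (simp add: circuit_def)
qed

definition real_mat :: "int ^ 2 ^ 2 \<Rightarrow> real ^ 2 ^ 2" where
  "real_mat g = (\<chi> i j. real_of_int (g$i$j))"

lemma real_vec_matrix: "real_vec (g *v v) = real_mat g *v real_vec v"
  by (simp add: vec2_eq_iff real_vec_def real_mat_def matrix_vector_mult_2)

lemma inj_real_mat: "invertible g \<Longrightarrow> inj ((*v) (real_mat g))"
proof -
  assume "invertible g"
  then have "det (real_mat g) \<noteq> 0"
    by (auto simp: invertible_int_iff det_2 real_mat_def simp flip: of_int_mult of_int_diff)
  then show ?thesis using inj_matrix_vector_mult invertible_det_nz by blast
qed

text \<open>An injective linear change of vectors preserves all positive relations, so the condition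
  on circuits comes for free.\<close>

lemma matroid_mapsI:
  assumes M: "lattice_rep M l" and N: "lattice_rep N l'" and f: "f \<in> Cover M \<rightarrow>\<^sub>E Cover N" "inj_on f (Cover M)"
    "\<And>e. e \<in> Cover M \<Longrightarrow> f (bar M e) = bar N (f e)"
    and g: "invertible g" "\<And>e. e \<in> Cover M \<Longrightarrow> l' (f e) = g *v l e"
  shows "f \<in> matroid_maps M N"
proof -
  have cfg: "lattice_config (Cover M) (bar M) l" using M by (simp add: lattice_rep_def)
  have "S \<in> Circuits M \<longleftrightarrow> f ` S \<in> Circuits N" if S: "S \<subseteq> Cover M" for S
  proof -
    have "f ` S \<in> Circuits N \<longleftrightarrow> circuit (Cover N) (bar N) (\<lambda>e. real_vec (l' e)) (f ` S)"
      using N by (simp add: lattice_rep_def)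
    also have "\<dots> \<longleftrightarrow> circuit (Cover M) (bar M) (\<lambda>e. real_vec (l' (f e))) S"
      by (rule circuit_image[where f = f and A = "Cover M" and \<beta> = "bar M" and \<beta>' = "bar N", OF f(2) _ S lattice_configD(1)[OF cfg] f(3)]) (use f(1) in auto)
    also have "\<dots> \<longleftrightarrow> circuit (Cover M) (bar M) (\<lambda>e. real_vec (l e)) S"
      by (rule circuit_linear_image[OF matrix_vector_mul_linear inj_real_mat[OF g(1)]]) (simp add: g(2) real_vec_matrix)
    also have "\<dots> \<longleftrightarrow> S \<in> Circuits M" using M by (simp add: lattice_rep_def)
    finally show ?thesis by blast
  qed
  then show ?thesis using f by (auto simp: matroid_maps_def)
qed

lemma matroid_mapsD:
  assumes "f \<in> matroid_maps M N"
  shows "f \<in> Cover M \<rightarrow>\<^sub>E Cover N" "inj_on f (Cover M)" "e \<in> Cover M \<Longrightarrow> f (bar M e) = bar N (f e)"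
    "S \<subseteq> Cover M \<Longrightarrow> S \<in> Circuits M \<longleftrightarrow> f ` S \<in> Circuits N"
  using assms unfolding matroid_maps_def by auto

lemma matrix_vector_smult: "g *v (c *s v) = c *s (g *v v)" for g :: "'a::comm_ring_1 ^ 'n ^ 'm"
  by (simp add: vec_eq_iff matrix_vector_mult_def sum_distrib_left algebra_simps)

text \<open>By unimodularity the coordinates of \<open>e\<close> with respect to a basis \<open>p, q\<close> are \<open>-1\<close>, \<open>0\<close> or \<open>1\<close>, and the
  signed circuit through \<open>e\<close> in \<open>e, p, q\<close> and their opposites shows which.\<close>

lemma matroid_map_linear:
  assumes M: "lattice_rep M l" and N: "lattice_rep N l'" and f: "f \<in> matroid_maps M N"
  shows "\<exists>g. invertible g \<and> (\<forall>e\<in>Cover M. l' (f e) = g *v l e)"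
proof -
  let ?\<rho> = "\<lambda>e. real_vec (l e)" and ?\<rho>' = "\<lambda>e. real_vec (l' e)"
  note fm = matroid_mapsD[OF f]
  have cM: "lattice_config (Cover M) (bar M) l" and circM: "Circuits M = {C. circuit (Cover M) (bar M) ?\<rho> C}"
    and cN: "lattice_config (Cover N) (bar N) l'" and circN: "Circuits N = {C. circuit (Cover N) (bar N) ?\<rho>' C}"
    using M N by (auto simp: lattice_rep_def)
  interpret SM: signed_config "Cover M" "bar M" ?\<rho> by (rule lattice_config_signed[OF cM])
  interpret SN: signed_config "Cover N" "bar N" ?\<rho>' by (rule lattice_config_signed[OF cN])
  note dM = lattice_configD[OF cM] and dN = lattice_configD[OF cN]
  have fN: "f e \<in> Cover N" if "e \<in> Cover M" for e using fm(1) that by auto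
  have finj: "f x = f y \<longleftrightarrow> x = y" if "x \<in> Cover M" "y \<in> Cover M" for x y
    using fm(2) that by (auto simp: inj_on_def)
  obtain p q where pq: "p \<in> Cover M" "q \<in> Cover M" "\<bar>det2 (l p) (l q)\<bar> = 1"
    by (rule lattice_config_pair[OF cM])
  have indM: "independent_family ?\<rho> {p, q}"
    by (rule independent_family_pair) (use pq(3) in \<open>auto simp: rdet2_real_vec\<close>)
  have disj: "{p, q} \<inter> bar M ` {p, q} = {}"
    using pq dM(2,4)[OF pq(1)] dM(2,4)[OF pq(2)] by auto
  have noC: "\<not> pos_dependent (bar M) ?\<rho> C" if "C \<subseteq> {p, q} \<union> bar M ` {p, q}" for C
  proof
    assume C: "pos_dependent (bar M) ?\<rho> C"
    then have "C \<inter> bar M ` C = {}" by (simp add: pos_dependent_def)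
    then have "independent_family ?\<rho> C"
      using SM.independent_family_signs[OF _ disj indM that] pq by blast
    then show False using SM.circuit_not_independent[OF C] by blast
  qed
  have img: "f ` (I \<union> bar M ` I) = f ` I \<union> bar N ` f ` I" if "I \<subseteq> Cover M" for I
  proof -
    have "f ` bar M ` I = bar N ` f ` I"
      unfolding image_image by (rule image_cong[OF refl]) (rule fm(3), use that in blast)
    then show ?thesis by (simp only: image_Un)
  qed
  have pull: "\<exists>S. S \<subseteq> I \<union> bar M ` I \<and> C = f ` S \<and> S \<subseteq> Cover M \<and> circuit (Cover M) (bar M) ?\<rho> S"
    if I: "I \<subseteq> Cover M" and C: "circuit (Cover N) (bar N) ?\<rho>' C" "C \<subseteq> f ` I \<union> bar N ` f ` I" for I C
  proof -
    obtain S where S: "S \<subseteq> I \<union> bar M ` I" "C = f ` S"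
      using C(2) unfolding img[OF I, symmetric] by (rule subset_imageE)
    moreover have SM': "S \<subseteq> Cover M" using S(1) I dM(1) by blast
    moreover have "C \<in> Circuits N" using C(1) unfolding circN by simp
    then have "S \<in> Circuits M" unfolding fm(4)[OF SM'] S(2) .
    then have "circuit (Cover M) (bar M) ?\<rho> S" unfolding circM by simp
    ultimately show ?thesis by blast
  qed
  \<comment> \<open>Otherwise \<open>f p\<close>, \<open>f q\<close> and their opposites would carry
    a circuit, and its preimage would be one on \<open>p\<close>, \<open>q\<close> and their
    opposites, which \<open>noC\<close> excludes.\<close>
  have "det2 (l' (f p)) (l' (f q)) \<noteq> 0"
  proof
    assume z: "det2 (l' (f p)) (l' (f q)) = 0"
    have fpq: "f p \<noteq> f q" using finj[OF pq(1,2)] pq(3) by auto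
    have "\<not> independent_family ?\<rho>' {f p, f q}"
      using independent_family_pair_nonzero[OF _ fpq, of ?\<rho>'] z by (auto simp: rdet2_real_vec)
    moreover have "{f p, f q} \<inter> bar N ` {f p, f q} = {}"
    proof -
      have "f ` {p, q} \<inter> f ` bar M ` {p, q} = f ` ({p, q} \<inter> bar M ` {p, q})"
        by (rule inj_on_image_Int[OF fm(2), symmetric]) (use pq dM(1) in auto)
      moreover have "f ` bar M ` {p, q} = bar N ` {f p, f q}" using fm(3) pq by auto
      ultimately show ?thesis using disj by auto
    qed
    ultimately obtain C where C: "circuit (Cover N) (bar N) ?\<rho>' C" "C \<subseteq> {f p, f q} \<union> bar N ` {f p, f q}"
      using SN.circuit_from_dependent[of "{f p, f q}"] fN pq by (metis empty_subsetI insert_subset)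
    then obtain S where "S \<subseteq> {p, q} \<union> bar M ` {p, q}" "circuit (Cover M) (bar M) ?\<rho> S"
      using pull[of "{p, q}" C] pq by auto
    then show False using noC unfolding circuit_def by blast
  qed
  then have D': "\<bar>det2 (l' (f p)) (l' (f q))\<bar> = 1"
    using lattice_config_abs_det2[OF cN fN[OF pq(1)] fN[OF pq(2)]] by linarith
  obtain g1 where g1: "invertible g1" "g1 *v E1 = l p" "g1 *v E2 = l q" using invertible_columns[OF pq(3)] .
  obtain g2 where g2: "invertible g2" "g2 *v E1 = l' (f p)" "g2 *v E2 = l' (f q)" using invertible_columns[OF D'] .
  define g where "g = g2 ** matrix_inv g1"
  have g: "invertible g" "g *v l p = l' (f p)" "g *v l q = l' (f q)"
  proof -
    have inv: "matrix_inv g1 *v l p = E1" "matrix_inv g1 *v l q = E2"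
      unfolding g1(2,3)[symmetric] by (rule matrix_inv_vector(1)[OF g1(1)])+
    show "invertible g"
      unfolding g_def by (rule invertible_mult[OF g2(1) invertible_matrix_inv[OF g1(1)]])
    show "g *v l p = l' (f p)" "g *v l q = l' (f q)"
      unfolding g_def matrix_vector_mul_assoc[symmetric] inv by (rule g2)+
  qed
  have "l' (f e) = g *v l e" if e: "e \<in> Cover M" for e
  proof (cases "e \<in> {p, q, bar M p, bar M q}")
    case True
    then show ?thesis
      using g pq fm(3) dM(4) dN(4)[OF fN] by (auto simp: matrix_vector_uminus)
  next
    case False
    have dist: "distinct [e, p, q]" using False pq(3) by auto
    have "bar M e \<notin> {p, q}" using False dM(3)[OF e] by auto
    then have disj3: "{e, p, q} \<inter> bar M ` {e, p, q} = {}"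
      using False disj dM(2)[OF e] by auto
    have "\<not> independent_family ?\<rho> {e, p, q}"
    proof
      assume "independent_family ?\<rho> {e, p, q}"
      then have "inj_on ?\<rho> {e, p, q}" "independent (?\<rho> ` {e, p, q})" using independent_family_iff[of "{e, p, q}" ?\<rho>] by auto
      then have "card {e, p, q} \<le> 2" using independent_bound[of "?\<rho> ` {e, p, q}"] card_image[of ?\<rho> "{e, p, q}"] by simp
      then show False using dist by simp
    qed
    then obtain C0 where C0: "circuit (Cover M) (bar M) ?\<rho> C0" "C0 \<subseteq> {e, p, q} \<union> bar M ` {e, p, q}"
      using SM.circuit_from_dependent[OF _ disj3] e pq by (metis empty_subsetI insert_subset)
    \<comment> \<open>A circuit of this kind must contain \<open>e\<close> or its opposite, as
      \<open>p\<close> and \<open>q\<close> are independent; passing to the opposite circuit if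
      necessary brings in \<open>e\<close> itself.\<close>
    have "\<exists>C. circuit (Cover M) (bar M) ?\<rho> C \<and> C \<subseteq> {e, p, q} \<union> bar M ` {e, p, q} \<and> e \<in> C"
    proof (cases "e \<in> C0")
      case False
      have "bar M e \<in> C0"
      proof (rule ccontr)
        assume "bar M e \<notin> C0"
        then have "C0 \<subseteq> {p, q} \<union> bar M ` {p, q}" using C0(2) False by auto
        then show False using noC C0(1) unfolding circuit_def by blast
      qed
      then have "e \<in> bar M ` C0" using dM(3)[OF e] by (metis imageI)
      moreover have "bar M ` C0 \<subseteq> {e, p, q} \<union> bar M ` {e, p, q}"
      proof -
        have "bar M ` C0 \<subseteq> bar M ` {e, p, q} \<union> bar M ` bar M ` {e, p, q}" using C0(2) by blast
        then show ?thesis using SM.image_inv_inv[of "{e, p, q}"] e pq by auto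
      qed
      ultimately show ?thesis using SM.circuit_inv[OF C0(1)] by blast
    qed (use C0 in blast)
    then obtain C where C: "circuit (Cover M) (bar M) ?\<rho> C" "C \<subseteq> {e, p, q} \<union> bar M ` {e, p, q}" "e \<in> C" by blast
    have CM: "C \<subseteq> Cover M" "pos_dependent (bar M) ?\<rho> C" using C(1) by (auto simp: circuit_def)
    have "bar M e \<notin> C" using C(3) CM(2) by (auto simp: pos_dependent_def)
    then have Csub: "C \<subseteq> {e, p, q, bar M p, bar M q}" using C(2) by auto
    have fC: "pos_dependent (bar N) ?\<rho>' (f ` C)"
      using fm(4)[OF CM(1)] C(1) circM circN by (auto simp: circuit_def)
    have fCsub: "f ` C \<subseteq> {f e, f p, f q, bar N (f p), bar N (f q)}" using Csub fm(3) pq by auto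
    have fe: "f e \<notin> {f p, f q, bar N (f p), bar N (f q)}"
      using False finj e pq dM(1) fm(3) by (metis empty_iff insert_iff)
    have mem: "f x \<in> f ` C \<longleftrightarrow> x \<in> C" if "x \<in> Cover M" for x
      using finj that CM(1) by (auto simp: image_iff subset_iff)
    have mem': "bar N (f x) \<in> f ` C \<longleftrightarrow> bar M x \<in> C" if "x \<in> Cover M" for x
      using mem[OF dM(1)[OF that]] fm(3)[OF that] by simp
    note 1 = circuit_coefficients[OF cM pq(1,2) e pq(3) False CM(2) C(3) Csub]
    note 2 = circuit_coefficients[OF cN fN[OF pq(1)] fN[OF pq(2)] fN[OF e] D' fe fC imageI[OF C(3)] fCsub]
    let ?D = "det2 (l p) (l q)" and ?D' = "det2 (l' (f p)) (l' (f q))"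
    have x: "det2 (l' (f e)) (l' (f q)) * ?D' = det2 (l e) (l q) * ?D" "det2 (l' (f p)) (l' (f e)) * ?D' = det2 (l p) (l e) * ?D"
      using 1 2 mem[OF pq(1)] mem[OF pq(2)] mem'[OF pq(1)] mem'[OF pq(2)] by simp_all
    have expand: "w = (det2 w v * det2 u v) *s u + (det2 u w * det2 u v) *s v" if "\<bar>det2 u v\<bar> = 1" for u v w :: "int ^ 2"
    proof -
      have "det2 u v * det2 u v = 1" using that by (metis abs_mult_self_eq mult_1)
      then have "w = det2 u v *s (det2 u v *s w)" by (simp add: vector_smult_assoc)
      also have "\<dots> = det2 u v *s (det2 w v *s u + det2 u w *s v)" by (rule arg_cong[OF det2_expand])
      finally show ?thesis by (simp add: vec_eq_iff algebra_simps)
    qed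
    have "g *v l e = g *v ((det2 (l e) (l q) * ?D) *s l p + (det2 (l p) (l e) * ?D) *s l q)"
      by (rule arg_cong[OF expand[OF pq(3)]])
    also have "\<dots> = (det2 (l e) (l q) * ?D) *s l' (f p) + (det2 (l p) (l e) * ?D) *s l' (f q)"
      by (simp add: matrix_vector_right_distrib matrix_vector_smult g)
    also have "\<dots> = l' (f e)" unfolding x[symmetric] by (rule expand[OF D', symmetric])
    finally show ?thesis ..
  qed
  then show ?thesis using g(1) by blast
qed

section \<open>The matroid of a lattice configuration\<close>

text \<open>The base set of the covering consists of the fibres, which are named here by elements of
  the prescribed infinite base type.\<close>

definition pair_code :: "('a \<Rightarrow> 'a) \<Rightarrow> 'a set \<Rightarrow> 'a set \<Rightarrow> 'b::infinite" where
  "pair_code \<beta> A = (SOME \<kappa>. inj_on \<kappa> ((\<lambda>e. {e, \<beta> e}) ` A))"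

lemma exists_inj_on_infinite:
  assumes "finite S"
  shows "\<exists>f :: 'a \<Rightarrow> 'b::infinite. inj_on f S"
proof -
  obtain B :: "'b set" where "finite B" "card B = card S"
    using infinite_arbitrarily_large[OF infinite_UNIV] by blast
  then show ?thesis using finite_same_card_bij[OF assms] bij_betw_imp_inj_on by metis
qed

lemma inj_on_pair_code: "finite A \<Longrightarrow> inj_on (pair_code \<beta> A :: 'a set \<Rightarrow> 'b::infinite) ((\<lambda>e. {e, \<beta> e}) ` A)"
  unfolding pair_code_def by (rule someI_ex[OF exists_inj_on_infinite]) simp

definition of_config :: "'a set \<Rightarrow> ('a \<Rightarrow> 'a) \<Rightarrow> ('a \<Rightarrow> int ^ 2) \<Rightarrow> ('a, 'b::infinite) signed_system" where
  "of_config A \<beta> l = \<lparr> Cover = A, Base = pair_code \<beta> A ` (\<lambda>e. {e, \<beta> e}) ` A,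
     Proj = (\<lambda>e\<in>A. pair_code \<beta> A {e, \<beta> e}), Circuits = {C. circuit A \<beta> (\<lambda>e. real_vec (l e)) C} \<rparr>"

lemma Cover_of_config [simp]: "Cover (of_config A \<beta> l) = A"
  by (simp add: of_config_def)

lemma Proj_of_config_eq_iff:
  assumes cfg: "lattice_config A \<beta> l" and e: "e \<in> A" "e' \<in> A"
  shows "Proj (of_config A \<beta> l :: ('a, 'b::infinite) signed_system) e' = Proj (of_config A \<beta> l) e \<longleftrightarrow> e' = e \<or> e' = \<beta> e"
proof -
  have "finite A" using cfg by (simp add: lattice_config_def)
  from inj_on_eq_iff[OF inj_on_pair_code[OF this, of \<beta>, where 'b = 'b], of "{e', \<beta> e'}" "{e, \<beta> e}"] e
  have "Proj (of_config A \<beta> l :: ('a, 'b) signed_system) e' = Proj (of_config A \<beta> l) e \<longleftrightarrow> {e', \<beta> e'} = {e, \<beta> e}"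
    by (simp add: of_config_def)
  also have "\<dots> \<longleftrightarrow> e' = e \<or> e' = \<beta> e"
    using lattice_configD(3)[OF cfg e(1)] by (auto simp: doubleton_eq_iff)
  finally show ?thesis .
qed

lemma two_fold_covering_of_config:
  assumes cfg: "lattice_config A \<beta> l"
  shows "two_fold_covering (Cover (of_config A \<beta> l :: ('a, 'b::infinite) signed_system))
    (Base (of_config A \<beta> l :: ('a, 'b) signed_system)) (Proj (of_config A \<beta> l :: ('a, 'b) signed_system))"
proof -
  let ?M = "of_config A \<beta> l :: ('a, 'b) signed_system"
  have fin: "finite A" using cfg by (simp add: lattice_config_def)
  have P: "Proj ?M ` A = Base ?M" by (simp add: of_config_def image_image)
  have "card {e' \<in> A. Proj ?M e' = x} = 2" if x: "x \<in> Base ?M" for x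
  proof -
    obtain e where e: "e \<in> A" "x = Proj ?M e" using x P by blast
    have "{e' \<in> A. Proj ?M e' = x} = {e, \<beta> e}"
      using Proj_of_config_eq_iff[OF cfg e(1), where 'b = 'b] e lattice_configD(1)[OF cfg e(1)] by auto
    then show ?thesis using lattice_configD(2)[OF cfg e(1)] by simp
  qed
  moreover have "finite (Base ?M)" using fin by (simp add: of_config_def)
  moreover have "Proj ?M \<in> A \<rightarrow>\<^sub>E Base ?M" by (auto simp: of_config_def)
  ultimately show ?thesis using P by (simp add: two_fold_covering_def)
qed

lemma bar_of_config:
  assumes cfg: "lattice_config A \<beta> l" and e: "e \<in> A"
  shows "bar (of_config A \<beta> l :: ('a, 'b::infinite) signed_system) e = \<beta> e"
proof -
  have e': "e \<in> Cover (of_config A \<beta> l :: ('a, 'b) signed_system)" using e by simp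
  note b = bar_props[OF two_fold_covering_of_config[OF cfg, where 'b = 'b] e']
  have "bar (of_config A \<beta> l :: ('a, 'b) signed_system) e \<in> A" using b by simp
  from Proj_of_config_eq_iff[OF cfg e this, where 'b = 'b] b show ?thesis by blast
qed

text \<open>Needed because \<open>bar\<close> of the constructed matroid is known to agree with the
  given involution only on the cover.\<close>

lemma circuit_cong:
  assumes "\<And>e. e \<in> A \<Longrightarrow> \<beta> e \<in> A" "\<And>e. e \<in> A \<Longrightarrow> \<beta> e = \<beta>' e"
  shows "circuit A \<beta>' \<rho> C \<longleftrightarrow> circuit A \<beta> \<rho> C"
proof (cases "C \<subseteq> A")
  case True
  then show ?thesis
    using circuit_image[where f = "\<lambda>x. x" and A = A and A' = A and \<beta> = \<beta> and \<beta>' = \<beta>' and T = C, OF _ _ _ assms(1) assms(2)]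
    by simp
qed (simp add: circuit_def)

lemma lattice_rep_of_config:
  assumes cfg: "lattice_config A \<beta> l"
  shows "lattice_rep (of_config A \<beta> l :: ('a, 'b::infinite) signed_system) l"
proof -
  let ?M = "of_config A \<beta> l :: ('a, 'b) signed_system"
  note b = bar_of_config[OF cfg, where 'b = 'b]
  have "lattice_config A (bar ?M) l"
    using cfg b unfolding lattice_config_def by simp
  moreover have "Circuits ?M = {C. circuit A (bar ?M) (\<lambda>e. real_vec (l e)) C}"
  proof -
    have "circuit A (bar ?M) (\<lambda>e. real_vec (l e)) C \<longleftrightarrow> circuit A \<beta> (\<lambda>e. real_vec (l e)) C" for C
      by (rule circuit_cong) (simp_all add: b lattice_configD(1)[OF cfg])
    then show ?thesis by (simp add: of_config_def)
  qed
  ultimately show ?thesis by (simp add: lattice_rep_def)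
qed

lemma lattice_rep_freely_oriented:
  assumes cov: "two_fold_covering (Cover M) (Base M) (Proj M)" and rep: "lattice_rep M l"
  shows "freely_oriented_matroid M"
proof -
  have cfg: "lattice_config (Cover M) (bar M) l" and circ: "Circuits M = {C. circuit (Cover M) (bar M) (\<lambda>e. real_vec (l e)) C}"
    using rep by (simp_all add: lattice_rep_def)
  interpret S: signed_config "Cover M" "bar M" "\<lambda>e. real_vec (l e)" by (rule lattice_config_signed[OF cfg])
  show ?thesis
    unfolding freely_oriented_matroid_def circ mem_Collect_eq
  proof (intro conjI ballI allI impI)
    fix C1 C2 e
    assume C: "C1 \<in> {C. circuit (Cover M) (bar M) (\<lambda>e. real_vec (l e)) C}"
      "C2 \<in> {C. circuit (Cover M) (bar M) (\<lambda>e. real_vec (l e)) C}" "C1 \<noteq> C2 \<and> e \<in> C1 \<inter> C2"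
    then obtain C3 where "circuit (Cover M) (bar M) (\<lambda>e. real_vec (l e)) C3" "C3 \<subseteq> (C1 - {e}) \<union> bar M ` (C2 - {e})"
      using S.circuit_elimination[of C1 C2 e] by blast
    then show "\<exists>C3\<in>{C. circuit (Cover M) (bar M) (\<lambda>e. real_vec (l e)) C}. C3 \<subseteq> (C1 - {e}) \<union> bar M ` (C2 - {e})"
      by blast
  next
    fix C1 C2
    assume "C1 \<in> {C. circuit (Cover M) (bar M) (\<lambda>e. real_vec (l e)) C}"
      "C2 \<in> {C. circuit (Cover M) (bar M) (\<lambda>e. real_vec (l e)) C}" "C1 \<subseteq> C2 \<union> bar M ` C2"
    then show "C1 = C2 \<or> C1 = bar M ` C2" using S.circuit_incomparable by simp
  qed (use cov S.circuit_inv in \<open>simp_all add: circuit_def pos_dependent_def\<close>)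
qed

text \<open>The representation is \<open>l\<close>, regarded as real. A basis consists of two
  elements whose determinant is a nonzero integer of absolute value at most one, so its volume is
  1.\<close>

theorem lattice_rep_regular:
  assumes cov: "two_fold_covering (Cover M) (Base M) (Proj M)" and lrep: "lattice_rep M l"
  shows "regular_of_rank TYPE(2) M"
proof -
  let ?\<rho> = "\<lambda>e. real_vec (l e)"
  have cfg: "lattice_config (Cover M) (bar M) l" and circ: "Circuits M = {C. circuit (Cover M) (bar M) ?\<rho> C}"
    using lrep by (simp_all add: lattice_rep_def)
  have sc: "signed_config (Cover M) (bar M) ?\<rho>" by (rule lattice_config_signed[OF cfg])
  interpret S: signed_config "Cover M" "bar M" ?\<rho> by (rule sc)
  have C': "C \<subseteq> Cover M \<and> pos_dependent (bar M) ?\<rho> C" if "C \<in> Circuits M" for C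
    using that unfolding circ by (simp add: circuit_def)
  have ind: "independent_family ?\<rho> I" if I: "signed_independent M I" for I
  proof (rule ccontr)
    assume dep: "\<not> independent_family ?\<rho> I"
    have I': "I \<subseteq> Cover M \<and> I \<inter> bar M ` I = {} \<and> \<not> (\<exists>C\<in>Circuits M. C \<subseteq> I \<union> bar M ` I)"
      using I signed_independent_iff[OF cov, of I] C' by blast
    then obtain C where "circuit (Cover M) (bar M) ?\<rho> C" "C \<subseteq> I \<union> bar M ` I"
      using S.circuit_from_dependent[OF _ _ dep] by blast
    then show False using I' circ by blast
  qed
  note basis = signed_basis_pair[OF cov sc C' ind]
  obtain p q where pq: "p \<in> Cover M" "q \<in> Cover M" "\<bar>det2 (l p) (l q)\<bar> = 1"
    by (rule lattice_config_pair[OF cfg])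
  have rpq: "rdet2 (?\<rho> p) (?\<rho> q) \<noteq> 0" using pq(3) by (auto simp: rdet2_real_vec)
  have "signed_basis M {p, q}" by (rule basis) (use pq rpq in auto)
  then have bpq: "base_independent M (Proj M ` {p, q})" and ipq: "inj_on (Proj M) {p, q}"
    by (auto simp: signed_basis_def base_basis_def)
  have "p \<noteq> q" using pq(3) by auto
  then have cpq: "card (Proj M ` {p, q}) = 2" using card_image[OF ipq] by simp
  have "span (?\<rho> ` Cover M) = UNIV"
  proof -
    have "x \<in> span (?\<rho> ` Cover M)" for x
    proof -
      let ?D = "rdet2 (?\<rho> p) (?\<rho> q)"
      have "?D *\<^sub>R x \<in> span (?\<rho> ` Cover M)"
        unfolding rdet2_expand[of "?\<rho> p" "?\<rho> q" x] using pq by (intro span_add span_scale span_base imageI)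
      then have "(1 / ?D) *\<^sub>R ?D *\<^sub>R x \<in> span (?\<rho> ` Cover M)" by (rule span_scale)
      then show ?thesis using rpq by simp
    qed
    then show ?thesis by blast
  qed
  moreover have "inj_on ?\<rho> I \<and> independent (?\<rho> ` I)" if I: "signed_independent M I" for I
  proof -
    have "finite I" using I S.finite by (auto simp: signed_independent_def intro: finite_subset)
    then show ?thesis using ind[OF I] by (simp add: independent_family_iff)
  qed
  ultimately have rep: "representation M ?\<rho>"
    using S.neg C' unfolding representation_def pos_dependent_def by simp
  have vol: "volume (?\<rho> ` B) = 1" if B: "signed_basis M B" for B
  proof -
    have sB: "signed_independent M B" and BM: "B \<subseteq> Cover M" and bB: "base_basis M (Proj M ` B)"
      using B by (auto simp: signed_basis_def signed_independent_def base_basis_def)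
    \<comment> \<open>By maximality a basis inside a pair with nonzero determinant has the
      projection of that pair; this is used to rule out fewer than two elements.\<close>
    have max: "Proj M ` {e, e'} = Proj M ` B \<and> card (Proj M ` {e, e'}) = 2"
      if e: "e \<in> Cover M" "e' \<in> Cover M" "rdet2 (?\<rho> e) (?\<rho> e') \<noteq> 0" "B \<subseteq> {e, e'}" for e e'
    proof -
      have "signed_basis M {e, e'}" by (rule basis) (use e in auto)
      then have 1: "base_independent M (Proj M ` {e, e'})" "inj_on (Proj M) {e, e'}"
        by (auto simp: signed_basis_def base_basis_def)
      have "e \<noteq> e'" using e(3) by (auto simp: rdet2_def)
      then have "card (Proj M ` {e, e'}) = 2" using card_image[OF 1(2)] by simp
      moreover have "Proj M ` B \<subseteq> Proj M ` {e, e'}" using e(4) by blast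
      ultimately show ?thesis using bB 1(1) unfolding base_basis_def by blast
    qed
    have finB: "finite B" using BM S.finite finite_subset by blast
    have cB: "card (Proj M ` B) = card B" using B by (simp add: signed_basis_def card_image)
    have "card B \<le> 2" by (rule signed_independent_card[OF cov ind sB])
    moreover have "card B \<noteq> 0"
    proof
      assume "card B = 0"
      then have "B = {}" using finB by simp
      then show False using max[OF pq(1,2) rpq] by simp
    qed
    \<comment> \<open>A single element could be enlarged by \<open>p\<close> or by \<open>q\<close>
      unless it were parallel to both, hence zero.\<close>
    moreover have "card B \<noteq> 1"
    proof
      assume c1: "card B = 1"
      then obtain b where b: "B = {b}" using card_1_singletonE by blast
      have bM: "b \<in> Cover M" using b BM by blast
      have "rdet2 (?\<rho> b) (?\<rho> q) = 0"
        using max[of b q] b bM pq(2) c1 cB by (metis insertCI empty_subsetI insert_subset numeral_One numeral_eq_iff semiring_norm(85))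
      moreover have "rdet2 (?\<rho> p) (?\<rho> b) = 0"
        using max[of p b] b bM pq(1) c1 cB by (metis insertCI empty_subsetI insert_subset numeral_One numeral_eq_iff semiring_norm(85))
      ultimately have "rdet2 (?\<rho> p) (?\<rho> q) *\<^sub>R ?\<rho> b = 0" unfolding rdet2_expand[of "?\<rho> p" "?\<rho> q" "?\<rho> b"] by simp
      then have "?\<rho> b = 0" using rpq by simp
      then have "(\<Sum>x\<in>B. 1 *\<^sub>R ?\<rho> x) = 0" by (simp add: b)
      then show False using independent_familyD[OF ind[OF sB], of "\<lambda>_. 1" b] b by simp
    qed
    ultimately have "card B = 2" by linarith
    then obtain b b' where b: "B = {b, b'}" "b \<noteq> b'" by (meson card_2_iff)
    have "rdet2 (?\<rho> b) (?\<rho> b') \<noteq> 0" by (rule independent_family_pair_nonzero[OF _ b(2)]) (use ind[OF sB] b(1) in simp)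
    then have "det2 (l b) (l b') \<noteq> 0" by (simp add: rdet2_real_vec)
    moreover have "\<bar>det2 (l b) (l b')\<bar> \<le> 1" by (rule lattice_config_abs_det2[OF cfg]) (use b BM in auto)
    ultimately have 1: "\<bar>det2 (l b) (l b')\<bar> = 1" by linarith
    then have "?\<rho> b \<noteq> ?\<rho> b'" by (auto simp: real_vec_inject)
    then have "volume (?\<rho> ` B) = \<bar>real_of_int (det2 (l b) (l b'))\<bar>" unfolding b(1) by (simp add: volume_pair rdet2_real_vec)
    then show ?thesis using 1 by linarith
  qed
  have "matroid_rank M = 2"
    unfolding matroid_rank_def
  proof (rule Max_eqI)
    have "{I. base_independent M I} \<subseteq> Pow (Base M)" by (auto simp: base_independent_def)
    moreover have "finite (Base M)" using cov by (simp add: two_fold_covering_def)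
    ultimately show "finite (card ` {I. base_independent M I})" using finite_subset by blast
    show "y \<le> 2" if "y \<in> card ` {I. base_independent M I}" for y
      using that base_independent_card[OF cov ind] by blast
    show "2 \<in> card ` {I. base_independent M I}" using bpq cpq by (metis (mono_tags) image_eqI mem_Collect_eq)
  qed
  then show ?thesis
    unfolding regular_of_rank_def unipotent_representation_def
    using lattice_rep_freely_oriented[OF cov lrep] rep vol by auto
qed

corollary regular_of_config:
  "lattice_config A \<beta> l \<Longrightarrow> regular_of_rank TYPE(2) (of_config A \<beta> l :: ('a, 'b::infinite) signed_system)"
  by (rule lattice_rep_regular[OF two_fold_covering_of_config lattice_rep_of_config])

section \<open>Comparison of regular matroids with the category of the action\<close>

section \<open>Zigzags of natural transformations\<close>

text \<open>Homotopy is a symmetric relation, so the opposite directions of the two transformations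
  into \<open>F\<close> do no harm.\<close>

lemma homotopy_equivalent_classifying_spaces:
  assumes C: "is_category C" and D: "is_category D"
    and P: "is_functor C D P Pm" and S: "is_functor D C S Sm" and F: "is_functor C C F Fm"
    and 1: "nat_trans C C (\<lambda>x. x) (\<lambda>x y f. f) F Fm \<eta>"
    and 2: "nat_trans C C (\<lambda>x. S (P x)) (\<lambda>x y f. Sm (P x) (P y) (Pm x y f)) F Fm \<epsilon>"
    and 3: "nat_trans D D (\<lambda>x. x) (\<lambda>x y f. f) (\<lambda>x. P (S x)) (\<lambda>x y f. Pm (S x) (S y) (Sm x y f)) \<zeta>"
  shows "classifying_space C homotopy_equivalent_space classifying_space D"
proof -
  let ?p = "classifying_map C D P Pm" and ?s = "classifying_map D C S Sm"
  have IC: "is_functor C C (\<lambda>x. x) (\<lambda>x y f. f)" and ID: "is_functor D D (\<lambda>x. x) (\<lambda>x y f. f)"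
    by (simp_all add: is_functor_def)
  have SP: "is_functor C C (\<lambda>x. S (P x)) (\<lambda>x y f. Sm (P x) (P y) (Pm x y f))" by (rule is_functor_compose[OF P S])
  have PS: "is_functor D D (\<lambda>x. P (S x)) (\<lambda>x y f. Pm (S x) (S y) (Sm x y f))" by (rule is_functor_compose[OF S P])
  note hom = homotopic_with_trans[OF nat_trans_homotopic[OF C SP F 2] homotopic_with_symD[OF nat_trans_homotopic[OF C IC F 1]]]
  have "homotopic_with (\<lambda>_. True) (classifying_space C) (classifying_space C) (?s \<circ> ?p) id"
    by (rule homotopic_with_eq[OF hom]) (simp_all add: classifying_map_compose[OF P S] classifying_map_id)
  moreover have "homotopic_with (\<lambda>_. True) (classifying_space D) (classifying_space D) (?p \<circ> ?s) id"
    by (rule homotopic_with_eq[OF homotopic_with_symD[OF nat_trans_homotopic[OF D ID PS 3]]])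
      (simp_all add: classifying_map_compose[OF S P] classifying_map_id)
  ultimately show ?thesis
    unfolding homotopy_equivalent_space_def using classifying_map(1)[OF P] classifying_map(1)[OF S] by blast
qed


section \<open>Transport of configurations to a fixed type\<close>

text \<open>Configurations arise on other types, such as sets of vectors or disjoint unions. Being
  finite, they fit into any infinite type, and so into the fixed type of the objects of the
  category.\<close>

definition code :: "'c set \<Rightarrow> 'c \<Rightarrow> 'a::infinite" where
  "code A = (SOME f. inj_on f A)"

lemma inj_on_code: "finite A \<Longrightarrow> inj_on (code A :: 'c \<Rightarrow> 'a::infinite) A"
  unfolding code_def by (rule someI_ex[OF exists_inj_on_infinite])

lemma decode_code: "finite A \<Longrightarrow> e \<in> A \<Longrightarrow> inv_into A (code A) (code A e :: 'a::infinite) = e"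
  by (rule inv_into_f_f[OF inj_on_code])

definition model :: "'c set \<Rightarrow> ('c \<Rightarrow> 'c) \<Rightarrow> ('c \<Rightarrow> int ^ 2) \<Rightarrow> ('a::infinite, 'b::infinite) signed_system" where
  "model A \<beta> l = of_config (code A ` A) (\<lambda>x. code A (\<beta> (inv_into A (code A) x))) (\<lambda>x. l (inv_into A (code A) x))"

definition model_map :: "'c set \<Rightarrow> 'd set \<Rightarrow> ('c \<Rightarrow> 'd) \<Rightarrow> 'a::infinite \<Rightarrow> 'a" where
  "model_map A A' \<phi> = (\<lambda>x\<in>code A ` A. code A' (\<phi> (inv_into A (code A) x)))"

lemma Cover_model [simp]: "Cover (model A \<beta> l :: ('a::infinite, 'b::infinite) signed_system) = code A ` A"
  by (simp add: model_def)

lemma model_map_code: "finite A \<Longrightarrow> e \<in> A \<Longrightarrow> model_map A A' \<phi> (code A e :: 'a::infinite) = code A' (\<phi> e)"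
  by (simp add: model_map_def decode_code)

lemma lattice_config_code:
  assumes cfg: "lattice_config A \<beta> l"
  shows "lattice_config (code A ` A :: 'a::infinite set) (\<lambda>x. code A (\<beta> (inv_into A (code A) x))) (\<lambda>x. l (inv_into A (code A) x))"
proof -
  have fin: "finite A" using cfg by (simp add: lattice_config_def)
  note dec = decode_code[OF fin, where 'a = 'a] and cd = lattice_configD[OF cfg]
  have "(\<lambda>x. l (inv_into A (code A) x)) ` (code A ` A :: 'a set) = l ` A"
    unfolding image_image by (rule image_cong[OF refl]) (simp add: dec)
  moreover have "(code A (\<beta> e) :: 'a) \<noteq> code A e" if "e \<in> A" for e
    using inj_onD[OF inj_on_code[OF fin, where 'a = 'a], of "\<beta> e" e] cd(1,2)[OF that] that by blast
  ultimately show ?thesis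
    using cfg fin cd unfolding lattice_config_def by (simp add: dec)
qed

lemma lattice_rep_model:
  assumes cfg: "lattice_config A \<beta> l"
  shows "lattice_rep (model A \<beta> l :: ('a::infinite, 'b::infinite) signed_system) (\<lambda>x. l (inv_into A (code A) x))"
  unfolding model_def by (rule lattice_rep_of_config[OF lattice_config_code[OF cfg]])

lemma regular_model:
  assumes cfg: "lattice_config A \<beta> l"
  shows "regular_of_rank TYPE(2) (model A \<beta> l :: ('a::infinite, 'b::infinite) signed_system)"
  unfolding model_def by (rule regular_of_config[OF lattice_config_code[OF cfg]])

lemma bar_model:
  assumes cfg: "lattice_config A \<beta> l" and e: "e \<in> A"
  shows "bar (model A \<beta> l :: ('a::infinite, 'b::infinite) signed_system) (code A e) = code A (\<beta> e)"
proof -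
  have "finite A" using cfg by (simp add: lattice_config_def)
  then show ?thesis
    unfolding model_def using bar_of_config[OF lattice_config_code[OF cfg], of "code A e :: 'a", where 'b = 'b] e
    by (simp add: decode_code)
qed

lemma model_map_in_matroid_maps:
  assumes cfg: "lattice_config A \<beta> l" and cfg': "lattice_config A' \<beta>' l'"
    and \<phi>: "\<phi> ` A \<subseteq> A'" "inj_on \<phi> A" "\<And>e. e \<in> A \<Longrightarrow> \<phi> (\<beta> e) = \<beta>' (\<phi> e)"
    and g: "invertible g" "\<And>e. e \<in> A \<Longrightarrow> l' (\<phi> e) = g *v l e"
  shows "model_map A A' \<phi> \<in> matroid_maps (model A \<beta> l :: ('a::infinite, 'b::infinite) signed_system) (model A' \<beta>' l')"
proof -
  have fin: "finite A" "finite A'" using cfg cfg' by (simp_all add: lattice_config_def)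
  note mm = model_map_code[OF fin(1), where 'a = 'a and A' = A' and \<phi> = \<phi>]
  have im: "\<phi> e \<in> A'" if "e \<in> A" for e using \<phi>(1) that by blast
  show ?thesis
  proof (rule matroid_mapsI[OF lattice_rep_model[OF cfg] lattice_rep_model[OF cfg'] _ _ _ g(1)])
    show "model_map A A' \<phi> \<in> Cover (model A \<beta> l :: ('a, 'b) signed_system) \<rightarrow>\<^sub>E Cover (model A' \<beta>' l' :: ('a, 'b) signed_system)"
      using im mm by (auto simp: model_map_def decode_code[OF fin(1)])
    show "inj_on (model_map A A' \<phi>) (Cover (model A \<beta> l :: ('a, 'b) signed_system))"
    proof (rule inj_onI)
      fix x y :: 'a assume "x \<in> Cover (model A \<beta> l :: ('a, 'b) signed_system)" "y \<in> Cover (model A \<beta> l :: ('a, 'b) signed_system)"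
        and eq: "model_map A A' \<phi> x = model_map A A' \<phi> y"
      then obtain e e' where e: "e \<in> A" "x = code A e" "e' \<in> A" "y = code A e'" by auto
      have "code A' (\<phi> e) = (code A' (\<phi> e') :: 'a)" using eq e mm by simp
      then have "\<phi> e = \<phi> e'" using inj_onD[OF inj_on_code[OF fin(2)]] im e by metis
      then show "x = y" using \<phi>(2) e by (auto dest: inj_onD)
    qed
    fix x :: 'a assume "x \<in> Cover (model A \<beta> l :: ('a, 'b) signed_system)"
    then obtain e where e: "e \<in> A" "x = code A e" by auto
    have be: "\<beta> e \<in> A" by (rule lattice_configD(1)[OF cfg e(1)])
    show "model_map A A' \<phi> (bar (model A \<beta> l :: ('a, 'b) signed_system) x) = bar (model A' \<beta>' l' :: ('a, 'b) signed_system) (model_map A A' \<phi> x)"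
      unfolding e(2) bar_model[OF cfg e(1)] mm[OF e(1)] mm[OF be] bar_model[OF cfg' im[OF e(1)]] \<phi>(3)[OF e(1)] ..
    show "l' (inv_into A' (code A') (model_map A A' \<phi> x)) = g *v l (inv_into A (code A) x)"
      unfolding e(2) mm[OF e(1)] decode_code[OF fin(1) e(1)] decode_code[OF fin(2) im[OF e(1)]] by (rule g(2)[OF e(1)])
  qed
qed

lemma model_map_cong: "(\<And>e. e \<in> A \<Longrightarrow> \<phi> e = \<psi> e) \<Longrightarrow> model_map A A' \<phi> = model_map A A' \<psi>"
  by (auto simp: model_map_def fun_eq_iff restrict_def inv_into_into)

lemma compose_model_map:
  assumes "finite A" "finite A'" "\<phi> ` A \<subseteq> A'"
  shows "compose (code A ` A) (model_map A' A'' \<psi>) (model_map A A' \<phi>) = (model_map A A'' (\<lambda>e. \<psi> (\<phi> e)) :: 'a::infinite \<Rightarrow> 'a)"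
proof
  fix x :: 'a
  show "compose (code A ` A) (model_map A' A'' \<psi>) (model_map A A' \<phi>) x = model_map A A'' (\<lambda>e. \<psi> (\<phi> e)) x"
  proof (cases "x \<in> code A ` A")
    case True
    then obtain e where e: "e \<in> A" "x = code A e" by blast
    moreover have "\<phi> e \<in> A'" using e assms(3) by blast
    ultimately show ?thesis using assms(1,2) by (simp add: compose_def model_map_code)
  qed (simp add: compose_def model_map_def)
qed

lemma model_map_id:
  assumes "finite A"
  shows "model_map A A (\<lambda>e. e) = (\<lambda>x\<in>code A ` A. x :: 'a::infinite)"
  by (auto simp: model_map_def fun_eq_iff restrict_def decode_code[OF assms])


section \<open>Comparison of the two categories\<close>

lemma IR_matrix_unique:
  fixes g h :: "int ^ 2 ^ 2"
  assumes "X \<in> IR" "\<And>v. v \<in> X \<Longrightarrow> g *v v = h *v v"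
  shows "g = h"
proof -
  obtain u v where "u \<in> X" "v \<in> X" "\<bar>det2 u v\<bar> = 1" using assms(1) unfolding IR_iff by blast
  then show ?thesis using matrix_determined[of g u h v] assms(2) by blast
qed

lemma lattice_config_IR:
  assumes X: "X \<in> IR"
  shows "lattice_config X uminus (\<lambda>v. v)"
proof -
  have 0: "0 \<notin> X" and sym: "uminus ` X = X" using X unfolding IR_iff by blast+
  have "- v \<in> X" if "v \<in> X" for v using sym that by (metis imageI)
  moreover have "- v \<noteq> v" if "v \<in> X" for v using 0 that by (metis eq_neg_iff_add_eq_0 vec_eq_iff add_cancel_left_left double_zero vector_add_component zero_index)
  moreover have "(\<lambda>v. v) ` X - {0} = X" using 0 by auto
  ultimately show ?thesis using finite_IR[OF X] X by (simp add: lattice_config_def)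
qed

text \<open>A choice made once for each matroid, without any compatibility between matroids;
  \<open>matrix_of\<close> then records a map relative to the choices at both ends.\<close>

definition rep_of :: "('a, 'b) signed_system \<Rightarrow> 'a \<Rightarrow> int ^ 2" where
  "rep_of M = (SOME l. lattice_rep M l)"

definition vectors_of :: "('a, 'b) signed_system \<Rightarrow> (int ^ 2) set" where
  "vectors_of M = rep_of M ` Cover M - {0}"

definition matrix_of :: "('a, 'b) signed_system \<Rightarrow> ('a, 'b) signed_system \<Rightarrow> ('a \<Rightarrow> 'a) \<Rightarrow> int ^ 2 ^ 2" where
  "matrix_of M N f = (SOME g. invertible g \<and> (\<forall>e\<in>Cover M. rep_of N (f e) = g *v rep_of M e))"

lemma lattice_rep_rep_of: "regular_of_rank TYPE(2) M \<Longrightarrow> lattice_rep M (rep_of M)"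
  unfolding rep_of_def by (rule someI_ex[OF lattice_rep_exists])

lemma vectors_of_IR: "regular_of_rank TYPE(2) M \<Longrightarrow> vectors_of M \<in> IR"
  using lattice_rep_rep_of by (auto simp: lattice_rep_def lattice_config_def vectors_of_def)

lemma matrix_of:
  assumes "regular_of_rank TYPE(2) M" "regular_of_rank TYPE(2) N" "f \<in> matroid_maps M N"
  shows "invertible (matrix_of M N f)" "e \<in> Cover M \<Longrightarrow> rep_of N (f e) = matrix_of M N f *v rep_of M e"
  using someI_ex[OF matroid_map_linear[OF lattice_rep_rep_of[OF assms(1)] lattice_rep_rep_of[OF assms(2)] assms(3)]]
  unfolding matrix_of_def by blast+

lemma invertible_mult_nonzero: "invertible g \<Longrightarrow> v \<noteq> 0 \<Longrightarrow> g *v v \<noteq> 0" for g :: "'a::comm_ring_1 ^ 'n ^ 'n"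
  by (metis matrix_inv_vector(1) matrix_vector_mult_0_right)

lemma matrix_of_image:
  assumes "regular_of_rank TYPE(2) M" "regular_of_rank TYPE(2) N" "f \<in> matroid_maps M N"
  shows "(*v) (matrix_of M N f) ` vectors_of M \<subseteq> vectors_of N"
proof
  fix w assume "w \<in> (*v) (matrix_of M N f) ` vectors_of M"
  then obtain e where e: "e \<in> Cover M" "rep_of M e \<noteq> 0" "w = matrix_of M N f *v rep_of M e"
    by (auto simp: vectors_of_def)
  have "w = rep_of N (f e)" using matrix_of(2)[OF assms e(1)] e(3) by simp
  moreover have "w \<noteq> 0" unfolding e(3) by (rule invertible_mult_nonzero[OF matrix_of(1)[OF assms] e(2)])
  moreover have "f e \<in> Cover N" using matroid_mapsD(1)[OF assms(3)] e(1) by blast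
  ultimately show "w \<in> vectors_of N" by (simp add: vectors_of_def)
qed

text \<open>The vectors contain a basis of the lattice and so determine the matrix. This is why the
  chosen matrices are functorial.\<close>

lemma matrix_of_unique:
  assumes "regular_of_rank TYPE(2) M" "regular_of_rank TYPE(2) N" "f \<in> matroid_maps M N"
    and g: "\<And>e. e \<in> Cover M \<Longrightarrow> rep_of N (f e) = g *v rep_of M e"
  shows "matrix_of M N f = g"
  by (rule IR_matrix_unique[OF vectors_of_IR[OF assms(1)]])
     (auto simp: vectors_of_def matrix_of(2)[OF assms(1-3), symmetric] g[symmetric])

text \<open>A matroid may have loops and parallel elements, which its set of vectors forgets, so that
  there is no natural map between a matroid and the model of its vectors. Both embed naturally into
  the model of their disjoint union.\<close>

definition doubled :: "('a, 'b) signed_system \<Rightarrow> ('a + int ^ 2) set" where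
  "doubled M = Cover M <+> vectors_of M"

definition doubled_model :: "('a::infinite, 'b::infinite) signed_system \<Rightarrow> ('a, 'b) signed_system" where
  "doubled_model M = model (doubled M) (map_sum (bar M) uminus) (case_sum (rep_of M) (\<lambda>v. v))"

lemma lattice_config_doubled:
  assumes M: "regular_of_rank TYPE(2) M"
  shows "lattice_config (doubled M) (map_sum (bar M) uminus) (case_sum (rep_of M) (\<lambda>v. v))"
proof -
  have 1: "lattice_config (Cover M) (bar M) (rep_of M)" using lattice_rep_rep_of[OF M] by (simp add: lattice_rep_def)
  note 2 = lattice_config_IR[OF vectors_of_IR[OF M]]
  note cd1 = lattice_configD[OF 1] and cd2 = lattice_configD[OF 2]
  have "finite (doubled M)" using 1 2 by (simp add: doubled_def lattice_config_def)
  moreover have "map_sum (bar M) uminus x \<in> doubled M \<and> map_sum (bar M) uminus x \<noteq> x \<and>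
      map_sum (bar M) uminus (map_sum (bar M) uminus x) = x \<and>
      case_sum (rep_of M) (\<lambda>v. v) (map_sum (bar M) uminus x) = - case_sum (rep_of M) (\<lambda>v. v) x" if x: "x \<in> doubled M" for x
  proof (cases x)
    case (Inl e)
    then have "e \<in> Cover M" using x by (auto simp: doubled_def)
    then show ?thesis using cd1 by (simp add: Inl doubled_def InlI)
  next
    case (Inr v)
    then have "v \<in> vectors_of M" using x by (auto simp: doubled_def)
    then show ?thesis using cd2 by (simp add: Inr doubled_def InrI)
  qed
  moreover have "case_sum (rep_of M) (\<lambda>v. v) ` doubled M - {0} = vectors_of M"
    unfolding doubled_def Plus_def image_Un image_image by (auto simp: vectors_of_def)
  ultimately show ?thesis using vectors_of_IR[OF M] by (simp add: lattice_config_def)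
qed

lemma finite_doubled: "regular_of_rank TYPE(2) M \<Longrightarrow> finite (doubled M)"
  using lattice_config_doubled unfolding lattice_config_def by blast

definition doubled_map :: "('a, 'b) signed_system \<Rightarrow> ('a, 'b) signed_system \<Rightarrow> ('a \<Rightarrow> 'a) \<Rightarrow> 'a + int ^ 2 \<Rightarrow> 'a + int ^ 2" where
  "doubled_map M N f = map_sum f ((*v) (matrix_of M N f))"

lemma doubled_map_image:
  assumes "regular_of_rank TYPE(2) M" "regular_of_rank TYPE(2) N" "f \<in> matroid_maps M N"
  shows "doubled_map M N f ` doubled M \<subseteq> doubled N"
  using matrix_of_image[OF assms] matroid_mapsD(1)[OF assms(3)] by (auto simp: doubled_map_def doubled_def)

lemma doubled_map_in:
  fixes M N :: "('a::infinite, 'b::infinite) signed_system"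
  assumes "regular_of_rank TYPE(2) M" "regular_of_rank TYPE(2) N" "f \<in> matroid_maps M N"
  shows "model_map (doubled M) (doubled N) (doubled_map M N f) \<in> matroid_maps (doubled_model M) (doubled_model N)"
  unfolding doubled_model_def
proof (rule model_map_in_matroid_maps[OF lattice_config_doubled[OF assms(1)] lattice_config_doubled[OF assms(2)]
      doubled_map_image[OF assms] _ _ matrix_of(1)[OF assms]])
  let ?g = "matrix_of M N f"
  have "inj ((*v) ?g)" by (rule inj_invertible[OF matrix_of(1)[OF assms]])
  then show "inj_on (doubled_map M N f) (doubled M)"
    using inj_onD[OF matroid_mapsD(2)[OF assms(3)]] unfolding doubled_map_def doubled_def
    by (intro inj_onI) (elim PlusE; simp add: inj_eq)
  fix x assume "x \<in> doubled M"
  then consider e where "x = Inl e" "e \<in> Cover M" | v where "x = Inr v" "v \<in> vectors_of M" by (auto simp: doubled_def)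
  then have "doubled_map M N f (map_sum (bar M) uminus x) = map_sum (bar N) uminus (doubled_map M N f x) \<and>
      case_sum (rep_of N) (\<lambda>v. v) (doubled_map M N f x) = ?g *v case_sum (rep_of M) (\<lambda>v. v) x"
    by cases (simp_all add: doubled_map_def matroid_mapsD(3)[OF assms(3)] matrix_of(2)[OF assms] matrix_vector_uminus)
  then show "doubled_map M N f (map_sum (bar M) uminus x) = map_sum (bar N) uminus (doubled_map M N f x)"
    "case_sum (rep_of N) (\<lambda>v. v) (doubled_map M N f x) = ?g *v case_sum (rep_of M) (\<lambda>v. v) x" by blast+
qed

definition lattice_model :: "(int ^ 2) set \<Rightarrow> ('a::infinite, 'b::infinite) signed_system" where
  "lattice_model X = model X uminus (\<lambda>v. v)"

definition lattice_model_map :: "(int ^ 2) set \<Rightarrow> (int ^ 2) set \<Rightarrow> int ^ 2 ^ 2 \<Rightarrow> 'a::infinite \<Rightarrow> 'a" where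
  "lattice_model_map X Y g = model_map X Y ((*v) g)"

lemma regular_category_simps:
  "Obj (regular_category TYPE(2) :: (('a, 'b) signed_system, 'a \<Rightarrow> 'a) category) = {M. regular_of_rank TYPE(2) M}"
  "Hom (regular_category TYPE(2)) = matroid_maps"
  "Id (regular_category TYPE(2) :: (('a, 'b) signed_system, 'a \<Rightarrow> 'a) category) M = (\<lambda>e\<in>Cover M. e)"
  "Comp (regular_category TYPE(2)) M1 M2 M3 g f = compose (Cover M1) g f"
  by (simp_all add: regular_category_def)

lemma IR_category_simps:
  "Obj IR_category = IR" "Hom IR_category X Y = {g. invertible g \<and> (*v) g ` X \<subseteq> Y}"
  "Id IR_category X = mat 1" "Comp IR_category X Y Z g h = g ** h"
  by (simp_all add: IR_category_def)

lemma matroid_maps_compose: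
  fixes L M N :: "('a::infinite, 'b::infinite) signed_system"
  assumes "regular_of_rank TYPE(2) L" "regular_of_rank TYPE(2) M" "regular_of_rank TYPE(2) N"
    and "f \<in> matroid_maps L M" "g \<in> matroid_maps M N"
  shows "compose (Cover L) g f \<in> matroid_maps L N"
  using is_categoryD(1)[OF is_category_regular_category[of "TYPE(2)", where 'a = 'a and 'b = 'b], of L M N f g] assms
  by (simp add: regular_category_simps)

lemma matroid_maps_id: "regular_of_rank TYPE(2) M \<Longrightarrow> (\<lambda>e\<in>Cover M. e) \<in> matroid_maps M M"
  for M :: "('a::infinite, 'b::infinite) signed_system"
  using is_category_regular_category[of "TYPE(2)", unfolded is_category_def, THEN conjunct1, rule_format, of M]
  by (simp add: regular_category_simps)

lemma matrix_of_id: "regular_of_rank TYPE(2) M \<Longrightarrow> matrix_of M M (\<lambda>e\<in>Cover M. e) = mat 1"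
  for M :: "('a::infinite, 'b::infinite) signed_system"
  by (rule matrix_of_unique[OF _ _ matroid_maps_id]) simp_all

lemma matrix_of_compose:
  fixes L M N :: "('a::infinite, 'b::infinite) signed_system"
  assumes L: "regular_of_rank TYPE(2) L" and M: "regular_of_rank TYPE(2) M" and N: "regular_of_rank TYPE(2) N"
    and f: "f \<in> matroid_maps L M" and g: "g \<in> matroid_maps M N"
  shows "matrix_of L N (compose (Cover L) g f) = matrix_of M N g ** matrix_of L M f"
proof (rule matrix_of_unique[OF L N matroid_maps_compose[OF L M N f g]])
  fix e assume e: "e \<in> Cover L"
  then have "f e \<in> Cover M" using matroid_mapsD(1)[OF f] by blast
  then show "rep_of N (compose (Cover L) g f e) = (matrix_of M N g ** matrix_of L M f) *v rep_of L e"
    using e matrix_of(2)[OF M N g, of "f e"] matrix_of(2)[OF L M f e]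
    by (simp add: compose_def matrix_vector_mul_assoc[symmetric])
qed

lemma is_functor_vectors_of:
  "is_functor (regular_category TYPE(2) :: (('a::infinite, 'b::infinite) signed_system, 'a \<Rightarrow> 'a) category)
     IR_category vectors_of matrix_of"
  unfolding is_functor_def regular_category_simps IR_category_simps mem_Collect_eq
  by (intro conjI ballI) (simp_all add: vectors_of_IR matrix_of_id matrix_of(1) matrix_of_image matrix_of_compose)

lemma lattice_model_map_in:
  assumes X: "X \<in> IR" and Y: "Y \<in> IR" and g: "invertible g" "(*v) g ` X \<subseteq> Y"
  shows "lattice_model_map X Y g \<in> matroid_maps (lattice_model X :: ('a::infinite, 'b::infinite) signed_system) (lattice_model Y)"
  unfolding lattice_model_map_def lattice_model_def
  by (rule model_map_in_matroid_maps[OF lattice_config_IR[OF X] lattice_config_IR[OF Y] g(2) _ _ g(1)])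
     (use inj_invertible[OF g(1)] in \<open>auto simp: matrix_vector_uminus intro: inj_on_subset\<close>)

lemma regular_lattice_model: "X \<in> IR \<Longrightarrow> regular_of_rank TYPE(2) (lattice_model X :: ('a::infinite, 'b::infinite) signed_system)"
  unfolding lattice_model_def by (rule regular_model[OF lattice_config_IR])

lemma Cover_lattice_model: "Cover (lattice_model X :: ('a::infinite, 'b::infinite) signed_system) = code X ` X"
  by (simp add: lattice_model_def)

lemma lattice_model_map_compose:
  assumes "X \<in> IR" "Y \<in> IR" "(*v) f ` X \<subseteq> Y"
  shows "lattice_model_map X Z (g ** f) = compose (code X ` X :: 'a::infinite set) (lattice_model_map Y Z g) (lattice_model_map X Y f)"
  unfolding lattice_model_map_def compose_model_map[OF finite_IR[OF assms(1)] finite_IR[OF assms(2)] assms(3)]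
  by (rule model_map_cong) (simp add: matrix_vector_mul_assoc)

lemma lattice_model_map_id:
  assumes "X \<in> IR"
  shows "lattice_model_map X X (mat 1) = (\<lambda>x\<in>code X ` X. x :: 'a::infinite)"
  unfolding lattice_model_map_def model_map_id[OF finite_IR[OF assms], symmetric] by (rule model_map_cong) simp

lemma is_functor_lattice_model:
  "is_functor IR_category (regular_category TYPE(2) :: (('a::infinite, 'b::infinite) signed_system, 'a \<Rightarrow> 'a) category)
     lattice_model lattice_model_map"
  unfolding is_functor_def regular_category_simps IR_category_simps mem_Collect_eq Cover_lattice_model
  by (intro conjI ballI) (simp_all add: regular_lattice_model lattice_model_map_in lattice_model_map_id lattice_model_map_compose)

lemma Cover_doubled_model: "Cover (doubled_model M :: ('a::infinite, 'b::infinite) signed_system) = code (doubled M) ` doubled M"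
  by (simp add: doubled_model_def)

lemma regular_doubled_model:
  "regular_of_rank TYPE(2) M \<Longrightarrow> regular_of_rank TYPE(2) (doubled_model M :: ('a::infinite, 'b::infinite) signed_system)"
  unfolding doubled_model_def by (rule regular_model[OF lattice_config_doubled])

definition doubled_model_map ::
  "('a::infinite, 'b::infinite) signed_system \<Rightarrow> ('a, 'b) signed_system \<Rightarrow> ('a \<Rightarrow> 'a) \<Rightarrow> 'a \<Rightarrow> 'a" where
  "doubled_model_map M N f = model_map (doubled M) (doubled N) (doubled_map M N f)"

lemma doubled_cases:
  assumes "x \<in> doubled M"
  obtains e where "x = Inl e" "e \<in> Cover M" | v where "x = Inr v" "v \<in> vectors_of M"
  using assms by (auto simp: doubled_def)

lemma is_functor_doubled:
  "is_functor (regular_category TYPE(2) :: (('a::infinite, 'b::infinite) signed_system, 'a \<Rightarrow> 'a) category)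
     (regular_category TYPE(2)) doubled_model doubled_model_map"
  unfolding is_functor_def regular_category_simps mem_Collect_eq Cover_doubled_model
proof (intro conjI ballI)
  fix M :: "('a, 'b) signed_system" assume "M \<in> {M. regular_of_rank TYPE(2) M}"
  then have M: "regular_of_rank TYPE(2) M" by simp
  show "regular_of_rank TYPE(2) (doubled_model M)" by (rule regular_doubled_model[OF M])
  show "doubled_model_map M M (\<lambda>e\<in>Cover M. e) = (\<lambda>e\<in>code (doubled M) ` doubled M. e)"
    unfolding doubled_model_map_def model_map_id[OF finite_doubled[OF M], symmetric]
    by (rule model_map_cong) (erule doubled_cases; simp add: doubled_map_def matrix_of_id[OF M])
  fix N f assume "N \<in> {M :: ('a, 'b) signed_system. regular_of_rank TYPE(2) M}" and f: "f \<in> matroid_maps M N"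
  then have N: "regular_of_rank TYPE(2) N" by simp
  show "doubled_model_map M N f \<in> matroid_maps (doubled_model M) (doubled_model N)"
    unfolding doubled_model_map_def by (rule doubled_map_in[OF M N f])
  fix L g assume "L \<in> {M :: ('a, 'b) signed_system. regular_of_rank TYPE(2) M}" and g: "g \<in> matroid_maps N L"
  then have L: "regular_of_rank TYPE(2) L" by simp
  show "doubled_model_map M L (compose (Cover M) g f) =
      compose (code (doubled M) ` doubled M) (doubled_model_map N L g) (doubled_model_map M N f)"
    unfolding doubled_model_map_def
      compose_model_map[OF finite_doubled[OF M] finite_doubled[OF N] doubled_map_image[OF M N f]]
    by (rule model_map_cong) (erule doubled_cases;
        simp add: doubled_map_def matrix_of_compose[OF M N L f g] compose_eq matrix_vector_mul_assoc)
qed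

definition matroid_in_doubled :: "('a::infinite, 'b::infinite) signed_system \<Rightarrow> 'a \<Rightarrow> 'a" where
  "matroid_in_doubled M = (\<lambda>e\<in>Cover M. code (doubled M) (Inl e :: 'a + int ^ 2))"

lemma matroid_in_doubled_in:
  fixes M :: "('a::infinite, 'b::infinite) signed_system"
  assumes M: "regular_of_rank TYPE(2) M"
  shows "matroid_in_doubled M \<in> matroid_maps M (doubled_model M)"
proof -
  note cfg = lattice_config_doubled[OF M]
  have mem: "(Inl e :: 'a + int ^ 2) \<in> doubled M" if "e \<in> Cover M" for e using that by (simp add: doubled_def InlI)
  note inj = inj_onD[OF inj_on_code[OF finite_doubled[OF M], where 'a = 'a]]
  show ?thesis
  proof (rule matroid_mapsI[OF lattice_rep_rep_of[OF M] lattice_rep_model[OF cfg, where 'a = 'a and 'b = 'b, folded doubled_model_def] _ _ _ invertible_mat_1])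
    show "matroid_in_doubled M \<in> Cover M \<rightarrow>\<^sub>E Cover (doubled_model M :: ('a, 'b) signed_system)"
      using mem by (simp add: matroid_in_doubled_def Cover_doubled_model)
    show "inj_on (matroid_in_doubled M) (Cover M)"
      using inj mem by (intro inj_onI) (auto simp: matroid_in_doubled_def)
    fix e assume e: "e \<in> Cover M"
    have "bar M e \<in> Cover M"
      using lattice_configD(1)[of "Cover M" "bar M" "rep_of M" e] lattice_rep_rep_of[OF M] e by (simp add: lattice_rep_def)
    then show "matroid_in_doubled M (bar M e) = bar (doubled_model M :: ('a, 'b) signed_system) (matroid_in_doubled M e)"
      using bar_model[OF cfg mem[OF e], where 'a = 'a and 'b = 'b, folded doubled_model_def] e by (simp add: matroid_in_doubled_def)
    show "(case inv_into (doubled M) (code (doubled M)) (matroid_in_doubled M e) of Inl x \<Rightarrow> rep_of M x | Inr v \<Rightarrow> v) =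
        mat 1 *v rep_of M e"
      using e decode_code[OF finite_doubled[OF M] mem[OF e], where 'a = 'a] by (simp add: matroid_in_doubled_def)
  qed
qed

lemma nat_trans_matroid_in_doubled:
  "nat_trans (regular_category TYPE(2)) (regular_category TYPE(2) :: (('a::infinite, 'b::infinite) signed_system, 'a \<Rightarrow> 'a) category)
     (\<lambda>M. M) (\<lambda>M N f. f) doubled_model doubled_model_map matroid_in_doubled"
  unfolding nat_trans_def regular_category_simps mem_Collect_eq
proof (intro conjI ballI)
  fix M N :: "('a, 'b) signed_system" and f
  assume "M \<in> {M. regular_of_rank TYPE(2) M}" "N \<in> {M. regular_of_rank TYPE(2) M}" and f: "f \<in> matroid_maps M N"
  then have M: "regular_of_rank TYPE(2) M" and N: "regular_of_rank TYPE(2) N" by simp_all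
  show "compose (Cover M) (matroid_in_doubled N) f = compose (Cover M) (doubled_model_map M N f) (matroid_in_doubled M)"
  proof
    fix e
    show "compose (Cover M) (matroid_in_doubled N) f e = compose (Cover M) (doubled_model_map M N f) (matroid_in_doubled M) e"
    proof (cases "e \<in> Cover M")
      case True
      moreover have "f e \<in> Cover N" using matroid_mapsD(1)[OF f] True by blast
      moreover have "(Inl e :: 'a + int ^ 2) \<in> doubled M" using True by (simp add: doubled_def InlI)
      ultimately show ?thesis
        by (simp add: compose_def matroid_in_doubled_def doubled_model_map_def model_map_code[OF finite_doubled[OF M]] doubled_map_def)
    qed (simp add: compose_def)
  qed
qed (simp add: matroid_in_doubled_in)

definition lattice_in_doubled :: "('a::infinite, 'b::infinite) signed_system \<Rightarrow> 'a \<Rightarrow> 'a" where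
  "lattice_in_doubled M = model_map (vectors_of M) (doubled M) Inr"

lemma nat_trans_lattice_in_doubled:
  "nat_trans (regular_category TYPE(2)) (regular_category TYPE(2) :: (('a::infinite, 'b::infinite) signed_system, 'a \<Rightarrow> 'a) category)
     (\<lambda>M. lattice_model (vectors_of M)) (\<lambda>M N f. lattice_model_map (vectors_of M) (vectors_of N) (matrix_of M N f))
     doubled_model doubled_model_map lattice_in_doubled"
  unfolding nat_trans_def regular_category_simps mem_Collect_eq Cover_lattice_model
proof (intro conjI ballI)
  fix M :: "('a, 'b) signed_system"
  assume "M \<in> {M. regular_of_rank TYPE(2) M}"
  then have M: "regular_of_rank TYPE(2) M" by simp
  have sub: "Inr ` vectors_of M \<subseteq> doubled M" by (auto simp: doubled_def)
  show "lattice_in_doubled M \<in> matroid_maps (lattice_model (vectors_of M)) (doubled_model M)"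
    unfolding lattice_in_doubled_def lattice_model_def doubled_model_def
    by (rule model_map_in_matroid_maps[OF lattice_config_IR[OF vectors_of_IR[OF M]] lattice_config_doubled[OF M] sub _ _ invertible_mat_1])
       simp_all
  fix N f assume "N \<in> {M :: ('a, 'b) signed_system. regular_of_rank TYPE(2) M}" and f: "f \<in> matroid_maps M N"
  then have N: "regular_of_rank TYPE(2) N" by simp
  show "compose (code (vectors_of M) ` vectors_of M) (lattice_in_doubled N)
        (lattice_model_map (vectors_of M) (vectors_of N) (matrix_of M N f)) =
      compose (code (vectors_of M) ` vectors_of M) (doubled_model_map M N f) (lattice_in_doubled M)"
    unfolding lattice_in_doubled_def lattice_model_map_def doubled_model_map_def
      compose_model_map[OF finite_IR[OF vectors_of_IR[OF M]] finite_doubled[OF M] sub]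
      compose_model_map[OF finite_IR[OF vectors_of_IR[OF M]] finite_IR[OF vectors_of_IR[OF N]] matrix_of_image[OF M N f]]
    by (rule model_map_cong) (simp add: doubled_map_def)
qed

text \<open>The representation chosen for the model of \<open>X\<close> need not be the inclusion of
  \<open>X\<close> into the lattice. These matrices measure the difference and connect
  \<open>X\<close> with the vectors of its model.\<close>

definition coordinate_change :: "('a::infinite, 'b::infinite) signed_system itself \<Rightarrow> (int ^ 2) set \<Rightarrow> int ^ 2 ^ 2" where
  "coordinate_change T X = (SOME g. invertible g \<and>
     (\<forall>v\<in>X. rep_of (lattice_model X :: ('a, 'b) signed_system) (code X v) = g *v v))"

lemma coordinate_change:
  assumes X: "X \<in> IR"
  shows "invertible (coordinate_change TYPE(('a::infinite, 'b::infinite) signed_system) X)"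
    and "v \<in> X \<Longrightarrow> rep_of (lattice_model X :: ('a, 'b) signed_system) (code X v) =
      coordinate_change TYPE(('a, 'b) signed_system) X *v v"
proof -
  let ?M = "lattice_model X :: ('a, 'b) signed_system"
  let ?Q = "\<lambda>g. invertible g \<and> (\<forall>v\<in>X. rep_of ?M (code X v) = g *v v)"
  have M: "regular_of_rank TYPE(2) ?M" by (rule regular_lattice_model[OF X])
  \<comment> \<open>The identity of the model, read in the tautological representation at the source
    and the chosen one at the target, is induced by a matrix.\<close>
  obtain g where g: "invertible g" "\<forall>x\<in>Cover ?M. rep_of ?M ((\<lambda>e\<in>Cover ?M. e) x) = g *v inv_into X (code X) x"
    using matroid_map_linear[OF lattice_rep_model[OF lattice_config_IR[OF X], where 'a = 'a and 'b = 'b, folded lattice_model_def]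
        lattice_rep_rep_of[OF M] matroid_maps_id[OF M]] by blast
  have "?Q g"
  proof (intro conjI ballI)
    fix v assume v: "v \<in> X"
    then have c: "(code X v :: 'a) \<in> Cover ?M" by (simp add: Cover_lattice_model)
    then show "rep_of ?M (code X v) = g *v v"
      using bspec[OF g(2) c] decode_code[OF finite_IR[OF X] v, where 'a = 'a] by simp
  qed (rule g(1))
  then have "?Q (coordinate_change TYPE(('a, 'b) signed_system) X)" unfolding coordinate_change_def by (rule someI)
  then show "invertible (coordinate_change TYPE(('a, 'b) signed_system) X)"
    and "v \<in> X \<Longrightarrow> rep_of ?M (code X v) = coordinate_change TYPE(('a, 'b) signed_system) X *v v"
    by blast+
qed

lemma nat_trans_coordinate_change:
  "nat_trans IR_category IR_category (\<lambda>X. X) (\<lambda>X Y g. g)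
     (\<lambda>X. vectors_of (lattice_model X :: ('a::infinite, 'b::infinite) signed_system))
     (\<lambda>X Y g. matrix_of (lattice_model X :: ('a, 'b) signed_system) (lattice_model Y) (lattice_model_map X Y g))
     (coordinate_change TYPE(('a, 'b) signed_system))"
  unfolding nat_trans_def IR_category_simps
proof (intro conjI ballI)
  let ?c = "coordinate_change TYPE(('a, 'b) signed_system)"
  fix X :: "(int ^ 2) set" assume X: "X \<in> IR"
  let ?M = "lattice_model X :: ('a, 'b) signed_system"
  note cX = coordinate_change[OF X, where 'a = 'a and 'b = 'b]
  have M: "regular_of_rank TYPE(2) ?M" by (rule regular_lattice_model[OF X])
  have "(*v) (?c X) ` X \<subseteq> vectors_of ?M"
  proof
    fix w assume "w \<in> (*v) (?c X) ` X"
    then obtain v where v: "v \<in> X" "w = ?c X *v v" by blast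
    have "v \<noteq> 0" using X v(1) unfolding IR_iff by blast
    then have "w \<noteq> 0" unfolding v(2) by (rule invertible_mult_nonzero[OF cX(1)])
    moreover have "w = rep_of ?M (code X v)" using cX(2)[OF v(1)] v(2) by simp
    ultimately show "w \<in> vectors_of ?M" using v(1) by (simp add: vectors_of_def Cover_lattice_model)
  qed
  then show "?c X \<in> {g. invertible g \<and> (*v) g ` X \<subseteq> vectors_of ?M}" using cX(1) by simp
  fix Y :: "(int ^ 2) set" and g assume Y: "Y \<in> IR" and "g \<in> {g. invertible g \<and> (*v) g ` X \<subseteq> Y}"
  then have g: "invertible g" "(*v) g ` X \<subseteq> Y" by simp_all
  let ?N = "lattice_model Y :: ('a, 'b) signed_system"
  have N: "regular_of_rank TYPE(2) ?N" by (rule regular_lattice_model[OF Y])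
  note cY = coordinate_change[OF Y, where 'a = 'a and 'b = 'b]
  show "?c Y ** g = matrix_of ?M ?N (lattice_model_map X Y g) ** ?c X"
  proof (rule IR_matrix_unique[OF X])
    fix v assume v: "v \<in> X"
    have gv: "g *v v \<in> Y" using g(2) v by blast
    have "(?c Y ** g) *v v = rep_of ?N (code Y (g *v v))"
      using cY(2)[OF gv] by (simp add: matrix_vector_mul_assoc)
    also have "code Y (g *v v) = (lattice_model_map X Y g (code X v) :: 'a)"
      unfolding lattice_model_map_def by (rule model_map_code[OF finite_IR[OF X] v, symmetric])
    also have "rep_of ?N \<dots> = matrix_of ?M ?N (lattice_model_map X Y g) *v rep_of ?M (code X v)"
      by (rule matrix_of(2)[OF M N lattice_model_map_in[OF X Y g]]) (use v in \<open>simp add: Cover_lattice_model\<close>)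
    also have "\<dots> = (matrix_of ?M ?N (lattice_model_map X Y g) ** ?c X) *v v"
      using cX(2)[OF v] by (simp add: matrix_vector_mul_assoc)
    finally show "(?c Y ** g) *v v = (matrix_of ?M ?N (lattice_model_map X Y g) ** ?c X) *v v" .
  qed
qed

theorem theorem3p20:
  shows "topspace (complex_realization (order_complex (IR :: (int ^ 2) set set))) \<noteq> {} \<and>
    contractible_space (complex_realization (order_complex (IR :: (int ^ 2) set set))) \<and>
    classifying_space (regular_category TYPE(2)
        :: (('a::infinite, 'b::infinite) signed_system, 'a \<Rightarrow> 'a) category)
      homotopy_equivalent_space
    classifying_space (delooping (GL_int :: (int ^ 2 ^ 2) monoid))"
proof (intro conjI)
  have "classifying_space (regular_category TYPE(2) :: (('a, 'b) signed_system, 'a \<Rightarrow> 'a) category)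
      homotopy_equivalent_space classifying_space IR_category"
  proof (rule homotopy_equivalent_classifying_spaces)
    show "is_functor (regular_category TYPE(2) :: (('a, 'b) signed_system, 'a \<Rightarrow> 'a) category) IR_category vectors_of matrix_of"
      by (rule is_functor_vectors_of)
    show "is_functor IR_category (regular_category TYPE(2) :: (('a, 'b) signed_system, 'a \<Rightarrow> 'a) category) lattice_model lattice_model_map"
      by (rule is_functor_lattice_model)
  qed (rule is_category_regular_category is_category_IR_category is_functor_doubled
      nat_trans_matroid_in_doubled nat_trans_lattice_in_doubled nat_trans_coordinate_change)+
  then show "classifying_space (regular_category TYPE(2) :: (('a, 'b) signed_system, 'a \<Rightarrow> 'a) category)
      homotopy_equivalent_space classifying_space GL2_category"
    using IR_category_homotopy_equivalent_GL2 by (rule homotopy_eqv_trans)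
qed (rule IR_realization_nonempty contractible_IR_realization)+

end
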